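(* Let $\Omega_{\mathrm{ext}}=\mathbb{R}\times[-1,1]$ with coordinates $(\alpha,\beta)$, and let $\Omega=[0,2\pi]\times[-1,1]$. Assume: (A1) A strongly Markovian, time-homogeneous process $(\alpha(t),\beta(t))$ obeys the Itô equations $$d\alpha=f_1(\alpha,\beta)\,dt+g_{11}(\alpha,\beta)\,dW_1(t)+g_{12}(\alpha,\beta)\,dW_2(t),$$ $$d\beta=f_2(\alpha,\beta)\,dt+g_{21}(\alpha,\beta)\,dW_1(t)+g_{22}(\alpha,\beta)\,dW_2(t).$$ Here $W_1,W_2$ are independent standard Wiener processes, and $f_i,g_{ij}$ are $C^2$ on $\Omega_{\mathrm{ext}}$. Let $\mathcal{G}=gg^\intercal$ with $g=(g_{ij})_{i,j=1,2}$. (A2) All $f_i$ and $g_{ij}$ are $2\pi$-periodic in $\alpha$. (A3) The operator $$\mathcal{P}u=-\sum_{j,k=1}^2\partial_j(A_{jk}\partial_k u)+\sum_{j=1}^2A_j\partial_j u,$$ with $A_{jk}=-\tfrac12\mathcal{G}_{jk}$ and $A_j=-\tfrac12\sum_{k=1}^2\partial_k\mathcal{G}_{jk}+f_j$, is strongly elliptic on $\Omega_{\mathrm{ext}}$. Here $\partial_1=\partial_\alpha$ and $\partial_2=\partial_\beta$. (A4) Consider the density evolution $\partial_t\rho=\mathcal{P}^*\rho=-\sum_{j,k}\partial_j(A_{jk}\partial_k\rho)-\sum_j\partial_j(A_j\rho)$ on $\Omega$. Impose reflecting boundary conditions $0=\sum_kA_{kj}\partial_k\rho+A_j\rho$ at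 $\beta=\pm1$ for all $\alpha$, and periodic conditions $\rho(0,\beta)=\rho(2\pi,\beta)$ for all $\beta\in[-1,1]$. Assume this has a unique stationary density $\rho_{\mathrm{ss}}\ge0$ with $\int_\Omega\rho_{\mathrm{ss}}\,d\alpha\,d\beta=1$, i.e. the unique normalized solution of $\mathcal{P}^*\rho_{\mathrm{ss}}=0$ with these boundary conditions. (A5) Let $J_{\mathrm{ss},j}=f_j\rho_{\mathrm{ss}}-\tfrac12\sum_k\partial_k(\mathcal{G}_{jk}\rho_{\mathrm{ss}})$. Let $\gamma:[-1,1]\to[0,2\pi]$ be any $C^1$ function whose graph $\{(\gamma(\beta),\beta):-1\le\beta\le1\}$ separates $\Omega_{\mathrm{ext}}$ into a left and a right connected component. Let $\mathbf n(\beta)$ be the unit normal to this graph pointing into the right component. Then for every such $\gamma$, $$\overline J:=\int_{-1}^1\mathbf n(\beta)^\intercal J_{\mathrm{ss}}(\gamma(\beta),\beta)\,d\beta>0.$$ Set $\overline T=(\overline J)^{-1}$. Then the problem $$\mathcal{P}T=-1 \text{ on }\Omega,$$ $$\sum_{k=1}^2\mathcal{G}_{2k}\,\partial_kT(\alpha,\pm1)=0\text{ for all }\alpha\in\mathbb{R},$$ $$T(\alpha,\beta)-T(\alpha+2\pi,\beta)=\overline T\text{ for all }(\alpha,\beta)\in\Omega_{\mathrm{ext}}$$ has a solution $T(\alpha,\beta)$ on $\Omega_{\mathrm{ext}}$, and by restriction on $\Omega$. Moreover, this solution is unique up to an additive constant.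
   Context: Strong ellipticity of $\mathcal{P}$ in this planar setting holds in particular when $\mathcal{G}_{11}>0$, $\mathcal{G}_{22}>0$ and $\det\mathcal{G}\neq0$. These conditions make the symmetric matrix $\mathcal{G}=gg^\intercal$ positive definite. The operator $\mathcal{P}$ equals the backward Kolmogorov operator (generator) $\sum_j f_j\partial_j+\tfrac12\sum_{j,k}\mathcal{G}_{jk}\partial_j\partial_k$ of the process. The quantity $\overline T$ is the mean rotation period of the stochastic oscillator. The level sets of $T$ are the mean-return-time isochrons.
   Formalization: The integral defining J̄ is taken along the graph with arc length √(1+γ'²)dβ, since dβ with a unit normal depends on γ and leaves T̄ ill-defined; ρ is 2π-periodic on the strip, since matching values alone defeats uniqueness; the reflecting condition is its normal (j=2) component. *)

theory Defs
  imports "HOL-Analysis.Analysis"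
begin

definition Omega_ext :: "(real \<times> real) set" where
  "Omega_ext = UNIV \<times> {-1..1}"

definition Omega_int :: "(real \<times> real) set" where
  "Omega_int = UNIV \<times> {-1<..<1}"

definition Omega :: "(real \<times> real) set" where
  "Omega = {0..2*pi} \<times> {-1..1}"

definition pd :: "nat \<Rightarrow> (real \<times> real \<Rightarrow> real) \<Rightarrow> real \<times> real \<Rightarrow> real" where
  "pd j u p = (if j = 1 then vector_derivative (\<lambda>a. u (a, snd p)) (at (fst p))
               else vector_derivative (\<lambda>b. u (fst p, b)) (at (snd p) within {-1..1}))"

definition has_pds :: "(real \<times> real \<Rightarrow> real) \<Rightarrow> real \<times> real \<Rightarrow> bool" where
  "has_pds u p \<longleftrightarrow> (\<lambda>a. u (a, snd p)) differentiable (at (fst p))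
                 \<and> (\<lambda>b. u (fst p, b)) differentiable (at (snd p) within {-1..1})"

definition C1_on :: "(real \<times> real) set \<Rightarrow> (real \<times> real \<Rightarrow> real) \<Rightarrow> bool" where
  "C1_on S u \<longleftrightarrow> continuous_on S u \<and> (\<forall>p\<in>S. has_pds u p)
                 \<and> continuous_on S (pd 1 u) \<and> continuous_on S (pd 2 u)"

definition C2_on :: "(real \<times> real) set \<Rightarrow> (real \<times> real \<Rightarrow> real) \<Rightarrow> bool" where
  "C2_on S u \<longleftrightarrow> C1_on S u \<and> C1_on S (pd 1 u) \<and> C1_on S (pd 2 u)"

definition sol_class :: "(real \<times> real \<Rightarrow> real) \<Rightarrow> bool" where
  "sol_class u \<longleftrightarrow> C1_on Omega_ext u \<and> C2_on Omega_int u"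

definition Gm :: "(nat \<Rightarrow> nat \<Rightarrow> real \<times> real \<Rightarrow> real) \<Rightarrow> nat \<Rightarrow> nat \<Rightarrow> real \<times> real \<Rightarrow> real" where
  "Gm g j k p = (\<Sum>i\<in>{1,2}. g j i p * g k i p)"

definition Acoef :: "(nat \<Rightarrow> nat \<Rightarrow> real \<times> real \<Rightarrow> real) \<Rightarrow> nat \<Rightarrow> nat \<Rightarrow> real \<times> real \<Rightarrow> real" where
  "Acoef g j k p = - (1/2) * Gm g j k p"

definition Avec :: "(nat \<Rightarrow> real \<times> real \<Rightarrow> real) \<Rightarrow> (nat \<Rightarrow> nat \<Rightarrow> real \<times> real \<Rightarrow> real)
                    \<Rightarrow> nat \<Rightarrow> real \<times> real \<Rightarrow> real" where
  "Avec f g j p = - (1/2) * (\<Sum>k\<in>{1,2}. pd k (Gm g j k) p) + f j p"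

definition Pop :: "(nat \<Rightarrow> real \<times> real \<Rightarrow> real) \<Rightarrow> (nat \<Rightarrow> nat \<Rightarrow> real \<times> real \<Rightarrow> real)
                   \<Rightarrow> (real \<times> real \<Rightarrow> real) \<Rightarrow> real \<times> real \<Rightarrow> real" where
  "Pop f g u p = - (\<Sum>j\<in>{1,2}. \<Sum>k\<in>{1,2}. pd j (\<lambda>q. Acoef g j k q * pd k u q) p)
                 + (\<Sum>j\<in>{1,2}. Avec f g j p * pd j u p)"

definition Padj :: "(nat \<Rightarrow> real \<times> real \<Rightarrow> real) \<Rightarrow> (nat \<Rightarrow> nat \<Rightarrow> real \<times> real \<Rightarrow> real)
                   \<Rightarrow> (real \<times> real \<Rightarrow> real) \<Rightarrow> real \<times> real \<Rightarrow> real" where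
  "Padj f g u p = - (\<Sum>j\<in>{1,2}. \<Sum>k\<in>{1,2}. pd j (\<lambda>q. Acoef g j k q * pd k u q) p)
                  - (\<Sum>j\<in>{1,2}. pd j (\<lambda>q. Avec f g j q * u q) p)"

definition strongly_elliptic :: "(nat \<Rightarrow> nat \<Rightarrow> real \<times> real \<Rightarrow> real) \<Rightarrow> bool" where
  "strongly_elliptic g \<longleftrightarrow> (\<exists>c>0. \<forall>p\<in>Omega_ext. \<forall>\<xi>::nat \<Rightarrow> real.
      (\<Sum>j\<in>{1,2}. \<Sum>k\<in>{1,2}. - Acoef g j k p * \<xi> j * \<xi> k) \<ge> c * ((\<xi> 1)\<^sup>2 + (\<xi> 2)\<^sup>2))"

text \<open>Normalized stationary solution of the Fokker--Planck problem with reflecting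
  (zero normal flux) conditions at beta = +-1 and periodic conditions in alpha.\<close>
definition stationary_density ::
  "(nat \<Rightarrow> real \<times> real \<Rightarrow> real) \<Rightarrow> (nat \<Rightarrow> nat \<Rightarrow> real \<times> real \<Rightarrow> real)
   \<Rightarrow> (real \<times> real \<Rightarrow> real) \<Rightarrow> bool" where
  "stationary_density f g \<rho> \<longleftrightarrow>
     sol_class \<rho>
   \<and> (\<forall>a b. b \<in> {-1..1} \<longrightarrow> \<rho> (a + 2*pi, b) = \<rho> (a, b))
   \<and> (\<forall>p\<in>Omega_int. Padj f g \<rho> p = 0)
   \<and> (\<forall>a. \<forall>b\<in>{-1, 1}.
        (\<Sum>k\<in>{1,2}. Acoef g k 2 (a, b) * pd k \<rho> (a, b)) + Avec f g 2 (a, b) * \<rho> (a, b) = 0)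
   \<and> (\<rho> has_integral 1) Omega"

definition Jss :: "(nat \<Rightarrow> real \<times> real \<Rightarrow> real) \<Rightarrow> (nat \<Rightarrow> nat \<Rightarrow> real \<times> real \<Rightarrow> real)
                   \<Rightarrow> (real \<times> real \<Rightarrow> real) \<Rightarrow> nat \<Rightarrow> real \<times> real \<Rightarrow> real" where
  "Jss f g \<rho> j p = f j p * \<rho> p - (1/2) * (\<Sum>k\<in>{1,2}. pd k (\<lambda>q. Gm g j k q * \<rho> q) p)"

definition admissible_curve :: "(real \<Rightarrow> real) \<Rightarrow> (real \<Rightarrow> real) \<Rightarrow> bool" where
  "admissible_curve \<gamma> \<gamma>' \<longleftrightarrow>
     (\<forall>b\<in>{-1..1}. (\<gamma> has_real_derivative \<gamma>' b) (at b within {-1..1}))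
   \<and> continuous_on {-1..1} \<gamma>'
   \<and> \<gamma> ` {-1..1} \<subseteq> {0..2*pi}
   \<and> components (Omega_ext - {(\<gamma> b, b) | b. b \<in> {-1..1}})
       = {{p \<in> Omega_ext. fst p < \<gamma> (snd p)}, {p \<in> Omega_ext. fst p > \<gamma> (snd p)}}"

text \<open>Unit normal to the graph pointing into the right component, and the current
  through the graph (integral of n^T J_ss along the graph, ds = sqrt(1+gamma'^2) dbeta).\<close>
definition unit_normal :: "(real \<Rightarrow> real) \<Rightarrow> nat \<Rightarrow> real \<Rightarrow> real" where
  "unit_normal \<gamma>' j b = (if j = 1 then 1 else - \<gamma>' b) / sqrt (1 + (\<gamma>' b)\<^sup>2)"

definition Jbar :: "(nat \<Rightarrow> real \<times> real \<Rightarrow> real) \<Rightarrow> (nat \<Rightarrow> nat \<Rightarrow> real \<times> real \<Rightarrow> real)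
                    \<Rightarrow> (real \<times> real \<Rightarrow> real) \<Rightarrow> (real \<Rightarrow> real) \<Rightarrow> (real \<Rightarrow> real) \<Rightarrow> real" where
  "Jbar f g \<rho> \<gamma> \<gamma>' = integral {-1..1}
     (\<lambda>b. (\<Sum>j\<in>{1,2}. unit_normal \<gamma>' j b * Jss f g \<rho> j (\<gamma> b, b)) * sqrt (1 + (\<gamma>' b)\<^sup>2))"

definition MRT_solution :: "(nat \<Rightarrow> real \<times> real \<Rightarrow> real) \<Rightarrow> (nat \<Rightarrow> nat \<Rightarrow> real \<times> real \<Rightarrow> real)
                            \<Rightarrow> real \<Rightarrow> (real \<times> real \<Rightarrow> real) \<Rightarrow> bool" where
  "MRT_solution f g Tbar T \<longleftrightarrow>
     sol_class T
   \<and> (\<forall>p \<in> {0..2*pi} \<times> {-1<..<1}. Pop f g T p = -1)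
   \<and> (\<forall>a. \<forall>b\<in>{-1, 1}. (\<Sum>k\<in>{1,2}. Gm g 2 k (a, b) * pd k T (a, b)) = 0)
   \<and> (\<forall>p\<in>Omega_ext. T p - T (fst p + 2*pi, snd p) = Tbar)"

end

theory Submission
  imports Defs "HOL-Complex_Analysis.Great_Picard"
begin

text \<open>
  Existence: look for T = s (U + sigma x) with U periodic and real constants sigma, kappa such that
  P (U + sigma x) = kappa, with the conormal boundary condition. Discretising by finite differences,
  this is a homogeneous linear system for (U, sigma, kappa) with fewer equations than unknowns, so
  there is a normalised nontrivial solution on every grid. Differencing the equation in the periodic
  direction gives discrete energy estimates uniform in the mesh size; a mixed Sobolev inequality turns
  them into equicontinuity, and Arzela--Ascoli yields a classical solution (U, sigma, kappa), not all
  zero. By the strong maximum principle and Hopf's lemma a periodic solution is constant and has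
  kappa = 0; hence sigma is nonzero. Testing with the stationary density (Green's identity) gives
  kappa = 2 pi sigma J, where J is the probability current through a vertical line. The current
  through any admissible curve is the same, because the stationary current is divergence free.

  Uniqueness: the difference of two solutions is periodic, so it is constant by the maximum principle.
\<close>

section \<open>Grid functions and discrete norms\<close>

text \<open>Only differences in the periodic direction respect the boundary condition: they carry
  along the zero flux on the rows 0 and N, so that summation by parts leaves no boundary terms.
  Vertical regularity is either part of the same energy or read off from the equation; this is why
  the equation is divided by the coefficient of the second vertical derivative.

  The coefficients are merely C^2. In divergence form the lower order terms already contain one
  difference of a coefficient, so that the equation can be differenced only once;
  \<open>third\<close> is what this yields up to the boundary, and it makes U and its first
  derivatives continuous on the closed strip. Continuity of the second derivatives takes one more
  tangential difference. It is applied to the nondivergence form, where just two differences fall on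
  each coefficient. There the boundary condition is lost, hence the weight \<open>chi\<close>, and
  the second derivatives are controlled in the open strip only, which is what
  \<open>sol_class\<close> demands.

  With sigma and kappa both unknown, counting replaces a discrete Fredholm alternative, and
  nontriviality is exploited only in the limit.\<close>

text \<open>X n a b is the value at the grid point (2 pi a / N, - 1 + 2 b / N) with N = n + 2; the rows
  b = 0 and b = N lie on the boundary.\<close>

type_synonym grid_fam = "nat \<Rightarrow> int \<Rightarrow> nat \<Rightarrow> real"

definition hh :: "nat \<Rightarrow> real" where "hh n = 2 * pi / real (n + 2)"
definition kk :: "nat \<Rightarrow> real" where "kk n = 2 / real (n + 2)"

lemma hh_pos [simp]: "0 < hh n" and kk_pos [simp]: "0 < kk n"
  by (auto simp: hh_def kk_def)

lemma hh_nz [simp]: "hh n \<noteq> 0" and kk_nz [simp]: "kk n \<noteq> 0"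
  using hh_pos[of n] kk_pos[of n] by linarith+

lemma hh_ge0 [simp]: "0 \<le> hh n" and kk_ge0 [simp]: "0 \<le> kk n"
  using hh_pos[of n] kk_pos[of n] by linarith+

definition d1 :: "grid_fam \<Rightarrow> grid_fam" where
  "d1 X n a b = (X n (a + 1) b - X n a b) / hh n"

definition d2 :: "grid_fam \<Rightarrow> grid_fam" where
  "d2 X n a b = (X n a (Suc b) - X n a b) / kk n"

definition per :: "grid_fam \<Rightarrow> bool" where
  "per X \<longleftrightarrow> (\<forall>n a b. X n (a + int (n + 2)) b = X n a b)"

text \<open>Row N is left out of the sum: a forward difference \<open>d2 X\<close> on the row N - 1
  already reads row N, and summation by parts in b runs over b < N.\<close>

definition gsum :: "nat \<Rightarrow> (int \<Rightarrow> nat \<Rightarrow> real) \<Rightarrow> real" where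
  "gsum n X = hh n * kk n * (\<Sum>a\<in>{0..<int (n + 2)}. \<Sum>b<n + 2. X a b)"

text \<open>A property of the whole family: the bound is uniform in the mesh size. Periodicity is
  built in, so that shifts in a preserve the class.\<close>

definition L2 :: "grid_fam \<Rightarrow> bool" where
  "L2 X \<longleftrightarrow> per X \<and> (\<exists>C. \<forall>n. gsum n (\<lambda>a b. (X n a b)\<^sup>2) \<le> C)"

definition Linf :: "grid_fam \<Rightarrow> bool" where
  "Linf X \<longleftrightarrow> per X \<and> (\<exists>C. \<forall>n a b. b \<le> n + 2 \<longrightarrow> \<bar>X n a b\<bar> \<le> C)"

lemma perD: "per X \<Longrightarrow> X n (a + int (n + 2)) b = X n a b"
  unfolding per_def by blast

lemma per_shift_sum:
  fixes F :: "int \<Rightarrow> real"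
  assumes "\<And>a. F (a + int N) = F a"
  shows "(\<Sum>a\<in>{0..<int N}. F (a + 1)) = (\<Sum>a\<in>{0..<int N}. F a)"
proof (cases "N = 0")
  case False
  have "(\<Sum>a\<in>{0..<int N}. F (a + 1)) = (\<Sum>a\<in>{1..<int N + 1}. F a)"
    by (rule sum.reindex_bij_witness[of _ "\<lambda>a. a - 1" "\<lambda>a. a + 1"]) auto
  also have "{1..<int N + 1} = insert (int N) {1..<int N}" using False by auto
  also have "(\<Sum>a\<in>insert (int N) {1..<int N}. F a) = F (int N) + (\<Sum>a\<in>{1..<int N}. F a)"
    by simp
  also have "F (int N) = F 0" using assms[of 0] by simp
  also have "F 0 + (\<Sum>a\<in>{1..<int N}. F a) = (\<Sum>a\<in>insert 0 {1..<int N}. F a)"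
    by simp
  also have "insert 0 {1..<int N} = {0..<int N}" using False by auto
  finally show ?thesis .
qed auto

lemma per_shift_sum_int:
  fixes F :: "int \<Rightarrow> real"
  assumes "\<And>a. F (a + int N) = F a"
  shows "(\<Sum>a\<in>{0..<int N}. F (a + j)) = (\<Sum>a\<in>{0..<int N}. F a)"
proof -
  have *: "(\<Sum>a\<in>{0..<int N}. F (a + (j + 1))) = (\<Sum>a\<in>{0..<int N}. F (a + j))" for j
  proof -
    have "F (a + int N + j) = F (a + j)" for a using assms[of "a + j"] by (simp add: algebra_simps)
    from per_shift_sum[of "\<lambda>a. F (a + j)", OF this] show ?thesis
      by (simp add: add.assoc add.commute add.left_commute)
  qed
  show ?thesis
  proof (induction j rule: int_induct[of _ 0])
    case (step1 i) then show ?case using *[of i] by simp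
  next
    case (step2 i) then show ?case using *[of "i - 1"] by simp
  qed auto
qed

lemma gsum_shift:
  assumes "\<And>a b. F (a + int (n + 2)) b = F a b"
  shows "gsum n (\<lambda>a b. F (a + j) b) = gsum n F"
  unfolding gsum_def
  using per_shift_sum_int[of "\<lambda>a. \<Sum>b<n + 2. F a b" "n + 2" j] assms by simp

lemma gsum_mono:
  assumes "\<And>a b. b < n + 2 \<Longrightarrow> F a b \<le> G a b"
  shows "gsum n F \<le> gsum n G"
  unfolding gsum_def
  by (intro mult_left_mono sum_mono) (use assms in \<open>auto intro: less_imp_le\<close>)

lemma gsum_cong:
  assumes "\<And>a b. b < n + 2 \<Longrightarrow> F a b = G a b"
  shows "gsum n F = gsum n G"
  using gsum_mono[of n F G] gsum_mono[of n G F] assms by force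

lemma gsum_add: "gsum n (\<lambda>a b. F a b + G a b) = gsum n F + gsum n G"
  unfolding gsum_def by (simp add: sum.distrib distrib_left)

lemma gsum_diff: "gsum n (\<lambda>a b. F a b - G a b) = gsum n F - gsum n G"
  unfolding gsum_def by (simp add: sum_subtractf right_diff_distrib)

lemma gsum_cmult: "gsum n (\<lambda>a b. r * F a b) = r * gsum n F"
  unfolding gsum_def by (simp only: sum_distrib_left mult.left_commute[of r])

lemma gsum_nonneg: "(\<And>a b. b < n + 2 \<Longrightarrow> 0 \<le> F a b) \<Longrightarrow> 0 \<le> gsum n F"
  unfolding gsum_def by (intro mult_nonneg_nonneg sum_nonneg) (auto intro: less_imp_le)

text \<open>4 pi is the area of \<open>Omega\<close>.\<close>

lemma gsum_const: "gsum n (\<lambda>a b. r) = 4 * pi * r"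
proof -
  have "gsum n (\<lambda>a b. r) = (hh n * real (n + 2)) * (kk n * real (n + 2)) * r"
    unfolding gsum_def by (simp del: of_nat_add add_2_eq_Suc' sum.lessThan_Suc)
  moreover have "hh n * real (n + 2) = 2 * pi" "kk n * real (n + 2) = 2"
    unfolding hh_def kk_def by (simp_all del: of_nat_add add_2_eq_Suc')
  ultimately show ?thesis by simp
qed

lemma L2_per: "L2 X \<Longrightarrow> per X" and Linf_per: "Linf X \<Longrightarrow> per X"
  by (auto simp: L2_def Linf_def)

lemma per_add: "per X \<Longrightarrow> per Y \<Longrightarrow> per (\<lambda>n a b. X n a b + Y n a b)"
  and per_diff: "per X \<Longrightarrow> per Y \<Longrightarrow> per (\<lambda>n a b. X n a b - Y n a b)"
  and per_uminus: "per X \<Longrightarrow> per (\<lambda>n a b. - X n a b)"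
  and per_mult: "per X \<Longrightarrow> per Y \<Longrightarrow> per (\<lambda>n a b. X n a b * Y n a b)"
  and per_const: "per (\<lambda>n a b. g n b)"
  and per_if: "per X \<Longrightarrow> per Y \<Longrightarrow> per (\<lambda>n a b. if P n b then X n a b else Y n a b)"
  and per_row: "per X \<Longrightarrow> per (\<lambda>n a b. X n a (F n b))"
  unfolding per_def by auto

lemma per_sh: "per X \<Longrightarrow> per (\<lambda>n a b. X n (a + j) b)"
  unfolding per_def by (metis add.assoc add.commute)

lemma per_shm: "per X \<Longrightarrow> per (\<lambda>n a b. X n (a - j) b)"
  using per_sh[of X "-j"] by simp

lemma per_d1: "per X \<Longrightarrow> per (d1 X)"
  using perD[of X] per_sh[of X 1] unfolding per_def d1_def by (simp add: add.assoc)

lemma per_d2: "per X \<Longrightarrow> per (d2 X)"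
  unfolding per_def d2_def by simp

lemmas per_intros = per_add per_diff per_uminus per_mult per_if per_sh per_shm per_d1 per_d2 per_const

lemma L2_dom:
  assumes "L2 X" "per Y" "\<And>n a b. b < n + 2 \<Longrightarrow> \<bar>Y n a b\<bar> \<le> \<bar>X n a b\<bar>"
  shows "L2 Y"
proof -
  from assms(1) obtain C where C: "\<And>n. gsum n (\<lambda>a b. (X n a b)\<^sup>2) \<le> C" by (auto simp: L2_def)
  have "gsum n (\<lambda>a b. (Y n a b)\<^sup>2) \<le> C" for n
    by (rule order_trans[OF gsum_mono C[of n]]) (use assms(3) in \<open>simp add: abs_le_square_iff\<close>)
  then show ?thesis using assms(2) by (auto simp: L2_def)
qed

lemma L2_cong:
  assumes "L2 X" "per Y" "\<And>n a b. b < n + 2 \<Longrightarrow> Y n a b = X n a b"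
  shows "L2 Y"
  using L2_dom[OF assms(1,2)] assms(3) by simp

lemma L2_add:
  assumes "L2 X" "L2 Y" shows "L2 (\<lambda>n a b. X n a b + Y n a b)"
proof -
  from assms obtain C D where C: "\<And>n. gsum n (\<lambda>a b. (X n a b)\<^sup>2) \<le> C"
    and D: "\<And>n. gsum n (\<lambda>a b. (Y n a b)\<^sup>2) \<le> D" by (auto simp: L2_def)
  have "gsum n (\<lambda>a b. (X n a b + Y n a b)\<^sup>2) \<le> 2 * C + 2 * D" for n
  proof -
    have "gsum n (\<lambda>a b. (X n a b + Y n a b)\<^sup>2)
        \<le> gsum n (\<lambda>a b. 2 * (X n a b)\<^sup>2 + 2 * (Y n a b)\<^sup>2)"
    proof (rule gsum_mono)
      fix a b
      show "(X n a b + Y n a b)\<^sup>2 \<le> 2 * (X n a b)\<^sup>2 + 2 * (Y n a b)\<^sup>2"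
        using sum_squares_bound[of "X n a b" "Y n a b"] by (simp add: power2_sum)
    qed
    also have "\<dots> \<le> 2 * C + 2 * D" using C[of n] D[of n] by (simp add: gsum_add gsum_cmult)
    finally show ?thesis .
  qed
  then show ?thesis using assms by (auto simp: L2_def intro: per_add)
qed

lemma L2_mult:
  assumes "Linf G" "L2 X" shows "L2 (\<lambda>n a b. G n a b * X n a b)"
proof -
  from assms obtain C D where C: "\<And>n. gsum n (\<lambda>a b. (X n a b)\<^sup>2) \<le> C"
    and D: "\<And>n a b. b \<le> n + 2 \<Longrightarrow> \<bar>G n a b\<bar> \<le> D" by (auto simp: L2_def Linf_def)
  have "gsum n (\<lambda>a b. (G n a b * X n a b)\<^sup>2) \<le> D\<^sup>2 * C" for n
  proof -
    have "gsum n (\<lambda>a b. (G n a b * X n a b)\<^sup>2) \<le> gsum n (\<lambda>a b. D\<^sup>2 * (X n a b)\<^sup>2)"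
    proof (rule gsum_mono)
      fix a b assume "b < n + 2"
      then have "(G n a b)\<^sup>2 \<le> D\<^sup>2" using D[of b n a] by (metis abs_ge_zero less_imp_le power2_abs power_mono)
      then show "(G n a b * X n a b)\<^sup>2 \<le> D\<^sup>2 * (X n a b)\<^sup>2"
        by (simp add: power_mult_distrib mult_right_mono)
    qed
    also have "\<dots> \<le> D\<^sup>2 * C" using C[of n] by (simp add: gsum_cmult mult_left_mono)
    finally show ?thesis .
  qed
  then show ?thesis using assms by (auto simp: L2_def Linf_def intro: per_mult)
qed

lemma Linf_const: "Linf (\<lambda>n a b. r)"
  unfolding Linf_def per_def by auto

lemma L2_uminus: "L2 X \<Longrightarrow> L2 (\<lambda>n a b. - X n a b)"
  using L2_mult[OF Linf_const[of "-1"]] by simp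

lemma L2_diff: "L2 X \<Longrightarrow> L2 Y \<Longrightarrow> L2 (\<lambda>n a b. X n a b - Y n a b)"
  using L2_add[of X, OF _ L2_uminus[of Y]] by simp

lemma L2_cmult: "L2 X \<Longrightarrow> L2 (\<lambda>n a b. r * X n a b)"
  using L2_mult[OF Linf_const[of r]] by simp

lemma L2_Linf: assumes "Linf G" shows "L2 G"
proof -
  have "gsum n (\<lambda>a b. 1\<^sup>2) \<le> 4 * pi" for n using gsum_const[of n 1] by simp
  then have "L2 (\<lambda>n a b. 1)" unfolding L2_def per_def by auto
  from L2_mult[OF assms this] show ?thesis by simp
qed

lemma L2_sh: assumes "L2 X" shows "L2 (\<lambda>n a b. X n (a + j) b)"
proof -
  have "gsum n (\<lambda>a b. (X n (a + j) b)\<^sup>2) = gsum n (\<lambda>a b. (X n a b)\<^sup>2)" for n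
    by (rule gsum_shift[of "\<lambda>a b. (X n a b)\<^sup>2"]) (use perD[OF L2_per[OF assms]] in simp)
  then show ?thesis using assms per_sh[of X j] by (auto simp: L2_def)
qed

lemma L2_shm: "L2 X \<Longrightarrow> L2 (\<lambda>n a b. X n (a - j) b)"
  using L2_sh[of X "-j"] by simp

text \<open>Row shifts padded with 0, so that the \<open>L2\<close> norm does not grow; a plain
  shift up would bring in the row N, which \<open>gsum\<close> does not control.\<close>

definition up :: "grid_fam \<Rightarrow> grid_fam" where
  "up X n a b = (if Suc b < n + 2 then X n a (Suc b) else 0)"

definition dn :: "grid_fam \<Rightarrow> grid_fam" where
  "dn X n a b = (case b of 0 \<Rightarrow> 0 | Suc b' \<Rightarrow> X n a b')"

lemma per_up: "per X \<Longrightarrow> per (up X)" and per_dn: "per X \<Longrightarrow> per (dn X)"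
  by (auto simp: per_def up_def dn_def split: nat.splits)

lemma L2_rowbound:
  assumes "L2 X" "per Y" "\<And>n a. (\<Sum>b<n + 2. (Y n a b)\<^sup>2) \<le> (\<Sum>b<n + 2. (X n a b)\<^sup>2)"
  shows "L2 Y"
proof -
  from assms(1) obtain C where C: "\<And>n. gsum n (\<lambda>a b. (X n a b)\<^sup>2) \<le> C" by (auto simp: L2_def)
  have "gsum n (\<lambda>a b. (Y n a b)\<^sup>2) \<le> gsum n (\<lambda>a b. (X n a b)\<^sup>2)" for n
    unfolding gsum_def by (intro mult_left_mono sum_mono assms(3)) (auto intro: less_imp_le)
  with C have "gsum n (\<lambda>a b. (Y n a b)\<^sup>2) \<le> C" for n by (meson order_trans)
  then show ?thesis using assms(2) by (auto simp: L2_def)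
qed

lemma L2_up: assumes "L2 X" shows "L2 (up X)"
proof (rule L2_rowbound[OF assms per_up[OF L2_per[OF assms]]])
  fix n a
  have "(\<Sum>b<n + 2. (up X n a b)\<^sup>2) = (\<Sum>b<Suc n. (X n a (Suc b))\<^sup>2)"
    by (simp add: up_def)
  also have "\<dots> \<le> (\<Sum>b<Suc (Suc n). (X n a b)\<^sup>2)"
    unfolding sum.lessThan_Suc_shift[of _ "Suc n"] by simp
  finally show "(\<Sum>b<n + 2. (up X n a b)\<^sup>2) \<le> (\<Sum>b<n + 2. (X n a b)\<^sup>2)" by simp
qed

lemma L2_dn: assumes "L2 X" shows "L2 (dn X)"
proof (rule L2_rowbound[OF assms per_dn[OF L2_per[OF assms]]])
  fix n a
  have "(\<Sum>b<n + 2. (dn X n a b)\<^sup>2) = (\<Sum>b<Suc n. (X n a b)\<^sup>2)"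
    using sum.lessThan_Suc_shift[of "\<lambda>b. (dn X n a b)\<^sup>2" "Suc n"] by (simp add: dn_def)
  also have "\<dots> \<le> (\<Sum>b<Suc (Suc n). (X n a b)\<^sup>2)" by simp
  finally show "(\<Sum>b<n + 2. (dn X n a b)\<^sup>2) \<le> (\<Sum>b<n + 2. (X n a b)\<^sup>2)" by simp
qed

text \<open>The two mesh sizes are comparable, so one mesh size times a tangential difference is harmless.\<close>

lemma L2_kd1: assumes "L2 X" shows "L2 (\<lambda>n a b. kk n * d1 X n a b)"
proof -
  have "L2 (\<lambda>n a b. (1/pi) * (X n (a + 1) b - X n a b))"
    by (intro L2_cmult L2_diff L2_sh assms)
  moreover have "kk n * d1 X n a b = (1/pi) * (X n (a + 1) b - X n a b)" for n a b
  proof -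
    have "kk n = hh n / pi" unfolding kk_def hh_def by simp
    then show ?thesis by (simp add: d1_def)
  qed
  ultimately show ?thesis by simp
qed

lemma Linf_add: assumes "Linf X" "Linf Y" shows "Linf (\<lambda>n a b. X n a b + Y n a b)"
proof -
  from assms obtain C D where C: "\<And>n a b. b \<le> n + 2 \<Longrightarrow> \<bar>X n a b\<bar> \<le> C"
    and D: "\<And>n a b. b \<le> n + 2 \<Longrightarrow> \<bar>Y n a b\<bar> \<le> D" by (auto simp: Linf_def)
  have "\<bar>X n a b + Y n a b\<bar> \<le> C + D" if "b \<le> n + 2" for n a b
    using C[OF that, of a] D[OF that, of a] by linarith
  then show ?thesis using assms by (auto simp: Linf_def intro: per_add)
qed

lemma Linf_mult: assumes "Linf X" "Linf Y" shows "Linf (\<lambda>n a b. X n a b * Y n a b)"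
proof -
  from assms obtain C D where C: "\<And>n a b. b \<le> n + 2 \<Longrightarrow> \<bar>X n a b\<bar> \<le> C"
    and D: "\<And>n a b. b \<le> n + 2 \<Longrightarrow> \<bar>Y n a b\<bar> \<le> D" by (auto simp: Linf_def)
  have "\<bar>X n a b * Y n a b\<bar> \<le> C * D" if "b \<le> n + 2" for n a b
    using C[OF that, of a] D[OF that, of a] by (simp add: abs_mult mult_mono')
  then show ?thesis using assms by (auto simp: Linf_def intro: per_mult)
qed

lemma Linf_uminus: "Linf X \<Longrightarrow> Linf (\<lambda>n a b. - X n a b)"
  by (simp add: Linf_def per_def)

lemma Linf_diff: "Linf X \<Longrightarrow> Linf Y \<Longrightarrow> Linf (\<lambda>n a b. X n a b - Y n a b)"
  using Linf_add[of X, OF _ Linf_uminus[of Y]] by simp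

lemma Linf_sh: "Linf X \<Longrightarrow> Linf (\<lambda>n a b. X n (a + j) b)"
  using per_sh[of X j] unfolding Linf_def by blast

lemma Linf_shm: "Linf X \<Longrightarrow> Linf (\<lambda>n a b. X n (a - j) b)"
  using Linf_sh[of X "-j"] by simp

lemma Linf_seq: "(\<And>n. \<bar>s n\<bar> \<le> C) \<Longrightarrow> Linf (\<lambda>n a b. s n)"
  by (auto simp: Linf_def per_def)

lemmas L2_intros = L2_add L2_diff L2_uminus L2_mult L2_sh L2_shm L2_up L2_dn

lemma d1_add: "d1 (\<lambda>n a b. X n a b + Y n a b) n a b = d1 X n a b + d1 Y n a b"
  and d1_diff: "d1 (\<lambda>n a b. X n a b - Y n a b) n a b = d1 X n a b - d1 Y n a b"
  and d1_uminus: "d1 (\<lambda>n a b. - X n a b) n a b = - d1 X n a b"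
  and d1_mult: "d1 (\<lambda>n a b. X n a b * Y n a b) n a b = d1 X n a b * Y n a b + X n (a + 1) b * d1 Y n a b"
  and d1_sh: "d1 (\<lambda>n a b. X n (a + j) b) n a b = d1 X n (a + j) b"
  and d1_shm: "d1 (\<lambda>n a b. X n (a - j) b) n a b = d1 X n (a - j) b"
  and d1_const: "d1 (\<lambda>n a b. G n b) n a b = 0"
  by (simp_all add: d1_def field_simps add.commute add.left_commute)

lemma d1_d2: "d1 (d2 X) n a b = d2 (d1 X) n a b"
  by (simp add: d1_def d2_def field_simps)

lemma d1_up: "d1 (up X) = up (d1 X)" and d1_dn: "d1 (dn X) = dn (d1 X)"
  by (auto simp: d1_def up_def dn_def fun_eq_iff split: nat.splits)

section \<open>Summation by parts and the tangential energy estimate\<close>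

lemma sum_by_parts:
  fixes x Q :: "nat \<Rightarrow> real"
  shows "(\<Sum>b<m. x b * (Q (Suc b) - Q b)) = x m * Q m - x 0 * Q 0 - (\<Sum>b<m. Q (Suc b) * (x (Suc b) - x b))"
  by (induction m) (auto simp: algebra_simps)

text \<open>Both boundary terms of \<open>sum_by_parts\<close> carry the value of \<open>Q\<close>
  on the row 0 or N.\<close>

lemma gsum_d2_parts:
  assumes "\<And>a. Q n a 0 = 0" "\<And>a. Q n a (n + 2) = 0"
  shows "gsum n (\<lambda>a b. x n a b * d2 Q n a b) = - gsum n (\<lambda>a b. Q n a (Suc b) * d2 x n a b)"
proof -
  have "(\<Sum>b<n + 2. x n a b * d2 Q n a b) = - (\<Sum>b<n + 2. Q n a (Suc b) * d2 x n a b)" for a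
    using sum_by_parts[of "x n a" "Q n a" "n + 2"] assms[of a]
    unfolding d2_def times_divide_eq_right sum_divide_distrib[symmetric]
    by (simp del: add_2_eq_Suc' sum.lessThan_Suc)
  then show ?thesis unfolding gsum_def by (simp add: sum_negf del: add_2_eq_Suc' sum.lessThan_Suc)
qed

text \<open>Periodicity leaves no boundary terms. The shift to a - 1 appears because the adjoint of
  the forward difference is minus the backward one.\<close>

lemma gsum_d1_parts:
  assumes "per x" "per y"
  shows "gsum n (\<lambda>a b. x n a b * d1 y n (a - 1) b) = - gsum n (\<lambda>a b. d1 x n a b * y n a b)"
proof -
  have *: "gsum n (\<lambda>a b. x n (a + 1) b * y n a b) = gsum n (\<lambda>a b. x n a b * y n (a - 1) b)"
    using gsum_shift[of "\<lambda>a b. x n a b * y n (a - 1) b" n 1] perD[OF per_mult[OF assms(1) per_shm[OF assms(2), of 1]]]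
    by simp
  have "gsum n (\<lambda>a b. x n a b * d1 y n (a - 1) b)
     = gsum n (\<lambda>a b. (1 / hh n) * (x n a b * y n a b - x n a b * y n (a - 1) b))"
    by (rule gsum_cong) (simp add: d1_def right_diff_distrib diff_divide_distrib)
  also have "\<dots> = (1 / hh n) * (gsum n (\<lambda>a b. x n a b * y n a b) - gsum n (\<lambda>a b. x n (a + 1) b * y n a b))"
    by (simp only: gsum_cmult gsum_diff *)
  also have "\<dots> = gsum n (\<lambda>a b. (1 / hh n) * (x n a b * y n a b - x n (a + 1) b * y n a b))"
    by (simp only: gsum_cmult gsum_diff)
  also have "\<dots> = gsum n (\<lambda>a b. (-1) * (d1 x n a b * y n a b))"
    by (rule gsum_cong) (simp add: d1_def left_diff_distrib diff_divide_distrib)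
  finally show ?thesis by (subst (asm) gsum_cmult) simp
qed

text \<open>The weight c/4 is chosen for \<open>L2_from_sum\<close>, where the three absorbed
  squares together cost at most half of the coercive term.\<close>

lemma young: "c > 0 \<Longrightarrow> x * (y::real) \<le> c / 4 * y\<^sup>2 + x\<^sup>2 / c"
proof -
  assume c: "c > 0"
  have "0 \<le> (c * y / 2 - x)\<^sup>2 / c" using c by simp
  also have "\<dots> = c / 4 * y\<^sup>2 + x\<^sup>2 / c - x * y" using c by (simp add: field_simps power2_eq_square)
  finally show ?thesis by simp
qed

text \<open>Uniform ellipticity of the matrix with rows (A, B) and (B, 1).\<close>

definition ellip :: "grid_fam \<Rightarrow> grid_fam \<Rightarrow> bool" where
  "ellip A B \<longleftrightarrow> (\<exists>c>0. \<forall>n a b x y. b \<le> n + 2 \<longrightarrow>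
      c * (x\<^sup>2 + y\<^sup>2) \<le> A n a b * x\<^sup>2 + 2 * B n a b * x * y + y\<^sup>2)"

lemma ellip_sh: "ellip A B \<Longrightarrow> ellip (\<lambda>n a b. A n (a + j) b) (\<lambda>n a b. B n (a + j) b)"
  unfolding ellip_def by blast

text \<open>Absorption: Young's inequality splits each product on the right into a small multiple of
  the squares on the left and a bounded rest. The separate \<open>x'\<close> is a shifted copy of
  \<open>x\<close> with the same norm, because \<open>R\<close> gets tested against a function moved
  by one node.\<close>

lemma L2_from_sum:
  assumes c: "c > 0" and per: "per x" "per y" "per x'" and L: "L2 R" "L2 e1" "L2 e2"
    and x': "\<And>n. gsum n (\<lambda>a b. (x' n a b)\<^sup>2) = gsum n (\<lambda>a b. (x n a b)\<^sup>2)"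
    and le: "\<And>n. gsum n (\<lambda>a b. c * ((x n a b)\<^sup>2 + (y n a b)\<^sup>2))
        \<le> gsum n (\<lambda>a b. R n a b * x' n a b - e1 n a b * x n a b - e2 n a b * y n a b) + D"
  shows "L2 x \<and> L2 y"
proof -
  from L obtain C1 C2 C3 where C: "\<And>n. gsum n (\<lambda>a b. (R n a b)\<^sup>2) \<le> C1"
    "\<And>n. gsum n (\<lambda>a b. (e1 n a b)\<^sup>2) \<le> C2" "\<And>n. gsum n (\<lambda>a b. (e2 n a b)\<^sup>2) \<le> C3"
    by (auto simp: L2_def)
  have key: "gsum n (\<lambda>a b. (x n a b)\<^sup>2) + gsum n (\<lambda>a b. (y n a b)\<^sup>2) \<le> ((C1 + C2 + C3) / c + D) * (2 / c)" for n
  proof -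
    let ?X = "gsum n (\<lambda>a b. (x n a b)\<^sup>2)" and ?Y = "gsum n (\<lambda>a b. (y n a b)\<^sup>2)"
    have Y0: "0 \<le> ?Y" by (rule gsum_nonneg) simp
    have "c * (?X + ?Y) = gsum n (\<lambda>a b. c * ((x n a b)\<^sup>2 + (y n a b)\<^sup>2))"
      by (simp add: gsum_cmult gsum_add)
    also note le[of n]
    also have "gsum n (\<lambda>a b. R n a b * x' n a b - e1 n a b * x n a b - e2 n a b * y n a b)
      + D \<le> gsum n (\<lambda>a b. (c / 4 * (x' n a b)\<^sup>2 + (1/c) * (R n a b)\<^sup>2) + (c / 4 * (x n a b)\<^sup>2 + (1/c) * (e1 n a b)\<^sup>2)
          + (c / 4 * (y n a b)\<^sup>2 + (1/c) * (e2 n a b)\<^sup>2)) + D"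
    proof (intro add_right_mono gsum_mono)
      fix a b
      show "R n a b * x' n a b - e1 n a b * x n a b - e2 n a b * y n a b \<le>
         (c / 4 * (x' n a b)\<^sup>2 + (1/c) * (R n a b)\<^sup>2) + (c / 4 * (x n a b)\<^sup>2 + (1/c) * (e1 n a b)\<^sup>2)
          + (c / 4 * (y n a b)\<^sup>2 + (1/c) * (e2 n a b)\<^sup>2)"
        using young[OF c, of "R n a b" "x' n a b"] young[OF c, of "- e1 n a b" "x n a b"]
          young[OF c, of "- e2 n a b" "y n a b"] by simp
    qed
    also have "\<dots> = (c/4 * ?X + (1/c) * gsum n (\<lambda>a b. (R n a b)\<^sup>2)) + (c/4 * ?X + (1/c) * gsum n (\<lambda>a b. (e1 n a b)\<^sup>2))
       + (c/4 * ?Y + (1/c) * gsum n (\<lambda>a b. (e2 n a b)\<^sup>2)) + D"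
      unfolding gsum_add gsum_cmult x' ..
    also have "\<dots> \<le> c/2 * (?X + ?Y) + ((1/c) * (C1 + C2 + C3) + D)"
    proof -
      have "(1/c) * gsum n (\<lambda>a b. (R n a b)\<^sup>2) \<le> (1/c) * C1" "(1/c) * gsum n (\<lambda>a b. (e1 n a b)\<^sup>2) \<le> (1/c) * C2"
        "(1/c) * gsum n (\<lambda>a b. (e2 n a b)\<^sup>2) \<le> (1/c) * C3"
        using C[of n] c by (simp_all add: divide_right_mono)
      moreover have "0 \<le> c/4 * ?Y" using c Y0 by simp
      moreover have "c/2 * (?X + ?Y) = c/4 * ?X + c/4 * ?X + (c/4 * ?Y + c/4 * ?Y)" by (simp add: algebra_simps)
      ultimately show ?thesis unfolding distrib_left[of "1/c"] by linarith
    qed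
    finally have "c/2 * (?X + ?Y) \<le> (1/c) * (C1 + C2 + C3) + D" by (simp add: algebra_simps)
    then show ?thesis using c by (simp add: field_simps power2_eq_square)
  qed
  have nn: "gsum n (\<lambda>a b. (x n a b)\<^sup>2) \<ge> 0" "gsum n (\<lambda>a b. (y n a b)\<^sup>2) \<ge> 0" for n
    by (auto intro: gsum_nonneg)
  have "gsum n (\<lambda>a b. (x n a b)\<^sup>2) \<le> ((C1 + C2 + C3) / c + D) * (2 / c)"
    "gsum n (\<lambda>a b. (y n a b)\<^sup>2) \<le> ((C1 + C2 + C3) / c + D) * (2 / c)" for n
    using key[of n] nn[of n] by linarith+
  then show ?thesis using per unfolding L2_def by blast
qed

text \<open>The equation is tested with the centred second difference
  \<open>d1 (d1 w) n (a - 1) b\<close>. Summing by parts in both directions turns the principal part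
  into the quadratic form of the pair \<open>d1 (d1 w)\<close>, \<open>d2 (d1 w)\<close>; the
  differences that fall on the coefficients and remainders are collected in \<open>e1\<close> and
  \<open>e2\<close>, where \<open>w\<close> occurs with first differences only. The remainders
  \<open>r1\<close> and \<open>r2\<close> allow three uses: for \<open>w\<close>, for
  \<open>d1 w\<close>, and for the weighted \<open>W\<close>.\<close>

lemma energy_tangential:
  assumes per: "per w" "per Q" "per q1" and "Linf A" and "Linf B"
    and dA: "Linf (d1 A)" and dB: "Linf (d1 B)" and el: "ellip A B"
    and q1: "\<And>n a b. b < n + 2 \<Longrightarrow> q1 n a b = A n a b * d1 w n a b + B n a b * d2 w n a b + r1 n a b"
    and q2: "\<And>n a b. b < n + 2 \<Longrightarrow> Q n a (Suc b) = B n a b * d1 w n a b + d2 w n a b + r2 n a b"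
    and Q0: "\<And>n a. Q n a 0 = 0" and QN: "\<And>n a. Q n a (n + 2) = 0"
    and R: "\<And>n a b. b < n + 2 \<Longrightarrow> d1 q1 n (a - 1) b + d2 Q n a b = R n a b"
    and L: "L2 R" "L2 (d1 w)" "L2 (d2 w)" "L2 (d1 r1)" "L2 (d1 r2)"
  shows "L2 (d1 (d1 w)) \<and> L2 (d2 (d1 w))"
proof -
  from el obtain c where c: "c > 0" and cl: "\<And>n a b x y. b \<le> n + 2 \<Longrightarrow>
      c * (x\<^sup>2 + y\<^sup>2) \<le> A n a b * x\<^sup>2 + 2 * B n a b * x * y + y\<^sup>2" unfolding ellip_def by blast
  let ?x = "d1 (d1 w)" and ?y = "d2 (d1 w)"
  let ?x' = "\<lambda>n a b. d1 (d1 w) n (a - 1) b"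
  define e1 where "e1 = (\<lambda>n a b. d1 A n a b * d1 w n a b + d1 B n a b * d2 w n a b + d1 r1 n a b)"
  define e2 where "e2 = (\<lambda>n a b. d1 B n a b * d1 w n a b + d1 r2 n a b)"
  have Le: "L2 e1" "L2 e2" unfolding e1_def e2_def by (intro L2_intros dA dB L)+
  have pw: "per (d1 w)" "per (d1 (d1 w))" "per (d2 (d1 w))" using per by (auto intro!: per_intros)
  show ?thesis
  proof (rule L2_from_sum[OF c pw(2,3) per_shm[OF pw(2), of 1] L(1) Le, where D = 0])
    fix n
    show "gsum n (\<lambda>a b. (d1 (d1 w) n (a - 1) b)\<^sup>2) = gsum n (\<lambda>a b. (d1 (d1 w) n a b)\<^sup>2)"
      using gsum_shift[of "\<lambda>a b. (d1 (d1 w) n a b)\<^sup>2" n "-1"] perD[OF pw(2)] by simp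
    have D1: "d1 q1 n a b = A n (a + 1) b * ?x n a b + B n (a + 1) b * ?y n a b + e1 n a b" if "b < n + 2" for a b
    proof -
      have "d1 q1 n a b = d1 (\<lambda>n a b. A n a b * d1 w n a b + B n a b * d2 w n a b + r1 n a b) n a b"
        using that by (simp add: d1_def[of q1] d1_def[of "\<lambda>n a b. _ n a b + _ n a b"] q1)
      then show ?thesis by (simp add: d1_add d1_mult e1_def d1_d2 algebra_simps)
    qed
    have D2: "d1 Q n a (Suc b) = B n (a + 1) b * ?x n a b + ?y n a b + e2 n a b" if "b < n + 2" for a b
    proof -
      have "d1 Q n a (Suc b) = d1 (\<lambda>n a b. B n a b * d1 w n a b + d2 w n a b + r2 n a b) n a b"
        using that by (simp add: d1_def[of Q] d1_def[of "\<lambda>n a b. _ n a b + _ n a b"] q2)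
      then show ?thesis by (simp add: d1_add d1_mult e2_def d1_d2 algebra_simps)
    qed
    have a1: "gsum n (\<lambda>a b. d1 q1 n (a - 1) b * ?x' n a b) = gsum n (\<lambda>a b. d1 q1 n a b * ?x n a b)"
      using gsum_shift[of "\<lambda>a b. d1 q1 n a b * ?x n a b" n "-1"]
        perD[OF per_mult[OF per_d1[OF per(3)] pw(2)], of n] by simp
    \<comment> \<open>By parts first in a, then in b; \<open>d1 Q\<close> vanishes on the rows 0 and
      N because \<open>Q\<close> does so for every a.\<close>
    have a2: "gsum n (\<lambda>a b. d2 Q n a b * ?x' n a b) = gsum n (\<lambda>a b. d1 Q n a (Suc b) * ?y n a b)"
    proof -
      have "gsum n (\<lambda>a b. d2 Q n a b * ?x' n a b) = - gsum n (\<lambda>a b. d1 (d2 Q) n a b * d1 w n a b)"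
        by (rule gsum_d1_parts) (use per pw in \<open>auto intro!: per_intros\<close>)
      also have "\<dots> = - gsum n (\<lambda>a b. d1 w n a b * d2 (d1 Q) n a b)"
        by (simp add: d1_d2 mult.commute)
      also have "\<dots> = gsum n (\<lambda>a b. d1 Q n a (Suc b) * d2 (d1 w) n a b)"
      proof -
        have "d1 Q n a 0 = 0" "d1 Q n a (n+2) = 0" for a by (simp_all only: d1_def Q0 QN, simp_all)
        from gsum_d2_parts[of "d1 Q" n "d1 w", OF this] show ?thesis by simp
      qed
      finally show ?thesis .
    qed
    have "gsum n (\<lambda>a b. R n a b * ?x' n a b) = gsum n (\<lambda>a b. d1 q1 n (a - 1) b * ?x' n a b + d2 Q n a b * ?x' n a b)"
      by (rule gsum_cong) (simp add: R[symmetric] distrib_right)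
    also have "\<dots> = gsum n (\<lambda>a b. d1 q1 n a b * ?x n a b + d1 Q n a (Suc b) * ?y n a b)"
      by (simp add: gsum_add a1 a2)
    also have "\<dots> = gsum n (\<lambda>a b. (A n (a+1) b * (?x n a b)\<^sup>2 + 2 * B n (a+1) b * ?x n a b * ?y n a b + (?y n a b)\<^sup>2)
        + (e1 n a b * ?x n a b + e2 n a b * ?y n a b))"
      by (rule gsum_cong) (simp add: D1 D2 power2_eq_square algebra_simps)
    finally have eq: "gsum n (\<lambda>a b. R n a b * ?x' n a b) = gsum n (\<lambda>a b. (A n (a+1) b * (?x n a b)\<^sup>2 + 2 * B n (a+1) b * ?x n a b * ?y n a b + (?y n a b)\<^sup>2))
        + gsum n (\<lambda>a b. (e1 n a b * ?x n a b + e2 n a b * ?y n a b))" by (simp add: gsum_add)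
    have "gsum n (\<lambda>a b. c * ((?x n a b)\<^sup>2 + (?y n a b)\<^sup>2))
       \<le> gsum n (\<lambda>a b. (A n (a+1) b * (?x n a b)\<^sup>2 + 2 * B n (a+1) b * ?x n a b * ?y n a b + (?y n a b)\<^sup>2))"
      by (rule gsum_mono) (use cl in auto)
    also have "\<dots> = gsum n (\<lambda>a b. R n a b * ?x' n a b - e1 n a b * ?x n a b - e2 n a b * ?y n a b)"
      using eq by (simp add: gsum_diff gsum_add)
    finally show "gsum n (\<lambda>a b. c * ((?x n a b)\<^sup>2 + (?y n a b)\<^sup>2)) \<le> gsum n (\<lambda>a b. R n a b * ?x' n a b - e1 n a b * ?x n a b - e2 n a b * ?y n a b) + 0" by simp
  qed
qed

section \<open>Discrete Sobolev inequalities\<close>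

lemma increment_square:
  fixes x :: "nat \<Rightarrow> real"
  assumes "i \<le> j" "t \<noteq> 0"
  shows "(x j - x i)\<^sup>2 \<le> (real (j - i) * t) * (t * (\<Sum>m\<in>{i..<j}. ((x (Suc m) - x m) / t)\<^sup>2))"
proof -
  have "x j - x i = (\<Sum>m\<in>{i..<j}. x (Suc m) - x m)" using sum_Suc_diff'[OF assms(1), of x] by simp
  also have "\<dots> = (\<Sum>m\<in>{i..<j}. t * ((x (Suc m) - x m) / t))" using assms(2) by simp
  also have "\<dots> = t * (\<Sum>m\<in>{i..<j}. ((x (Suc m) - x m) / t))" by (simp only: sum_distrib_left)
  finally have "(x j - x i)\<^sup>2 = t\<^sup>2 * (\<Sum>m\<in>{i..<j}. ((x (Suc m) - x m) / t))\<^sup>2"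
    by (simp only: power_mult_distrib)
  also have "\<dots> \<le> t\<^sup>2 * ((\<Sum>m\<in>{i..<j}. ((x (Suc m) - x m) / t)\<^sup>2) * real (card {i..<j}))"
    by (intro mult_left_mono sum_squared_le_sum_of_squares) auto
  finally show ?thesis by (simp add: power2_eq_square mult_ac)
qed

text \<open>The value at b is compared with the value at each i < N by
  \<open>increment_square\<close>, and the resulting bounds are averaged over i.\<close>

lemma sup_square_1d:
  fixes x :: "nat \<Rightarrow> real"
  assumes "b \<le> N" "N \<ge> 1" "t > 0"
  shows "(x b)\<^sup>2 \<le> (2 / real N) * (\<Sum>i<N. (x i)\<^sup>2) + 2 * (real N * t) * (t * (\<Sum>i<N. ((x (Suc i) - x i) / t)\<^sup>2))"
proof -
  let ?D = "t * (\<Sum>i<N. ((x (Suc i) - x i) / t)\<^sup>2)"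
  have D0: "0 \<le> ?D" using assms by (intro mult_nonneg_nonneg sum_nonneg) auto
  have inc: "(x j - x i)\<^sup>2 \<le> real N * t * ?D" if "i \<le> j" "j \<le> N" for i j
  proof -
    have "(x j - x i)\<^sup>2 \<le> (real (j - i) * t) * (t * (\<Sum>m\<in>{i..<j}. ((x (Suc m) - x m) / t)\<^sup>2))"
      using increment_square[OF that(1), of t x] assms by simp
    also have "\<dots> \<le> (real N * t) * ?D"
    proof (rule mult_mono)
      show "t * (\<Sum>m\<in>{i..<j}. ((x (Suc m) - x m) / t)\<^sup>2) \<le> ?D"
        using assms that by (intro mult_left_mono sum_mono2) auto
      show "0 \<le> t * (\<Sum>m\<in>{i..<j}. ((x (Suc m) - x m) / t)\<^sup>2)"
        using assms by (intro mult_nonneg_nonneg sum_nonneg) auto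
    qed (use assms that in auto)
    finally show ?thesis .
  qed
  have b: "(x b)\<^sup>2 \<le> 2 * (x i)\<^sup>2 + 2 * (real N * t * ?D)" if "i < N" for i
  proof -
    have "(x b - x i)\<^sup>2 \<le> real N * t * ?D"
    proof (cases "i \<le> b")
      case True then show ?thesis using inc[of i b] assms by simp
    next
      case False then show ?thesis using inc[of b i] that by (simp add: power2_commute[of "x b"])
    qed
    moreover have "(x b)\<^sup>2 \<le> 2 * (x i)\<^sup>2 + 2 * (x b - x i)\<^sup>2"
    proof -
      have "0 \<le> (x b - 2 * x i)\<^sup>2" by simp
      then show ?thesis by (simp add: power2_eq_square algebra_simps)
    qed
    ultimately show ?thesis by linarith
  qed
  have "real N * (x b)\<^sup>2 = (\<Sum>i<N. (x b)\<^sup>2)" by simp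
  also have "\<dots> \<le> (\<Sum>i<N. 2 * (x i)\<^sup>2 + 2 * (real N * t * ?D))" by (intro sum_mono b) simp
  also have "\<dots> = 2 * (\<Sum>i<N. (x i)\<^sup>2) + real N * (2 * (real N * t * ?D))"
    by (simp add: sum.distrib sum_distrib_left)
  finally have "(x b)\<^sup>2 \<le> (2 * (\<Sum>i<N. (x i)\<^sup>2) + real N * (2 * (real N * t * ?D))) / real N"
    using assms by (subst pos_le_divide_eq) (auto simp: mult.commute)
  also have "\<dots> = (2 / real N) * (\<Sum>i<N. (x i)\<^sup>2) + 2 * (real N * t) * ?D"
    using assms by (simp add: add_divide_distrib)
  finally show ?thesis .
qed

lemma per_window_sum:
  fixes F :: "int \<Rightarrow> real"
  assumes "\<And>a. F (a + int N) = F a"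
  shows "(\<Sum>i<N. F (a + int i)) = (\<Sum>a\<in>{0..<int N}. F a)"
proof -
  have "(\<Sum>i<N. F (a + int i)) = (\<Sum>c\<in>{0..<int N}. F (c + a))"
    by (rule sum.reindex_bij_witness[of _ nat int]) (auto simp: add.commute)
  then show ?thesis using per_shift_sum_int[of F N a, OF assms] by simp
qed

lemma kN: "kk n * real (n + 2) = 2" and hN: "hh n * real (n + 2) = 2 * pi"
  unfolding hh_def kk_def by (simp_all del: of_nat_add add_2_eq_Suc')

text \<open>A trace estimate: \<open>sup_square_1d\<close> is applied to every column and the
  results are summed over the columns. The constant 4 is 2 * (N * \<open>kk n\<close>), the strip
  having height 2.\<close>

lemma row_L2:
  assumes "L2 z" "L2 (d2 z)"
  obtains C where "\<And>n b. b \<le> n + 2 \<Longrightarrow> hh n * (\<Sum>a\<in>{0..<int (n + 2)}. (z n a b)\<^sup>2) \<le> C"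
proof -
  from assms obtain C1 C2 where C: "\<And>n. gsum n (\<lambda>a b. (z n a b)\<^sup>2) \<le> C1"
    "\<And>n. gsum n (\<lambda>a b. (d2 z n a b)\<^sup>2) \<le> C2" by (auto simp: L2_def)
  have "hh n * (\<Sum>a\<in>{0..<int (n + 2)}. (z n a b)\<^sup>2) \<le> C1 + 4 * C2" if "b \<le> n + 2" for n b
  proof -
    have "(z n a b)\<^sup>2 \<le> kk n * (\<Sum>i<n+2. (z n a i)\<^sup>2) + 4 * (kk n * (\<Sum>i<n+2. (d2 z n a i)\<^sup>2))" for a
    proof -
      have "2 / real (n + 2) = kk n" by (simp add: kk_def)
      moreover have "real (n + 2) * kk n = 2" using kN by (simp add: mult.commute)
      ultimately show ?thesis
        using sup_square_1d[OF that, of "kk n" "z n a"] unfolding d2_def[symmetric] by simp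
    qed
    then have "hh n * (\<Sum>a\<in>{0..<int (n + 2)}. (z n a b)\<^sup>2)
       \<le> hh n * (\<Sum>a\<in>{0..<int (n + 2)}. kk n * (\<Sum>i<n+2. (z n a i)\<^sup>2) + 4 * (kk n * (\<Sum>i<n+2. (d2 z n a i)\<^sup>2)))"
      by (intro mult_left_mono sum_mono) (auto intro: less_imp_le)
    also have "\<dots> = gsum n (\<lambda>a b. (z n a b)\<^sup>2) + 4 * gsum n (\<lambda>a b. (d2 z n a b)\<^sup>2)"
      unfolding gsum_def sum.distrib sum_distrib_left[symmetric] by (simp only: distrib_left mult_ac)
    also have "\<dots> \<le> C1 + 4 * C2" using C[of n] by simp
    finally show ?thesis .
  qed
  then show ?thesis using that by blast
qed

text \<open>As \<open>row_L2\<close> with the directions exchanged. The window of one period starts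
  at a itself, so that periodicity makes the bound independent of a.\<close>

lemma col_L2:
  assumes "L2 z" "L2 (d1 z)"
  obtains C where "\<And>n a. kk n * (\<Sum>b<n + 2. (z n a b)\<^sup>2) \<le> C"
proof -
  from assms obtain C1 C2 where C: "\<And>n. gsum n (\<lambda>a b. (z n a b)\<^sup>2) \<le> C1"
    "\<And>n. gsum n (\<lambda>a b. (d1 z n a b)\<^sup>2) \<le> C2" by (auto simp: L2_def)
  have "kk n * (\<Sum>b<n + 2. (z n a b)\<^sup>2) \<le> (1/pi) * C1 + (4 * pi) * C2" for n a
  proof -
    let ?I = "{0..<int (n + 2)}"
    have "(z n a b)\<^sup>2 \<le> (1/pi) * (hh n * (\<Sum>c\<in>?I. (z n c b)\<^sup>2)) + (4 * pi) * (hh n * (\<Sum>c\<in>?I. (d1 z n c b)\<^sup>2))" for b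
    proof -
      have w1: "(\<Sum>i<n+2. (z n (a + int i) b)\<^sup>2) = (\<Sum>c\<in>?I. (z n c b)\<^sup>2)"
        by (rule per_window_sum) (use perD[OF L2_per[OF assms(1)]] in simp)
      have w2: "(\<Sum>i<n+2. ((z n (a + int (Suc i)) b - z n (a + int i) b) / hh n)\<^sup>2) = (\<Sum>c\<in>?I. (d1 z n c b)\<^sup>2)"
      proof -
        have "(\<Sum>i<n+2. (d1 z n (a + int i) b)\<^sup>2) = (\<Sum>c\<in>?I. (d1 z n c b)\<^sup>2)"
          by (rule per_window_sum) (use perD[OF L2_per[OF assms(2)]] in simp)
        then show ?thesis by (simp add: d1_def add_ac)
      qed
      have "2 / real (n + 2) = (1/pi) * hh n" "real (n + 2) * hh n = 2 * pi"
        using hN[of n] by (simp_all add: hh_def mult.commute)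
      then show ?thesis
        using sup_square_1d[of 0 "n+2" "hh n" "\<lambda>i. z n (a + int i) b"] unfolding w1 w2 by simp
    qed
    then have "kk n * (\<Sum>b<n + 2. (z n a b)\<^sup>2) \<le> kk n * (\<Sum>b<n + 2. (1/pi) * (hh n * (\<Sum>c\<in>?I. (z n c b)\<^sup>2)) + (4 * pi) * (hh n * (\<Sum>c\<in>?I. (d1 z n c b)\<^sup>2)))"
      by (intro mult_left_mono sum_mono) (auto intro: less_imp_le)
    also have "\<dots> = (1/pi) * gsum n (\<lambda>a b. (z n a b)\<^sup>2) + (4 * pi) * gsum n (\<lambda>a b. (d1 z n a b)\<^sup>2)"
      unfolding gsum_def sum.swap[of _ "{..<n+2}" ?I] sum.distrib sum_distrib_left[symmetric]
      by (simp only: distrib_left mult_ac)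
    also have "\<dots> \<le> (1/pi) * C1 + (4 * pi) * C2"
      using C[of n] by (intro add_mono mult_left_mono) auto
    finally show ?thesis .
  qed
  then show ?thesis using that by blast
qed

text \<open>Uniform boundedness and a uniform Hoelder condition with exponent 1/2 in both variables,
  measured in physical distances.\<close>

definition equi :: "grid_fam \<Rightarrow> bool" where
  "equi z \<longleftrightarrow> per z \<and> (\<exists>C\<ge>0. \<forall>n a a' b b'. b \<le> n + 2 \<longrightarrow> b' \<le> n + 2 \<longrightarrow>
      \<bar>z n a b\<bar> \<le> C \<and>
      \<bar>z n a b - z n a' b'\<bar> \<le> C * (sqrt (hh n * real_of_int \<bar>a - a'\<bar>) + sqrt (kk n * \<bar>real b - real b'\<bar>)))"

text \<open>The mixed difference controls \<open>d1 z\<close> in mean square on every single row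
  (\<open>row_L2\<close>) and \<open>d2 z\<close> on every single column (\<open>col_L2\<close>);
  Cauchy-Schwarz along the row and the column then yields the exponent 1/2. The second difference
  that enters is the mixed one, which is what tangential estimates supply.\<close>

lemma mixed_sobolev:
  assumes z: "L2 z" and z1: "L2 (d1 z)" and z2: "L2 (d2 z)" and z12: "L2 (d2 (d1 z))"
  shows "equi z"
proof -
  have pz: "\<And>n a b. z n (a + int (n + 2)) b = z n a b" using perD[OF L2_per[OF z]] .
  obtain C1 where C1: "\<And>n b. b \<le> n + 2 \<Longrightarrow> hh n * (\<Sum>a\<in>{0..<int (n + 2)}. (d1 z n a b)\<^sup>2) \<le> C1"
    using row_L2[OF z1 z12] by metis
  have z21: "L2 (d1 (d2 z))" using z12 by (rule L2_cong) (auto intro: per_intros L2_per[OF z] simp: d1_d2)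
  obtain C2 where C2: "\<And>n a. kk n * (\<Sum>b<n + 2. (d2 z n a b)\<^sup>2) \<le> C2"
    using col_L2[OF z2 z21] by metis
  obtain C3 where C3: "\<And>n a. kk n * (\<Sum>b<n + 2. (z n a b)\<^sup>2) \<le> C3"
    using col_L2[OF z z1] by metis
  define M where "M = sqrt (C3 + 4 * C2)"
  have sup: "\<bar>z n a b\<bar> \<le> M" if "b \<le> n + 2" for n a b
  proof -
    have "2 / real (n + 2) = kk n" by (simp add: kk_def)
    moreover have "real (n + 2) * kk n = 2" using kN by (simp add: mult.commute)
    ultimately have "(z n a b)\<^sup>2 \<le> kk n * (\<Sum>i<n+2. (z n a i)\<^sup>2) + 4 * (kk n * (\<Sum>i<n+2. (d2 z n a i)\<^sup>2))"
      using sup_square_1d[OF that, of "kk n" "z n a"] unfolding d2_def[symmetric] by simp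
    also have "\<dots> \<le> C3 + 4 * C2" using C3[where n=n and a=a] C2[where n=n and a=a] by linarith
    finally show ?thesis unfolding M_def by (metis real_sqrt_abs real_sqrt_le_iff)
  qed
  have M0: "0 \<le> M" using sup[of 0 0 0] by simp
  have C10: "0 \<le> C1" using C1[of 0 0] by (meson hh_pos less_imp_le mult_nonneg_nonneg order_trans sum_nonneg zero_le_power2 le0)
  have C20: "0 \<le> C2" using C2[of 0 0] by (meson kk_pos less_imp_le mult_nonneg_nonneg order_trans sum_nonneg zero_le_power2)
  have hor1: "\<bar>z n (a + int m) b - z n a b\<bar> \<le> (sqrt C1 + M) * sqrt (hh n * real m)" if b: "b \<le> n + 2" for n a m b
  proof (cases "m \<le> n + 2")
    case True
    have "(z n (a + int m) b - z n a b)\<^sup>2 \<le> (real m * hh n) * (hh n * (\<Sum>i\<in>{0..<m}. ((z n (a + int (Suc i)) b - z n (a + int i) b) / hh n)\<^sup>2))"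
      using increment_square[of 0 m "hh n" "\<lambda>i. z n (a + int i) b"] by simp
    also have "\<dots> = (real m * hh n) * (hh n * (\<Sum>i\<in>{0..<m}. (d1 z n (a + int i) b)\<^sup>2))"
      by (simp add: d1_def add_ac)
    also have "\<dots> \<le> (real m * hh n) * (hh n * (\<Sum>i<n+2. (d1 z n (a + int i) b)\<^sup>2))"
      using True by (intro mult_left_mono sum_mono2) (auto intro: less_imp_le)
    also have "(\<Sum>i<n+2. (d1 z n (a + int i) b)\<^sup>2) = (\<Sum>c\<in>{0..<int (n+2)}. (d1 z n c b)\<^sup>2)"
      by (rule per_window_sum) (use perD[OF L2_per[OF z1]] in simp)
    also have "(real m * hh n) * (hh n * (\<Sum>c\<in>{0..<int (n+2)}. (d1 z n c b)\<^sup>2)) \<le> (real m * hh n) * C1"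
      using C1[OF b] by (intro mult_left_mono) (auto intro: less_imp_le)
    finally have "\<bar>z n (a + int m) b - z n a b\<bar> \<le> sqrt ((real m * hh n) * C1)"
      by (metis real_sqrt_abs real_sqrt_le_iff)
    also have "\<dots> = sqrt C1 * sqrt (hh n * real m)" by (simp add: real_sqrt_mult mult_ac)
    also have "\<dots> \<le> (sqrt C1 + M) * sqrt (hh n * real m)"
      using M0 by (intro mult_right_mono) (auto intro: less_imp_le)
    finally show ?thesis .
  next
    \<comment> \<open>More than one period apart: the distance is at least 2 pi >= 4, its square
      root at least 2, and the trivial bound 2 \<open>M\<close> suffices.\<close>
    case False
    have "2\<^sup>2 \<le> hh n * real m"
    proof -
      have "hh n * real (n + 2) \<le> hh n * real m" using False by (intro mult_left_mono) (auto intro: less_imp_le)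
      then have "2 * pi \<le> hh n * real m" by (simp only: hN)
      then show ?thesis using pi_ge_two by simp
    qed
    then have "2 \<le> sqrt (hh n * real m)" by (rule real_le_rsqrt)
    then have "M * 2 \<le> M * sqrt (hh n * real m)" using M0 by (intro mult_left_mono)
    also have "\<dots> \<le> (sqrt C1 + M) * sqrt (hh n * real m)"
      using C10 by (intro mult_right_mono) (auto intro: less_imp_le)
    finally show ?thesis using sup[OF b, of "a + int m"] sup[OF b, of a] by linarith
  qed
  have hor: "\<bar>z n a b - z n a' b\<bar> \<le> (sqrt C1 + M) * sqrt (hh n * real_of_int \<bar>a - a'\<bar>)" if b: "b \<le> n + 2" for n a a' b
  proof (cases "a' \<le> a")
    case True
    then have "a' + int (nat (a - a')) = a" "real (nat (a - a')) = real_of_int \<bar>a - a'\<bar>" by auto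
    then show ?thesis using hor1[OF b, of a' "nat (a - a')"] by simp
  next
    case False
    then have "a + int (nat (a' - a)) = a'" "real (nat (a' - a)) = real_of_int \<bar>a - a'\<bar>" by auto
    then show ?thesis using hor1[OF b, of a "nat (a' - a)"] by (simp add: abs_minus_commute)
  qed
  have ver1: "\<bar>z n a b' - z n a b\<bar> \<le> sqrt C2 * sqrt (kk n * (real b' - real b))" if "b \<le> b'" "b' \<le> n + 2" for n a b b'
  proof -
    have "(z n a b' - z n a b)\<^sup>2 \<le> (real (b' - b) * kk n) * (kk n * (\<Sum>i\<in>{b..<b'}. (d2 z n a i)\<^sup>2))"
      using increment_square[OF that(1), of "kk n" "z n a"] by (simp add: d2_def)
    also have "\<dots> \<le> (real (b' - b) * kk n) * (kk n * (\<Sum>i<n+2. (d2 z n a i)\<^sup>2))"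
      using that by (intro mult_left_mono sum_mono2) (auto intro: less_imp_le)
    also have "\<dots> \<le> (real (b' - b) * kk n) * C2"
      using C2 by (intro mult_left_mono) (auto intro: less_imp_le)
    finally have "\<bar>z n a b' - z n a b\<bar> \<le> sqrt ((real (b' - b) * kk n) * C2)"
      by (metis real_sqrt_abs real_sqrt_le_iff)
    then show ?thesis using that by (simp add: real_sqrt_mult mult_ac of_nat_diff)
  qed
  have ver: "\<bar>z n a b - z n a b'\<bar> \<le> sqrt C2 * sqrt (kk n * \<bar>real b - real b'\<bar>)" if "b \<le> n + 2" "b' \<le> n + 2" for n a b b'
    using ver1[of b b' n a] ver1[of b' b n a] that by (cases "b \<le> b'") (auto simp: abs_minus_commute)
  define C where "C = sqrt C1 + M + sqrt C2"
  have CC: "0 \<le> C" "M \<le> C" "sqrt C1 + M \<le> C" "sqrt C2 \<le> C"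
    using M0 C10 C20 by (auto simp: C_def)
  have "\<bar>z n a b\<bar> \<le> C \<and>
      \<bar>z n a b - z n a' b'\<bar> \<le> C * (sqrt (hh n * real_of_int \<bar>a - a'\<bar>) + sqrt (kk n * \<bar>real b - real b'\<bar>))"
    if b: "b \<le> n + 2" "b' \<le> n + 2" for n a a' b b'
  proof
    show "\<bar>z n a b\<bar> \<le> C" using sup[OF b(1), of a] CC by linarith
    have "\<bar>z n a b - z n a' b'\<bar> \<le> \<bar>z n a b - z n a' b\<bar> + \<bar>z n a' b - z n a' b'\<bar>" by linarith
    also have "\<dots> \<le> C * sqrt (hh n * real_of_int \<bar>a - a'\<bar>) + C * sqrt (kk n * \<bar>real b - real b'\<bar>)"
    proof (rule add_mono)
      show "\<bar>z n a b - z n a' b\<bar> \<le> C * sqrt (hh n * real_of_int \<bar>a - a'\<bar>)"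
        using hor[OF b(1), of a a'] CC by (meson order_trans mult_right_mono real_sqrt_ge_zero hh_pos less_imp_le mult_nonneg_nonneg of_int_0_le_iff abs_ge_zero)
      show "\<bar>z n a' b - z n a' b'\<bar> \<le> C * sqrt (kk n * \<bar>real b - real b'\<bar>)"
        using ver[OF b, of a'] CC by (meson order_trans mult_right_mono real_sqrt_ge_zero kk_pos less_imp_le mult_nonneg_nonneg abs_ge_zero)
    qed
    finally show "\<bar>z n a b - z n a' b'\<bar> \<le> C * (sqrt (hh n * real_of_int \<bar>a - a'\<bar>) + sqrt (kk n * \<bar>real b - real b'\<bar>))"
      by (simp add: distrib_left)
  qed
  with CC(1) L2_per[OF z] show ?thesis unfolding equi_def by blast
qed

section \<open>Row masks and a weight vanishing at the boundary\<close>

lemma Linf_if: assumes "Linf X" "Linf Y" shows "Linf (\<lambda>n a b. if P n b then X n a b else Y n a b)"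
proof -
  from assms obtain C D where C: "\<And>n a b. b \<le> n + 2 \<Longrightarrow> \<bar>X n a b\<bar> \<le> C"
    and D: "\<And>n a b. b \<le> n + 2 \<Longrightarrow> \<bar>Y n a b\<bar> \<le> D" by (auto simp: Linf_def)
  have "\<bar>if P n b then X n a b else Y n a b\<bar> \<le> max C D" if "b \<le> n + 2" for n a b
    using C[OF that, of a] D[OF that, of a] by auto
  then have "\<exists>C. \<forall>n a b. b \<le> n + 2 \<longrightarrow> \<bar>if P n b then X n a b else Y n a b\<bar> \<le> C" by blast
  then show ?thesis using per_if[of X Y P] assms unfolding Linf_def by blast
qed

lemma Linf_prev: assumes "Linf X" shows "Linf (\<lambda>n a b. X n a (b - 1))"
proof -
  from assms obtain C where C: "\<And>n a b. b \<le> n + 2 \<Longrightarrow> \<bar>X n a b\<bar> \<le> C" by (auto simp: Linf_def)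
  have "\<bar>X n a (b - 1)\<bar> \<le> C" if "b \<le> n + 2" for n a b using C[of "b - 1" n a] that by simp
  then show ?thesis using assms by (auto simp: Linf_def intro!: per_row)
qed

text \<open>Cuts off from the row N - 1 on, where a second vertical difference would read the row N
  + 1.\<close>

definition msk :: "grid_fam \<Rightarrow> grid_fam" where
  "msk X n a b = (if Suc b < n + 2 then X n a b else 0)"

lemma per_msk: "per X \<Longrightarrow> per (msk X)"
  by (simp add: per_def msk_def)

lemma L2_msk: "L2 X \<Longrightarrow> L2 (msk X)"
  by (rule L2_dom) (auto simp: msk_def intro: per_msk L2_per)

lemma d1_msk: "d1 (msk X) = msk (d1 X)"
  by (auto simp: d1_def msk_def fun_eq_iff)

text \<open>A weight vanishing on the rows 0, N - 1 and N (the last by truncated subtraction),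
  where N = n + 2; it approximates (1 + beta) (1 - beta).\<close>

definition chi :: "nat \<Rightarrow> nat \<Rightarrow> real" where
  "chi n b = (kk n)\<^sup>2 * real (b * (n + 1 - b))"

lemma chi_0 [simp]: "chi n 0 = 0" and chi_top [simp]: "chi n (Suc n) = 0" "chi n (Suc (Suc n)) = 0"
  by (auto simp: chi_def)

lemma Linf_chi: "Linf (\<lambda>n a b. chi n b)"
proof -
  have "\<bar>chi n b\<bar> \<le> 4" if "b \<le> n + 2" for n b
  proof -
    have "real (b * (n + 1 - b)) \<le> real (n + 2) * real (n + 2)"
      unfolding of_nat_mult using that by (intro mult_mono) auto
    then have "chi n b \<le> (kk n)\<^sup>2 * (real (n + 2) * real (n + 2))"
      unfolding chi_def by (intro mult_left_mono) auto
    also have "\<dots> = (kk n * real (n + 2))\<^sup>2" unfolding power_mult_distrib by (simp only: power2_eq_square)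
    also have "\<dots> = 4" unfolding kN by simp
    finally show ?thesis by (simp add: chi_def)
  qed
  then have "\<exists>C. \<forall>n a b. b \<le> n + 2 \<longrightarrow> \<bar>chi n b\<bar> \<le> C" by blast
  then show ?thesis unfolding Linf_def by (simp add: per_const)
qed

definition dchi :: grid_fam where "dchi = d2 (\<lambda>n a b. chi n b)"

lemma dchi_eq: "dchi n a b = (chi n (Suc b) - chi n b) / kk n"
  by (simp add: dchi_def d2_def)

lemma dchi_top [simp]: "dchi n a (Suc n) = 0" by (simp add: dchi_eq)

lemma chi_Suc: "chi n (Suc b) = chi n b + kk n * dchi n a b"
  by (simp add: dchi_eq)

lemma Linf_dchi: "Linf dchi"
proof -
  have "\<bar>dchi n a b\<bar> \<le> 2" if "b \<le> n + 2" for n a b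
  proof (cases "b \<le> n")
    case True
    have "dchi n a b = kk n * (real (Suc b * (n + 1 - Suc b)) - real (b * (n + 1 - b)))"
      by (simp add: dchi_eq chi_def power2_eq_square right_diff_distrib diff_divide_distrib)
    also have "real (Suc b * (n + 1 - Suc b)) - real (b * (n + 1 - b)) = real n - 2 * real b"
    proof -
      have "real (n + 1 - Suc b) = real n - real b" "real (n + 1 - b) = real n + 1 - real b"
        using True by (simp_all add: of_nat_diff)
      then show ?thesis unfolding of_nat_mult by (simp add: algebra_simps)
    qed
    finally have e: "dchi n a b = kk n * (real n - 2 * real b)" .
    have "\<bar>real n - 2 * real b\<bar> \<le> real (n + 2)" using True by linarith
    then have "\<bar>kk n * (real n - 2 * real b)\<bar> \<le> kk n * real (n + 2)"
      unfolding abs_mult by (simp add: mult_left_mono)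
    then show ?thesis by (simp only: e kN)
  next
    case False
    then have "b = Suc n \<or> b = n + 2" using that by auto
    then show ?thesis by (auto simp: dchi_eq chi_def)
  qed
  moreover have "per dchi" by (simp add: per_def dchi_eq)
  ultimately show ?thesis unfolding Linf_def by blast
qed

lemma d1_chi_mult: "d1 (\<lambda>n a b. chi n b * X n a b) n a b = chi n b * d1 X n a b"
  and d1_dchi_mult: "d1 (\<lambda>n a b. dchi n a b * X n a b) n a b = dchi n a b * d1 X n a b"
  by (simp_all add: d1_def dchi_eq right_diff_distrib)

text \<open>The product rule. On the row N - 1 both sides are 0, since \<open>chi\<close> vanishes
  on the rows N - 1 and N and \<open>up\<close> is 0 there; so the padded shift \<open>up\<close>
  may stand for the true one.\<close>

lemma d2_chi_mult:
  assumes "b < n + 2"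
  shows "d2 (\<lambda>n a b. chi n b * X n a b) n a b = chi n b * d2 X n a b + dchi n a b * up X n a b"
proof (cases "Suc b < n + 2")
  case True
  then show ?thesis by (simp add: d2_def dchi_eq up_def field_simps)
next
  case False
  then have "b = Suc n" using assms by simp
  then show ?thesis by (simp add: d2_def)
qed

text \<open>\<open>chi\<close> on the row b differs from \<open>chi\<close> on the row b + 1 by
  \<open>kk n * dchi\<close>, and the mismatch is paid for by one mesh size times \<open>X\<close>.
  If \<open>X\<close> is a tangential difference, \<open>L2_kd1\<close> bounds that product.\<close>

lemma L2_chi_up:
  assumes "L2 (\<lambda>n a b. chi n b * X n a b)" "L2 (\<lambda>n a b. kk n * X n a b)" and "per X"
  shows "L2 (\<lambda>n a b. chi n b * up X n a b)"
proof (rule L2_cong)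
  show "L2 (\<lambda>n a b. up (\<lambda>n a b. chi n b * X n a b) n a b - dchi n a b * up (\<lambda>n a b. kk n * X n a b) n a b)"
    by (rule L2_diff[OF L2_up[OF assms(1)] L2_mult[OF Linf_dchi L2_up[OF assms(2)]]])
  show "per (\<lambda>n a b. chi n b * up X n a b)" by (rule per_mult[OF per_const per_up[OF assms(3)]])
  show "chi n b * up X n a b = up (\<lambda>n a b. chi n b * X n a b) n a b - dchi n a b * up (\<lambda>n a b. kk n * X n a b) n a b" for n a b
  proof (cases "Suc b < n + 2")
    case True
    have e: "chi n b = chi n (Suc b) - kk n * dchi n a b" using chi_Suc[of n b a] by simp
    show ?thesis using True by (simp add: up_def e left_diff_distrib right_diff_distrib mult_ac)
  qed (simp add: up_def)
qed

lemma d1_mult_back: "d1 (\<lambda>n a b. X n a b * Y n a b) n (a - 1) b = d1 X n (a - 1) b * Y n a b + X n (a - 1) b * d1 Y n (a - 1) b"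
  by (simp add: d1_def field_simps)

lemma d2_mult: "d2 (\<lambda>n a b. X n a b * Y n a b) n a b = d2 X n a b * Y n a (Suc b) + X n a b * d2 Y n a b"
  and d2_add: "d2 (\<lambda>n a b. X n a b + Y n a b) n a b = d2 X n a b + d2 Y n a b"
  by (simp_all add: d2_def field_simps)

lemmas d1_simps = d1_add d1_diff d1_uminus d1_mult d1_sh d1_shm d1_const

section \<open>Energy estimates for the difference scheme\<close>

text \<open>Q is the discrete vertical flux, extended by 0 to the boundary; w is the corrector and s, c
  are the discrete sigma, kappa. The equation has been divided by its last leading coefficient and put
  into divergence form. On the row b = 0 there is no room for the lower order terms, and they are dropped.\<close>

locale scheme =
  fixes A B F1 F2 K w Q :: grid_fam and s c :: "nat \<Rightarrow> real"
  assumes LA: "Linf A" "Linf (d1 A)" "Linf (d1 (d1 A))"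
    and LB: "Linf B" "Linf (d1 B)" "Linf (d1 (d1 B))" "Linf (d2 B)" "Linf (d1 (d2 B))"
    and LF1: "Linf F1" "Linf (d1 F1)" "Linf (d1 (d1 F1))"
    and LF2: "Linf F2" "Linf (d1 F2)" "Linf (d1 (d1 F2))"
    and LK: "Linf K" "Linf (d1 K)" "Linf (d1 (d1 K))"
    and ell: "ellip A B"
    and s1: "\<And>n. \<bar>s n\<bar> \<le> 1" and c1: "\<And>n. \<bar>c n\<bar> \<le> 1"
    and L2w: "L2 w" and perQ: "per Q"
    and Q0: "\<And>n a. Q n a 0 = 0" and QN: "\<And>n a. Q n a (n + 2) = 0"
    and QS: "\<And>n a b. b < n + 2 \<Longrightarrow> Q n a (Suc b) = B n a b * (d1 w n a b + s n) + d2 w n a b"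
    and eqn: "\<And>n a b. b < n + 2 \<Longrightarrow>
        d1 (\<lambda>n a b. A n a b * (d1 w n a b + s n) + B n a b * d2 w n a b) n (a - 1) b + d2 Q n a b
        = c n * K n a b + (if b = 0 then 0 else
            (d1 A n (a - 1) b - F1 n a b + d2 B n a (b - 1)) * (d1 w n a b + s n)
            + (d1 B n (a - 1) b - F2 n a b) * d2 w n a b)"
begin

text \<open>The horizontal difference of the full function w + s x, which is not periodic; hence
  \<open>d1 p\<close> is \<open>d1 (d1 w)\<close>.\<close>

definition "p n a b = d1 w n a b + s n"
definition "v = d2 w"
definition "q1 n a b = A n a b * p n a b + B n a b * v n a b"
text \<open>The differences of \<open>A\<close> and \<open>B\<close> inside \<open>b1\<close> and
  \<open>b2\<close> are those that the product rule creates in the divergence form; they cancel in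
  \<open>nondivergence\<close>.\<close>

definition "b1 n a b = (if b = 0 then 0 else d1 A n (a - 1) b - F1 n a b + d2 B n a (b - 1))"
definition "b2 n a b = (if b = 0 then 0 else d1 B n (a - 1) b - F2 n a b)"
definition "R n a b = c n * K n a b + b1 n a b * p n a b + b2 n a b * v n a b"

lemma perw: "per w" using L2_per[OF L2w] .
lemma Ls: "Linf (\<lambda>n a b. s n)" using Linf_seq[OF s1] .
lemma Lc: "Linf (\<lambda>n a b. c n)" using Linf_seq[OF c1] .

lemma Lb: "Linf b1" "Linf b2"
proof -
  have "Linf (\<lambda>n a b. if b = 0 then 0 else d1 A n (a - 1) b - F1 n a b + d2 B n a (b - 1))"
    by (intro Linf_if[of "\<lambda>n a b. 0"] Linf_const Linf_add Linf_diff Linf_shm[OF LA(2), of 1] Linf_shm[OF LA(3), of 1] Linf_prev[OF LB(4)] Linf_prev[OF LB(5)] LF1)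
  then show "Linf b1" by (simp add: b1_def[abs_def])
  have "Linf (\<lambda>n a b. if b = 0 then 0 else d1 B n (a - 1) b - F2 n a b)"
    by (intro Linf_if[of "\<lambda>n a b. 0"] Linf_const Linf_diff Linf_shm[OF LB(2), of 1] Linf_shm[OF LB(3), of 1] LF2)
  then show "Linf b2" by (simp add: b2_def[abs_def])
qed

lemma Ldb: "Linf (d1 b1)" "Linf (d1 b2)"
proof -
  have "d1 b1 = (\<lambda>n a b. if b = 0 then 0 else d1 (d1 A) n (a - 1) b - d1 F1 n a b + d1 (d2 B) n a (b - 1))"
    by (auto simp: fun_eq_iff b1_def d1_def field_simps)
  moreover have "Linf \<dots>"
    by (intro Linf_if[of "\<lambda>n a b. 0"] Linf_const Linf_add Linf_diff Linf_shm[OF LA(2), of 1] Linf_shm[OF LA(3), of 1] Linf_prev[OF LB(4)] Linf_prev[OF LB(5)] LF1)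
  ultimately show "Linf (d1 b1)" by simp
  have "d1 b2 = (\<lambda>n a b. if b = 0 then 0 else d1 (d1 B) n (a - 1) b - d1 F2 n a b)"
    by (auto simp: fun_eq_iff b2_def d1_def field_simps)
  moreover have "Linf \<dots>"
    by (intro Linf_if[of "\<lambda>n a b. 0"] Linf_const Linf_diff Linf_shm[OF LB(2), of 1] Linf_shm[OF LB(3), of 1] LF2)
  ultimately show "Linf (d1 b2)" by simp
qed

lemma eq_R: "b < n + 2 \<Longrightarrow> d1 q1 n (a - 1) b + d2 Q n a b = R n a b"
  using eqn[of b n a] by (simp add: R_def q1_def[abs_def] p_def[abs_def] v_def b1_def b2_def)

lemma Q_Suc: "b < n + 2 \<Longrightarrow> Q n a (Suc b) = B n a b * p n a b + v n a b"
  using QS[of b n a] by (simp add: p_def v_def)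

lemma per_q1: "per q1"
proof -
  have p: "per p" unfolding p_def[abs_def] by (intro per_add per_d1 per_const perw)
  have v: "per v" unfolding v_def by (intro per_d2 perw)
  show "per q1" unfolding q1_def[abs_def] by (intro per_add per_mult p v Linf_per[OF LA(1)] Linf_per[OF LB(1)])
qed

lemma d1_p: "d1 p = d1 (d1 w)" by (simp add: fun_eq_iff p_def[abs_def] d1_def)
lemma d1_v: "d1 v = d2 (d1 w)" by (simp add: fun_eq_iff v_def d1_d2)

lemma L2_first: "L2 (d1 w)" "L2 (d2 w)"
proof -
  from ell obtain e where e: "e > 0" and el: "\<And>n a b x y. b \<le> n + 2 \<Longrightarrow>
      e * (x\<^sup>2 + y\<^sup>2) \<le> A n a b * x\<^sup>2 + 2 * B n a b * x * y + y\<^sup>2" unfolding ellip_def by blast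
  text \<open>Testing the equation with w itself.\<close>
  define e0 where "e0 = (\<lambda>n a b. (-1) * (c n * K n a b + b1 n a b * s n))"
  define e1 where "e1 = (\<lambda>n a b. A n a b * s n + b1 n a b * w n a b)"
  define e2 where "e2 = (\<lambda>n a b. B n a b * s n + b2 n a b * w n a b)"
  have Le: "L2 e1" "L2 e2" unfolding e1_def e2_def
    by (intro L2_add L2_Linf Linf_mult Ls LA LB L2_mult Lb L2w)+
  have "Linf e0" unfolding e0_def by (intro Linf_mult Linf_const Linf_add Lc LK Lb Ls)
  note L0 = L2_Linf[OF this]
  have pw: "per (d1 w)" "per (d2 w)" using perw by (auto intro: per_d1 per_d2)
  obtain Cw C0 where Cw: "\<And>n. gsum n (\<lambda>a b. (w n a b)\<^sup>2) \<le> Cw" and C0: "\<And>n. gsum n (\<lambda>a b. (e0 n a b)\<^sup>2) \<le> C0"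
    using L2w L0 by (auto simp: L2_def)
  obtain C1 C2 where C1: "\<And>n. gsum n (\<lambda>a b. (e1 n a b)\<^sup>2) \<le> C1" and C2: "\<And>n. gsum n (\<lambda>a b. (e2 n a b)\<^sup>2) \<le> C2"
    using Le by (auto simp: L2_def)
  have main: "gsum n (\<lambda>a b. e * ((d1 w n a b)\<^sup>2 + (d2 w n a b)\<^sup>2))
     \<le> gsum n (\<lambda>a b. e0 n a b * w n a b - e1 n a b * d1 w n a b - e2 n a b * d2 w n a b)" for n
  proof -
    have "gsum n (\<lambda>a b. w n a b * R n a b) = gsum n (\<lambda>a b. w n a b * d1 q1 n (a - 1) b + w n a b * d2 Q n a b)"
      by (rule gsum_cong) (simp add: eq_R[symmetric] distrib_left)
    also have "\<dots> = - gsum n (\<lambda>a b. d1 w n a b * q1 n a b) - gsum n (\<lambda>a b. Q n a (Suc b) * d2 w n a b)"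
      using gsum_d1_parts[OF perw per_q1, of n] gsum_d2_parts[of Q n w, OF Q0 QN] by (simp add: gsum_add)
    also have "\<dots> = - gsum n (\<lambda>a b. d1 w n a b * q1 n a b + Q n a (Suc b) * d2 w n a b)"
      by (simp add: gsum_add)
    also have "gsum n (\<lambda>a b. d1 w n a b * q1 n a b + Q n a (Suc b) * d2 w n a b)
       = gsum n (\<lambda>a b. (A n a b * (d1 w n a b)\<^sup>2 + 2 * B n a b * d1 w n a b * d2 w n a b + (d2 w n a b)\<^sup>2)
           + s n * (A n a b * d1 w n a b + B n a b * d2 w n a b))"
      by (rule gsum_cong) (simp add: Q_Suc q1_def p_def v_def power2_eq_square algebra_simps)
    finally have 1: "gsum n (\<lambda>a b. w n a b * R n a b) = - (gsum n (\<lambda>a b. A n a b * (d1 w n a b)\<^sup>2 + 2 * B n a b * d1 w n a b * d2 w n a b + (d2 w n a b)\<^sup>2)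
         + gsum n (\<lambda>a b. s n * (A n a b * d1 w n a b + B n a b * d2 w n a b)))" by (simp only: gsum_add)
    have "gsum n (\<lambda>a b. e * ((d1 w n a b)\<^sup>2 + (d2 w n a b)\<^sup>2)) \<le> gsum n (\<lambda>a b. A n a b * (d1 w n a b)\<^sup>2 + 2 * B n a b * d1 w n a b * d2 w n a b + (d2 w n a b)\<^sup>2)"
      by (rule gsum_mono) (use el in auto)
    also have "\<dots> = gsum n (\<lambda>a b. (-1) * (w n a b * R n a b) - s n * (A n a b * d1 w n a b + B n a b * d2 w n a b))"
      unfolding gsum_diff gsum_cmult[of n "-1"] using 1 by linarith
    also have "\<dots> = gsum n (\<lambda>a b. e0 n a b * w n a b - e1 n a b * d1 w n a b - e2 n a b * d2 w n a b)"
      by (rule gsum_cong) (simp add: R_def e0_def e1_def e2_def p_def v_def algebra_simps)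
    finally show ?thesis .
  qed
  have D: "gsum n (\<lambda>a b. e0 n a b * w n a b) \<le> C0 + Cw" for n
  proof -
    have "e0 n a b * w n a b \<le> (e0 n a b)\<^sup>2 + (w n a b)\<^sup>2" for a b
      using sum_squares_bound[of "e0 n a b" "w n a b"] zero_le_power2[of "e0 n a b"] zero_le_power2[of "w n a b"] by linarith
    then have "gsum n (\<lambda>a b. e0 n a b * w n a b) \<le> gsum n (\<lambda>a b. (e0 n a b)\<^sup>2 + (w n a b)\<^sup>2)"
      by (intro gsum_mono)
    then show ?thesis using C0[of n] Cw[of n] by (simp add: gsum_add)
  qed
  have "L2 (d1 w) \<and> L2 (d2 w)"
  \<comment> \<open>The product \<open>e0 * w\<close> is not absorbed: both factors are bounded in
    \<open>L2\<close>, so it goes into the additive constant \<open>D\<close>, and 0 takes the place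
    of \<open>R\<close>.\<close>
  proof (rule L2_from_sum[OF e pw pw(1) L2_Linf[OF Linf_const[of 0]] Le refl, where D = "C0 + Cw"])
    fix n
    have "gsum n (\<lambda>a b. e0 n a b * w n a b - e1 n a b * d1 w n a b - e2 n a b * d2 w n a b)
      \<le> gsum n (\<lambda>a b. 0 * d1 w n a b - e1 n a b * d1 w n a b - e2 n a b * d2 w n a b) + (C0 + Cw)"
      using D[of n] unfolding gsum_diff gsum_cmult[of n 0] by simp
    then show "gsum n (\<lambda>a b. e * ((d1 w n a b)\<^sup>2 + (d2 w n a b)\<^sup>2))
      \<le> gsum n (\<lambda>a b. 0 * d1 w n a b - e1 n a b * d1 w n a b - e2 n a b * d2 w n a b) + (C0 + Cw)"
      using main[of n] by linarith
  qed
  then show "L2 (d1 w)" "L2 (d2 w)" by auto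
qed

end

context scheme begin

lemma L2_p: "L2 p" and L2_v: "L2 v"
  using L2_add[OF L2_first(1) L2_Linf[OF Ls]] L2_first(2) by (simp_all add: p_def[abs_def] v_def)

lemma L2_R: "L2 R"
  unfolding R_def[abs_def]
  by (intro L2_add L2_mult[OF Lb(1) L2_p] L2_mult[OF Lb(2) L2_v] L2_Linf Linf_mult Lc LK(1))

text \<open>\<open>energy_tangential\<close> for \<open>w\<close> itself. The slope \<open>s\<close>
  is not part of a difference of \<open>w\<close> and enters through the remainders.\<close>

lemma second: "L2 (d1 p)" "L2 (d1 v)"
proof -
  have "L2 (d1 (d1 w)) \<and> L2 (d2 (d1 w))"
  proof (rule energy_tangential[OF perw perQ per_q1 LA(1) LB(1) LA(2) LB(2) ell,
      where R = R and ?r1.0 = "\<lambda>n a b. A n a b * s n" and ?r2.0 = "\<lambda>n a b. B n a b * s n"])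
    have "d1 (\<lambda>n a b. A n a b * s n) = (\<lambda>n a b. d1 A n a b * s n)" "d1 (\<lambda>n a b. B n a b * s n) = (\<lambda>n a b. d1 B n a b * s n)"
      by (auto simp: fun_eq_iff d1_simps)
    then show "L2 (d1 (\<lambda>n a b. A n a b * s n))" "L2 (d1 (\<lambda>n a b. B n a b * s n))"
      using L2_Linf[OF Linf_mult[OF LA(2) Ls]] L2_Linf[OF Linf_mult[OF LB(2) Ls]] by simp_all
  qed (use Q0 QN eq_R Q_Suc L2_R L2_first in \<open>auto simp: q1_def p_def v_def algebra_simps\<close>)
  then show "L2 (d1 p)" "L2 (d1 v)" by (auto simp: d1_p d1_v)
qed

lemma d1_q1: "d1 q1 = (\<lambda>n a b. A n (a + 1) b * d1 p n a b + B n (a + 1) b * d1 v n a b + (d1 A n a b * p n a b + d1 B n a b * v n a b))"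
  by (auto simp: fun_eq_iff q1_def[abs_def] d1_simps algebra_simps)

lemma d1_R: "d1 R = (\<lambda>n a b. c n * d1 K n a b + (d1 b1 n a b * p n a b + b1 n (a + 1) b * d1 p n a b)
     + (d1 b2 n a b * v n a b + b2 n (a + 1) b * d1 v n a b))"
  by (auto simp: fun_eq_iff R_def[abs_def] d1_simps)

lemma L2_d1_R: "L2 (d1 R)"
  unfolding d1_R
  by (intro L2_add L2_mult[OF Ldb(1) L2_p] L2_mult[OF Ldb(2) L2_v] L2_Linf[OF Linf_mult[OF Lc LK(2)]]
     L2_mult[OF Linf_sh[OF Lb(1), of 1] second(1)] L2_mult[OF Linf_sh[OF Lb(2), of 1] second(2)])

lemma L2_d1_q1: "L2 (d1 q1)"
  unfolding d1_q1
  by (intro L2_add L2_mult[OF LA(2) L2_p] L2_mult[OF LB(2) L2_v]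
     L2_mult[OF Linf_sh[OF LA(1), of 1] second(1)] L2_mult[OF Linf_sh[OF LB(1), of 1] second(2)])

lemma d1_shift_fun: "d1 (\<lambda>n a b. X n (a + j) b) = (\<lambda>n a b. d1 X n (a + j) b)"
  by (auto simp: fun_eq_iff d1_sh)

text \<open>\<open>energy_tangential\<close> for \<open>d1 w\<close>, applied to the equation
  differenced once. The differenced remainders contain \<open>d1 (d1 A)\<close>, and
  \<open>d1 b1\<close> contains \<open>d1 (d2 B)\<close>: two differences now fall on the
  coefficients.\<close>

lemma third: "L2 (d1 (d1 p))" "L2 (d1 (d1 v))"
proof -
  let ?r1 = "\<lambda>n a b. d1 A n a b * p n a b + d1 B n a b * v n a b"
  let ?r2 = "\<lambda>n a b. d1 B n a b * p n a b"
  have "L2 (d1 (d1 (d1 w))) \<and> L2 (d2 (d1 (d1 w)))"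
  proof (rule energy_tangential[OF per_d1[OF perw] per_d1[OF perQ] per_d1[OF per_q1]
      Linf_sh[OF LA(1), of 1] Linf_sh[OF LB(1), of 1] _ _ ellip_sh[OF ell, of 1],
      where R = "d1 R" and ?r1.0 = ?r1 and ?r2.0 = ?r2])
    show "Linf (d1 (\<lambda>n a b. A n (a + 1) b))" "Linf (d1 (\<lambda>n a b. B n (a + 1) b))"
      unfolding d1_shift_fun using Linf_sh[OF LA(2), of 1] Linf_sh[OF LB(2), of 1] by auto
    show "d1 q1 n a b = A n (a + 1) b * d1 (d1 w) n a b + B n (a + 1) b * d2 (d1 w) n a b + ?r1 n a b" for n a b
      by (simp add: d1_q1 d1_p d1_v)
    show "d1 Q n a (Suc b) = B n (a + 1) b * d1 (d1 w) n a b + d2 (d1 w) n a b + ?r2 n a b" if "b < n + 2" for n a b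
    proof -
      have "d1 Q n a (Suc b) = d1 (\<lambda>n a b. B n a b * p n a b + v n a b) n a b"
        using that by (simp add: d1_def[of Q] d1_def[of "\<lambda>n a b. _ n a b + _ n a b"] Q_Suc)
      then show ?thesis by (simp add: d1_simps d1_p d1_v)
    qed
    show "d1 Q n a 0 = 0" "d1 Q n a (n + 2) = 0" for n a by (simp_all only: d1_def Q0 QN, simp_all)
    show "d1 (d1 q1) n (a - 1) b + d2 (d1 Q) n a b = d1 R n a b" if "b < n + 2" for n a b
    proof -
      have "d1 R n a b = d1 (\<lambda>n a b. d1 q1 n (a - 1) b + d2 Q n a b) n a b"
        using eq_R[OF that, of a] eq_R[OF that, of "a + 1"]
        by (simp only: d1_def[of R] d1_def[of "\<lambda>n a b. d1 q1 n (a - 1) b + d2 Q n a b"])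
      then show ?thesis by (simp add: d1_simps d1_d2)
    qed
    have "d1 ?r1 = (\<lambda>n a b. (d1 (d1 A) n a b * p n a b + d1 A n (a + 1) b * d1 p n a b) + (d1 (d1 B) n a b * v n a b + d1 B n (a + 1) b * d1 v n a b))"
      by (auto simp: fun_eq_iff d1_simps)
    moreover have "L2 \<dots>"
      by (intro L2_add L2_mult[OF LA(3) L2_p] L2_mult[OF LB(3) L2_v]
        L2_mult[OF Linf_sh[OF LA(2), of 1] second(1)] L2_mult[OF Linf_sh[OF LB(2), of 1] second(2)])
    ultimately show "L2 (d1 ?r1)" by simp
    have "d1 ?r2 = (\<lambda>n a b. (d1 (d1 B) n a b * p n a b + d1 B n (a + 1) b * d1 p n a b))"
      by (auto simp: fun_eq_iff d1_simps)
    moreover have "L2 \<dots>"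
      by (intro L2_add L2_mult[OF LB(3) L2_p] L2_mult[OF Linf_sh[OF LB(2), of 1] second(1)])
    ultimately show "L2 (d1 ?r2)" by simp
  qed (use L2_d1_R second in \<open>auto simp: d1_p d1_v\<close>)
  moreover have "d1 (d1 v) = d2 (d1 (d1 w))" by (auto simp: d1_v fun_eq_iff d1_d2)
  ultimately show "L2 (d1 (d1 p))" "L2 (d1 (d1 v))" by (auto simp: d1_p)
qed

lemma L2_d1_d1_q1: "L2 (d1 (d1 q1))"
proof -
  have "d1 (d1 q1) = (\<lambda>n a b. (d1 A n (a + 1) b * d1 p n a b + A n (a + 1 + 1) b * d1 (d1 p) n a b)
      + (d1 B n (a + 1) b * d1 v n a b + B n (a + 1 + 1) b * d1 (d1 v) n a b)
      + ((d1 (d1 A) n a b * p n a b + d1 A n (a + 1) b * d1 p n a b) + (d1 (d1 B) n a b * v n a b + d1 B n (a + 1) b * d1 v n a b)))"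
    by (simp add: d1_q1 fun_eq_iff d1_simps)
  moreover have "L2 \<dots>"
    by (intro L2_add L2_mult[OF LA(3) L2_p] L2_mult[OF LB(3) L2_v]
        L2_mult[OF Linf_sh[OF LA(2), of 1] second(1)] L2_mult[OF Linf_sh[OF LB(2), of 1] second(2)]
        L2_mult[OF Linf_sh[OF Linf_sh[OF LA(1), of 1], of 1] third(1)] L2_mult[OF Linf_sh[OF Linf_sh[OF LB(1), of 1], of 1] third(2)])
  ultimately show ?thesis by simp
qed

lemma equi_w: "equi w"
proof (rule mixed_sobolev[OF L2w L2_first])
  show "L2 (d2 (d1 w))" using second by (simp add: d1_v)
qed

lemma equi_d1w: "equi (d1 w)"
proof (rule mixed_sobolev[OF L2_first(1)])
  show "L2 (d1 (d1 w))" "L2 (d2 (d1 w))" using second by (simp_all add: d1_v d1_p)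
  have "d1 (d1 v) = d2 (d1 (d1 w))" by (auto simp: d1_v fun_eq_iff d1_d2)
  then show "L2 (d2 (d1 (d1 w)))" using third by simp
qed

text \<open>\<open>Q\<close> on the row b + 1 is expressed by \<open>p\<close> and \<open>v\<close>
  on the row b, hence \<open>dn\<close>.\<close>

lemma L2_Q: "L2 Q" and L2_d1_Q: "L2 (d1 Q)"
proof -
  have Q: "Q n a b = dn (\<lambda>n a b. B n a b * p n a b + v n a b) n a b" if "b < n + 2" for n a b
    using that Q_Suc[of "b - 1" n a] Q0 by (cases b) (auto simp: dn_def)
  show "L2 Q"
    by (rule L2_cong[OF _ perQ Q]) (intro L2_dn L2_add L2_mult[OF LB(1) L2_p] L2_v)
  have dQ: "d1 Q n a b = dn (\<lambda>n a b. (d1 B n a b * p n a b + B n (a + 1) b * d1 p n a b) + d1 v n a b) n a b" if "b < n + 2" for n a b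
  proof -
    have "d1 Q n a b = d1 (dn (\<lambda>n a b. B n a b * p n a b + v n a b)) n a b"
      unfolding d1_def[of Q] d1_def[of "dn _"] using Q[OF that] by simp
    then show ?thesis by (cases b) (simp_all add: d1_dn dn_def d1_simps)
  qed
  show "L2 (d1 Q)"
    by (rule L2_cong[OF _ per_d1[OF perQ] dQ])
      (intro L2_dn L2_add L2_mult[OF LB(2) L2_p] L2_mult[OF Linf_sh[OF LB(1), of 1] second(1)] second(2))
qed

text \<open>The vertical difference of the flux is read off from the equation as \<open>R\<close>
  minus a tangential difference, with no loss at the boundary. Moreover \<open>Q\<close> has exact
  zeros on the rows 0 and N, so its limit inherits the conormal condition. Therefore
  \<open>Q\<close>, rather than \<open>v\<close>, is passed to the limit.\<close>

lemma equi_Q: "equi Q"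
proof (rule mixed_sobolev[OF L2_Q L2_d1_Q])
  show "L2 (d2 Q)"
  proof (rule L2_cong[OF L2_diff[OF L2_R L2_shm[OF L2_d1_q1, of 1]] per_d2[OF perQ]])
    show "d2 Q n a b = R n a b - d1 q1 n (a - 1) b" if "b < n + 2" for n a b
      using eq_R[OF that, of a] by simp
  qed
  show "L2 (d2 (d1 Q))"
  proof (rule L2_cong[OF L2_diff[OF L2_d1_R L2_shm[OF L2_d1_d1_q1, of 1]] per_d2[OF per_d1[OF perQ]]])
    fix n :: nat and a :: int and b :: nat assume b: "b < n + 2"
    have "d1 R n a b = d1 (\<lambda>n a b. d1 q1 n (a - 1) b + d2 Q n a b) n a b"
      using eq_R[OF b, of a] eq_R[OF b, of "a + 1"]
      by (simp only: d1_def[of R] d1_def[of "\<lambda>n a b. d1 q1 n (a - 1) b + d2 Q n a b"])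
    then show "d2 (d1 Q) n a b = d1 R n a b - d1 (d1 q1) n (a - 1) b" by (simp add: d1_simps d1_d2)
  qed
qed

section \<open>The nondivergence form and its tangential differences\<close>

definition "w2 = d1 p"

lemma L2_w2: "L2 w2" and L2_d1_w2: "L2 (d1 w2)" and L2_d2_w2: "L2 (d2 w2)"
proof -
  show "L2 w2" "L2 (d1 w2)" using second third by (simp_all add: w2_def)
  have "d1 (d1 v) = d2 w2" by (auto simp: w2_def d1_p d1_v fun_eq_iff d1_d2)
  then show "L2 (d2 w2)" using third by simp
qed

lemma d1_d1_v: "d1 (d1 v) = d2 w2"
  by (auto simp: w2_def d1_p d1_v fun_eq_iff d1_d2)

lemma d2_p: "d2 p = d1 v"
  by (auto simp: fun_eq_iff p_def[abs_def] v_def d1_d2) (simp add: d2_def)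

text \<open>What the nondivergence equation leaves for the sum \<open>B * d2 p + d2 v\<close>; it is
  evaluated one row above these two terms.\<close>

definition "H n a b = c n * K n a b - F1 n a b * p n a b - F2 n a b * v n a b
   - A n (a - 1) b * d1 p n (a - 1) b - B n (a - 1) b * d1 v n (a - 1) b"

definition "V = msk (d2 v)"

text \<open>The equation is taken on the row b + 1, which is never the row 0, so its lower order
  terms are complete and cancel against the product rule.\<close>

lemma nondivergence:
  assumes b: "Suc b < n + 2"
  shows "d2 v n a b = H n a (Suc b) - B n a b * d2 p n a b"
proof -
  have "d1 q1 n (a - 1) (Suc b) + d2 Q n a (Suc b) = R n a (Suc b)" by (rule eq_R[OF b])
  moreover have "d2 Q n a (Suc b) = d2 (\<lambda>n a b. B n a b * p n a b + v n a b) n a b"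
    using b Q_Suc[of "Suc b" n a] Q_Suc[of b n a] by (simp add: d2_def)
  moreover have "d2 (\<lambda>n a b. B n a b * p n a b + v n a b) n a b = d2 B n a b * p n a (Suc b) + B n a b * d2 p n a b + d2 v n a b"
    by (simp add: d2_add d2_mult)
  moreover have "d1 q1 n (a - 1) (Suc b) = d1 A n (a - 1) (Suc b) * p n a (Suc b) + A n (a - 1) (Suc b) * d1 p n (a - 1) (Suc b)
      + (d1 B n (a - 1) (Suc b) * v n a (Suc b) + B n (a - 1) (Suc b) * d1 v n (a - 1) (Suc b))"
    unfolding q1_def[abs_def] d1_add d1_mult_back ..
  ultimately show ?thesis by (simp add: R_def b1_def b2_def H_def algebra_simps)
qed

lemma V_eq: "V = (\<lambda>n a b. up H n a b - msk (\<lambda>n a b. B n a b * d2 p n a b) n a b)"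
  by (auto simp: fun_eq_iff V_def msk_def up_def nondivergence)

lemma L2_H: "L2 H"
  unfolding H_def[abs_def]
  by (intro L2_diff L2_Linf[OF Linf_mult[OF Lc LK(1)]] L2_mult[OF LF1(1) L2_p] L2_mult[OF LF2(1) L2_v]
    L2_shm[OF L2_mult[OF LA(1) second(1)], of 1] L2_shm[OF L2_mult[OF LB(1) second(2)], of 1])

text \<open>The part of \<open>d1 H\<close> that can be differenced once more while staying bounded
  by \<open>third\<close>.\<close>

definition "LH n a b = c n * d1 K n a b - (d1 F1 n a b * p n a b + F1 n (a + 1) b * d1 p n a b)
   - (d1 F2 n a b * v n a b + F2 n (a + 1) b * d1 v n a b)
   - d1 A n (a - 1) b * d1 p n (a - 1) b - d1 B n (a - 1) b * d1 v n (a - 1) b"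

lemma d1_H: "d1 H = (\<lambda>n a b. LH n a b - A n a b * d1 (d1 p) n (a - 1) b - B n a b * d1 (d1 v) n (a - 1) b)"
  by (simp add: fun_eq_iff H_def[abs_def] LH_def d1_simps d1_shm)

lemma L2_LH: "L2 LH"
  unfolding LH_def[abs_def]
  by (intro L2_diff L2_add L2_Linf[OF Linf_mult[OF Lc LK(2)]] L2_mult[OF LF1(2) L2_p] L2_mult[OF LF2(2) L2_v]
    L2_mult[OF Linf_sh[OF LF1(1), of 1] second(1)] L2_mult[OF Linf_sh[OF LF2(1), of 1] second(2)]
    L2_shm[OF L2_mult[OF LA(2) second(1)], of 1] L2_shm[OF L2_mult[OF LB(2) second(2)], of 1])

lemma L2_d1_H: "L2 (d1 H)"
  unfolding d1_H
  by (intro L2_diff L2_LH L2_mult[OF LA(1) L2_shm[OF third(1), of 1]] L2_mult[OF LB(1) L2_shm[OF third(2), of 1]])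

lemma L2_V: "L2 V"
  unfolding V_eq d2_p by (intro L2_diff L2_up[OF L2_H] L2_msk L2_mult[OF LB(1) second(2)])

lemma d1_Bd2p: "d1 (\<lambda>n a b. B n a b * d1 v n a b) = (\<lambda>n a b. d1 B n a b * d1 v n a b + B n (a + 1) b * d1 (d1 v) n a b)"
  by (simp add: fun_eq_iff d1_simps)

lemma d1_V: "d1 V = (\<lambda>n a b. up (d1 H) n a b - msk (\<lambda>n a b. d1 B n a b * d1 v n a b + B n (a + 1) b * d1 (d1 v) n a b) n a b)"
proof -
  have "d1 V = (\<lambda>n a b. d1 (up H) n a b - d1 (msk (\<lambda>n a b. B n a b * d1 v n a b)) n a b)"
    by (simp add: V_eq d2_p fun_eq_iff d1_diff)
  then show ?thesis by (simp add: d1_up d1_msk d1_Bd2p)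
qed

lemma L2_d1_V: "L2 (d1 V)"
  unfolding d1_V
  by (intro L2_diff L2_up[OF L2_d1_H] L2_msk L2_add L2_mult[OF LB(2) second(2)] L2_mult[OF Linf_sh[OF LB(1), of 1] third(2)])

text \<open>Lower order remainder of the equation differenced twice in the first direction.\<close>

definition "LL n a b = up (\<lambda>n a b. d1 LH n a b - d1 A n a b * d1 (d1 p) n (a - 1) b - d1 B n a b * d1 (d1 v) n (a - 1) b) n a b
   - msk (\<lambda>n a b. (d1 (d1 B) n a b * d1 v n a b + d1 B n (a + 1) b * d1 (d1 v) n a b) + d1 B n (a + 1) b * d1 (d1 v) n a b) n a b"

lemma L2_LL: "L2 LL"
proof -
  have "d1 LH = (\<lambda>n a b. c n * d1 (d1 K) n a b
     - ((d1 (d1 F1) n a b * p n a b + d1 F1 n (a + 1) b * d1 p n a b) + (d1 F1 n (a + 1) b * d1 p n a b + F1 n (a + 1 + 1) b * d1 (d1 p) n a b))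
     - ((d1 (d1 F2) n a b * v n a b + d1 F2 n (a + 1) b * d1 v n a b) + (d1 F2 n (a + 1) b * d1 v n a b + F2 n (a + 1 + 1) b * d1 (d1 v) n a b))
     - (d1 (d1 A) n (a - 1) b * d1 p n (a - 1) b + d1 A n a b * d1 (d1 p) n (a - 1) b)
     - (d1 (d1 B) n (a - 1) b * d1 v n (a - 1) b + d1 B n a b * d1 (d1 v) n (a - 1) b))"
    by (simp add: fun_eq_iff LH_def[abs_def] d1_simps d1_shm)
  moreover have "L2 \<dots>"
    by (intro L2_diff L2_add L2_Linf[OF Linf_mult[OF Lc LK(3)]] L2_mult[OF LF1(3) L2_p] L2_mult[OF LF2(3) L2_v]
      L2_mult[OF Linf_sh[OF LF1(2), of 1] second(1)] L2_mult[OF Linf_sh[OF LF2(2), of 1] second(2)]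
      L2_mult[OF Linf_sh[OF Linf_sh[OF LF1(1), of 1], of 1] third(1)]
      L2_mult[OF Linf_sh[OF Linf_sh[OF LF2(1), of 1], of 1] third(2)]
      L2_shm[OF L2_mult[OF LA(3) second(1)], of 1] L2_shm[OF L2_mult[OF LB(3) second(2)], of 1]
      L2_mult[OF LA(2) L2_shm[OF third(1), of 1]] L2_mult[OF LB(2) L2_shm[OF third(2), of 1]])
  ultimately have "L2 (d1 LH)" by simp
  then show ?thesis unfolding LL_def[abs_def]
    by (intro L2_diff L2_up L2_msk L2_add L2_mult[OF LA(2) L2_shm[OF third(1), of 1]] L2_mult[OF LB(2) L2_shm[OF third(2), of 1]]
      L2_mult[OF LB(3) second(2)] L2_mult[OF Linf_sh[OF LB(2), of 1] third(2)])
qed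

end

text \<open>The row shift of a coefficient, capped because \<open>Linf\<close> says nothing beyond
  the row N.\<close>

lemma Linf_next: assumes "Linf X" shows "Linf (\<lambda>n a b. X n a (min (n + 2) (Suc b)))"
proof -
  from assms obtain C where C: "\<And>n a b. b \<le> n + 2 \<Longrightarrow> \<bar>X n a b\<bar> \<le> C" by (auto simp: Linf_def)
  then have "\<exists>C. \<forall>n a b. b \<le> n + 2 \<longrightarrow> \<bar>X n a (min (n + 2) (Suc b))\<bar> \<le> C"
    by (meson min.cobounded1)
  then show ?thesis using assms per_row[of X "\<lambda>n b. min (n + 2) (Suc b)"] unfolding Linf_def by blast
qed

section \<open>Weighted interior estimates\<close>

context scheme begin

text \<open>Together with \<open>d1_d1_V_msk\<close> this is a second order difference equation for
  \<open>w2\<close>; \<open>LL\<close> holds everything already bounded by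
  \<open>third\<close>.\<close>

lemma d1_d1_V: "d1 (d1 V) = (\<lambda>n a b. LL n a b
     - up (\<lambda>n a b. A n (a + 1) b * d1 (d1 w2) n (a - 1) b + B n (a + 1) b * d1 (d2 w2) n (a - 1) b) n a b
     - msk (\<lambda>n a b. B n (a + 2) b * d1 (d2 w2) n a b) n a b)"
proof -
  have 1: "d1 (d1 H) = (\<lambda>n a b. (d1 LH n a b - d1 A n a b * d1 (d1 p) n (a - 1) b - d1 B n a b * d1 (d1 v) n (a - 1) b)
      - (A n (a + 1) b * d1 (d1 w2) n (a - 1) b + B n (a + 1) b * d1 (d2 w2) n (a - 1) b))"
    by (simp add: d1_H fun_eq_iff d1_simps d1_shm w2_def[symmetric] d1_d1_v)
  have 2: "d1 (\<lambda>n a b. d1 B n a b * d1 v n a b + B n (a + 1) b * d1 (d1 v) n a b)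
     = (\<lambda>n a b. ((d1 (d1 B) n a b * d1 v n a b + d1 B n (a + 1) b * d1 (d1 v) n a b) + d1 B n (a + 1) b * d1 (d1 v) n a b)
         + B n (a + 2) b * d1 (d2 w2) n a b)"
    by (simp add: fun_eq_iff d1_simps d1_d1_v add.commute[of 2])
  have "d1 (d1 V) = (\<lambda>n a b. d1 (up (d1 H)) n a b - d1 (msk (\<lambda>n a b. d1 B n a b * d1 v n a b + B n (a + 1) b * d1 (d1 v) n a b)) n a b)"
    by (simp add: d1_V fun_eq_iff d1_diff)
  also have "\<dots> = (\<lambda>n a b. up (d1 (d1 H)) n a b - msk (d1 (\<lambda>n a b. d1 B n a b * d1 v n a b + B n (a + 1) b * d1 (d1 v) n a b)) n a b)"
    by (simp add: d1_up d1_msk)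
  finally show ?thesis unfolding 1 2 by (auto simp: fun_eq_iff LL_def up_def msk_def)
qed

lemma d1_d1_V_msk: "d1 (d1 V) = msk (d2 (d2 w2))"
proof -
  have "d1 (d1 V) = msk (d1 (d1 (d2 v)))" by (simp add: V_def d1_msk)
  also have "d1 (d1 (d2 v)) = d2 (d2 w2)" by (simp add: fun_eq_iff d1_d2 flip: d1_d1_v)
     (simp add: fun_eq_iff d1_d2[abs_def] d2_def d1_def field_simps)
  finally show ?thesis .
qed

text \<open>The shift by two nodes arises from differencing twice: in \<open>d1_mult\<close> each
  difference evaluates the coefficient one node further to the right.\<close>

definition "A2 n a b = A n (a + 2) b"
definition "B2 n a b = B n (a + 2) b"

lemma L_A2: "Linf A2" "Linf (d1 A2)" and L_B2: "Linf B2" "Linf (d1 B2)" "Linf (d2 B2)" and ell2: "ellip A2 B2"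
proof -
  have "d1 A2 = (\<lambda>n a b. d1 A n (a + 2) b)" "d1 B2 = (\<lambda>n a b. d1 B n (a + 2) b)" "d2 B2 = (\<lambda>n a b. d2 B n (a + 2) b)"
    by (simp_all add: A2_def[abs_def] B2_def[abs_def] fun_eq_iff d1_sh d2_def)
  then show "Linf A2" "Linf (d1 A2)" "Linf B2" "Linf (d1 B2)" "Linf (d2 B2)"
    using Linf_sh[OF LA(1), of 2] Linf_sh[OF LA(2), of 2] Linf_sh[OF LB(1), of 2] Linf_sh[OF LB(2), of 2] Linf_sh[OF LB(4), of 2]
    by (simp_all add: A2_def[abs_def] B2_def[abs_def])
  show "ellip A2 B2" using ellip_sh[OF ell, of 2] by (simp add: A2_def[abs_def] B2_def[abs_def])
qed

definition "q1' n a b = A2 n a b * d1 w2 n a b + B2 n a b * d2 w2 n a b"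
definition "q2' n a b = B2 n a b * d1 w2 n a b + d2 w2 n a b"
definition "R3 n a b = LL n a b + up (\<lambda>n a b. d1 A2 n (a - 1) b * d1 w2 n a b + d1 B2 n (a - 1) b * d2 w2 n a b) n a b
   + d2 B2 n a b * up (d1 w2) n a b"

lemma L2_q': "L2 q1'" "L2 q2'"
  unfolding q1'_def[abs_def] q2'_def[abs_def]
  by (intro L2_add L2_mult[OF L_A2(1) L2_d1_w2] L2_mult[OF L_B2(1) L2_d2_w2] L2_mult[OF L_B2(1) L2_d1_w2] L2_d2_w2)+

lemma L2_R3: "L2 R3"
  unfolding R3_def[abs_def]
  by (intro L2_add L2_LL L2_up L2_mult[OF Linf_shm[OF L_A2(2), of 1] L2_d1_w2] L2_mult[OF Linf_shm[OF L_B2(2), of 1] L2_d2_w2]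
    L2_mult[OF L_B2(3) L2_up[OF L2_d1_w2]])

text \<open>Puts the twice differenced equation back into divergence form, at the cost of first
  differences of the shifted coefficients. The horizontal flux sits on the row b + 1 and the
  vertical one on the row b, which explains \<open>dn\<close> in \<open>Q3\<close>.\<close>

lemma interior_divergence_form:
  assumes b: "Suc b < n + 2"
  shows "d1 q1' n (a - 1) (Suc b) + d2 q2' n a b = R3 n a b"
proof -
  have "d2 (d2 w2) n a b = d1 (d1 V) n a b" using b by (simp add: d1_d1_V_msk msk_def)
  also have "\<dots> = LL n a b - (A n (a + 1) (Suc b) * d1 (d1 w2) n (a - 1) (Suc b) + B n (a + 1) (Suc b) * d1 (d2 w2) n (a - 1) (Suc b))
      - B n (a + 2) b * d1 (d2 w2) n a b"
    using b by (simp add: d1_d1_V up_def msk_def)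
  finally have 1: "d2 (d2 w2) n a b = \<dots>" .
  have 2: "d1 q1' n (a - 1) (Suc b) = d1 A2 n (a - 1) (Suc b) * d1 w2 n a (Suc b) + A n (a + 1) (Suc b) * d1 (d1 w2) n (a - 1) (Suc b)
     + (d1 B2 n (a - 1) (Suc b) * d2 w2 n a (Suc b) + B n (a + 1) (Suc b) * d1 (d2 w2) n (a - 1) (Suc b))"
  proof -
    have "A2 n (a - 1) (Suc b) = A n (a + 1) (Suc b)" "B2 n (a - 1) (Suc b) = B n (a + 1) (Suc b)"
      by (simp_all add: A2_def B2_def algebra_simps)
    then show ?thesis unfolding q1'_def[abs_def] d1_add d1_mult_back by simp
  qed
  have 3: "d2 q2' n a b = d2 B2 n a b * d1 w2 n a (Suc b) + B n (a + 2) b * d1 (d2 w2) n a b + d2 (d2 w2) n a b"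
  proof -
    have "B2 n a b = B n (a + 2) b" by (simp add: B2_def)
    then show ?thesis unfolding q2'_def[abs_def] d2_add d2_mult d1_d2[symmetric] by simp
  qed
  show ?thesis unfolding 2 3 1 using b by (simp add: R3_def up_def)
qed

definition "W n a b = chi n b * w2 n a b"
text \<open>The weighted vertical flux, moved up by one row. It vanishes on the row 0 by
  \<open>dn\<close> and on the row N because \<open>chi n (Suc n) = 0\<close>; this restores the
  boundary hypotheses of \<open>energy_tangential\<close>.\<close>

definition "Q3 = dn (\<lambda>n a b. chi n b * q2' n a b)"
definition "q3 n a b = chi n b * q1' n a b"

lemma L2_W: "L2 W" "L2 (d1 W)" "L2 (d2 W)"
proof -
  show "L2 W" unfolding W_def[abs_def] by (rule L2_mult[OF Linf_chi L2_w2])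
  have "d1 W = (\<lambda>n a b. chi n b * d1 w2 n a b)" by (simp add: fun_eq_iff W_def[abs_def] d1_chi_mult)
  then show "L2 (d1 W)" using L2_mult[OF Linf_chi L2_d1_w2] by simp
  show "L2 (d2 W)"
  proof (rule L2_cong[OF L2_add[OF L2_mult[OF Linf_chi L2_d2_w2] L2_mult[OF Linf_dchi L2_up[OF L2_w2]]]])
    show "per (d2 W)" using per_d2[OF L2_per[OF \<open>L2 W\<close>]] .
    show "d2 W n a b = chi n b * d2 w2 n a b + dchi n a b * up w2 n a b" if "b < n + 2" for n a b
      unfolding W_def[abs_def] using d2_chi_mult[OF that] .
  qed
qed

lemma d1_W: "d1 W = (\<lambda>n a b. chi n b * d1 w2 n a b)" by (simp add: fun_eq_iff W_def[abs_def] d1_chi_mult)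

lemma d2_W: "b < n + 2 \<Longrightarrow> d2 W n a b = chi n b * d2 w2 n a b + dchi n a b * up w2 n a b"
  unfolding W_def[abs_def] by (rule d2_chi_mult)

text \<open>Third use of \<open>energy_tangential\<close>. As \<open>chi\<close> commutes with
  \<open>d1\<close>, commutators arise only from vertical differences, and these are
  \<open>dchi\<close> times quantities bounded by \<open>third\<close>.\<close>

lemma L2_dd_W: "L2 (d1 (d1 W))" "L2 (d2 (d1 W))"
proof -
  let ?r1 = "\<lambda>n a b. - (B2 n a b * (dchi n a b * up w2 n a b))"
  let ?r2 = "\<lambda>n a b. - (dchi n a b * up w2 n a b)"
  let ?R = "dn (\<lambda>n a b. chi n (Suc b) * R3 n a b + dchi n a b * q2' n a b)"
  have LR: "L2 ?R"
  proof (rule L2_dn)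
    \<comment> \<open>The weight belongs to the row b + 1, \<open>R3\<close> to the row b;
      \<open>chi_Suc\<close> splits the weight, and the extra mesh size is bounded.\<close>
    have "L2 (\<lambda>n a b. chi n b * R3 n a b + dchi n a b * (kk n * R3 n a b) + dchi n a b * q2' n a b)"
    proof -
      have "Linf (\<lambda>n a b. kk n)" by (rule Linf_seq[of _ 1]) (simp add: kk_def)
      then show ?thesis
        by (intro L2_add L2_mult[OF Linf_chi L2_R3] L2_mult[OF Linf_dchi] L2_q') (rule L2_mult[OF _ L2_R3])
    qed
    moreover have "(\<lambda>n a b. chi n (Suc b) * R3 n a b + dchi n a b * q2' n a b) = (\<lambda>n a b. chi n b * R3 n a b + dchi n a b * (kk n * R3 n a b) + dchi n a b * q2' n a b)"
    proof (intro ext)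
      fix n a b
      show "chi n (Suc b) * R3 n a b + dchi n a b * q2' n a b = chi n b * R3 n a b + dchi n a b * (kk n * R3 n a b) + dchi n a b * q2' n a b"
        unfolding chi_Suc[of n b a] by (simp add: distrib_right mult_ac)
    qed
    ultimately show "L2 (\<lambda>n a b. chi n (Suc b) * R3 n a b + dchi n a b * q2' n a b)" by simp
  qed
  have "L2 (d1 (d1 W)) \<and> L2 (d2 (d1 W))"
  proof (rule energy_tangential[OF L2_per[OF L2_W(1)] _ _ L_A2(1) L_B2(1) L_A2(2) L_B2(2) ell2, where Q = Q3 and ?q1.0 = q3 and R = ?R
     and ?r1.0 = ?r1 and ?r2.0 = ?r2])
    show "per Q3" unfolding Q3_def by (intro per_dn per_mult per_const L2_per[OF L2_q'(2)])
    show "per q3" unfolding q3_def[abs_def] by (intro per_mult per_const L2_per[OF L2_q'(1)])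
    show "q3 n a b = A2 n a b * d1 W n a b + B2 n a b * d2 W n a b + ?r1 n a b" if "b < n + 2" for n a b
      using d2_W[OF that, of a] by (simp add: d1_W q3_def q1'_def algebra_simps)
    show "Q3 n a (Suc b) = B2 n a b * d1 W n a b + d2 W n a b + ?r2 n a b" if "b < n + 2" for n a b
      using d2_W[OF that, of a] by (simp add: d1_W Q3_def dn_def q2'_def algebra_simps)
    show "Q3 n a 0 = 0" for n a by (simp add: Q3_def dn_def)
    show "Q3 n a (n + 2) = 0" for n a by (simp add: Q3_def dn_def)
    show "d1 q3 n (a - 1) b + d2 Q3 n a b = ?R n a b" if "b < n + 2" for n a b
    proof (cases b)
      case 0
      then show ?thesis by (simp add: q3_def[abs_def] d1_def d2_def Q3_def dn_def)
    next
      case (Suc b')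
      have "d2 Q3 n a b = (chi n (Suc b') * q2' n a (Suc b') - chi n b' * q2' n a b') / kk n"
        by (simp add: Suc Q3_def dn_def d2_def)
      also have "\<dots> = chi n (Suc b') * d2 q2' n a b' + dchi n a b' * q2' n a b'"
        by (simp add: dchi_eq d2_def field_simps)
      finally have 1: "d2 Q3 n a b = \<dots>" .
      have 2: "d1 q3 n (a - 1) b = chi n (Suc b') * d1 q1' n (a - 1) (Suc b')"
        by (simp add: q3_def[abs_def] d1_chi_mult Suc)
      have "d1 q3 n (a - 1) b + d2 Q3 n a b = chi n (Suc b') * (d1 q1' n (a - 1) (Suc b') + d2 q2' n a b') + dchi n a b' * q2' n a b'"
        unfolding 1 2 by (simp add: distrib_left)
      then show ?thesis using interior_divergence_form[of b' n a] that Suc by (simp add: dn_def)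
    qed
    show "L2 ?R" by (rule LR)
    have "d1 (up w2) = up (d1 w2)" by (rule d1_up)
    then have "d1 ?r1 = (\<lambda>n a b. - (d1 B2 n a b * (dchi n a b * up w2 n a b) + B2 n (a + 1) b * (dchi n a b * up (d1 w2) n a b)))"
      by (auto simp only: fun_eq_iff d1_uminus d1_mult[of B2] d1_dchi_mult)
    moreover have "L2 \<dots>"
      by (intro L2_uminus L2_add L2_mult[OF L_B2(2)] L2_mult[OF Linf_sh[OF L_B2(1), of 1]] L2_mult[OF Linf_dchi] L2_up L2_w2 L2_d1_w2)
    ultimately show "L2 (d1 ?r1)" by simp
    have "d1 ?r2 = (\<lambda>n a b. - (dchi n a b * up (d1 w2) n a b))"
      by (auto simp only: fun_eq_iff d1_uminus d1_dchi_mult d1_up)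
    moreover have "L2 \<dots>" by (intro L2_uminus L2_mult[OF Linf_dchi] L2_up L2_d1_w2)
    ultimately show "L2 (d1 ?r2)" by simp
  qed (rule L2_W)+
  then show "L2 (d1 (d1 W))" "L2 (d2 (d1 W))" by auto
qed

lemma equi_W: "equi W"
  by (rule mixed_sobolev[OF L2_W L2_dd_W(2)])

definition "Z n a b = chi n b * d1 v n a b"

lemma L2_chi_dd: "L2 (\<lambda>n a b. chi n b * d1 (d1 w2) n a b)" "L2 (\<lambda>n a b. chi n b * d1 (d2 w2) n a b)"
proof -
  have "d1 (d1 W) = (\<lambda>n a b. chi n b * d1 (d1 w2) n a b)" by (simp add: d1_W fun_eq_iff d1_chi_mult)
  then show "L2 (\<lambda>n a b. chi n b * d1 (d1 w2) n a b)" using L2_dd_W(1) by simp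
  show "L2 (\<lambda>n a b. chi n b * d1 (d2 w2) n a b)"
  proof (rule L2_cong[OF L2_diff[OF L2_dd_W(2) L2_mult[OF Linf_dchi L2_up[OF L2_d1_w2]]]])
    show "per (\<lambda>n a b. chi n b * d1 (d2 w2) n a b)"
      by (intro per_mult per_const per_d1 L2_per[OF L2_d2_w2])
    show "chi n b * d1 (d2 w2) n a b = d2 (d1 W) n a b - dchi n a b * up (d1 w2) n a b" if "b < n + 2" for n a b
      using d2_chi_mult[OF that, of "d1 w2" a] by (simp add: d1_W d1_d2)
  qed
qed

text \<open>By \<open>d1_d1_V_msk\<close> this bounds the double vertical difference of
  \<open>w2\<close>, which does not occur in the energy and is supplied by the equation.\<close>

lemma L2_chi_d1_d1_V: "L2 (\<lambda>n a b. chi n b * d1 (d1 V) n a b)"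
proof -
  have up1: "L2 (\<lambda>n a b. chi n b * up (d1 (d1 w2)) n a b)"
    by (rule L2_chi_up[OF L2_chi_dd(1) L2_kd1[OF L2_d1_w2] per_d1[OF L2_per[OF L2_d1_w2]]])
  have up2: "L2 (\<lambda>n a b. chi n b * up (d1 (d2 w2)) n a b)"
    by (rule L2_chi_up[OF L2_chi_dd(2) L2_kd1[OF L2_d2_w2] per_d1[OF L2_per[OF L2_d2_w2]]])
  have LupA: "Linf (\<lambda>n a b. A n (a + 1) (min (n + 2) (Suc b)))" and LupB: "Linf (\<lambda>n a b. B n (a + 1) (min (n + 2) (Suc b)))"
    using Linf_next[OF Linf_sh[OF LA(1), of 1]] Linf_next[OF Linf_sh[OF LB(1), of 1]] by auto
  have "L2 (\<lambda>n a b. chi n b * LL n a b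
     - (A n (a + 1) (min (n + 2) (Suc b)) * (chi n b * up (d1 (d1 w2)) n (a - 1) b) + B n (a + 1) (min (n + 2) (Suc b)) * (chi n b * up (d1 (d2 w2)) n (a - 1) b))
     - msk (\<lambda>n a b. B n (a + 2) b * (chi n b * d1 (d2 w2) n a b)) n a b)"
    by (intro L2_diff L2_add L2_mult[OF Linf_chi L2_LL] L2_mult[OF LupA L2_shm[OF up1, of 1]] L2_mult[OF LupB L2_shm[OF up2, of 1]]
      L2_msk L2_mult[OF Linf_sh[OF LB(1), of 2] L2_chi_dd(2)])
  then show ?thesis
  proof (rule L2_cong)
    show "per (\<lambda>n a b. chi n b * d1 (d1 V) n a b)"
      by (intro per_mult per_const per_d1 L2_per[OF L2_V])
  qed (auto simp: d1_d1_V up_def msk_def algebra_simps)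
qed

text \<open>\<open>d2 Z\<close> and \<open>d2 (d1 Z)\<close> contain tangential differences of
  \<open>d2 v\<close>. Under the weight, \<open>d2 v\<close> may be replaced by its masked version
  \<open>V\<close>, for which the equation gives bounds.\<close>

lemma equi_Z: "equi Z"
proof (rule mixed_sobolev)
  show LZ: "L2 Z" unfolding Z_def[abs_def] by (rule L2_mult[OF Linf_chi second(2)])
  have dZ: "d1 Z = (\<lambda>n a b. chi n b * d1 (d1 v) n a b)" by (simp add: Z_def[abs_def] fun_eq_iff d1_chi_mult)
  show LdZ: "L2 (d1 Z)" unfolding dZ by (rule L2_mult[OF Linf_chi third(2)])
  have chi_V: "chi n b * d2 (d1 v) n a b = chi n b * d1 V n a b" if "b < n + 2" for n a b
  proof (cases "Suc b < n + 2")
    case True then show ?thesis by (simp add: V_def d1_msk msk_def d1_d2)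
  next
    case False then have "b = Suc n" using that by simp
    then show ?thesis by simp
  qed
  show "L2 (d2 Z)"
  proof (rule L2_cong[OF L2_add[OF L2_mult[OF Linf_chi L2_d1_V] L2_mult[OF Linf_dchi L2_up[OF second(2)]]]])
    show "per (d2 Z)" by (rule per_d2[OF L2_per[OF LZ]])
    show "d2 Z n a b = chi n b * d1 V n a b + dchi n a b * up (d1 v) n a b" if "b < n + 2" for n a b
      unfolding Z_def[abs_def] d2_chi_mult[OF that] chi_V[OF that] ..
  qed
  have chi_V2: "chi n b * d2 (d1 (d1 v)) n a b = chi n b * d1 (d1 V) n a b" if "b < n + 2" for n a b
  proof (cases "Suc b < n + 2")
    case True then show ?thesis by (simp add: d1_d1_V_msk msk_def d1_d1_v)
  next
    case False then have "b = Suc n" using that by simp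
    then show ?thesis by simp
  qed
  show "L2 (d2 (d1 Z))"
  proof (rule L2_cong[OF L2_add[OF L2_chi_d1_d1_V L2_mult[OF Linf_dchi L2_up[OF third(2)]]]])
    show "per (d2 (d1 Z))" by (rule per_d2[OF L2_per[OF LdZ]])
    show "d2 (d1 Z) n a b = chi n b * d1 (d1 V) n a b + dchi n a b * up (d1 (d1 v)) n a b" if "b < n + 2" for n a b
      unfolding dZ d2_chi_mult[OF that] chi_V2[OF that] ..
  qed
qed

end

section \<open>Compactness and passage to the limit\<close>

definition ga :: "nat \<Rightarrow> int \<Rightarrow> real" where "ga n a = hh n * real_of_int a"
definition gb :: "nat \<Rightarrow> nat \<Rightarrow> real" where "gb n b = - 1 + kk n * real b"
definition ix :: "nat \<Rightarrow> real \<Rightarrow> int" where "ix n x = \<lfloor>x / hh n\<rfloor>"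
definition iy :: "nat \<Rightarrow> real \<Rightarrow> nat" where "iy n y = nat \<lfloor>(y + 1) / kk n\<rfloor>"

lemma ix_ga: "ix n (ga n a) = a" and iy_gb: "iy n (gb n b) = b"
  by (simp_all add: ix_def ga_def iy_def gb_def)

lemma gb_range: "b \<le> n + 2 \<Longrightarrow> gb n b \<in> {-1..1}"
proof -
  assume "b \<le> n + 2"
  then have "kk n * real b \<le> kk n * real (n + 2)" by (intro mult_left_mono) auto
  then have "kk n * real b \<le> 2" by (simp only: kN)
  then show ?thesis by (simp add: gb_def)
qed

lemma ga_ix: "\<bar>ga n (ix n x) - x\<bar> \<le> hh n"
proof -
  have "real_of_int \<lfloor>x / hh n\<rfloor> \<le> x / hh n" "x / hh n \<le> real_of_int \<lfloor>x / hh n\<rfloor> + 1" by linarith+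
  then have "hh n * real_of_int \<lfloor>x / hh n\<rfloor> \<le> hh n * (x / hh n)" "hh n * (x / hh n) \<le> hh n * (real_of_int \<lfloor>x / hh n\<rfloor> + 1)"
    by (intro mult_left_mono; simp)+
  then show ?thesis by (simp add: ga_def ix_def distrib_left)
qed

lemma gb_iy:
  assumes "y \<in> {-1..1}" shows "\<bar>gb n (iy n y) - y\<bar> \<le> kk n" "iy n y \<le> n + 2"
proof -
  have nn: "0 \<le> (y + 1) / kk n" using assms by simp
  have "real_of_int \<lfloor>(y+1) / kk n\<rfloor> \<le> (y+1) / kk n" "(y+1) / kk n \<le> real_of_int \<lfloor>(y+1) / kk n\<rfloor> + 1" by linarith+
  then have "kk n * real_of_int \<lfloor>(y+1) / kk n\<rfloor> \<le> kk n * ((y+1) / kk n)" "kk n * ((y+1) / kk n) \<le> kk n * (real_of_int \<lfloor>(y+1) / kk n\<rfloor> + 1)"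
    by (intro mult_left_mono; simp)+
  moreover have iyr: "real (iy n y) = real_of_int \<lfloor>(y+1) / kk n\<rfloor>" using nn by (simp add: iy_def)
  moreover have "kk n * ((y+1) / kk n) = y + 1" by simp
  ultimately show "\<bar>gb n (iy n y) - y\<bar> \<le> kk n" unfolding gb_def iyr distrib_left by linarith
  have "(y+1) / kk n \<le> 2 / kk n" using assms by (intro divide_right_mono) auto
  also have "\<dots> = real (n + 2)" by (simp add: kk_def)
  finally show "iy n y \<le> n + 2" unfolding iy_def by linarith
qed

lemma hh_tendsto: "hh \<longlonglongrightarrow> 0" and kk_tendsto: "kk \<longlonglongrightarrow> 0"
proof -
  have "(\<lambda>n. r / real (n + 2)) \<longlonglongrightarrow> 0" for r
    using LIMSEQ_ignore_initial_segment[OF lim_const_over_n[of r], of 2] by simp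
  then show "hh \<longlonglongrightarrow> 0" "kk \<longlonglongrightarrow> 0" by (simp_all add: hh_def[abs_def] kk_def[abs_def])
qed

lemma per_int_mult:
  assumes "per X" shows "X n (a + int (n + 2) * t) b = X n a b"
proof (induction t rule: int_induct[of _ 0])
  case (step1 i)
  have "X n (a + int (n + 2) * (i + 1)) b = X n ((a + int (n + 2) * i) + int (n + 2)) b" by (simp add: algebra_simps)
  then show ?case using step1 perD[OF assms, of n "a + int (n + 2) * i" b] by simp
next
  case (step2 i)
  have "X n (a + int (n + 2) * i) b = X n ((a + int (n + 2) * (i - 1)) + int (n + 2)) b" by (simp add: algebra_simps)
  then show ?case using step2 perD[OF assms, of n "a + int (n + 2) * (i - 1)" b] by simp
qed simp

lemma ix_periodic: "ix n (x + 2 * pi * real_of_int t) = ix n x + int (n + 2) * t"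
proof -
  have "(x + 2 * pi * real_of_int t) / hh n = x / hh n + real_of_int (int (n + 2) * t)"
  proof -
    have "2 * pi = hh n * real (n + 2)" by (simp only: hN)
    then have "2 * pi * real_of_int t / hh n = real (n + 2) * real_of_int t" by simp
    then show ?thesis by (simp add: add_divide_distrib)
  qed
  then show ?thesis unfolding ix_def by (metis floor_add_int)
qed

lemma ga_periodic: "ga m (i + int (m + 2) * t) = ga m i + 2 * pi * real_of_int t"
proof -
  have "hh m * (real (m + 2) * real_of_int t) = 2 * pi * real_of_int t" using hN[of m] by (metis mult.assoc)
  then show ?thesis by (simp add: ga_def distrib_left)
qed

definition gconv :: "(nat \<Rightarrow> nat) \<Rightarrow> grid_fam \<Rightarrow> (real \<times> real \<Rightarrow> real) \<Rightarrow> bool" where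
  "gconv r z F \<longleftrightarrow> (\<forall>e>0. \<exists>n0. \<forall>n\<ge>n0. \<forall>a b. b \<le> r n + 2 \<longrightarrow> \<bar>z (r n) a b - F (ga (r n) a, gb (r n) b)\<bar> < e)"

lemma gconv_subseq:
  assumes "gconv r z F" "strict_mono k" shows "gconv (r \<circ> k) z F"
  unfolding gconv_def
proof (intro allI impI)
  fix e :: real assume "e > 0"
  then obtain n0 where n0: "\<And>n a b. n \<ge> n0 \<Longrightarrow> b \<le> r n + 2 \<Longrightarrow> \<bar>z (r n) a b - F (ga (r n) a, gb (r n) b)\<bar> < e"
    using assms(1) unfolding gconv_def by metis
  show "\<exists>n0. \<forall>n\<ge>n0. \<forall>a b. b \<le> (r \<circ> k) n + 2 \<longrightarrow> \<bar>z ((r \<circ> k) n) a b - F (ga ((r \<circ> k) n) a, gb ((r \<circ> k) n) b)\<bar> < e"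
  proof (intro exI allI impI)
    fix n a b assume "n0 \<le> n" "b \<le> (r \<circ> k) n + 2"
    then show "\<bar>z ((r \<circ> k) n) a b - F (ga ((r \<circ> k) n) a, gb ((r \<circ> k) n) b)\<bar> < e"
      using n0[of "k n" b a] seq_suble[OF assms(2), of n] by simp
  qed
qed

text \<open>Diagonal selection makes the step functions converge at all nodes of all meshes, a
  countable set; the uniform Hoelder bound turns this into uniform convergence. The strip is not
  compact, but by periodicity one period of nodes of a single coarse mesh controls every
  point.\<close>

lemma grid_Arzela_Ascoli:
  assumes "equi z" "strict_mono (r :: nat \<Rightarrow> nat)"
  obtains k F where "strict_mono (k :: nat \<Rightarrow> nat)" "gconv (r \<circ> k) z F" "continuous_on Omega_ext F"
    "\<And>x y. F (x + 2 * pi, y) = F (x, y)"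
proof -
  from assms(1) obtain C where pz: "per z" and C0: "C \<ge> 0"
    and bd: "\<And>n a b. b \<le> n + 2 \<Longrightarrow> \<bar>z n a b\<bar> \<le> C"
    and hol: "\<And>n a a' b b'. b \<le> n + 2 \<Longrightarrow> b' \<le> n + 2 \<Longrightarrow>
      \<bar>z n a b - z n a' b'\<bar> \<le> C * (sqrt (hh n * real_of_int \<bar>a - a'\<bar>) + sqrt (kk n * \<bar>real b - real b'\<bar>))"
    unfolding equi_def by (metis (no_types, lifting))
  define f where "f n q = z n (ix n (fst q)) (iy n (snd q))" for n and q :: "real \<times> real"
  have f_bd: "\<bar>f n q\<bar> \<le> C" if "snd q \<in> {-1..1}" for n q
    unfolding f_def using bd gb_iy(2)[OF that] by blast
  have f_hol: "\<bar>f n (x, y) - f n (x', y')\<bar> \<le> C * (sqrt (\<bar>x - x'\<bar> + 2 * hh n) + sqrt (\<bar>y - y'\<bar> + 2 * kk n))"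
    if "y \<in> {-1..1}" "y' \<in> {-1..1}" for n x x' y y'
  proof -
    have "hh n * real_of_int \<bar>ix n x - ix n x'\<bar> = \<bar>ga n (ix n x) - ga n (ix n x')\<bar>"
      by (simp add: ga_def abs_mult flip: right_diff_distrib)
    also have "\<dots> \<le> \<bar>x - x'\<bar> + 2 * hh n" using ga_ix[of n x] ga_ix[of n x'] by linarith
    finally have 1: "hh n * real_of_int \<bar>ix n x - ix n x'\<bar> \<le> \<bar>x - x'\<bar> + 2 * hh n" .
    have "kk n * \<bar>real (iy n y) - real (iy n y')\<bar> = \<bar>gb n (iy n y) - gb n (iy n y')\<bar>"
      by (simp add: gb_def abs_mult flip: right_diff_distrib)
    also have "\<dots> \<le> \<bar>y - y'\<bar> + 2 * kk n" using gb_iy(1)[OF that(1), of n] gb_iy(1)[OF that(2), of n] by linarith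
    finally have 2: "kk n * \<bar>real (iy n y) - real (iy n y')\<bar> \<le> \<bar>y - y'\<bar> + 2 * kk n" .
    have "\<bar>f n (x, y) - f n (x', y')\<bar> \<le> C * (sqrt (hh n * real_of_int \<bar>ix n x - ix n x'\<bar>) + sqrt (kk n * \<bar>real (iy n y) - real (iy n y')\<bar>))"
      unfolding f_def fst_conv snd_conv by (rule hol[OF gb_iy(2)[OF that(1)] gb_iy(2)[OF that(2)]])
    also have "\<dots> \<le> C * (sqrt (\<bar>x - x'\<bar> + 2 * hh n) + sqrt (\<bar>y - y'\<bar> + 2 * kk n))"
      using 1 2 C0 by (intro mult_left_mono add_mono real_sqrt_le_mono)
    finally show ?thesis .
  qed
  have f_per: "f n (x + 2 * pi * real_of_int t, y) = f n (x, y)" for n x y t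
    unfolding f_def fst_conv snd_conv ix_periodic by (rule per_int_mult[OF pz])
  define S where "S = (\<lambda>(m, i, j). (ga m i, gb m j)) ` {(m, i, j). j \<le> m + 2}"
  have "countable S" unfolding S_def by auto
  moreover have "norm (f (r n) q) \<le> C" if "q \<in> S" for n q
  proof -
    from that obtain m i j where "q = (ga m i, gb m j)" "j \<le> m + 2" by (auto simp: S_def)
    then have "snd q \<in> {-1..1}" using gb_range[of j m] by auto
    from f_bd[OF this] show ?thesis by simp
  qed
  ultimately obtain k where k: "strict_mono (k::nat\<Rightarrow>nat)" and conv: "\<And>q. q \<in> S \<Longrightarrow> \<exists>l. (\<lambda>n. f (r (k n)) q) \<longlonglongrightarrow> l"
    using function_convergent_subsequence[of S "\<lambda>n. f (r n)" C] by blast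
  define g where "g n = f (r (k n))" for n
  have rk: "strict_mono (r \<circ> k)" using assms(2) k by (simp add: strict_mono_o)
  have hk0: "(\<lambda>n. hh (r (k n))) \<longlonglongrightarrow> 0" "(\<lambda>n. kk (r (k n))) \<longlonglongrightarrow> 0"
    using LIMSEQ_subseq_LIMSEQ[OF hh_tendsto rk] LIMSEQ_subseq_LIMSEQ[OF kk_tendsto rk] by (simp_all add: o_def)
  have cauchy: "uniformly_Cauchy_on Omega_ext g"
  proof (rule uniformly_Cauchy_onI)
    fix e :: real assume e: "e > 0"
    \<comment> \<open>The coarse mesh m: a point and its node differ by at most \<open>hh m\<close>,
      and the later, finer meshes add at most 2 \<open>hh m\<close>, which explains the factor
      3.\<close>
    have "(\<lambda>m. C * (sqrt (3 * hh m) + sqrt (3 * kk m))) \<longlonglongrightarrow> C * (sqrt (3 * 0) + sqrt (3 * 0))"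
      by (intro tendsto_intros hh_tendsto kk_tendsto)
    then have "\<forall>\<^sub>F m in sequentially. C * (sqrt (3 * hh m) + sqrt (3 * kk m)) < e / 3"
      using e by (intro order_tendstoD) auto
    then obtain m where m: "C * (sqrt (3 * hh m) + sqrt (3 * kk m)) < e / 3"
      by (auto simp: eventually_sequentially)
    have "\<forall>\<^sub>F n in sequentially. hh (r (k n)) < hh m" "\<forall>\<^sub>F n in sequentially. kk (r (k n)) < kk m"
      using order_tendstoD(2)[OF hk0(1) hh_pos] order_tendstoD(2)[OF hk0(2) kk_pos] by auto
    moreover have "\<forall>\<^sub>F n in sequentially. \<forall>ij\<in>{0..<int (m+2)} \<times> {..m+2}. \<bar>g n (ga m (fst ij), gb m (snd ij)) - lim (\<lambda>n. g n (ga m (fst ij), gb m (snd ij)))\<bar> < e / 6"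
    proof (rule eventually_ball_finite)
      show "\<forall>ij\<in>{0..<int (m+2)} \<times> {..m+2}. \<forall>\<^sub>F n in sequentially. \<bar>g n (ga m (fst ij), gb m (snd ij)) - lim (\<lambda>n. g n (ga m (fst ij), gb m (snd ij)))\<bar> < e / 6"
      proof
        fix ij assume "ij \<in> {0..<int (m+2)} \<times> {..m+2}"
        then have "(ga m (fst ij), gb m (snd ij)) \<in> S" unfolding S_def by (intro image_eqI[of _ _ "(m, fst ij, snd ij)"]) auto
        then have "(\<lambda>n. g n (ga m (fst ij), gb m (snd ij))) \<longlonglongrightarrow> lim (\<lambda>n. g n (ga m (fst ij), gb m (snd ij)))"
          using conv unfolding g_def convergent_LIMSEQ_iff[symmetric] convergent_def by blast
        from tendstoD[OF this, of "e/6"] e show "\<forall>\<^sub>F n in sequentially. \<bar>g n (ga m (fst ij), gb m (snd ij)) - lim (\<lambda>n. g n (ga m (fst ij), gb m (snd ij)))\<bar> < e / 6"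
          by (simp add: dist_real_def)
      qed
    qed auto
    ultimately have "\<forall>\<^sub>F n in sequentially. hh (r (k n)) < hh m \<and> kk (r (k n)) < kk m \<and> (\<forall>ij\<in>{0..<int (m+2)} \<times> {..m+2}. \<bar>g n (ga m (fst ij), gb m (snd ij)) - lim (\<lambda>n. g n (ga m (fst ij), gb m (snd ij)))\<bar> < e / 6)"
      by eventually_elim auto
    then obtain n0 where n0: "\<And>n. n \<ge> n0 \<Longrightarrow> hh (r (k n)) < hh m \<and> kk (r (k n)) < kk m \<and> (\<forall>ij\<in>{0..<int (m+2)} \<times> {..m+2}. \<bar>g n (ga m (fst ij), gb m (snd ij)) - lim (\<lambda>n. g n (ga m (fst ij), gb m (snd ij)))\<bar> < e / 6)"
      by (auto simp: eventually_sequentially)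
    have close: "\<exists>L. \<forall>n\<ge>n0. \<bar>g n q - L\<bar> < e / 3 + e / 6" if q: "q \<in> Omega_ext" for q
    proof -
      obtain x y where xy: "q = (x, y)" "y \<in> {-1..1}" using q by (auto simp: Omega_ext_def)
      define i where "i = ix m x mod int (m + 2)"
      define t where "t = ix m x div int (m + 2)"
      have it: "ix m x = i + int (m + 2) * t" by (simp add: i_def t_def)
      have i: "i \<in> {0..<int (m+2)}" by (simp add: i_def)
      define j where "j = iy m y"
      have j: "j \<in> {..m+2}" using gb_iy(2)[OF xy(2)] by (simp add: j_def)
      let ?L = "lim (\<lambda>n. g n (ga m i, gb m j))"
      have "\<bar>g n q - ?L\<bar> < e / 3 + e / 6" if n: "n \<ge> n0" for n
      proof -
        have "\<bar>g n q - g n (ga m (ix m x), gb m j)\<bar> \<le> C * (sqrt (\<bar>x - ga m (ix m x)\<bar> + 2 * hh (r (k n))) + sqrt (\<bar>y - gb m j\<bar> + 2 * kk (r (k n))))"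
          unfolding g_def xy(1) using j gb_range by (intro f_hol xy) auto
        also have "\<dots> \<le> C * (sqrt (3 * hh m) + sqrt (3 * kk m))"
          using n0[OF n] ga_ix[of m x] gb_iy(1)[OF xy(2), of m] C0 unfolding j_def
          by (intro mult_left_mono add_mono real_sqrt_le_mono) (auto simp: abs_minus_commute)
        also note m
        finally have 1: "\<bar>g n q - g n (ga m (ix m x), gb m j)\<bar> < e / 3" .
        have "g n (ga m (ix m x), gb m j) = g n (ga m i, gb m j)"
          unfolding it ga_periodic g_def f_per ..
        moreover have "\<bar>g n (ga m i, gb m j) - ?L\<bar> < e / 6"
          using n0[OF n] i j by force
        ultimately show ?thesis using 1 by linarith
      qed
      then show ?thesis by blast
    qed
    show "\<exists>M. \<forall>q\<in>Omega_ext. \<forall>m\<ge>M. \<forall>n\<ge>M. dist (g m q) (g n q) < e"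
    proof (intro exI ballI allI impI)
      fix q n n' assume "q \<in> Omega_ext" "n0 \<le> n" "n0 \<le> n'"
      with close[of q] obtain L where "\<bar>g n q - L\<bar> < e / 3 + e / 6" "\<bar>g n' q - L\<bar> < e / 3 + e / 6" by blast
      then show "dist (g n q) (g n' q) < e" unfolding dist_real_def by linarith
    qed
  qed
  then obtain F0 where F0: "uniform_limit Omega_ext g F0 sequentially"
    using Cauchy_uniformly_convergent unfolding uniformly_convergent_on_def by blast
  \<comment> \<open>The value 0 off the strip makes the limit periodic for every y, as the
    conclusion states it.\<close>
  define F where "F q = (if snd q \<in> {-1..1} then F0 q else 0)" for q
  have F: "uniform_limit Omega_ext g F sequentially"
    by (rule uniform_limit_cong'[THEN iffD1, OF _ _ F0]) (auto simp: F_def Omega_ext_def)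
  have Flim: "(\<lambda>n. g n (x, y)) \<longlonglongrightarrow> F (x, y)" if "y \<in> {-1..1}" for x y
    using tendsto_uniform_limitI[OF F, of "(x, y)"] that by (auto simp: Omega_ext_def)
  have Fper: "F (x + 2 * pi, y) = F (x, y)" for x y
  proof (cases "y \<in> {-1..1}")
    case True
    have "(\<lambda>n. g n (x, y)) \<longlonglongrightarrow> F (x + 2 * pi, y)"
      using Flim[OF True, of "x + 2 * pi"] f_per[of _ x 1 y] by (simp add: g_def)
    then show ?thesis using Flim[OF True, of x] LIMSEQ_unique by blast
  qed (auto simp: F_def)
  have Fhol: "\<bar>F (x, y) - F (x', y')\<bar> \<le> C * (sqrt \<bar>x - x'\<bar> + sqrt \<bar>y - y'\<bar>)" if "y \<in> {-1..1}" "y' \<in> {-1..1}" for x x' y y'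
  proof (rule LIMSEQ_le)
    show "(\<lambda>n. \<bar>g n (x, y) - g n (x', y')\<bar>) \<longlonglongrightarrow> \<bar>F (x, y) - F (x', y')\<bar>"
      by (intro tendsto_intros Flim that)
    have "(\<lambda>n. C * (sqrt (\<bar>x - x'\<bar> + 2 * hh (r (k n))) + sqrt (\<bar>y - y'\<bar> + 2 * kk (r (k n))))) \<longlonglongrightarrow> C * (sqrt (\<bar>x - x'\<bar> + 2 * 0) + sqrt (\<bar>y - y'\<bar> + 2 * 0))"
      by (intro tendsto_intros hk0)
    then show "(\<lambda>n. C * (sqrt (\<bar>x - x'\<bar> + 2 * hh (r (k n))) + sqrt (\<bar>y - y'\<bar> + 2 * kk (r (k n))))) \<longlonglongrightarrow> C * (sqrt \<bar>x - x'\<bar> + sqrt \<bar>y - y'\<bar>)" by simp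
    show "\<exists>N. \<forall>n\<ge>N. \<bar>g n (x, y) - g n (x', y')\<bar> \<le> C * (sqrt (\<bar>x - x'\<bar> + 2 * hh (r (k n))) + sqrt (\<bar>y - y'\<bar> + 2 * kk (r (k n))))"
      unfolding g_def using f_hol[OF that] by blast
  qed
  have Fcont: "continuous_on Omega_ext F"
    unfolding continuous_on_def
  proof
    fix q assume "q \<in> Omega_ext"
    then obtain x y where q: "q = (x, y)" "y \<in> {-1..1}" by (auto simp: Omega_ext_def)
    have "((\<lambda>q'. C * (sqrt \<bar>fst q' - x\<bar> + sqrt \<bar>snd q' - y\<bar>)) \<longlongrightarrow> C * (sqrt \<bar>fst q - x\<bar> + sqrt \<bar>snd q - y\<bar>)) (at q within Omega_ext)"
      by (intro tendsto_intros)
    then have 0: "((\<lambda>q'. C * (sqrt \<bar>fst q' - x\<bar> + sqrt \<bar>snd q' - y\<bar>)) \<longlongrightarrow> 0) (at q within Omega_ext)" by (simp add: q)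
    have "((\<lambda>q'. F q' - F q) \<longlongrightarrow> 0) (at q within Omega_ext)"
    proof (rule Lim_null_comparison[OF _ 0])
      show "\<forall>\<^sub>F q' in at q within Omega_ext. norm (F q' - F q) \<le> C * (sqrt \<bar>fst q' - x\<bar> + sqrt \<bar>snd q' - y\<bar>)"
        unfolding eventually_at_filter using Fhol[OF _ q(2)] by (intro always_eventually) (auto simp: Omega_ext_def q)
    qed
    then show "(F \<longlongrightarrow> F q) (at q within Omega_ext)" by (simp add: LIM_zero_iff)
  qed
  have "gconv (r \<circ> k) z F"
    unfolding gconv_def
  proof (intro allI impI)
    fix e :: real assume "e > 0"
    from uniform_limitD[OF F this] obtain n0 where n0: "\<And>n q. n \<ge> n0 \<Longrightarrow> q \<in> Omega_ext \<Longrightarrow> dist (g n q) (F q) < e"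
      unfolding eventually_sequentially by blast
    show "\<exists>n0. \<forall>n\<ge>n0. \<forall>a b. b \<le> (r \<circ> k) n + 2 \<longrightarrow> \<bar>z ((r \<circ> k) n) a b - F (ga ((r \<circ> k) n) a, gb ((r \<circ> k) n) b)\<bar> < e"
    proof (intro exI allI impI)
      fix n a b assume n: "n0 \<le> n" and b: "b \<le> (r \<circ> k) n + 2"
      have "(ga ((r \<circ> k) n) a, gb ((r \<circ> k) n) b) \<in> Omega_ext" using gb_range[OF b] by (auto simp: Omega_ext_def)
      from n0[OF n this] show "\<bar>z ((r \<circ> k) n) a b - F (ga ((r \<circ> k) n) a, gb ((r \<circ> k) n) b)\<bar> < e"
        by (simp add: dist_real_def g_def f_def ix_ga iy_gb)
    qed
  qed
  then show thesis using that k Fcont Fper by blast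
qed

section \<open>Limits along grid nodes\<close>

definition gpt :: "(nat \<Rightarrow> nat) \<Rightarrow> nat \<times> int \<times> nat \<Rightarrow> real \<times> real" where
  "gpt r t = (case t of (n, a, b) \<Rightarrow> (ga (r n) a, gb (r n) b))"

text \<open>The filter of grid nodes converging to a given point while the mesh is refined.\<close>

definition gfil :: "(nat \<Rightarrow> nat) \<Rightarrow> real \<times> real \<Rightarrow> (nat \<times> int \<times> nat) filter" where
  "gfil r q = inf (inf (filtercomap fst sequentially) (filtercomap (gpt r) (nhds q)))
     (principal {(n, a, b). b < r n + 2})"

definition ev :: "(nat \<Rightarrow> nat) \<Rightarrow> grid_fam \<Rightarrow> nat \<times> int \<times> nat \<Rightarrow> real" where
  "ev r X t = (case t of (n, a, b) \<Rightarrow> X (r n) a b)"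

lemma filterlim_gfil:
  assumes "filterlim (\<lambda>x. fst (\<phi> x)) sequentially Fi" "((\<lambda>x. gpt r (\<phi> x)) \<longlongrightarrow> q) Fi"
    "\<forall>\<^sub>F x in Fi. snd (snd (\<phi> x)) < r (fst (\<phi> x)) + 2"
  shows "filterlim \<phi> (gfil r q) Fi"
  unfolding gfil_def filterlim_inf filterlim_filtercomap_iff filterlim_principal
  using assms by (auto simp: o_def split_beta)

lemma gfil_fst: "filterlim fst sequentially (gfil r q)"
  unfolding gfil_def by (rule filterlim_mono[OF filterlim_filtercomap order_refl]) (simp add: le_infI1)

lemma gfil_pt: "(gpt r \<longlongrightarrow> q) (gfil r q)"
  unfolding gfil_def by (rule filterlim_mono[OF filterlim_filtercomap order_refl]) (simp add: le_infI1)

lemma gfil_row: "\<forall>\<^sub>F t in gfil r q. snd (snd t) < r (fst t) + 2"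
  unfolding gfil_def eventually_inf_principal by (auto simp: split_beta)

lemma eventually_gfilD:
  assumes "eventually P (gfil r (x, y))"
  obtains d n0 where "d > 0" "\<And>n a b. n \<ge> n0 \<Longrightarrow> b < r n + 2 \<Longrightarrow> \<bar>ga (r n) a - x\<bar> < d \<Longrightarrow> \<bar>gb (r n) b - y\<bar> < d \<Longrightarrow> P (n, a, b)"
proof -
  have "\<forall>\<^sub>F t in inf (filtercomap fst sequentially) (filtercomap (gpt r) (nhds (x, y))). t \<in> {(n, a, b). b < r n + 2} \<longrightarrow> P t"
    using assms unfolding gfil_def eventually_inf_principal .
  then obtain Q1 Q2 where Q: "eventually Q1 (filtercomap fst sequentially)" "eventually Q2 (filtercomap (gpt r) (nhds (x, y)))"
    "\<And>t. Q1 t \<Longrightarrow> Q2 t \<Longrightarrow> t \<in> {(n, a, b). b < r n + 2} \<longrightarrow> P t"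
    unfolding eventually_inf by blast
  from Q(1) obtain n0 where n0: "\<And>t. fst t \<ge> n0 \<Longrightarrow> Q1 t"
    unfolding eventually_filtercomap eventually_sequentially by blast
  from Q(2) obtain e where e: "e > 0" "\<And>t. dist (gpt r t) (x, y) < e \<Longrightarrow> Q2 t"
    unfolding eventually_filtercomap eventually_nhds_metric by blast
  show thesis
  proof (rule that[of "e / 2" n0])
    fix n a b assume a: "n \<ge> n0" "b < r n + 2" "\<bar>ga (r n) a - x\<bar> < e / 2" "\<bar>gb (r n) b - y\<bar> < e / 2"
    have "dist (gpt r (n, a, b)) (x, y) \<le> \<bar>ga (r n) a - x\<bar> + \<bar>gb (r n) b - y\<bar>"
      unfolding gpt_def dist_prod_def dist_real_def by (simp add: sqrt_sum_squares_le_sum_abs)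
    then have "Q2 (n, a, b)" using a e(2) by auto
    then show "P (n, a, b)" using Q(3)[of "(n, a, b)"] n0[of "(n, a, b)"] a by auto
  qed (use e in auto)
qed

lemma gpt_in: "\<forall>\<^sub>F t in gfil r q. gpt r t \<in> Omega_ext"
  using gfil_row by eventually_elim (use gb_range in \<open>auto simp: gpt_def Omega_ext_def split_beta\<close>)

lemma tendsto_on_strip:
  assumes "continuous_on Omega_ext F" "q \<in> Omega_ext" "(\<phi> \<longlongrightarrow> q) Fi" "\<forall>\<^sub>F t in Fi. \<phi> t \<in> Omega_ext"
  shows "((\<lambda>t. F (\<phi> t)) \<longlongrightarrow> F q) Fi"
  by (rule continuous_on_tendsto_compose[OF assms(1,3,2,4)])

lemma tendsto_coeff:
  assumes "continuous_on Omega_ext F" "q \<in> Omega_ext" "\<And>n a b. b \<le> n + 2 \<Longrightarrow> X n a b = F (ga n a, gb n b)"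
  shows "(ev r X \<longlongrightarrow> F q) (gfil r q)"
proof (rule Lim_transform_eventually[OF tendsto_on_strip[OF assms(1,2) gfil_pt gpt_in]])
  show "\<forall>\<^sub>F t in gfil r q. F (gpt r t) = ev r X t"
    using gfil_row by eventually_elim (auto simp: ev_def gpt_def split_beta assms(3))
qed

lemma tendsto_gconv:
  assumes F: "continuous_on Omega_ext F" and q: "q \<in> Omega_ext" and G: "gconv r X F"
    and n: "filterlim (\<lambda>x. fst (\<phi> x)) sequentially Fi" and pt: "((\<lambda>x. gpt r (\<phi> x)) \<longlongrightarrow> q) Fi"
    and row: "\<forall>\<^sub>F x in Fi. snd (snd (\<phi> x)) \<le> r (fst (\<phi> x)) + 2"
  shows "((\<lambda>x. ev r X (\<phi> x)) \<longlongrightarrow> F q) Fi"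
proof -
  have "((\<lambda>x. F (gpt r (\<phi> x))) \<longlongrightarrow> F q) Fi"
    by (rule tendsto_on_strip[OF F q pt]) (use row in eventually_elim, use gb_range in \<open>auto simp: gpt_def Omega_ext_def split_beta\<close>)
  moreover have "((\<lambda>x. ev r X (\<phi> x) - F (gpt r (\<phi> x))) \<longlongrightarrow> 0) Fi"
  proof (rule tendstoI)
    fix e :: real assume "e > 0"
    then obtain n0 where n0: "\<And>n a b. n \<ge> n0 \<Longrightarrow> b \<le> r n + 2 \<Longrightarrow> \<bar>X (r n) a b - F (ga (r n) a, gb (r n) b)\<bar> < e"
      using G unfolding gconv_def by metis
    have "\<forall>\<^sub>F x in Fi. fst (\<phi> x) \<ge> n0" using n unfolding filterlim_at_top by blast
    then show "\<forall>\<^sub>F x in Fi. dist (ev r X (\<phi> x) - F (gpt r (\<phi> x))) 0 < e"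
      using row by eventually_elim (auto simp: ev_def gpt_def split_beta n0)
  qed
  ultimately show ?thesis using tendsto_add[of "\<lambda>x. F (gpt r (\<phi> x))" "F q" Fi "\<lambda>x. ev r X (\<phi> x) - F (gpt r (\<phi> x))" 0] by simp
qed

lemma tendsto_gconv0:
  assumes "continuous_on Omega_ext F" "q \<in> Omega_ext" "gconv r X F"
  shows "(ev r X \<longlongrightarrow> F q) (gfil r q)"
  using tendsto_gconv[OF assms gfil_fst gfil_pt] gfil_row
  by (metis (mono_tags, lifting) eventually_mono less_imp_le)

lemma mesh_tendsto:
  assumes "strict_mono (r :: nat \<Rightarrow> nat)" "filterlim \<nu> sequentially Fi"
  shows "((\<lambda>t. hh (r (\<nu> t))) \<longlongrightarrow> 0) Fi" "((\<lambda>t. kk (r (\<nu> t))) \<longlongrightarrow> 0) Fi"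
proof -
  have "(\<lambda>n. hh (r n)) \<longlonglongrightarrow> 0" "(\<lambda>n. kk (r n)) \<longlonglongrightarrow> 0"
    using LIMSEQ_subseq_LIMSEQ[OF hh_tendsto assms(1)] LIMSEQ_subseq_LIMSEQ[OF kk_tendsto assms(1)] by (simp_all add: o_def)
  then show "((\<lambda>t. hh (r (\<nu> t))) \<longlongrightarrow> 0) Fi" "((\<lambda>t. kk (r (\<nu> t))) \<longlongrightarrow> 0) Fi"
    using filterlim_compose[OF _ assms(2)] by blast+
qed

lemma gfil_coords: "((\<lambda>t. ga (r (fst t)) (fst (snd t))) \<longlongrightarrow> fst q) (gfil r q)"
    "((\<lambda>t. gb (r (fst t)) (snd (snd t))) \<longlongrightarrow> snd q) (gfil r q)"
  using tendsto_fst[OF gfil_pt[of r q]] tendsto_snd[OF gfil_pt[of r q]] by (simp_all add: gpt_def split_beta)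

lemma gfil_left:
  assumes "strict_mono r"
  shows "filterlim (\<lambda>t. (fst t, fst (snd t) - 1, snd (snd t))) (gfil r q) (gfil r q)"
proof (rule filterlim_gfil)
  have "((\<lambda>t. (ga (r (fst t)) (fst (snd t)) - hh (r (fst t)), gb (r (fst t)) (snd (snd t)))) \<longlongrightarrow> (fst q - 0, snd q)) (gfil r q)"
    by (intro tendsto_intros gfil_coords mesh_tendsto[OF assms gfil_fst])
  then show "((\<lambda>t. gpt r (fst t, fst (snd t) - 1, snd (snd t))) \<longlongrightarrow> q) (gfil r q)"
    by (simp add: gpt_def ga_def right_diff_distrib)
qed (use gfil_fst gfil_row in \<open>auto\<close>)

lemma gfil_up_pt:
  assumes "strict_mono r"
  shows "((\<lambda>t. gpt r (fst t, fst (snd t), Suc (snd (snd t)))) \<longlongrightarrow> q) (gfil r q)"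
proof -
  have "((\<lambda>t. (ga (r (fst t)) (fst (snd t)), gb (r (fst t)) (snd (snd t)) + kk (r (fst t)))) \<longlongrightarrow> (fst q, snd q + 0)) (gfil r q)"
    by (intro tendsto_intros gfil_coords mesh_tendsto[OF assms gfil_fst])
  moreover have "gb n b + kk n = gb n (Suc b)" for n b by (simp add: gb_def distrib_left)
  ultimately show ?thesis by (simp add: gpt_def)
qed

lemma gb_less_1_iff: "gb n b < 1 \<longleftrightarrow> b < n + 2"
proof -
  have "gb n b < 1 \<longleftrightarrow> kk n * real b < kk n * real (n + 2)" unfolding kN gb_def by linarith
  then show ?thesis by (simp only: mult_less_cancel_left_pos[OF kk_pos] of_nat_less_iff)
qed

text \<open>The next node up still converges to q, so its second coordinate is eventually below 1,
  and \<open>gb_less_1_iff\<close> translates this into row numbers.\<close>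

lemma gfil_up_row:
  assumes "strict_mono r" "snd q < 1"
  shows "\<forall>\<^sub>F t in gfil r q. Suc (snd (snd t)) < r (fst t) + 2"
proof -
  have "\<forall>\<^sub>F t in gfil r q. snd (gpt r (fst t, fst (snd t), Suc (snd (snd t)))) < 1"
    using order_tendstoD(2)[OF tendsto_snd[OF gfil_up_pt[OF assms(1)]] assms(2)] .
  then show ?thesis by eventually_elim (simp only: gpt_def prod.case snd_conv gb_less_1_iff)
qed

lemma gfil_up:
  assumes "strict_mono r" "snd q < 1"
  shows "filterlim (\<lambda>t. (fst t, fst (snd t), Suc (snd (snd t)))) (gfil r q) (gfil r q)"
  by (rule filterlim_gfil) (use gfil_fst gfil_up_pt[OF assms(1)] gfil_up_row[OF assms] in auto)

text \<open>The node below and to the left of q. The cap at the row N - 1 keeps it inside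
  \<open>gfil\<close> when the second coordinate of q is 1.\<close>

definition sel :: "(nat \<Rightarrow> nat) \<Rightarrow> real \<times> real \<Rightarrow> nat \<Rightarrow> nat \<times> int \<times> nat" where
  "sel r q n = (n, ix (r n) (fst q), min (iy (r n) (snd q)) (Suc (r n)))"

lemma filterlim_sel:
  assumes r: "strict_mono r" and q: "q \<in> Omega_ext"
  shows "filterlim (sel r q) (gfil r q) sequentially"
proof (rule filterlim_gfil)
  have y: "snd q \<in> {-1..1}" using q by (auto simp: Omega_ext_def)
  have m: "(\<lambda>n. hh (r n)) \<longlonglongrightarrow> 0" "(\<lambda>n. kk (r n)) \<longlonglongrightarrow> 0"
    by (rule mesh_tendsto[OF r filterlim_ident])+
  have 1: "(\<lambda>n. ga (r n) (ix (r n) (fst q)) - fst q) \<longlonglongrightarrow> 0"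
    by (rule Lim_null_comparison[OF always_eventually m(1)]) (intro allI, simp only: real_norm_def ga_ix)
  have b: "\<bar>gb (r n) (min (iy (r n) (snd q)) (Suc (r n))) - snd q\<bar> \<le> 2 * kk (r n)" for n
  proof -
    note g = gb_iy(1)[OF y, of "r n"] and le = gb_iy(2)[OF y, of "r n"]
    have e: "gb (r n) (Suc (Suc (r n))) = gb (r n) (Suc (r n)) + kk (r n)" by (simp add: gb_def distrib_left)
    show ?thesis
    proof (cases "iy (r n) (snd q) = Suc (Suc (r n))")
      case True
      then have m: "min (iy (r n) (snd q)) (Suc (r n)) = Suc (r n)" by simp
      show ?thesis using g e kk_pos[of "r n"] unfolding m True by linarith
    next
      case False
      then have m: "min (iy (r n) (snd q)) (Suc (r n)) = iy (r n) (snd q)" using le by linarith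
      show ?thesis using g kk_pos[of "r n"] unfolding m by linarith
    qed
  qed
  have m2: "(\<lambda>n. 2 * kk (r n)) \<longlonglongrightarrow> 0" using tendsto_mult_left[OF m(2), of 2] by simp
  have 2: "(\<lambda>n. gb (r n) (min (iy (r n) (snd q)) (Suc (r n))) - snd q) \<longlonglongrightarrow> 0"
    by (rule Lim_null_comparison[OF always_eventually m2]) (intro allI, simp only: real_norm_def b)
  have "(\<lambda>n. (ga (r n) (ix (r n) (fst q)), gb (r n) (min (iy (r n) (snd q)) (Suc (r n))))) \<longlonglongrightarrow> (fst q, snd q)"
    by (rule tendsto_Pair[OF LIM_zero_cancel[OF 1] LIM_zero_cancel[OF 2]])
  then show "(\<lambda>n. gpt r (sel r q n)) \<longlonglongrightarrow> q" by (simp add: gpt_def sel_def)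
  show "filterlim (\<lambda>n. fst (sel r q n)) sequentially sequentially" unfolding sel_def fst_conv by (rule filterlim_ident)
  show "\<forall>\<^sub>F n in sequentially. snd (snd (sel r q n)) < r (fst (sel r q n)) + 2"
    by (rule always_eventually) (auto simp: sel_def)
qed

section \<open>Derivatives as limits of difference quotients\<close>

lemma scaled_bound:
  fixes z h g e :: real
  assumes "h > 0" "\<bar>z / h - g\<bar> \<le> e" shows "\<bar>z - h * g\<bar> \<le> h * e"
proof -
  have "z - h * g = h * (z / h - g)" using assms(1) by (simp add: right_diff_distrib)
  then have "\<bar>z - h * g\<bar> = h * \<bar>z / h - g\<bar>" using assms(1) by (simp only: abs_mult)
  then show ?thesis using assms by (simp add: mult_left_mono)
qed

text \<open>A discrete mean value inequality, by telescoping.\<close>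

lemma increment_bound_int:
  fixes X :: "int \<Rightarrow> real"
  assumes "i \<le> j" "\<And>m. i \<le> m \<Longrightarrow> m < j \<Longrightarrow> \<bar>(X (m + 1) - X m) / h - g\<bar> \<le> e" "h > 0"
  shows "\<bar>X j - X i - (h * real_of_int j - h * real_of_int i) * g\<bar> \<le> e * (h * real_of_int j - h * real_of_int i)"
  using assms(1,2)
proof (induction j rule: int_ge_induct)
  case (step j)
  have "\<bar>(X (j + 1) - X j) / h - g\<bar> \<le> e" using step.prems[of j] step.hyps by simp
  then have "\<bar>X (j + 1) - X j - h * g\<bar> \<le> h * e" by (rule scaled_bound[OF assms(3)])
  moreover have "\<bar>X j - X i - (h * real_of_int j - h * real_of_int i) * g\<bar> \<le> e * (h * real_of_int j - h * real_of_int i)"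
    using step by simp
  ultimately show ?case by (simp add: algebra_simps)
qed simp

lemma increment_bound_nat:
  fixes X :: "nat \<Rightarrow> real"
  assumes "i \<le> j" "\<And>m. i \<le> m \<Longrightarrow> m < j \<Longrightarrow> \<bar>(X (Suc m) - X m) / h - g\<bar> \<le> e" "h > 0"
  shows "\<bar>X j - X i - (h * real j - h * real i) * g\<bar> \<le> e * (h * real j - h * real i)"
  using assms(1,2)
proof (induction j rule: dec_induct)
  case (step j)
  have "\<bar>(X (Suc j) - X j) / h - g\<bar> \<le> e" using step.prems[of j] step.hyps by simp
  then have "\<bar>X (Suc j) - X j - h * g\<bar> \<le> h * e" by (rule scaled_bound[OF assms(3)])
  moreover have "\<bar>X j - X i - (h * real j - h * real i) * g\<bar> \<le> e * (h * real j - h * real i)"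
    using step by simp
  ultimately show ?case by (simp add: algebra_simps)
qed simp

lemma increment_bound_sym:
  fixes X u :: "'i::linorder \<Rightarrow> real"
  assumes "\<And>i j. i \<le> j \<Longrightarrow> i \<in> I \<Longrightarrow> j \<in> I \<Longrightarrow> \<bar>X j - X i - (u j - u i) * g\<bar> \<le> e * (u j - u i)" "i \<in> I" "j \<in> I" "e > 0"
  shows "\<bar>X j - X i - (u j - u i) * g\<bar> \<le> e * \<bar>u j - u i\<bar>"
proof (cases "i \<le> j")
  case True
  show ?thesis using assms(1)[OF True assms(2,3)] assms(4) by (smt (verit) mult_le_cancel_left_pos)
next
  case False
  then have "\<bar>X i - X j - (u i - u j) * g\<bar> \<le> e * (u i - u j)" using assms by simp
  also have "\<dots> \<le> e * \<bar>u j - u i\<bar>" using assms(4) by (intro mult_left_mono) auto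
  also have "\<bar>X i - X j - (u i - u j) * g\<bar> = \<bar>X j - X i - (u j - u i) * g\<bar>"
    by (simp add: abs_minus_commute left_diff_distrib)
  finally show ?thesis .
qed

text \<open>The quotients converge along all nodes tending to (x, y), hence those close to that
  point lie within e of \<open>g\<close>. The discrete mean value inequality, passed to the limit,
  is then the definition of the derivative at x.\<close>

lemma derivative_limit_1:
  assumes r: "strict_mono r" and y: "y \<in> {-1..1}"
    and X: "\<And>x. (ev r X \<longlongrightarrow> F (x, y)) (gfil r (x, y))"
    and D: "(ev r (d1 X) \<longlongrightarrow> g) (gfil r (x, y))"
  shows "((\<lambda>x. F (x, y)) has_real_derivative g) (at x)"
  unfolding has_field_derivative_def has_derivative_within_alt
proof (intro conjI allI impI)
  show "bounded_linear ((*) g)" by (rule bounded_linear_mult_right)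
  fix e :: real assume e: "e > 0"
  from tendstoD[OF D e] obtain d n0 where d: "d > 0"
    and n0: "\<And>n a b. n \<ge> n0 \<Longrightarrow> b < r n + 2 \<Longrightarrow> \<bar>ga (r n) a - x\<bar> < d \<Longrightarrow> \<bar>gb (r n) b - y\<bar> < d \<Longrightarrow> dist (ev r (d1 X) (n, a, b)) g < e"
    by (rule eventually_gfilD) blast
  show "\<exists>d>0. \<forall>x'\<in>UNIV. norm (x' - x) < d \<longrightarrow> norm (F (x', y) - F (x, y) - g * (x' - x)) \<le> e * norm (x' - x)"
  proof (intro exI[of _ d] conjI ballI impI d)
    fix x' assume x': "norm (x' - x) < d"
    have in': "(x, y) \<in> Omega_ext" "(x', y) \<in> Omega_ext" using y by (auto simp: Omega_ext_def)
    note S = filterlim_sel[OF r in'(1)] filterlim_sel[OF r in'(2)]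
    let ?a = "\<lambda>n. ix (r n) x" and ?a' = "\<lambda>n. ix (r n) x'" and ?b = "\<lambda>n. min (iy (r n) y) (Suc (r n))"
    have L1: "(\<lambda>n. X (r n) (?a n) (?b n)) \<longlonglongrightarrow> F (x, y)" and L2: "(\<lambda>n. X (r n) (?a' n) (?b n)) \<longlonglongrightarrow> F (x', y)"
      using filterlim_compose[OF X S(1)] filterlim_compose[OF X S(2)] by (simp_all add: sel_def ev_def)
    have G1: "(\<lambda>n. ga (r n) (?a n)) \<longlonglongrightarrow> x" and G2: "(\<lambda>n. ga (r n) (?a' n)) \<longlonglongrightarrow> x'" and G3: "(\<lambda>n. gb (r n) (?b n)) \<longlonglongrightarrow> y"
      using filterlim_compose[OF gfil_coords(1) S(1)] filterlim_compose[OF gfil_coords(1) S(2)] filterlim_compose[OF gfil_coords(2) S(1)]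
      by (simp_all add: sel_def)
    have "\<forall>\<^sub>F n in sequentially. n \<ge> n0" "\<forall>\<^sub>F n in sequentially. \<bar>ga (r n) (?a n) - x\<bar> < d"
      "\<forall>\<^sub>F n in sequentially. ga (r n) (?a' n) < x + d" "\<forall>\<^sub>F n in sequentially. ga (r n) (?a' n) > x - d" "\<forall>\<^sub>F n in sequentially. \<bar>gb (r n) (?b n) - y\<bar> < d"
      using tendstoD[OF G1 d] tendstoD[OF G3 d] order_tendstoD[OF G2, of "x + d"] order_tendstoD[OF G2, of "x - d"] x'
      by (auto simp: dist_real_def eventually_ge_at_top)
    then have ev: "\<forall>\<^sub>F n in sequentially. \<bar>X (r n) (?a' n) (?b n) - X (r n) (?a n) (?b n) - (ga (r n) (?a' n) - ga (r n) (?a n)) * g\<bar> \<le> e * \<bar>ga (r n) (?a' n) - ga (r n) (?a n)\<bar>"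
    proof eventually_elim
      case (elim n)
      let ?I = "{a. \<bar>ga (r n) a - x\<bar> < d}"
      show ?case
      proof (rule increment_bound_sym[where I = ?I and X = "\<lambda>a. X (r n) a (?b n)" and u = "ga (r n)"])
        fix i j assume ij: "i \<le> j" "i \<in> ?I" "j \<in> ?I"
        show "\<bar>X (r n) j (?b n) - X (r n) i (?b n) - (ga (r n) j - ga (r n) i) * g\<bar> \<le> e * (ga (r n) j - ga (r n) i)"
          unfolding ga_def
        proof (rule increment_bound_int[OF ij(1)])
          fix m assume m: "i \<le> m" "m < j"
          have "ga (r n) i \<le> ga (r n) m" "ga (r n) m \<le> ga (r n) j" using m unfolding ga_def by (intro mult_left_mono; simp)+
          then have "\<bar>ga (r n) m - x\<bar> < d" using ij by auto
          moreover have "?b n < r n + 2" by linarith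
          ultimately have "dist (ev r (d1 X) (n, m, ?b n)) g < e" using n0[of n "?b n" m] elim by blast
          then show "\<bar>(X (r n) (m + 1) (?b n) - X (r n) m (?b n)) / hh (r n) - g\<bar> \<le> e"
            by (simp add: ev_def d1_def dist_real_def)
        qed simp
      qed (use elim e in auto)
    qed
    have "(\<lambda>n. \<bar>X (r n) (?a' n) (?b n) - X (r n) (?a n) (?b n) - (ga (r n) (?a' n) - ga (r n) (?a n)) * g\<bar>) \<longlonglongrightarrow> \<bar>F (x', y) - F (x, y) - (x' - x) * g\<bar>"
      "(\<lambda>n. e * \<bar>ga (r n) (?a' n) - ga (r n) (?a n)\<bar>) \<longlonglongrightarrow> e * \<bar>x' - x\<bar>"
      by (intro tendsto_intros L1 L2 G1 G2)+
    from tendsto_le[OF _ this(2) this(1) ev] show "norm (F (x', y) - F (x, y) - g * (x' - x)) \<le> e * norm (x' - x)"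
      by (simp add: mult.commute)
  qed
qed

lemma derivative_limit_2:
  assumes r: "strict_mono r" and y: "y \<in> {-1..1}"
    and X: "\<And>y'. y' \<in> {-1..1} \<Longrightarrow> \<bar>y' - y\<bar> < d0 \<Longrightarrow> (ev r X \<longlongrightarrow> F (x, y')) (gfil r (x, y'))" and d0: "d0 > 0"
    and D: "(ev r (d2 X) \<longlongrightarrow> g) (gfil r (x, y))"
  shows "((\<lambda>y. F (x, y)) has_real_derivative g) (at y within {-1..1})"
  unfolding has_field_derivative_def has_derivative_within_alt
proof (intro conjI allI impI)
  show "bounded_linear ((*) g)" by (rule bounded_linear_mult_right)
  fix e :: real assume e: "e > 0"
  from tendstoD[OF D e] obtain d n0 where d: "d > 0"
    and n0: "\<And>n a b. n \<ge> n0 \<Longrightarrow> b < r n + 2 \<Longrightarrow> \<bar>ga (r n) a - x\<bar> < d \<Longrightarrow> \<bar>gb (r n) b - y\<bar> < d \<Longrightarrow> dist (ev r (d2 X) (n, a, b)) g < e"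
    by (rule eventually_gfilD) blast
  show "\<exists>d>0. \<forall>y'\<in>{-1..1}. norm (y' - y) < d \<longrightarrow> norm (F (x, y') - F (x, y) - g * (y' - y)) \<le> e * norm (y' - y)"
  proof (intro exI[of _ "min d d0"] conjI ballI impI)
    show "min d d0 > 0" using d d0 by simp
    fix y' assume y': "norm (y' - y) < min d d0" and y'in: "y' \<in> {-1..1}"
    have in': "(x, y) \<in> Omega_ext" "(x, y') \<in> Omega_ext" using y y'in by (auto simp: Omega_ext_def)
    note S = filterlim_sel[OF r in'(1)] filterlim_sel[OF r in'(2)]
    let ?a = "\<lambda>n. ix (r n) x" and ?b' = "\<lambda>n. min (iy (r n) y') (Suc (r n))" and ?b = "\<lambda>n. min (iy (r n) y) (Suc (r n))"
    have L1: "(\<lambda>n. X (r n) (?a n) (?b n)) \<longlonglongrightarrow> F (x, y)" and L2: "(\<lambda>n. X (r n) (?a n) (?b' n)) \<longlonglongrightarrow> F (x, y')"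
      using filterlim_compose[OF X S(1)] filterlim_compose[OF X S(2)] y y'in y' d0 by (simp_all add: sel_def ev_def)
    have G1: "(\<lambda>n. gb (r n) (?b n)) \<longlonglongrightarrow> y" and G2: "(\<lambda>n. gb (r n) (?b' n)) \<longlonglongrightarrow> y'" and G3: "(\<lambda>n. ga (r n) (?a n)) \<longlonglongrightarrow> x"
      using filterlim_compose[OF gfil_coords(2) S(1)] filterlim_compose[OF gfil_coords(2) S(2)] filterlim_compose[OF gfil_coords(1) S(1)]
      by (simp_all add: sel_def)
    have "\<forall>\<^sub>F n in sequentially. n \<ge> n0" "\<forall>\<^sub>F n in sequentially. \<bar>gb (r n) (?b n) - y\<bar> < d"
      "\<forall>\<^sub>F n in sequentially. gb (r n) (?b' n) < y + d" "\<forall>\<^sub>F n in sequentially. gb (r n) (?b' n) > y - d" "\<forall>\<^sub>F n in sequentially. \<bar>ga (r n) (?a n) - x\<bar> < d"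
      using tendstoD[OF G1 d] tendstoD[OF G3 d] order_tendstoD[OF G2, of "y + d"] order_tendstoD[OF G2, of "y - d"] y'
      by (auto simp: dist_real_def eventually_ge_at_top)
    then have ev: "\<forall>\<^sub>F n in sequentially. \<bar>X (r n) (?a n) (?b' n) - X (r n) (?a n) (?b n) - (gb (r n) (?b' n) - gb (r n) (?b n)) * g\<bar> \<le> e * \<bar>gb (r n) (?b' n) - gb (r n) (?b n)\<bar>"
    proof eventually_elim
      case (elim n)
      \<comment> \<open>Rows up to N - 1: every quotient between two of them is then taken on a row
        that \<open>gfil\<close> admits.\<close>
      let ?I = "{b. \<bar>gb (r n) b - y\<bar> < d \<and> b \<le> Suc (r n)}"
      show ?case
      proof (rule increment_bound_sym[where I = ?I and X = "\<lambda>b. X (r n) (?a n) b" and u = "gb (r n)"])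
        fix i j assume ij: "i \<le> j" "i \<in> ?I" "j \<in> ?I"
        have eq: "gb (r n) j - gb (r n) i = kk (r n) * real j - kk (r n) * real i" by (simp add: gb_def)
        show "\<bar>X (r n) (?a n) j - X (r n) (?a n) i - (gb (r n) j - gb (r n) i) * g\<bar> \<le> e * (gb (r n) j - gb (r n) i)"
          unfolding eq
        proof (rule increment_bound_nat[OF ij(1)])
          fix m assume m: "i \<le> m" "m < j"
          have "gb (r n) i \<le> gb (r n) m" "gb (r n) m \<le> gb (r n) j" using m unfolding gb_def by (auto intro!: mult_left_mono)
          then have "\<bar>gb (r n) m - y\<bar> < d" using ij by auto
          with n0[of n m "?a n"] elim m ij show "\<bar>(X (r n) (?a n) (Suc m) - X (r n) (?a n) m) / kk (r n) - g\<bar> \<le> e"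
            by (simp add: ev_def d2_def dist_real_def)
        qed simp
      qed (use elim e in auto)
    qed
    have "(\<lambda>n. \<bar>X (r n) (?a n) (?b' n) - X (r n) (?a n) (?b n) - (gb (r n) (?b' n) - gb (r n) (?b n)) * g\<bar>) \<longlonglongrightarrow> \<bar>F (x, y') - F (x, y) - (y' - y) * g\<bar>"
      "(\<lambda>n. e * \<bar>gb (r n) (?b' n) - gb (r n) (?b n)\<bar>) \<longlonglongrightarrow> e * \<bar>y' - y\<bar>"
      by (intro tendsto_intros L1 L2 G1 G2)+
    from tendsto_le[OF _ this(2) this(1) ev] show "norm (F (x, y') - F (x, y) - g * (y' - y)) \<le> e * norm (y' - y)"
      by (simp add: mult.commute)
  qed
qed

text \<open>The cap continues the samples constantly above the row N, since
  \<open>Linf (d2 B)\<close> and its relatives evaluate forward differences on the row N as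
  well.\<close>

definition gr :: "(real \<times> real \<Rightarrow> real) \<Rightarrow> grid_fam" where
  "gr X n a b = X (ga n a, min 1 (gb n b))"

lemma gr_eq: "b \<le> n + 2 \<Longrightarrow> gr X n a b = X (ga n a, gb n b)"
  using gb_range[of b n] by (simp add: gr_def min_absorb2)

lemma tendsto_gr: "continuous_on Omega_ext F \<Longrightarrow> q \<in> Omega_ext \<Longrightarrow> (ev r (gr F) \<longlongrightarrow> F q) (gfil r q)"
  by (rule tendsto_coeff) (auto simp: gr_eq)

lemma chi_gb: "b < n + 2 \<Longrightarrow> chi n b = (gb n b + 1) * (1 - gb n b - kk n)"
proof -
  assume "b < n + 2"
  then have "real (n + 1 - b) = real (n + 2) - 1 - real b" by (simp add: of_nat_diff)
  then have "kk n * real (n + 1 - b) = 2 - kk n - kk n * real b" by (simp only: right_diff_distrib kN)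
  moreover have "chi n b = (kk n * real b) * (kk n * real (n + 1 - b))"
    by (simp add: chi_def power2_eq_square)
  ultimately show ?thesis by (simp add: gb_def)
qed

lemma continuous_on_sub: "continuous_on Omega_ext F \<Longrightarrow> continuous_on Omega_int F"
  by (erule continuous_on_subset) (auto simp: Omega_ext_def Omega_int_def)

section \<open>The limit of the discrete correctors\<close>

locale corrector_scheme = scheme +
  fixes fA fB fF1 fF2 fK :: "real \<times> real \<Rightarrow> real"
  assumes cf: "continuous_on Omega_ext fA" "continuous_on Omega_ext fB" "continuous_on Omega_ext fF1"
      "continuous_on Omega_ext fF2" "continuous_on Omega_ext fK"
    and gr: "A = gr fA" "B = gr fB" "F1 = gr fF1" "F2 = gr fF2" "K = gr fK"
    and w00: "\<And>n. w n 0 0 = 0"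
    and normalized: "\<And>n. gsum n (\<lambda>a b. (w n a b)\<^sup>2) + (s n)\<^sup>2 + (c n)\<^sup>2 = 1"
begin

text \<open>The limit of the flux gives the derivative in y as \<open>V2\<close>, continuous up to
  the boundary. The second derivatives are the limits of \<open>W\<close> and \<open>Z\<close>
  divided by 1 - y^2, and \<open>U22\<close> is defined by solving the equation for it. One
  \<open>U12\<close> serves for both mixed derivatives because differences commute
  (\<open>d2_p\<close>).\<close>

theorem limit:
  obtains U U1 U2 U11 U12 U22 :: "real \<times> real \<Rightarrow> real" and \<sigma> \<kappa> :: real where
    "continuous_on Omega_ext U" "continuous_on Omega_ext U1" "continuous_on Omega_ext U2"
    "continuous_on Omega_int U11" "continuous_on Omega_int U12" "continuous_on Omega_int U22"
    "\<And>x y. U (x + 2 * pi, y) = U (x, y)"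
    "\<And>x y. y \<in> {-1..1} \<Longrightarrow> ((\<lambda>x. U (x, y)) has_real_derivative U1 (x, y)) (at x)"
    "\<And>x y. y \<in> {-1..1} \<Longrightarrow> ((\<lambda>y. U (x, y)) has_real_derivative U2 (x, y)) (at y within {-1..1})"
    "\<And>x y. y \<in> {-1<..<1} \<Longrightarrow> ((\<lambda>x. U1 (x, y)) has_real_derivative U11 (x, y)) (at x)"
    "\<And>x y. y \<in> {-1<..<1} \<Longrightarrow> ((\<lambda>y. U1 (x, y)) has_real_derivative U12 (x, y)) (at y within {-1..1})"
    "\<And>x y. y \<in> {-1<..<1} \<Longrightarrow> ((\<lambda>x. U2 (x, y)) has_real_derivative U12 (x, y)) (at x)"
    "\<And>x y. y \<in> {-1<..<1} \<Longrightarrow> ((\<lambda>y. U2 (x, y)) has_real_derivative U22 (x, y)) (at y within {-1..1})"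
    "\<And>q. q \<in> Omega_int \<Longrightarrow> fA q * U11 q + 2 * fB q * U12 q + U22 q + fF1 q * (U1 q + \<sigma>) + fF2 q * U2 q = \<kappa> * fK q"
    "\<And>x y. y \<in> {-1, 1} \<Longrightarrow> fB (x, y) * (U1 (x, y) + \<sigma>) + U2 (x, y) = 0"
    "U (0, -1) = 0" "\<not> (\<sigma> = 0 \<and> \<kappa> = 0 \<and> (\<forall>q\<in>Omega_ext. U q = 0))"
proof -
  obtain k1 Fw where k1: "strict_mono k1" and g1: "gconv k1 w Fw" and cw: "continuous_on Omega_ext Fw"
    and pw: "\<And>x y. Fw (x + 2 * pi, y) = Fw (x, y)"
    using grid_Arzela_Ascoli[OF equi_w strict_mono_id] by (auto simp: id_def o_def)
  obtain k2 Fp where k2: "strict_mono k2" and g2: "gconv (k1 \<circ> k2) (d1 w) Fp" and cp: "continuous_on Omega_ext Fp"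
    using grid_Arzela_Ascoli[OF equi_d1w k1] by metis
  define r2 where "r2 = k1 \<circ> k2"
  have r2: "strict_mono r2" unfolding r2_def by (rule strict_mono_o[OF k1 k2])
  obtain k3 FQ where k3: "strict_mono k3" and g3: "gconv (r2 \<circ> k3) Q FQ" and cQ: "continuous_on Omega_ext FQ"
    using grid_Arzela_Ascoli[OF equi_Q r2] by metis
  define r3 where "r3 = r2 \<circ> k3"
  have r3: "strict_mono r3" unfolding r3_def by (rule strict_mono_o[OF r2 k3])
  obtain k4 FW where k4: "strict_mono k4" and g4: "gconv (r3 \<circ> k4) W FW" and cW: "continuous_on Omega_ext FW"
    using grid_Arzela_Ascoli[OF equi_W r3] by metis
  define r4 where "r4 = r3 \<circ> k4"
  have r4: "strict_mono r4" unfolding r4_def by (rule strict_mono_o[OF r3 k4])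
  obtain k5 FZ where k5: "strict_mono k5" and g5: "gconv (r4 \<circ> k5) Z FZ" and cZ: "continuous_on Omega_ext FZ"
    using grid_Arzela_Ascoli[OF equi_Z r4] by metis
  define r5 where "r5 = r4 \<circ> k5"
  have r5: "strict_mono r5" unfolding r5_def by (rule strict_mono_o[OF r4 k5])
  have "bounded (range (\<lambda>n. s (r5 n)))" unfolding bounded_iff using s1 by auto
  then obtain \<sigma> k6 where k6: "strict_mono k6" and s6: "((\<lambda>n. s (r5 n)) \<circ> k6) \<longlonglongrightarrow> \<sigma>"
    using bounded_imp_convergent_subsequence by blast
  define r6 where "r6 = r5 \<circ> k6"
  have r6: "strict_mono r6" unfolding r6_def by (rule strict_mono_o[OF r5 k6])
  have "bounded (range (\<lambda>n. c (r6 n)))" unfolding bounded_iff using c1 by auto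
  then obtain \<kappa> k7 where k7: "strict_mono k7" and c7: "((\<lambda>n. c (r6 n)) \<circ> k7) \<longlonglongrightarrow> \<kappa>"
    using bounded_imp_convergent_subsequence by blast
  define r where "r = r6 \<circ> k7"
  have r: "strict_mono r" unfolding r_def by (rule strict_mono_o[OF r6 k7])
  have cs: "(\<lambda>n. c (r n)) \<longlonglongrightarrow> \<kappa>" "(\<lambda>n. s (r n)) \<longlonglongrightarrow> \<sigma>"
    using c7 LIMSEQ_subseq_LIMSEQ[OF s6 k7] by (simp_all add: r_def r6_def o_def)
  have G1: "gconv r w Fw" unfolding r_def r6_def r5_def r4_def r3_def r2_def by (intro gconv_subseq g1 k2 k3 k4 k5 k6 k7)
  have G2: "gconv r (d1 w) Fp" unfolding r_def r6_def r5_def r4_def r3_def r2_def by (intro gconv_subseq g2 k3 k4 k5 k6 k7)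
  have G3: "gconv r Q FQ" unfolding r_def r6_def r5_def r4_def r3_def by (intro gconv_subseq g3[unfolded r2_def] g3 k4 k5 k6 k7)
  have G4: "gconv r W FW" unfolding r_def r6_def r5_def r4_def by (intro gconv_subseq g4 k5 k6 k7)
  have G5: "gconv r Z FZ" unfolding r_def r6_def r5_def by (intro gconv_subseq g5 k6 k7)
  define P where "P q = Fp q + \<sigma>" for q
  define V2 where "V2 q = FQ q - fB q * P q" for q
  define U11 where "U11 q = FW q / (1 - (snd q)\<^sup>2)" for q
  define U12 where "U12 q = FZ q / (1 - (snd q)\<^sup>2)" for q
  define U22 where "U22 q = \<kappa> * fK q - fF1 q * P q - fF2 q * V2 q - fA q * U11 q - fB q * U12 q - fB q * U12 q" for q
  have cP: "continuous_on Omega_ext P" unfolding P_def by (intro continuous_intros cp)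
  have cV: "continuous_on Omega_ext V2" unfolding V2_def by (intro continuous_intros cP cQ cf)
  have pos: "1 - (snd q)\<^sup>2 > 0" if "q \<in> Omega_int" for q
    using that by (auto simp: Omega_int_def abs_square_less_1)
  have c11: "continuous_on Omega_int U11" "continuous_on Omega_int U12"
    unfolding U11_def U12_def using pos by (intro continuous_intros continuous_on_sub cW cZ; force)+
  have c22: "continuous_on Omega_int U22"
    unfolding U22_def by (intro continuous_intros continuous_on_sub cf cP cV c11)
  have Tcoef: "(ev r A \<longlongrightarrow> fA q) (gfil r q)" "(ev r B \<longlongrightarrow> fB q) (gfil r q)" "(ev r F1 \<longlongrightarrow> fF1 q) (gfil r q)"
    "(ev r F2 \<longlongrightarrow> fF2 q) (gfil r q)" "(ev r K \<longlongrightarrow> fK q) (gfil r q)" if "q \<in> Omega_ext" for q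
    unfolding gr by (rule tendsto_gr[OF cf(1) that] tendsto_gr[OF cf(2) that] tendsto_gr[OF cf(3) that] tendsto_gr[OF cf(4) that] tendsto_gr[OF cf(5) that])+
  have Tcs: "((\<lambda>t. s (r (fst t))) \<longlongrightarrow> \<sigma>) (gfil r q)" "((\<lambda>t. c (r (fst t))) \<longlongrightarrow> \<kappa>) (gfil r q)" for q
    using filterlim_compose[OF cs(1) gfil_fst] filterlim_compose[OF cs(2) gfil_fst] by auto
  have Tw: "(ev r w \<longlongrightarrow> Fw q) (gfil r q)" "(ev r (d1 w) \<longlongrightarrow> Fp q) (gfil r q)" if "q \<in> Omega_ext" for q
    using tendsto_gconv0[OF cw that G1] tendsto_gconv0[OF cp that G2] .
  have Tp: "(ev r p \<longlongrightarrow> P q) (gfil r q)" if "q \<in> Omega_ext" for q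
    using tendsto_add[OF Tw(2)[OF that] Tcs(1)] by (simp add: P_def ev_def[abs_def] p_def split_beta)
  have Tv: "(ev r v \<longlongrightarrow> V2 q) (gfil r q)" if q: "q \<in> Omega_ext" for q
  proof (rule Lim_transform_eventually)
    have "((\<lambda>t. ev r Q (fst t, fst (snd t), Suc (snd (snd t)))) \<longlongrightarrow> FQ q) (gfil r q)"
      by (rule tendsto_gconv[OF cQ q G3]) (use gfil_fst gfil_up_pt[OF r] gfil_row[of r q] in \<open>auto elim: eventually_mono\<close>)
    then show "((\<lambda>t. ev r Q (fst t, fst (snd t), Suc (snd (snd t))) - ev r B t * ev r p t) \<longlongrightarrow> V2 q) (gfil r q)"
      unfolding V2_def by (rule tendsto_diff[OF _ tendsto_mult[OF Tcoef(2)[OF q] Tp[OF q]]])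
    show "\<forall>\<^sub>F t in gfil r q. ev r Q (fst t, fst (snd t), Suc (snd (snd t))) - ev r B t * ev r p t = ev r v t"
      using gfil_row by eventually_elim (simp add: ev_def split_beta Q_Suc)
  qed
  have int_ext: "q \<in> Omega_ext" if "q \<in> Omega_int" for q using that by (auto simp: Omega_ext_def Omega_int_def)
  have Tchi: "((\<lambda>t. chi (r (fst t)) (snd (snd t))) \<longlongrightarrow> 1 - (snd q)\<^sup>2) (gfil r q)" for q
  proof (rule Lim_transform_eventually)
    have "((\<lambda>t. (gb (r (fst t)) (snd (snd t)) + 1) * (1 - gb (r (fst t)) (snd (snd t)) - kk (r (fst t)))) \<longlongrightarrow> (snd q + 1) * (1 - snd q - 0)) (gfil r q)"
      by (intro tendsto_intros gfil_coords mesh_tendsto[OF r gfil_fst])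
    then show "((\<lambda>t. (gb (r (fst t)) (snd (snd t)) + 1) * (1 - gb (r (fst t)) (snd (snd t)) - kk (r (fst t)))) \<longlongrightarrow> 1 - (snd q)\<^sup>2) (gfil r q)"
      by (simp add: power2_eq_square algebra_simps)
    show "\<forall>\<^sub>F t in gfil r q. (gb (r (fst t)) (snd (snd t)) + 1) * (1 - gb (r (fst t)) (snd (snd t)) - kk (r (fst t))) = chi (r (fst t)) (snd (snd t))"
      using gfil_row by eventually_elim (simp add: chi_gb)
  qed
  \<comment> \<open>Undoes the weight, whose limit 1 - y^2 is positive in the open strip.\<close>
  have Tdiv: "(ev r X \<longlongrightarrow> F q / (1 - (snd q)\<^sup>2)) (gfil r q)"
    if q: "q \<in> Omega_int" and F: "(ev r (\<lambda>n a b. chi n b * X n a b) \<longlongrightarrow> F q) (gfil r q)" for X F q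
  proof (rule Lim_transform_eventually)
    show "((\<lambda>t. ev r (\<lambda>n a b. chi n b * X n a b) t / chi (r (fst t)) (snd (snd t))) \<longlongrightarrow> F q / (1 - (snd q)\<^sup>2)) (gfil r q)"
      using pos[OF q] by (intro tendsto_divide F Tchi) simp
    have "\<forall>\<^sub>F t in gfil r q. chi (r (fst t)) (snd (snd t)) > 0" using order_tendstoD(1)[OF Tchi pos[OF q]] .
    then show "\<forall>\<^sub>F t in gfil r q. ev r (\<lambda>n a b. chi n b * X n a b) t / chi (r (fst t)) (snd (snd t)) = ev r X t"
      by eventually_elim (simp add: ev_def split_beta)
  qed
  have T11: "(ev r (d1 p) \<longlongrightarrow> U11 q) (gfil r q)" if "q \<in> Omega_int" for q
    unfolding U11_def by (rule Tdiv[OF that]) (use tendsto_gconv0[OF cW int_ext[OF that] G4] in \<open>simp add: W_def[abs_def] w2_def\<close>)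
  have T12: "(ev r (d1 v) \<longlongrightarrow> U12 q) (gfil r q)" if "q \<in> Omega_int" for q
    unfolding U12_def by (rule Tdiv[OF that]) (use tendsto_gconv0[OF cZ int_ext[OF that] G5] in \<open>simp add: Z_def[abs_def]\<close>)
  have TH: "(ev r H \<longlongrightarrow> \<kappa> * fK q - fF1 q * P q - fF2 q * V2 q - fA q * U11 q - fB q * U12 q) (gfil r q)" if q: "q \<in> Omega_int" for q
  proof -
    let ?l = "\<lambda>t. (fst t, fst (snd t) - 1, snd (snd t))"
    have "((\<lambda>t. c (r (fst t)) * ev r K t - ev r F1 t * ev r p t - ev r F2 t * ev r v t - ev r A (?l t) * ev r (d1 p) (?l t) - ev r B (?l t) * ev r (d1 v) (?l t))
       \<longlongrightarrow> \<kappa> * fK q - fF1 q * P q - fF2 q * V2 q - fA q * U11 q - fB q * U12 q) (gfil r q)"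
      using Tcoef[OF int_ext[OF q]] Tp[OF int_ext[OF q]] Tv[OF int_ext[OF q]] Tcs(2)
        filterlim_compose[OF Tcoef(1)[OF int_ext[OF q]] gfil_left[OF r]] filterlim_compose[OF Tcoef(2)[OF int_ext[OF q]] gfil_left[OF r]]
        filterlim_compose[OF T11[OF q] gfil_left[OF r]] filterlim_compose[OF T12[OF q] gfil_left[OF r]]
      by (intro tendsto_diff tendsto_mult)
    then show ?thesis by (simp add: ev_def[abs_def] H_def split_beta)
  qed
  have T22: "(ev r (d2 v) \<longlongrightarrow> U22 q) (gfil r q)" if q: "q \<in> Omega_int" for q
  proof (rule Lim_transform_eventually)
    have q1: "snd q < 1" using q by (auto simp: Omega_int_def)
    show "((\<lambda>t. ev r H (fst t, fst (snd t), Suc (snd (snd t))) - ev r B t * ev r (d1 v) t) \<longlongrightarrow> U22 q) (gfil r q)"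
      unfolding U22_def
      by (rule tendsto_diff[OF filterlim_compose[OF TH[OF q] gfil_up[OF r q1]] tendsto_mult[OF Tcoef(2)[OF int_ext[OF q]] T12[OF q]]])
    show "\<forall>\<^sub>F t in gfil r q. ev r H (fst t, fst (snd t), Suc (snd (snd t))) - ev r B t * ev r (d1 v) t = ev r (d2 v) t"
      using gfil_up_row[OF r q1] by eventually_elim (simp add: ev_def split_beta nondivergence d2_p)
  qed
  have ii: "(x, y) \<in> Omega_int" if "y \<in> {-1<..<1}" for x y :: real using that by (auto simp: Omega_int_def)
  have ee: "(x, y) \<in> Omega_ext" if "y \<in> {-1..1}" for x y :: real using that by (auto simp: Omega_ext_def)
  have D1: "((\<lambda>x. Fw (x, y)) has_real_derivative Fp (x, y)) (at x)" if "y \<in> {-1..1}" for x y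
    by (rule derivative_limit_1[OF r that Tw(1) Tw(2)]) (use that ee in auto)
  have D2: "((\<lambda>y. Fw (x, y)) has_real_derivative V2 (x, y)) (at y within {-1..1})" if "y \<in> {-1..1}" for x y
    by (rule derivative_limit_2[OF r that Tw(1), of 1]) (use that ee Tv in \<open>auto simp: v_def\<close>)
  have y': "y \<in> {-1..1}" if "y \<in> {-1<..<1}" for y :: real using that by auto
  have D11: "((\<lambda>x. Fp (x, y)) has_real_derivative U11 (x, y)) (at x)" if "y \<in> {-1<..<1}" for x y
    by (rule derivative_limit_1[OF r y'[OF that] Tw(2)]) (use T11[OF ii[OF that]] ee y'[OF that] in \<open>auto simp: d1_p\<close>)
  have D12: "((\<lambda>y. Fp (x, y)) has_real_derivative U12 (x, y)) (at y within {-1..1})" if "y \<in> {-1<..<1}" for x y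
    by (rule derivative_limit_2[OF r y'[OF that] Tw(2), of 1]) (use T12[OF ii[OF that]] ee y'[OF that] in \<open>auto simp: d1_v\<close>)
  have D21: "((\<lambda>x. V2 (x, y)) has_real_derivative U12 (x, y)) (at x)" if "y \<in> {-1<..<1}" for x y
    by (rule derivative_limit_1[OF r y'[OF that] Tv]) (use T12[OF ii[OF that]] ee y'[OF that] in auto)
  have D22: "((\<lambda>y. V2 (x, y)) has_real_derivative U22 (x, y)) (at y within {-1..1})" if "y \<in> {-1<..<1}" for x y
    by (rule derivative_limit_2[OF r y'[OF that] Tv, of 1]) (use T22[OF ii[OF that]] ee y'[OF that] in auto)
  \<comment> \<open>The rows 0 and N lie exactly on y = -1 and y = 1, and \<open>Q\<close> is 0
    there.\<close>
  have edge: "FQ (x, y) = 0" if y: "y \<in> {-1, 1}" for x y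
  proof -
    have q: "(x, y) \<in> Omega_ext" using y by (auto simp: Omega_ext_def)
    let ?b = "\<lambda>n. if y = 1 then r n + 2 else 0"
    have gb: "gb (r n) (?b n) = y" for n
    proof -
      have "gb (r n) (r n + 2) = 1" unfolding gb_def kN by simp
      moreover have "gb (r n) 0 = -1" by (simp add: gb_def)
      ultimately show ?thesis using y by auto
    qed
    have m: "(\<lambda>n. hh (r n)) \<longlonglongrightarrow> 0" by (rule mesh_tendsto(1)[OF r filterlim_ident])
    have 0: "(\<lambda>n. ga (r n) (ix (r n) x) - x) \<longlonglongrightarrow> 0"
      by (rule Lim_null_comparison[OF always_eventually m]) (intro allI, simp only: real_norm_def ga_ix)
    define \<phi> where "\<phi> n = (n, ix (r n) x, ?b n)" for n
    have eq: "gpt r (\<phi> n) = (ga (r n) (ix (r n) x), y)" for n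
      unfolding gpt_def \<phi>_def prod.case using gb[of n] by (simp only:)
    have t: "(\<lambda>n. ga (r n) (ix (r n) x)) \<longlonglongrightarrow> x" using 0 by (rule LIM_zero_cancel)
    have "(\<lambda>n. gpt r (\<phi> n)) = (\<lambda>n. (ga (r n) (ix (r n) x), y))" by (intro ext eq)
    moreover have "(\<lambda>n. (ga (r n) (ix (r n) x), y)) \<longlonglongrightarrow> (x, y)"
      by (intro tendsto_intros t)
    ultimately have pt: "(\<lambda>n. gpt r (\<phi> n)) \<longlonglongrightarrow> (x, y)" by metis
    have "(\<lambda>n. ev r Q (\<phi> n)) \<longlonglongrightarrow> FQ (x, y)"
    proof (rule tendsto_gconv[OF cQ q G3 _ pt])
      show "filterlim (\<lambda>n. fst (\<phi> n)) sequentially sequentially" unfolding \<phi>_def fst_conv by (rule filterlim_ident)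
      show "\<forall>\<^sub>F n in sequentially. snd (snd (\<phi> n)) \<le> r (fst (\<phi> n)) + 2"
        by (rule always_eventually) (simp add: \<phi>_def)
    qed
    moreover have "ev r Q (\<phi> n) = 0" for n
      unfolding ev_def \<phi>_def prod.case by (cases "y = 1") (simp_all only: refl if_True if_False Q0 QN simp_thms)
    ultimately have 1: "(\<lambda>n::nat. 0) \<longlonglongrightarrow> FQ (x, y)" by (simp only:)
    show ?thesis by (rule LIMSEQ_unique[OF 1 tendsto_const])
  qed
  have w0: "Fw (0, -1) = 0"
  proof -
    have *: "\<bar>Fw (0, -1)\<bar> < e" if "e > 0" for e
    proof -
      obtain n where "\<And>a b. b \<le> r n + 2 \<Longrightarrow> \<bar>w (r n) a b - Fw (ga (r n) a, gb (r n) b)\<bar> < e"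
        using G1 \<open>e > 0\<close> unfolding gconv_def by blast
      from this[of 0 0] show ?thesis using w00[of "r n"] by (simp add: ga_def gb_def)
    qed
    from *[of "\<bar>Fw (0, -1)\<bar>"] show ?thesis by (cases "Fw (0, -1) = 0") auto
  qed
  have nt: "\<not> (\<sigma> = 0 \<and> \<kappa> = 0 \<and> (\<forall>q\<in>Omega_ext. Fw q = 0))"
  proof
    assume z: "\<sigma> = 0 \<and> \<kappa> = 0 \<and> (\<forall>q\<in>Omega_ext. Fw q = 0)"
    \<comment> \<open>Small enough for 4 pi e < 1/2 and e <= 1: then the mean square of
      \<open>w\<close> is below 1/2, and so are s^2 + c^2, against the normalisation to 1.\<close>
    define e where "e = 1 / (2 + 8 * pi)"
    have "1 \<le> 2 + 8 * pi" using pi_gt_zero by linarith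
    have e: "e > 0" unfolding e_def by (rule divide_pos_pos[OF zero_less_one]) (use \<open>1 \<le> 2 + 8 * pi\<close> in linarith)
    have e1: "e \<le> 1" unfolding e_def by (subst divide_le_eq_1_pos) (use \<open>1 \<le> 2 + 8 * pi\<close> in linarith)+
    obtain n0 where n0: "\<And>n a b. n \<ge> n0 \<Longrightarrow> b \<le> r n + 2 \<Longrightarrow> \<bar>w (r n) a b - Fw (ga (r n) a, gb (r n) b)\<bar> < e"
      using G1 e unfolding gconv_def by metis
    have "(\<lambda>n. (s (r n))\<^sup>2 + (c (r n))\<^sup>2) \<longlonglongrightarrow> \<sigma>\<^sup>2 + \<kappa>\<^sup>2" by (intro tendsto_intros cs)
    then have "\<forall>\<^sub>F n in sequentially. (s (r n))\<^sup>2 + (c (r n))\<^sup>2 < 1/2" using z by (intro order_tendstoD) auto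
    then obtain n1 where n1: "\<And>n. n \<ge> n1 \<Longrightarrow> (s (r n))\<^sup>2 + (c (r n))\<^sup>2 < 1/2" unfolding eventually_sequentially by blast
    let ?n = "max n0 n1"
    have "gsum (r ?n) (\<lambda>a b. (w (r ?n) a b)\<^sup>2) \<le> gsum (r ?n) (\<lambda>a b. e)"
    proof (rule gsum_mono)
      fix a b assume b: "b < r ?n + 2"
      have "(ga (r ?n) a, gb (r ?n) b) \<in> Omega_ext" using gb_range[of b "r ?n"] b by (auto simp: Omega_ext_def)
      then have "\<bar>w (r ?n) a b\<bar> < e" using n0[of ?n b a] b z by simp
      then have "\<bar>w (r ?n) a b\<bar> * \<bar>w (r ?n) a b\<bar> \<le> e * 1" using e e1 by (intro mult_mono) auto
      then show "(w (r ?n) a b)\<^sup>2 \<le> e" by (simp add: power2_eq_square)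
    qed
    also have "\<dots> = 4 * pi * e" by (rule gsum_const)
    also have "\<dots> < 1 / 2"
    proof -
      have "2 + 8 * pi \<noteq> 0" using \<open>1 \<le> 2 + 8 * pi\<close> by linarith
      from nonzero_eq_divide_eq[OF this, of e 1] have "e * (2 + 8 * pi) = 1" using e_def by blast
      then have "2 * e + 2 * (4 * pi * e) = 1" by (simp add: algebra_simps)
      then show ?thesis using e by linarith
    qed
    finally show False using n1[of ?n] normalized[of "r ?n"] by linarith
  qed
  show thesis
  proof (rule that[of Fw Fp V2 U11 U12 U22 \<sigma> \<kappa>])
    show "fA q * U11 q + 2 * fB q * U12 q + U22 q + fF1 q * (Fp q + \<sigma>) + fF2 q * V2 q = \<kappa> * fK q" for q
      by (simp add: U22_def P_def)
    show "fB (x, y) * (Fp (x, y) + \<sigma>) + V2 (x, y) = 0" if "y \<in> {-1, 1}" for x y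
      using edge[OF that] by (simp add: V2_def P_def)
  qed (rule cw cp cV c11 c22 pw w0 nt | erule D1 D2 D11 D12 D21 D22)+
qed

end

section \<open>Solvability of the discrete problem by counting unknowns\<close>

lemma underdetermined_matrix:
  fixes J :: "'j set"
  assumes "finite J"
  shows "\<forall>(I :: 'i set) (M :: 'j \<Rightarrow> 'i \<Rightarrow> real). finite I \<longrightarrow> card J < card I \<longrightarrow> (\<exists>x::'i \<Rightarrow> real. (\<exists>i\<in>I. x i \<noteq> 0) \<and> (\<forall>j\<in>J. (\<Sum>i\<in>I. M j i * x i) = 0))"
  using assms
proof (induction J rule: finite_induct)
  case empty
  show ?case
  proof (intro allI impI)
    fix I :: "'i set" and M :: "'j \<Rightarrow> 'i \<Rightarrow> real"
    assume "card ({}::'j set) < card I"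
    then have "I \<noteq> {}" by auto
    then show "\<exists>x::'i \<Rightarrow> real. (\<exists>i\<in>I. x i \<noteq> 0) \<and> (\<forall>j\<in>{}. (\<Sum>i\<in>I. M j i * x i) = 0)"
      by (intro exI[of _ "\<lambda>_. 1"]) auto
  qed
next
  case (insert l J)
  show ?case
  proof (intro allI impI)
    fix I :: "'i set" and M :: "'j \<Rightarrow> 'i \<Rightarrow> real"
    assume I: "finite I" and c: "card (insert l J) < card I"
    then have cJ: "Suc (card J) < card I" using insert by simp
    show "\<exists>x::'i \<Rightarrow> real. (\<exists>i\<in>I. x i \<noteq> 0) \<and> (\<forall>j\<in>insert l J. (\<Sum>i\<in>I. M j i * x i) = 0)"
    proof (cases "\<forall>i\<in>I. M l i = 0")
      case True
      obtain x :: "'i \<Rightarrow> real" where "(\<exists>i\<in>I. x i \<noteq> 0) \<and> (\<forall>j\<in>J. (\<Sum>i\<in>I. M j i * x i) = 0)"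
        using insert.IH[rule_format, OF I Suc_lessD[OF cJ], of M] by blast
      then show ?thesis using True by (intro exI[of _ x]) auto
    next
      case False
      then obtain k where k: "k \<in> I" "M l k \<noteq> 0" by auto
      let ?I = "I - {k}"
      have "finite ?I" "card J < card ?I" using I cJ k by auto
      \<comment> \<open>Gaussian elimination: the unknown k is removed from the other equations by
        means of the row l, and \<open>t\<close> below is its value recovered from that row.\<close>
      from insert.IH[rule_format, OF this, of "\<lambda>j i. M j i - M j k * M l i / M l k"]
      obtain x :: "'i \<Rightarrow> real" where x: "\<exists>i\<in>?I. x i \<noteq> 0"
        "\<And>j. j \<in> J \<Longrightarrow> (\<Sum>i\<in>?I. (M j i - M j k * M l i / M l k) * x i) = 0"
        by blast
      define t where "t = - (\<Sum>i\<in>?I. M l i * x i) / M l k"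
      define y where "y = x(k := t)"
      have s: "(\<Sum>i\<in>I. M j i * y i) = M j k * t + (\<Sum>i\<in>?I. M j i * x i)" for j
        using sum.remove[OF I k(1), of "\<lambda>i. M j i * y i"] by (simp add: y_def)
      have "(\<Sum>i\<in>I. M l i * y i) = 0" unfolding s t_def using k by simp
      moreover have "(\<Sum>i\<in>I. M j i * y i) = 0" if "j \<in> J" for j
      proof -
        have "(\<Sum>i\<in>?I. (M j i - M j k * M l i / M l k) * x i) = (\<Sum>i\<in>?I. M j i * x i) - (M j k / M l k) * (\<Sum>i\<in>?I. M l i * x i)"
        proof -
          have "(M j i - M j k * M l i / M l k) * x i = M j i * x i - (M j k / M l k) * (M l i * x i)" for i
            by (simp add: left_diff_distrib)
          then show ?thesis by (simp only: sum_subtractf sum_distrib_left)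
        qed
        then show ?thesis unfolding s t_def using x(2)[OF that] by (simp add: mult_ac)
      qed
      moreover have "\<exists>i\<in>I. y i \<noteq> 0" using x(1) by (auto simp: y_def)
      ultimately show ?thesis by blast
    qed
  qed
qed

text \<open>The matrix entries are the values of the functionals on unit vectors, so that the
  difference scheme never has to be written out as a matrix.\<close>

lemma underdetermined_system:
  fixes \<Phi> :: "'j \<Rightarrow> ('i \<Rightarrow> real) \<Rightarrow> real"
  assumes fin: "finite J" "finite I" "card J < card I"
    and lin: "\<And>j x y r. \<Phi> j (\<lambda>i. r * x i + y i) = r * \<Phi> j x + \<Phi> j y"
  obtains x where "\<exists>i\<in>I. x i \<noteq> 0" "\<And>i. i \<notin> I \<Longrightarrow> x i = 0" "\<And>j. j \<in> J \<Longrightarrow> \<Phi> j x = 0"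
proof -
  have z: "\<Phi> j (\<lambda>i. 0) = 0" for j using lin[of j 1 "\<lambda>i. 0" "\<lambda>i. 0"] by simp
  have expand: "\<Phi> j (\<lambda>i. \<Sum>k\<in>S. x k * (if i = k then 1 else 0)) = (\<Sum>k\<in>S. \<Phi> j (\<lambda>i. if i = k then 1 else 0) * x k)"
    if "finite S" for j x and S :: "'i set"
    using that
  proof (induction S rule: finite_induct)
    case (insert k S)
    then show ?case using lin[of j "x k" "\<lambda>i. if i = k then 1 else 0" "\<lambda>i. \<Sum>k\<in>S. x k * (if i = k then 1 else 0)"]
      by (simp add: mult.commute)
  qed (simp add: z)
  obtain x :: "'i \<Rightarrow> real" where x: "\<exists>i\<in>I. x i \<noteq> 0" "\<And>j. j \<in> J \<Longrightarrow> (\<Sum>i\<in>I. \<Phi> j (\<lambda>l. if l = i then 1 else 0) * x i) = 0"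
    using underdetermined_matrix[OF fin(1), rule_format, OF fin(2,3), of "\<lambda>j i. \<Phi> j (\<lambda>l. if l = i then 1 else 0)"] by blast
  define y where "y = (\<lambda>i. \<Sum>k\<in>I. x k * (if i = k then 1 else 0))"
  have y: "y i = (if i \<in> I then x i else 0)" for i
    unfolding y_def using fin(2) by (simp add: if_distrib cong: if_cong)
  show thesis
  proof (rule that[of y])
    show "\<Phi> j y = 0" if "j \<in> J" for j unfolding y_def expand[OF fin(2)] using x(2)[OF that] .
  qed (use x(1) y in auto)
qed

definition flux :: "grid_fam \<Rightarrow> grid_fam \<Rightarrow> real \<Rightarrow> grid_fam" where
  "flux B w s n a b = (case b of 0 \<Rightarrow> 0 | Suc b' \<Rightarrow> B n a b' * (d1 w n a b' + s) + d2 w n a b')"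

definition hflux :: "grid_fam \<Rightarrow> grid_fam \<Rightarrow> grid_fam \<Rightarrow> real \<Rightarrow> grid_fam" where
  "hflux A B w s n a b = A n a b * (d1 w n a b + s) + B n a b * d2 w n a b"

definition residual :: "grid_fam \<Rightarrow> grid_fam \<Rightarrow> grid_fam \<Rightarrow> grid_fam \<Rightarrow> grid_fam \<Rightarrow> grid_fam \<Rightarrow> real \<Rightarrow> real \<Rightarrow> grid_fam" where
  "residual A B F1 F2 K w s c n a b =
     d1 (hflux A B w s) n (a - 1) b + d2 (flux B w s) n a b
     - c * K n a b - (if b = 0 then 0 else
            (d1 A n (a - 1) b - F1 n a b + d2 B n a (b - 1)) * (d1 w n a b + s)
            + (d1 B n (a - 1) b - F2 n a b) * d2 w n a b)"

text \<open>Unknowns are one period of \<open>w\<close> on the rows 0 to N, and s and c. Equations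
  are the difference equation on the rows below N, the flux condition on the row N, and
  \<open>w 0 0 = 0\<close>: one fewer than the unknowns.\<close>

lemma discrete_solution:
  assumes per: "per A" "per B" "per F1" "per F2" "per K"
  shows "\<exists>w s c. (\<forall>a b. w (a + int (n + 2)) b = w a b) \<and> w 0 0 = 0
      \<and> (\<forall>a b. b < n + 2 \<longrightarrow> residual A B F1 F2 K (\<lambda>_. w) s c n a b = 0)
      \<and> (\<forall>a. flux B (\<lambda>_. w) s n a (n + 2) = 0)
      \<and> gsum n (\<lambda>a b. (w a b)\<^sup>2) + s\<^sup>2 + c\<^sup>2 = 1"
proof -
  let ?N = "n + 2"
  let ?G = "{0..<int ?N} \<times> {..?N}"
  define wf :: "(int \<times> nat \<Rightarrow> real) \<Rightarrow> grid_fam" where "wf x = (\<lambda>_ a b. x (a mod int ?N, b))" for x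
  \<comment> \<open>The pairs (-1, 0) and (-2, 0) lie outside the grid: as unknowns they stand for s
    and c, and as an equation (-1, 0) stands for \<open>w 0 0 = 0\<close>.\<close>
  define \<Phi> where "\<Phi> j x = (if fst j = -1 then x (0, 0) else
     if snd j = ?N then flux B (wf x) (x (-1, 0)) n (fst j) ?N
     else residual A B F1 F2 K (wf x) (x (-1, 0)) (x (-2, 0)) n (fst j) (snd j))" for j :: "int \<times> nat" and x
  have lin_w: "d1 (wf (\<lambda>i. r * x i + y i)) m a b = r * d1 (wf x) m a b + d1 (wf y) m a b"
       "d2 (wf (\<lambda>i. r * x i + y i)) m a b = r * d2 (wf x) m a b + d2 (wf y) m a b" for r x y m a b
    by (simp_all add: wf_def d1_def d2_def diff_divide_distrib add_divide_distrib right_diff_distrib)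
  have lin_flux: "flux B (wf (\<lambda>i. r * x i + y i)) (r * s + s') = (\<lambda>m a b. r * flux B (wf x) s m a b + flux B (wf y) s' m a b)" for r x y s s'
  proof (intro ext)
    fix m a b
    show "flux B (wf (\<lambda>i. r * x i + y i)) (r * s + s') m a b = r * flux B (wf x) s m a b + flux B (wf y) s' m a b"
      by (cases b; unfold flux_def nat.case lin_w; simp add: algebra_simps)
  qed
  have lin: "\<Phi> j (\<lambda>i. r * x i + y i) = r * \<Phi> j x + \<Phi> j y" for j x y r
  proof -
    have q: "hflux A B (wf (\<lambda>i. r * x i + y i)) (r * s + s') = (\<lambda>m a b. r * hflux A B (wf x) s m a b + hflux A B (wf y) s' m a b)" for s s'
      by (intro ext; unfold hflux_def lin_w; simp add: algebra_simps)
    have dl: "d1 (\<lambda>m a b. r * X m a b + Y m a b) m a b = r * d1 X m a b + d1 Y m a b"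
      "d2 (\<lambda>m a b. r * X m a b + Y m a b) m a b = r * d2 X m a b + d2 Y m a b" for X Y m a b
      by (simp_all add: d1_def d2_def diff_divide_distrib add_divide_distrib right_diff_distrib)
    have rl: "residual A B F1 F2 K (wf (\<lambda>i. r * x i + y i)) (r * s + s') (r * c + c') n a b
       = r * residual A B F1 F2 K (wf x) s c n a b + residual A B F1 F2 K (wf y) s' c' n a b" for s s' c c' a b
      unfolding residual_def q lin_flux dl lin_w by (simp add: algebra_simps)
    show ?thesis unfolding \<Phi>_def lin_flux rl by simp
  qed
  have nG: "(-1, 0) \<notin> ?G" "(-2, 0) \<notin> insert (-1, 0) ?G" by auto
  have fin: "finite (insert (-1, 0) ?G)" "finite (insert (-2, 0) (insert (-1, 0) ?G))" "card (insert (-1, 0) ?G) < card (insert (-2, 0) (insert (-1, 0) ?G))"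
    using nG by auto
  obtain x where x: "\<exists>i\<in>insert (-2, 0) (insert (-1, 0) ?G). x i \<noteq> 0" "\<And>j. j \<in> insert (-1, 0) ?G \<Longrightarrow> \<Phi> j x = 0"
  proof (rule underdetermined_system[of _ _ \<Phi>, OF fin lin])
    fix x
    assume "\<exists>i\<in>insert (-2, 0) (insert (-1, 0) ?G). x i \<noteq> 0" "\<And>j. j \<in> insert (-1, 0) ?G \<Longrightarrow> \<Phi> j x = 0"
    then show thesis by (rule that)
  qed
  define s0 where "s0 = x (-1, 0)"
  define c0 where "c0 = x (-2, 0)"
  define w0 where "w0 a b = x (a mod int ?N, b)" for a b
  have wfx: "wf x = (\<lambda>_. w0)" by (simp add: wf_def w0_def[abs_def])
  have pw: "per (\<lambda>m. if m = n then w0 else (\<lambda>_ _. 0))" by (auto simp: per_def w0_def)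
  have pw': "w0 (a + int ?N) b = w0 a b" for a b by (simp add: w0_def del: add_2_eq_Suc' of_nat_add)
  have pflux: "flux B (\<lambda>_. w0) s0 n (a + int ?N) b = flux B (\<lambda>_. w0) s0 n a b" for a b
  proof (cases b)
    case (Suc b')
    have "w0 (a + int ?N + 1) b' = w0 (a + 1) b'" using pw'[of "a + 1" b'] by (simp add: algebra_simps)
    then show ?thesis using pw'[of a] perD[OF per(2), of n a] by (simp add: flux_def d1_def d2_def Suc)
  qed (simp add: flux_def)
  have pres: "residual A B F1 F2 K (\<lambda>_. w0) s0 c0 n (a + int ?N) b = residual A B F1 F2 K (\<lambda>_. w0) s0 c0 n a b" for a b
  proof -
    have sh: "a + int ?N + 1 = (a + 1) + int ?N" "a + int ?N - 1 = (a - 1) + int ?N" "a - 1 + int ?N + 1 = a + int ?N" "a - 1 + 1 = a" for a by auto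
    note P = perD[OF per(1)] perD[OF per(2)] perD[OF per(3)] perD[OF per(4)] perD[OF per(5)]
    show ?thesis unfolding residual_def hflux_def d1_def d2_def sh P pw' pflux ..
  qed
  have per_ext: "F a = 0" if "\<And>a. F (a + int ?N) = (F a :: real)" "\<And>a. a \<in> {0..<int ?N} \<Longrightarrow> F a = 0" for F a
  proof -
    have "F (a + int ?N * t) = F a" for a t
    proof (induction t rule: int_induct[of _ 0])
      case (step1 i)
      have e: "a + int ?N * (i + 1) = (a + int ?N * i) + int ?N" by (simp add: algebra_simps)
      show ?case unfolding e that(1) by (rule step1(2))
    next
      case (step2 i)
      have e: "a + int ?N * i = (a + int ?N * (i - 1)) + int ?N" by (simp add: algebra_simps)
      show ?case using step2(2) unfolding e that(1) .
    qed simp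
    from this[of "a mod int ?N" "a div int ?N"] have "F a = F (a mod int ?N)"
      by (metis add.commute mult_div_mod_eq)
    then show ?thesis using that(2)[of "a mod int ?N"] by simp
  qed
  have R0: "residual A B F1 F2 K (\<lambda>_. w0) s0 c0 n a b = 0" if "b < ?N" for a b
  proof (rule per_ext[of "\<lambda>a. residual A B F1 F2 K (\<lambda>_. w0) s0 c0 n a b", OF pres])
    fix a assume "a \<in> {0..<int ?N}"
    then show "residual A B F1 F2 K (\<lambda>_. w0) s0 c0 n a b = 0"
      using x(2)[of "(a, b)"] that by (simp add: \<Phi>_def wfx s0_def c0_def split: if_splits)
  qed
  have F0: "flux B (\<lambda>_. w0) s0 n a ?N = 0" for a
  proof (rule per_ext[of "\<lambda>a. flux B (\<lambda>_. w0) s0 n a ?N", OF pflux])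
    fix a assume "a \<in> {0..<int ?N}"
    then show "flux B (\<lambda>_. w0) s0 n a ?N = 0"
      using x(2)[of "(a, ?N)"] by (simp add: \<Phi>_def wfx s0_def split: if_splits)
  qed
  have w00: "w0 0 0 = 0" using x(2)[of "(-1, 0)"] by (simp add: \<Phi>_def w0_def)
  define S where "S = gsum n (\<lambda>a b. (w0 a b)\<^sup>2) + s0\<^sup>2 + c0\<^sup>2"
  have g0: "gsum n (\<lambda>a b. (w0 a b)\<^sup>2) \<ge> 0" by (rule gsum_nonneg) simp
  have S0: "S > 0"
  proof (rule ccontr)
    assume "\<not> S > 0"
    then have "gsum n (\<lambda>a b. (w0 a b)\<^sup>2) = 0" "s0\<^sup>2 = 0" "c0\<^sup>2 = 0"
      using g0 zero_le_power2[of s0] zero_le_power2[of c0] unfolding S_def by linarith+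
    then have z: "(\<Sum>a\<in>{0..<int ?N}. \<Sum>b<?N. (w0 a b)\<^sup>2) = 0" "s0 = 0" "c0 = 0" by (auto simp: gsum_def)
    have wz: "w0 a b = 0" if "a \<in> {0..<int ?N}" "b < ?N" for a b
    proof -
      have "\<forall>a\<in>{0..<int ?N}. (\<Sum>b<?N. (w0 a b)\<^sup>2) = 0"
        by (rule iffD1[OF sum_nonneg_eq_0_iff z(1)]) (auto simp del: sum.lessThan_Suc intro!: sum_nonneg)
      then have "(\<Sum>b<?N. (w0 a b)\<^sup>2) = 0" using that(1) by blast
      then have "(w0 a b)\<^sup>2 = 0" using that(2) by (subst (asm) sum_nonneg_eq_0_iff) auto
      then show ?thesis by simp
    qed
    have wz': "w0 a b = 0" if "b < ?N" for a b
      by (rule per_ext[of "\<lambda>a. w0 a b"]) (use pw' wz that in auto)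
    \<comment> \<open>\<open>gsum\<close> does not see the row N; there the flux condition
      determines \<open>w0\<close> from the row N - 1.\<close>
    have "w0 a ?N = 0" for a
      using F0[of a] wz'[of "Suc n" a] wz'[of "Suc n" "a + 1"] z by (simp add: flux_def d1_def d2_def)
    then have "w0 a b = 0" if "b \<le> ?N" for a b using wz'[of b a] that by (cases "b = ?N") auto
    then have "x (a, b) = 0" if "(a, b) \<in> ?G" for a b
      using that by (auto simp: w0_def dest: spec[of _ a])  (metis mod_pos_pos_trivial)
    then show False using x(1) z(2,3) by (auto simp: s0_def c0_def)
  qed
  define m where "m = 1 / sqrt S"
  have m: "m\<^sup>2 * S = 1" using S0 by (simp add: m_def power_divide)
  have scale: "d1 (\<lambda>_ a b. m * w0 a b) = (\<lambda>k a b. m * d1 (\<lambda>_. w0) k a b)" "d2 (\<lambda>_ a b. m * w0 a b) = (\<lambda>k a b. m * d2 (\<lambda>_. w0) k a b)"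
    by (auto simp: fun_eq_iff d1_def d2_def right_diff_distrib)
  have sflux: "flux B (\<lambda>_ a b. m * w0 a b) (m * s0) = (\<lambda>k a b. m * flux B (\<lambda>_. w0) s0 k a b)"
  proof (intro ext)
    fix k a b
    show "flux B (\<lambda>_ a b. m * w0 a b) (m * s0) k a b = m * flux B (\<lambda>_. w0) s0 k a b"
      by (cases b; unfold flux_def nat.case scale; simp add: algebra_simps)
  qed
  have sres: "residual A B F1 F2 K (\<lambda>_ a b. m * w0 a b) (m * s0) (m * c0) n a b = m * residual A B F1 F2 K (\<lambda>_. w0) s0 c0 n a b" for a b
  proof -
    have 1: "hflux A B (\<lambda>_ a b. m * w0 a b) (m * s0) = (\<lambda>k a b. m * hflux A B (\<lambda>_. w0) s0 k a b)"
      by (intro ext; unfold hflux_def scale; simp add: algebra_simps)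
    have 2: "d1 (\<lambda>k a b. m * X k a b) k a b = m * d1 X k a b" "d2 (\<lambda>k a b. m * X k a b) k a b = m * d2 X k a b" for X k a b
      by (simp_all add: d1_def d2_def right_diff_distrib)
    show ?thesis unfolding residual_def 1 sflux 2 scale by (simp add: algebra_simps)
  qed
  have "gsum n (\<lambda>a b. (m * w0 a b)\<^sup>2) + (m * s0)\<^sup>2 + (m * c0)\<^sup>2 = 1"
    using m unfolding S_def power_mult_distrib gsum_cmult by (simp add: distrib_left)
  then show ?thesis
    using pw' w00 R0 F0 sres sflux
    by (intro exI[of _ "\<lambda>a b. m * w0 a b"] exI[of _ "m * s0"] exI[of _ "m * c0"]) simp
qed

section \<open>Sampling periodic C^2 coefficients\<close>

definition cper :: "(real \<times> real \<Rightarrow> real) \<Rightarrow> bool" where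
  "cper X \<longleftrightarrow> continuous_on Omega_ext X \<and> (\<forall>x y. y \<in> {-1..1} \<longrightarrow> X (x + 2 * pi, y) = X (x, y))"

definition dx1 :: "(real \<times> real \<Rightarrow> real) \<Rightarrow> (real \<times> real \<Rightarrow> real) \<Rightarrow> bool" where
  "dx1 X X' \<longleftrightarrow> (\<forall>x y. y \<in> {-1..1} \<longrightarrow> ((\<lambda>x. X (x, y)) has_real_derivative X' (x, y)) (at x))"

definition dx2 :: "(real \<times> real \<Rightarrow> real) \<Rightarrow> (real \<times> real \<Rightarrow> real) \<Rightarrow> bool" where
  "dx2 X X' \<longleftrightarrow> (\<forall>x y. y \<in> {-1..1} \<longrightarrow> ((\<lambda>y. X (x, y)) has_real_derivative X' (x, y)) (at y within {-1..1}))"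

text \<open>The derivatives that control the differences of the samples listed in
  \<open>scheme\<close>.\<close>

definition C2p :: "(real \<times> real \<Rightarrow> real) \<Rightarrow> bool" where
  "C2p X \<longleftrightarrow> (\<exists>X1 X2 X11 X12. cper X \<and> cper X1 \<and> cper X2 \<and> cper X11 \<and> cper X12
     \<and> dx1 X X1 \<and> dx2 X X2 \<and> dx1 X1 X11 \<and> dx2 X1 X12)"

lemma cper_periodic_int:
  assumes "cper X" "y \<in> {-1..1}" shows "X (x + 2 * pi * real_of_int t, y) = X (x, y)"
proof (induction t rule: int_induct[of _ 0])
  case (step1 i)
  have e: "x + 2 * pi * real_of_int (i + 1) = (x + 2 * pi * real_of_int i) + 2 * pi" by (simp add: algebra_simps)
  show ?case using step1(2) assms unfolding e cper_def by simp
next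
  case (step2 i)
  have e: "x + 2 * pi * real_of_int i = (x + 2 * pi * real_of_int (i - 1)) + 2 * pi" by (simp add: algebra_simps)
  show ?case using step2(2) assms unfolding e cper_def by simp
qed simp

lemma reduce_period: obtains t :: int where "x - 2 * pi * real_of_int t \<in> {0..2*pi}"
proof
  let ?t = "\<lfloor>x / (2 * pi)\<rfloor>"
  have 1: "real_of_int ?t \<le> x / (2 * pi)" and 2: "x / (2 * pi) \<le> real_of_int ?t + 1" by linarith+
  have p: "0 < 2 * pi" by simp
  have "2 * pi * real_of_int ?t \<le> x" "x \<le> 2 * pi * (real_of_int ?t + 1)"
    using iffD1[OF pos_le_divide_eq[OF p] 1] iffD1[OF pos_divide_le_eq[OF p] 2] by (simp_all only: mult.commute)
  then show "x - 2 * pi * real_of_int ?t \<in> {0..2*pi}" by (simp add: algebra_simps)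
qed

lemma cper_bounded:
  assumes "cper X" obtains C where "C \<ge> 0" "\<And>x y. y \<in> {-1..1} \<Longrightarrow> \<bar>X (x, y)\<bar> \<le> C"
proof -
  have "Omega = cbox (0, -1) (2 * pi, 1)" unfolding Omega_def by (simp add: cbox_Pair_eq)
  then have "compact Omega" by (metis compact_cbox)
  moreover have "continuous_on Omega X"
    using assms unfolding cper_def by (auto elim!: continuous_on_subset simp: Omega_def Omega_ext_def)
  ultimately have "compact (X ` Omega)" by (rule compact_continuous_image[rotated])
  then obtain C where C: "\<And>q. q \<in> Omega \<Longrightarrow> \<bar>X q\<bar> \<le> C"
    using compact_imp_bounded[of "X ` Omega"] unfolding bounded_iff by auto
  have "\<bar>X (x, y)\<bar> \<le> C" if y: "y \<in> {-1..1}" for x y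
  proof -
    obtain t where t: "x - 2 * pi * real_of_int t \<in> {0..2*pi}" by (rule reduce_period)
    have "X (x, y) = X (x - 2 * pi * real_of_int t, y)"
      using cper_periodic_int[OF assms y, of "x - 2 * pi * real_of_int t" t] by simp
    then show ?thesis using C[of "(x - 2 * pi * real_of_int t, y)"] t y by (simp add: Omega_def)
  qed
  moreover from this[of 0 0] have "C \<ge> 0" by (simp add: abs_le_iff)
  ultimately show thesis using that by blast
qed

lemma lipschitz_1:
  assumes "dx1 X X'" "\<And>x y. y \<in> {-1..1} \<Longrightarrow> \<bar>X' (x, y)\<bar> \<le> C" "y \<in> {-1..1}"
  shows "\<bar>X (x', y) - X (x, y)\<bar> \<le> C * \<bar>x' - x\<bar>"
  using field_differentiable_bound[of UNIV "\<lambda>x. X (x, y)" "\<lambda>x. X' (x, y)" C x' x] assms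
  unfolding dx1_def by simp

lemma lipschitz_2:
  assumes "dx2 X X'" "\<And>x y. y \<in> {-1..1} \<Longrightarrow> \<bar>X' (x, y)\<bar> \<le> C" "y \<in> {-1..1}" "y' \<in> {-1..1}"
  shows "\<bar>X (x, y') - X (x, y)\<bar> \<le> C * \<bar>y' - y\<bar>"
  using field_differentiable_bound[of "{-1..1}" "\<lambda>y. X (x, y)" "\<lambda>y. X' (x, y)" C y' y] assms
  unfolding dx2_def by simp

lemma ga_Suc: "ga n (a + 1) = ga n a + hh n"
  by (simp add: ga_def distrib_left)

lemma per_gr: assumes "cper X" shows "per (gr X)"
proof -
  have "X (ga n (a + int (n + 2)), min 1 (gb n b)) = X (ga n a, min 1 (gb n b))" for n a b
  proof -
    have "ga n (a + int (n + 2)) = ga n a + 2 * pi" using ga_periodic[of n a 1] by simp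
    moreover have "min 1 (gb n b) \<in> {-1..1}" by (auto simp: gb_def)
    ultimately show ?thesis using assms unfolding cper_def by metis
  qed
  then show ?thesis unfolding per_def gr_def by blast
qed

definition yb :: "nat \<Rightarrow> nat \<Rightarrow> real" where "yb n b = min 1 (gb n b)"

lemma yb: "yb n b \<in> {-1..1}" "\<bar>yb n (Suc b) - yb n b\<bar> \<le> kk n"
proof -
  have "gb n (Suc b) = gb n b + kk n" by (simp add: gb_def distrib_left)
  then show "\<bar>yb n (Suc b) - yb n b\<bar> \<le> kk n" using kk_pos[of n] unfolding yb_def by linarith
  have "gb n b \<ge> -1" by (simp add: gb_def)
  then show "yb n b \<in> {-1..1}" by (simp add: yb_def)
qed

lemma Linf_bound:
  assumes "per X" "\<And>n a b. \<bar>X n a b\<bar> \<le> C" shows "Linf X"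
  using assms unfolding Linf_def by blast

lemma divide_bound: "h > 0 \<Longrightarrow> \<bar>z\<bar> \<le> C * h \<Longrightarrow> \<bar>z / h\<bar> \<le> (C::real)"
  by (simp add: abs_divide pos_divide_le_eq)

text \<open>A second difference is an increment in x of an increment of \<open>X\<close>. The mean
  value inequality in x bounds it by the derivative of the inner increment, which is an increment of
  \<open>X1\<close> and thus bounded by \<open>X11\<close> or \<open>X12\<close>.\<close>

lemma gr_bounds:
  assumes "C2p X"
  shows "Linf (gr X)" "Linf (d1 (gr X))" "Linf (d1 (d1 (gr X)))" "Linf (d2 (gr X))" "Linf (d1 (d2 (gr X)))"
proof -
  from assms obtain X1 X2 X11 X12 where c: "cper X" "cper X1" "cper X2" "cper X11" "cper X12"
    and d: "dx1 X X1" "dx2 X X2" "dx1 X1 X11" "dx2 X1 X12" unfolding C2p_def by blast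
  obtain C0 where C0: "\<And>x y. y \<in> {-1..1} \<Longrightarrow> \<bar>X (x, y)\<bar> \<le> C0" by (rule cper_bounded[OF c(1)]) blast
  obtain C1 where C1: "\<And>x y. y \<in> {-1..1} \<Longrightarrow> \<bar>X1 (x, y)\<bar> \<le> C1" by (rule cper_bounded[OF c(2)]) blast
  obtain C2 where C2: "C2 \<ge> 0" "\<And>x y. y \<in> {-1..1} \<Longrightarrow> \<bar>X2 (x, y)\<bar> \<le> C2" by (rule cper_bounded[OF c(3)]) blast
  obtain C3 where C3: "\<And>x y. y \<in> {-1..1} \<Longrightarrow> \<bar>X11 (x, y)\<bar> \<le> C3" by (rule cper_bounded[OF c(4)]) blast
  obtain C4 where C4: "C4 \<ge> 0" "\<And>x y. y \<in> {-1..1} \<Longrightarrow> \<bar>X12 (x, y)\<bar> \<le> C4" by (rule cper_bounded[OF c(5)]) blast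
  note P = per_gr[OF c(1)]
  have g: "gr X n a b = X (ga n a, yb n b)" for n a b by (simp add: gr_def yb_def)
  show "Linf (gr X)" by (rule Linf_bound[OF P, of C0]) (unfold g, rule C0[OF yb(1)])
  show "Linf (d1 (gr X))"
  proof (rule Linf_bound[OF per_d1[OF P], of C1])
    show "\<bar>d1 (gr X) n a b\<bar> \<le> C1" for n a b
      unfolding d1_def g ga_Suc
      by (rule divide_bound[OF hh_pos]) (use lipschitz_1[OF d(1) C1 yb(1), of "ga n a + hh n" n b "ga n a"] in simp)
  qed
  show "Linf (d2 (gr X))"
  proof (rule Linf_bound[OF per_d2[OF P], of C2])
    fix n a b
    have "\<bar>X (ga n a, yb n (Suc b)) - X (ga n a, yb n b)\<bar> \<le> C2 * \<bar>yb n (Suc b) - yb n b\<bar>"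
      by (rule lipschitz_2[OF d(2) C2(2) yb(1) yb(1)])
    also have "\<dots> \<le> C2 * kk n" using yb(2) C2(1) by (rule mult_left_mono)
    finally show "\<bar>d2 (gr X) n a b\<bar> \<le> C2" unfolding d2_def g by (rule divide_bound[OF kk_pos])
  qed
  have sh: "((\<lambda>t. X (t + h, y)) has_real_derivative X1 (t + h, y)) (at t)" if "y \<in> {-1..1}" for t h y
    using d(1) that unfolding dx1_def by (subst DERIV_shift[symmetric]) blast
  show "Linf (d1 (d1 (gr X)))"
  proof (rule Linf_bound[OF per_d1[OF per_d1[OF P]], of C3])
    fix n a b
    let ?h = "hh n" and ?y = "yb n b" and ?x = "ga n a"
    have "\<bar>(X ((?x + ?h) + ?h, ?y) - X (?x + ?h, ?y)) - (X (?x + ?h, ?y) - X (?x, ?y))\<bar> \<le> (C3 * ?h) * \<bar>(?x + ?h) - ?x\<bar>"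
    proof -
      have "norm ((X ((?x + ?h) + ?h, ?y) - X (?x + ?h, ?y)) - (X (?x + ?h, ?y) - X (?x, ?y))) \<le> (C3 * ?h) * norm ((?x + ?h) - ?x)"
      proof (rule field_differentiable_bound[of UNIV "\<lambda>t. X (t + ?h, ?y) - X (t, ?y)" "\<lambda>t. X1 (t + ?h, ?y) - X1 (t, ?y)"])
        show "((\<lambda>t. X (t + ?h, ?y) - X (t, ?y)) has_real_derivative X1 (t + ?h, ?y) - X1 (t, ?y)) (at t within UNIV)" for t
          using d(1) yb(1) unfolding dx1_def by (intro DERIV_diff sh yb(1)) blast
        show "norm (X1 (t + ?h, ?y) - X1 (t, ?y)) \<le> C3 * ?h" for t
          using lipschitz_1[OF d(3) C3 yb(1), of "t + ?h" n b t] by simp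
      qed auto
      then show ?thesis by simp
    qed
    then have "\<bar>((X ((?x + ?h) + ?h, ?y) - X (?x + ?h, ?y)) - (X (?x + ?h, ?y) - X (?x, ?y))) / ?h\<bar> \<le> C3 * ?h"
      by (intro divide_bound[OF hh_pos]) simp
    then have "\<bar>((X ((?x + ?h) + ?h, ?y) - X (?x + ?h, ?y)) - (X (?x + ?h, ?y) - X (?x, ?y))) / ?h / ?h\<bar> \<le> C3"
      by (rule divide_bound[OF hh_pos])
    then show "\<bar>d1 (d1 (gr X)) n a b\<bar> \<le> C3" unfolding d1_def g ga_Suc diff_divide_distrib .
  qed
  show "Linf (d1 (d2 (gr X)))"
  proof (rule Linf_bound[OF per_d1[OF per_d2[OF P]], of C4])
    fix n a b
    let ?h = "hh n" and ?k = "kk n" and ?y = "yb n b" and ?y' = "yb n (Suc b)" and ?x = "ga n a"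
    have "\<bar>(X (?x + ?h, ?y') - X (?x + ?h, ?y)) - (X (?x, ?y') - X (?x, ?y))\<bar> \<le> (C4 * ?k) * \<bar>(?x + ?h) - ?x\<bar>"
    proof -
      have "norm ((X (?x + ?h, ?y') - X (?x + ?h, ?y)) - (X (?x, ?y') - X (?x, ?y))) \<le> (C4 * ?k) * norm ((?x + ?h) - ?x)"
      proof (rule field_differentiable_bound[of UNIV "\<lambda>t. X (t, ?y') - X (t, ?y)" "\<lambda>t. X1 (t, ?y') - X1 (t, ?y)"])
        show "((\<lambda>t. X (t, ?y') - X (t, ?y)) has_real_derivative X1 (t, ?y') - X1 (t, ?y)) (at t within UNIV)" for t
          using d(1) yb(1)[of n b] yb(1)[of n "Suc b"] unfolding dx1_def by (intro DERIV_diff) blast+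
        show "norm (X1 (t, ?y') - X1 (t, ?y)) \<le> C4 * ?k" for t
          using lipschitz_2[OF d(4) C4(2) yb(1) yb(1), of t n "Suc b" n b] mult_left_mono[OF yb(2)[of n b] C4(1)] by simp
      qed auto
      then show ?thesis by simp
    qed
    then have "\<bar>((X (?x + ?h, ?y') - X (?x + ?h, ?y)) - (X (?x, ?y') - X (?x, ?y))) / ?h\<bar> \<le> C4 * ?k"
      by (intro divide_bound[OF hh_pos]) (simp add: mult_ac)
    then have 1: "\<bar>((X (?x + ?h, ?y') - X (?x + ?h, ?y)) - (X (?x, ?y') - X (?x, ?y))) / ?h / ?k\<bar> \<le> C4"
      by (rule divide_bound[OF kk_pos])
    have "d1 (d2 (gr X)) n a b = ((X (?x + ?h, ?y') - X (?x + ?h, ?y)) - (X (?x, ?y') - X (?x, ?y))) / ?h / ?k"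
      unfolding d1_def d2_def g ga_Suc by (simp add: diff_divide_distrib mult.commute)
    with 1 show "\<bar>d1 (d2 (gr X)) n a b\<bar> \<le> C4" by simp
  qed
qed

theorem corrector_exists:
  fixes fA fB fF1 fF2 fK :: "real \<times> real \<Rightarrow> real"
  assumes C: "C2p fA" "C2p fB" "C2p fF1" "C2p fF2" "C2p fK"
    and e: "e > 0" and ell: "\<And>q x y. q \<in> Omega_ext \<Longrightarrow> e * (x\<^sup>2 + y\<^sup>2) \<le> fA q * x\<^sup>2 + 2 * fB q * x * y + y\<^sup>2"
  obtains U U1 U2 U11 U12 U22 :: "real \<times> real \<Rightarrow> real" and \<sigma> \<kappa> :: real where
    "continuous_on Omega_ext U" "continuous_on Omega_ext U1" "continuous_on Omega_ext U2"
    "continuous_on Omega_int U11" "continuous_on Omega_int U12" "continuous_on Omega_int U22"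
    "\<And>x y. U (x + 2 * pi, y) = U (x, y)"
    "\<And>x y. y \<in> {-1..1} \<Longrightarrow> ((\<lambda>x. U (x, y)) has_real_derivative U1 (x, y)) (at x)"
    "\<And>x y. y \<in> {-1..1} \<Longrightarrow> ((\<lambda>y. U (x, y)) has_real_derivative U2 (x, y)) (at y within {-1..1})"
    "\<And>x y. y \<in> {-1<..<1} \<Longrightarrow> ((\<lambda>x. U1 (x, y)) has_real_derivative U11 (x, y)) (at x)"
    "\<And>x y. y \<in> {-1<..<1} \<Longrightarrow> ((\<lambda>y. U1 (x, y)) has_real_derivative U12 (x, y)) (at y within {-1..1})"
    "\<And>x y. y \<in> {-1<..<1} \<Longrightarrow> ((\<lambda>x. U2 (x, y)) has_real_derivative U12 (x, y)) (at x)"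
    "\<And>x y. y \<in> {-1<..<1} \<Longrightarrow> ((\<lambda>y. U2 (x, y)) has_real_derivative U22 (x, y)) (at y within {-1..1})"
    "\<And>q. q \<in> Omega_int \<Longrightarrow> fA q * U11 q + 2 * fB q * U12 q + U22 q + fF1 q * (U1 q + \<sigma>) + fF2 q * U2 q = \<kappa> * fK q"
    "\<And>x y. y \<in> {-1, 1} \<Longrightarrow> fB (x, y) * (U1 (x, y) + \<sigma>) + U2 (x, y) = 0"
    "U (0, -1) = 0" "\<not> (\<sigma> = 0 \<and> \<kappa> = 0 \<and> (\<forall>q\<in>Omega_ext. U q = 0))"
proof -
  have cont: "continuous_on Omega_ext X" and cp: "cper X" if "C2p X" for X using that by (auto simp: C2p_def cper_def)
  note pg = per_gr[OF cp[OF C(1)]] per_gr[OF cp[OF C(2)]] per_gr[OF cp[OF C(3)]] per_gr[OF cp[OF C(4)]] per_gr[OF cp[OF C(5)]]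
  obtain w s c where
    wp: "\<And>n a b. w n (a + int (n + 2)) b = w n a b" and w0: "\<And>n. w n 0 0 = (0::real)"
    and res: "\<And>n a b. b < n + 2 \<Longrightarrow> residual (gr fA) (gr fB) (gr fF1) (gr fF2) (gr fK) (\<lambda>_. w n) (s n) (c n) n a b = 0"
    and fl: "\<And>n a. flux (gr fB) (\<lambda>_. w n) (s n) n a (n + 2) = 0"
    and nrm: "\<And>n. gsum n (\<lambda>a b. (w n a b)\<^sup>2) + (s n)\<^sup>2 + (c n)\<^sup>2 = 1"
    using discrete_solution[OF pg] by metis
  \<comment> \<open>\<open>discrete_solution\<close> treats one n at a time with a family constant
    in n; at the level n a difference sees only the member n.\<close>
  have dw: "d1 (\<lambda>_. w n) n = d1 w n" "d2 (\<lambda>_. w n) n = d2 w n" for n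
    by (simp_all add: fun_eq_iff d1_def d2_def)
  have perw: "per w" using wp by (simp add: per_def)
  define Q where "Q n = flux (gr fB) w (s n) n" for n
  have Qeq: "Q n a b = flux (gr fB) (\<lambda>_. w n) (s n) n a b" for n a b
    unfolding Q_def flux_def dw ..
  have g0: "gsum n (\<lambda>a b. (w n a b)\<^sup>2) \<ge> 0" for n by (rule gsum_nonneg) simp
  have b1: "(s n)\<^sup>2 \<le> 1" "(c n)\<^sup>2 \<le> 1" "gsum n (\<lambda>a b. (w n a b)\<^sup>2) \<le> 1" for n
    using nrm[of n] g0[of n] zero_le_power2[of "s n"] zero_le_power2[of "c n"] by linarith+
  interpret corrector_scheme "gr fA" "gr fB" "gr fF1" "gr fF2" "gr fK" w Q s c fA fB fF1 fF2 fK
  proof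
    show "ellip (gr fA) (gr fB)"
      unfolding ellip_def
    proof (intro exI[of _ e] conjI e allI impI)
      fix n :: nat and a :: int and b :: nat and x y :: real assume b: "b \<le> n + 2"
      have "(ga n a, gb n b) \<in> Omega_ext" using gb_range[OF b] by (simp add: Omega_ext_def)
      from ell[OF this] show "e * (x\<^sup>2 + y\<^sup>2) \<le> gr fA n a b * x\<^sup>2 + 2 * gr fB n a b * x * y + y\<^sup>2"
        using b by (simp add: gr_eq)
    qed
    show "\<bar>s n\<bar> \<le> 1" "\<bar>c n\<bar> \<le> 1" for n using b1 by (simp_all add: abs_square_le_1)
    show "L2 w" using perw b1(3) unfolding L2_def by blast
    show "per Q"
      unfolding per_def
    proof (intro allI)
      fix n a b
      show "Q n (a + int (n + 2)) b = Q n a b"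
        unfolding Q_def flux_def using perD[OF pg(2), of n a] perD[OF per_d1[OF perw], of n a] perD[OF per_d2[OF perw], of n a]
        by (cases b) simp_all
    qed
    show "Q n a 0 = 0" for n a by (simp add: Q_def flux_def)
    show "Q n a (n + 2) = 0" for n a unfolding Qeq by (rule fl)
    show "Q n a (Suc b) = gr fB n a b * (d1 w n a b + s n) + d2 w n a b" for n a b by (simp add: Q_def flux_def)
    show "d1 (\<lambda>n a b. gr fA n a b * (d1 w n a b + s n) + gr fB n a b * d2 w n a b) n (a - 1) b + d2 Q n a b
        = c n * gr fK n a b + (if b = 0 then 0 else
            (d1 (gr fA) n (a - 1) b - gr fF1 n a b + d2 (gr fB) n a (b - 1)) * (d1 w n a b + s n)
            + (d1 (gr fB) n (a - 1) b - gr fF2 n a b) * d2 w n a b)" if b: "b < n + 2" for n a b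
    proof -
      have 1: "d1 (hflux (gr fA) (gr fB) (\<lambda>_. w n) (s n)) n (a - 1) b = d1 (\<lambda>n a b. gr fA n a b * (d1 w n a b + s n) + gr fB n a b * d2 w n a b) n (a - 1) b"
        unfolding d1_def[of "hflux _ _ _ _"] d1_def[of "\<lambda>n a b. gr fA n a b * (d1 w n a b + s n) + gr fB n a b * d2 w n a b"] hflux_def dw ..
      have 2: "d2 (flux (gr fB) (\<lambda>_. w n) (s n)) n a b = d2 Q n a b" unfolding d2_def Qeq ..
      show ?thesis using res[OF b, of a] unfolding residual_def 1 2 dw by linarith
    qed
    show "w n 0 0 = 0" "gsum n (\<lambda>a b. (w n a b)\<^sup>2) + (s n)\<^sup>2 + (c n)\<^sup>2 = 1" for n by (rule w0 nrm)+
  qed (rule gr_bounds[OF C(1)] gr_bounds[OF C(2)] gr_bounds[OF C(3)] gr_bounds[OF C(4)] gr_bounds[OF C(5)]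
     cont C refl)+
  show thesis by (rule limit) (rule that)
qed

section \<open>Maximum principle\<close>

text \<open>The two mixed derivatives are not assumed to agree: the entry for the mixed derivative is
  their mean, which is all that a quadratic form sees.\<close>

definition jeta :: "(real \<times> real \<Rightarrow> real) \<Rightarrow> (real \<times> real \<Rightarrow> real) \<Rightarrow> (real \<times> real \<Rightarrow> real) \<Rightarrow> (real \<times> real \<Rightarrow> real)
    \<Rightarrow> (real \<times> real \<Rightarrow> real) \<Rightarrow> (real \<times> real \<Rightarrow> real) \<Rightarrow> (real \<times> real \<Rightarrow> real) \<Rightarrow> bool" where
  "jeta ua u u1 u2 u11 u12 u22 \<longleftrightarrow>
     continuous_on Omega_int u2 \<and> continuous_on Omega_int ua \<and> continuous_on Omega_int u22 \<and>
     (\<forall>x y. y \<in> {-1<..<1} \<longrightarrow>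
        ((\<lambda>x. u (x, y)) has_real_derivative u1 (x, y)) (at x) \<and> ((\<lambda>y. u (x, y)) has_real_derivative u2 (x, y)) (at y) \<and>
        ((\<lambda>x. u1 (x, y)) has_real_derivative u11 (x, y)) (at x) \<and> ((\<lambda>y. u1 (x, y)) has_real_derivative ua (x, y)) (at y) \<and>
        ((\<lambda>x. u2 (x, y)) has_real_derivative 2 * u12 (x, y) - ua (x, y)) (at x) \<and> ((\<lambda>y. u2 (x, y)) has_real_derivative u22 (x, y)) (at y))"

definition jet :: "(real \<times> real \<Rightarrow> real) \<Rightarrow> (real \<times> real \<Rightarrow> real) \<Rightarrow> (real \<times> real \<Rightarrow> real) \<Rightarrow> (real \<times> real \<Rightarrow> real)
    \<Rightarrow> (real \<times> real \<Rightarrow> real) \<Rightarrow> (real \<times> real \<Rightarrow> real) \<Rightarrow> bool" where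
  "jet u u1 u2 u11 u12 u22 \<longleftrightarrow> (\<exists>ua. jeta ua u u1 u2 u11 u12 u22)"

lemma jetaD:
  assumes "jeta ua w w1 w2 w11 w12 w22"
  shows "continuous_on Omega_int w2" "continuous_on Omega_int ua" "continuous_on Omega_int w22"
    "y \<in> {-1<..<1} \<Longrightarrow> ((\<lambda>x. w (x, y)) has_real_derivative w1 (x, y)) (at x)"
    "y \<in> {-1<..<1} \<Longrightarrow> ((\<lambda>y. w (x, y)) has_real_derivative w2 (x, y)) (at y)"
    "y \<in> {-1<..<1} \<Longrightarrow> ((\<lambda>x. w1 (x, y)) has_real_derivative w11 (x, y)) (at x)"
    "y \<in> {-1<..<1} \<Longrightarrow> ((\<lambda>y. w1 (x, y)) has_real_derivative ua (x, y)) (at y)"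
    "y \<in> {-1<..<1} \<Longrightarrow> ((\<lambda>x. w2 (x, y)) has_real_derivative 2 * w12 (x, y) - ua (x, y)) (at x)"
    "y \<in> {-1<..<1} \<Longrightarrow> ((\<lambda>y. w2 (x, y)) has_real_derivative w22 (x, y)) (at y)"
  using assms unfolding jeta_def by blast+

text \<open>Two partial derivatives, the second one continuous, give total differentiability.
  \<open>Y\<close> may be the closed interval, which covers the boundary points of the
  strip.\<close>

lemma has_derivative_of_partials:
  fixes F F1 F2 :: "real \<times> real \<Rightarrow> real"
  assumes F1: "((\<lambda>x. F (x, y)) has_real_derivative F1 (x, y)) (at x)"
    and F2: "\<And>x y. y \<in> Y \<Longrightarrow> ((\<lambda>y. F (x, y)) has_real_derivative F2 (x, y)) (at y within Y)"
    and y: "y \<in> Y" and conv: "convex Y" and cont: "continuous_on (UNIV \<times> Y) F2"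
  shows "(F has_derivative (\<lambda>h. F1 (x, y) * fst h + F2 (x, y) * snd h)) (at (x, y) within UNIV \<times> Y)"
proof -
  let ?fy = "\<lambda>x y. blinfun_scaleR_left (F2 (x, y))"
  let ?fy = "\<lambda>x y. F2 (x, y) *\<^sub>R (id_blinfun :: real \<Rightarrow>\<^sub>L real)"
  have "((\<lambda>(x, y). F (x, y)) has_derivative (\<lambda>(tx, ty). F1 (x, y) * tx + blinfun_apply (?fy x y) ty)) (at (x, y) within UNIV \<times> Y)"
  proof (rule has_derivative_partialsI)
    show "((\<lambda>x. F (x, y)) has_derivative (*) (F1 (x, y))) (at x within UNIV)"
      using F1 by (simp add: has_field_derivative_def)
    show "((\<lambda>y. F (x, y)) has_derivative blinfun_apply (?fy x y)) (at y within Y)" if "y \<in> Y" for x y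
      using F2[OF that, of x] by (simp add: has_field_derivative_def scaleR_blinfun.rep_eq)
    have "((\<lambda>(x, y). F2 (x, y)) \<longlongrightarrow> F2 (x, y)) (at (x, y) within UNIV \<times> Y)"
      using cont y by (simp add: continuous_on_def)
    then show "continuous (at (x, y) within UNIV \<times> Y) (\<lambda>(x, y). ?fy x y)"
      unfolding continuous_within split_beta by (auto intro!: tendsto_intros)
  qed (use y conv in auto)
  then show ?thesis by (simp add: case_prod_unfold scaleR_blinfun.rep_eq)
qed

lemma Omega_int_eq: "Omega_int = UNIV \<times> {-1<..<1}" and open_Omega_int: "open Omega_int"
  by (simp_all add: Omega_int_def open_Times)

lemma line_derivative:
  fixes F F1 F2 :: "real \<times> real \<Rightarrow> real"
  assumes D: "\<And>x y. y \<in> {-1<..<1} \<Longrightarrow> ((\<lambda>x. F (x, y)) has_real_derivative F1 (x, y)) (at x)"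
    "\<And>x y. y \<in> {-1<..<1} \<Longrightarrow> ((\<lambda>y. F (x, y)) has_real_derivative F2 (x, y)) (at y)"
    and c: "continuous_on Omega_int F2" and q: "q + t *\<^sub>R \<xi> \<in> Omega_int"
  shows "((\<lambda>t. F (q + t *\<^sub>R \<xi>)) has_real_derivative (F1 (q + t *\<^sub>R \<xi>) * fst \<xi> + F2 (q + t *\<^sub>R \<xi>) * snd \<xi>)) (at t)"
proof -
  obtain x y where xy: "q + t *\<^sub>R \<xi> = (x, y)" by fastforce
  have y: "y \<in> {-1<..<1}" using q unfolding xy Omega_int_def by auto
  have "(F has_derivative (\<lambda>h. F1 (x, y) * fst h + F2 (x, y) * snd h)) (at (x, y) within UNIV \<times> {-1<..<1})"
    by (rule has_derivative_of_partials[where F = F and ?F1.0 = F1 and ?F2.0 = F2, OF D(1)[OF y] _ y]) (use D(2) c in \<open>auto simp: Omega_int_eq intro: has_field_derivative_at_within\<close>)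
  then have 1: "(F has_derivative (\<lambda>h. F1 (x, y) * fst h + F2 (x, y) * snd h)) (at (q + t *\<^sub>R \<xi>))"
    using at_within_open[OF q open_Omega_int] unfolding xy Omega_int_eq by simp
  have 2: "((\<lambda>t. q + t *\<^sub>R \<xi>) has_derivative (\<lambda>s. s *\<^sub>R \<xi>)) (at t)"
    by (auto intro!: derivative_eq_intros)
  have "((\<lambda>t. F (q + t *\<^sub>R \<xi>)) has_derivative (\<lambda>s. F1 (x, y) * fst (s *\<^sub>R \<xi>) + F2 (x, y) * snd (s *\<^sub>R \<xi>))) (at t)"
    by (rule has_derivative_compose[OF 2 1])
  then show ?thesis unfolding has_field_derivative_def xy
    by (rule has_derivative_eq_rhs) (auto simp: fun_eq_iff algebra_simps)
qed

text \<open>If l were positive, \<open>\<phi>'\<close> would be positive just to the right of 0 and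
  \<open>\<phi>\<close> would increase there.\<close>

lemma second_derivative_test:
  fixes \<phi> \<phi>' :: "real \<Rightarrow> real"
  assumes r: "r > 0" and d: "\<And>t. \<bar>t\<bar> < r \<Longrightarrow> (\<phi> has_real_derivative \<phi>' t) (at t)"
    and dd: "(\<phi>' has_real_derivative l) (at 0)" and max: "\<And>t. \<bar>t\<bar> < r \<Longrightarrow> \<phi> t \<le> \<phi> 0"
  shows "\<phi>' 0 = 0" "l \<le> 0"
proof -
  show 0: "\<phi>' 0 = 0"
    by (rule DERIV_local_max[OF d[of 0] r]) (use max r in auto)
  show "l \<le> 0"
  proof (rule ccontr)
    assume "\<not> l \<le> 0"
    then obtain e where e: "e > 0" "\<And>h. 0 < h \<Longrightarrow> h < e \<Longrightarrow> \<phi>' 0 < \<phi>' (0 + h)"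
      using DERIV_pos_inc_right[OF dd] by auto
    define s where "s = min e r / 2"
    have s: "0 < s" "s < e" "s < r" using e r by (auto simp: s_def)
    obtain z where z: "0 < z" "z < s" "\<phi> s - \<phi> 0 = (s - 0) * \<phi>' z"
      using MVT2[of 0 s \<phi> \<phi>'] d s by (metis abs_of_nonneg order.strict_trans1)
    have "\<phi>' z > 0" using e(2)[of z] z s 0 by simp
    then have "\<phi> s > \<phi> 0" using z s by (metis diff_gt_0_iff_gt diff_zero mult_pos_pos)
    then show False using max[of s] s by simp
  qed
qed

text \<open>Restriction to the line through q in the direction (a, b). The mixed derivatives enter
  through their sum, so their mean \<open>w12\<close> gives the correct quadratic form.\<close>

lemma hessian_test:
  assumes j: "jet w w1 w2 w11 w12 w22" and q: "q \<in> Omega_int" and r: "r > 0"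
    and max: "\<And>q'. dist q q' < r \<Longrightarrow> w q' \<le> w q"
  shows "w1 q * a + w2 q * b = 0" "a\<^sup>2 * w11 q + 2 * a * b * w12 q + b\<^sup>2 * w22 q \<le> 0"
proof -
  obtain ua where "jeta ua w w1 w2 w11 w12 w22" using j unfolding jet_def by blast
  note j = jetaD[OF this]
  let ?\<xi> = "(a, b)"
  obtain r0 where r0: "r0 > 0" "\<And>q'. dist q' q < r0 \<Longrightarrow> q' \<in> Omega_int"
    using open_Omega_int q unfolding open_dist by blast
  \<comment> \<open>Adding 1 avoids a division by 0 for the direction (0, 0).\<close>
  define n where "n = norm ?\<xi> + 1"
  have n: "n > 0" unfolding n_def using norm_ge_zero[of ?\<xi>] by linarith
  define s where "s = min r r0 / n"
  have s: "s > 0" using r r0 n by (simp add: s_def)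
  have close: "dist (q + t *\<^sub>R ?\<xi>) q < min r r0" if "\<bar>t\<bar> < s" for t
  proof -
    have "dist (q + t *\<^sub>R ?\<xi>) q = \<bar>t\<bar> * norm ?\<xi>" by (simp only: dist_norm add_diff_cancel_left' norm_scaleR)
    also have "\<dots> \<le> \<bar>t\<bar> * n" by (intro mult_left_mono) (auto simp: n_def)
    also have "\<dots> < s * n" using that n by simp
    finally show ?thesis using n by (simp add: s_def)
  qed
  have inn: "q + t *\<^sub>R ?\<xi> \<in> Omega_int" if "\<bar>t\<bar> < s" for t
    using close[OF that] r0 by simp
  let ?\<phi>' = "\<lambda>t. w1 (q + t *\<^sub>R ?\<xi>) * a + w2 (q + t *\<^sub>R ?\<xi>) * b"
  have d: "((\<lambda>t. w (q + t *\<^sub>R ?\<xi>)) has_real_derivative ?\<phi>' t) (at t)" if "\<bar>t\<bar> < s" for t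
    using line_derivative[of w w1 w2 q t ?\<xi>, OF j(4,5,1) inn[OF that]] by simp
  have d1: "((\<lambda>t. w1 (q + t *\<^sub>R ?\<xi>)) has_real_derivative (w11 q * a + ua q * b)) (at 0)"
    using line_derivative[of w1 w11 ua q 0 ?\<xi>, OF j(6,7,2)] q by (simp flip: zero_prod_def)
  have d2: "((\<lambda>t. w2 (q + t *\<^sub>R ?\<xi>)) has_real_derivative ((2 * w12 q - ua q) * a + w22 q * b)) (at 0)"
    using line_derivative[of w2 "\<lambda>q. 2 * w12 q - ua q" w22 q 0 ?\<xi>, OF j(8,9,3)] q by (simp flip: zero_prod_def)
  have dd: "(?\<phi>' has_real_derivative (w11 q * a + ua q * b) * a + ((2 * w12 q - ua q) * a + w22 q * b) * b) (at 0)"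
    by (intro DERIV_add DERIV_cmult_right d1 d2)
  have m: "w (q + t *\<^sub>R ?\<xi>) \<le> w (q + 0 *\<^sub>R ?\<xi>)" if "\<bar>t\<bar> < s" for t
    using max[of "q + t *\<^sub>R ?\<xi>"] close[OF that] by (simp add: dist_commute flip: zero_prod_def)
  from second_derivative_test[OF s d dd m]
  show "w1 q * a + w2 q * b = 0" "a\<^sup>2 * w11 q + 2 * a * b * w12 q + b\<^sup>2 * w22 q \<le> 0"
    by (simp_all add: power2_eq_square algebra_simps flip: zero_prod_def)
qed

lemma jet_add_cmult:
  assumes "jet u u1 u2 u11 u12 u22" "jet v v1 v2 v11 v12 v22"
  shows "jet (\<lambda>q. u q + e * v q) (\<lambda>q. u1 q + e * v1 q) (\<lambda>q. u2 q + e * v2 q) (\<lambda>q. u11 q + e * v11 q) (\<lambda>q. u12 q + e * v12 q) (\<lambda>q. u22 q + e * v22 q)"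
proof -
  from assms obtain ua va where "jeta ua u u1 u2 u11 u12 u22" "jeta va v v1 v2 v11 v12 v22"
    unfolding jet_def by blast
  note u = jetaD[OF this(1)] and v = jetaD[OF this(2)]
  have m: "((\<lambda>x. u2 (x, y) + e * v2 (x, y)) has_real_derivative 2 * (u12 (x, y) + e * v12 (x, y)) - (ua (x, y) + e * va (x, y))) (at x)"
    if "y \<in> {-1<..<1}" for x y
    by (rule DERIV_cong[OF DERIV_add[OF u(8)[OF that] DERIV_cmult[OF v(8)[OF that]]]]) (simp add: algebra_simps)
  show ?thesis
    unfolding jet_def jeta_def
  proof (intro exI[of _ "\<lambda>q. ua q + e * va q"] conjI allI impI)
    fix x y :: real assume y: "y \<in> {-1<..<1}"
    show "((\<lambda>x. u (x, y) + e * v (x, y)) has_real_derivative u1 (x, y) + e * v1 (x, y)) (at x)"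
      "((\<lambda>y. u (x, y) + e * v (x, y)) has_real_derivative u2 (x, y) + e * v2 (x, y)) (at y)"
      "((\<lambda>x. u1 (x, y) + e * v1 (x, y)) has_real_derivative u11 (x, y) + e * v11 (x, y)) (at x)"
      "((\<lambda>y. u1 (x, y) + e * v1 (x, y)) has_real_derivative ua (x, y) + e * va (x, y)) (at y)"
      "((\<lambda>y. u2 (x, y) + e * v2 (x, y)) has_real_derivative u22 (x, y) + e * v22 (x, y)) (at y)"
      by (rule DERIV_add[OF u(4)[OF y] DERIV_cmult[OF v(4)[OF y]]] DERIV_add[OF u(5)[OF y] DERIV_cmult[OF v(5)[OF y]]]
        DERIV_add[OF u(6)[OF y] DERIV_cmult[OF v(6)[OF y]]] DERIV_add[OF u(7)[OF y] DERIV_cmult[OF v(7)[OF y]]]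
        DERIV_add[OF u(9)[OF y] DERIV_cmult[OF v(9)[OF y]]])+
  qed (rule m; assumption | intro continuous_intros u v)+
qed

text \<open>The trace of the product of a positive and a negative semidefinite matrix is at most 0:
  multiplied by G22, it is the form H at (G12, G22) plus det G times H11.\<close>

lemma elliptic_test:
  assumes h: "\<And>a b :: real. a\<^sup>2 * H11 + 2 * a * b * H12 + b\<^sup>2 * H22 \<le> 0"
    and G: "G22 > 0" "G11 * G22 - G12\<^sup>2 \<ge> (0::real)"
  shows "G11 * H11 + 2 * G12 * H12 + G22 * H22 \<le> 0"
proof -
  have "G22 * (G11 * H11 + 2 * G12 * H12 + G22 * H22) = (G12\<^sup>2 * H11 + 2 * G12 * G22 * H12 + G22\<^sup>2 * H22) + (G11 * G22 - G12\<^sup>2) * H11"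
    by (simp add: power2_eq_square algebra_simps)
  also have "\<dots> \<le> 0"
  proof -
    have "H11 \<le> 0" using h[of 1 0] by simp
    then have "(G11 * G22 - G12\<^sup>2) * H11 \<le> 0" using G(2) by (intro mult_nonneg_nonpos)
    then show ?thesis using h[of G12 G22] by linarith
  qed
  finally show ?thesis using G(1) by (simp add: mult_le_0_iff)
qed

section \<open>Hopf's lemma and the strong maximum principle\<close>

locale elliptic_operator =
  fixes G11 G12 G22 b1 b2 :: "real \<times> real \<Rightarrow> real" and \<theta> M :: real
  assumes th: "\<theta> > 0"
    and ell: "\<And>q x y. q \<in> Omega_ext \<Longrightarrow> \<theta> * (x\<^sup>2 + y\<^sup>2) \<le> G11 q * x\<^sup>2 + 2 * G12 q * x * y + G22 q * y\<^sup>2"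
    and bdd: "\<And>q. q \<in> Omega_ext \<Longrightarrow> \<bar>G11 q\<bar> \<le> M \<and> \<bar>G22 q\<bar> \<le> M \<and> \<bar>b1 q\<bar> \<le> M \<and> \<bar>b2 q\<bar> \<le> M"
begin

lemma G_pos: assumes q: "q \<in> Omega_ext" shows "G22 q > 0" "G11 q * G22 q - (G12 q)\<^sup>2 \<ge> 0"
proof -
  show g: "G22 q > 0" using ell[OF q, of 0 1] th by simp
  \<comment> \<open>The form at the vector (G22, -G12) equals G22 times the determinant.\<close>
  have "0 \<le> \<theta> * ((G22 q)\<^sup>2 + (- G12 q)\<^sup>2)" using th by simp
  also have "\<dots> \<le> G11 q * (G22 q)\<^sup>2 + 2 * G12 q * G22 q * (- G12 q) + G22 q * (- G12 q)\<^sup>2" by (rule ell[OF q])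
  also have "\<dots> = G22 q * (G11 q * G22 q - (G12 q)\<^sup>2)" by (simp add: power2_eq_square algebra_simps)
  finally show "G11 q * G22 q - (G12 q)\<^sup>2 \<ge> 0" using g by (simp add: zero_le_mult_iff)
qed

lemma int_ext: "q \<in> Omega_int \<Longrightarrow> q \<in> Omega_ext" by (auto simp: Omega_int_def Omega_ext_def)

definition L :: "(real \<times> real \<Rightarrow> real) \<Rightarrow> (real \<times> real \<Rightarrow> real) \<Rightarrow> (real \<times> real \<Rightarrow> real) \<Rightarrow> (real \<times> real \<Rightarrow> real) \<Rightarrow> (real \<times> real \<Rightarrow> real) \<Rightarrow> real \<times> real \<Rightarrow> real" where
  "L u1 u2 u11 u12 u22 q = G11 q * u11 q + 2 * G12 q * u12 q + G22 q * u22 q + b1 q * u1 q + b2 q * u2 q"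

lemma no_interior_max:
  assumes "jet w w1 w2 w11 w12 w22" "q \<in> Omega_int" "r > 0" "\<And>q'. dist q q' < r \<Longrightarrow> w q' \<le> w q"
  shows "L w1 w2 w11 w12 w22 q \<le> 0"
proof -
  have "w1 q = 0" "w2 q = 0" using hessian_test(1)[OF assms, of 1 0] hessian_test(1)[OF assms, of 0 1] by auto
  moreover have "G11 q * w11 q + 2 * G12 q * w12 q + G22 q * w22 q \<le> 0"
    by (rule elliptic_test[OF hessian_test(2)[OF assms] G_pos[OF int_ext[OF assms(2)]]])
  ultimately show ?thesis by (simp add: L_def)
qed

text \<open>Compare u with the Gaussian barrier exp (- k |q - p|^2) - exp (- k R^2).\<close>

lemma Hopf:
  assumes j: "jet u u1 u2 u11 u12 u22" and cu: "continuous_on Omega_ext u"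
    and sub: "\<And>q. q \<in> Omega_int \<Longrightarrow> 0 \<le> L u1 u2 u11 u12 u22 q"
    and R: "R > 0" and ball: "ball p R \<subseteq> Omega_int" and less: "\<And>q. q \<in> ball p R \<Longrightarrow> u q < m"
    and max: "\<And>q. q \<in> Omega_ext \<Longrightarrow> u q \<le> m"
    and s: "dist p s = R" "u s = m"
    and der: "(u has_derivative (\<lambda>h. 0)) (at s within Omega_ext)" and sin: "s \<in> Omega_ext"
  shows False
proof -
  define r2 where "r2 q = (fst q - fst p)\<^sup>2 + (snd q - snd p)\<^sup>2" for q
  have r2: "r2 q = (dist p q)\<^sup>2" for q
    by (simp add: r2_def dist_prod_def dist_real_def power2_commute)
  define C where "C = 2 * M + 2 * M * R"
  have M0: "M \<ge> 0" using bdd[OF sin] by linarith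
  \<comment> \<open>L v is 2 k E times the difference of 2 k times the quadratic form of q - p and
    lower order terms. The latter are at most \<open>C\<close> in the closed ball; with this k the
    former is at least C + 1 where |q - p| >= R/2.\<close>
  define k where "k = (C + 1) / (\<theta> * R\<^sup>2 / 2)"
  have C0: "C \<ge> 0" using M0 R by (simp add: C_def)
  have k: "k > 0" "k * (\<theta> * R\<^sup>2 / 2) = C + 1" using C0 th R by (auto simp: k_def)
  define E where "E q = exp (- k * r2 q)" for q
  define v where "v q = E q - exp (- k * R\<^sup>2)" for q
  define v1 where "v1 q = - 2 * k * (fst q - fst p) * E q" for q
  define v2 where "v2 q = - 2 * k * (snd q - snd p) * E q" for q
  define v11 where "v11 q = (4 * k\<^sup>2 * (fst q - fst p)\<^sup>2 - 2 * k) * E q" for q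
  define v12 where "v12 q = 4 * k\<^sup>2 * (fst q - fst p) * (snd q - snd p) * E q" for q
  define v22 where "v22 q = (4 * k\<^sup>2 * (snd q - snd p)\<^sup>2 - 2 * k) * E q" for q
  have Lv: "L v1 v2 v11 v12 v22 q > 0" if q: "q \<in> Omega_ext" "R / 2 \<le> dist p q" "dist p q \<le> R" for q
  proof -
    let ?x = "fst q - fst p" and ?y = "snd q - snd p"
    have b: "\<bar>?x\<bar> \<le> R" "\<bar>?y\<bar> \<le> R"
      using q(3) dist_fst_le[of p q] dist_snd_le[of p q] by (auto simp: dist_real_def abs_minus_commute)
    note B = bdd[OF q(1)]
    have 1: "G11 q + G22 q + b1 q * ?x + b2 q * ?y \<le> C"
    proof -
      have "\<bar>b1 q * ?x\<bar> \<le> M * R" "\<bar>b2 q * ?y\<bar> \<le> M * R"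
        unfolding abs_mult using B b M0 by (auto intro!: mult_mono)
      then show ?thesis using B unfolding C_def by (simp add: abs_le_iff)
    qed
    have "(R / 2)\<^sup>2 \<le> r2 q" unfolding r2 using q(2) R by (intro power_mono) auto
    then have "\<theta> * (R\<^sup>2 / 4) \<le> \<theta> * (?x\<^sup>2 + ?y\<^sup>2)" using th by (intro mult_left_mono) (auto simp: r2_def power_divide)
    also have "\<dots> \<le> G11 q * ?x\<^sup>2 + 2 * G12 q * ?x * ?y + G22 q * ?y\<^sup>2" by (rule ell[OF q(1)])
    finally have "2 * k * (\<theta> * (R\<^sup>2 / 4)) \<le> 2 * k * (G11 q * ?x\<^sup>2 + 2 * G12 q * ?x * ?y + G22 q * ?y\<^sup>2)"
      using k by (intro mult_left_mono) auto
    moreover have "2 * k * (\<theta> * (R\<^sup>2 / 4)) = C + 1" unfolding k(2)[symmetric] by simp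
    ultimately have "0 < 2 * k * (G11 q * ?x\<^sup>2 + 2 * G12 q * ?x * ?y + G22 q * ?y\<^sup>2) - (G11 q + G22 q + b1 q * ?x + b2 q * ?y)"
      using 1 by linarith
    then have "0 < (2 * k * E q) * (2 * k * (G11 q * ?x\<^sup>2 + 2 * G12 q * ?x * ?y + G22 q * ?y\<^sup>2) - (G11 q + G22 q + b1 q * ?x + b2 q * ?y))"
      using k by (intro mult_pos_pos) (auto simp: E_def)
    also have "\<dots> = L v1 v2 v11 v12 v22 q"
      by (simp add: L_def v1_def v2_def v11_def v12_def v22_def power2_eq_square algebra_simps)
    finally show ?thesis .
  qed
  have jv: "jet v v1 v2 v11 v12 v22"
    unfolding jet_def jeta_def v_def v1_def v2_def v11_def v12_def v22_def E_def r2_def fst_conv snd_conv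
    by (intro exI[of _ "\<lambda>q. 4 * k\<^sup>2 * (fst q - fst p) * (snd q - snd p) * exp (- k * ((fst q - fst p)\<^sup>2 + (snd q - snd p)\<^sup>2))"] conjI allI impI continuous_intros)
      (auto intro!: derivative_eq_intros simp: power2_eq_square algebra_simps)
  have cp: "continuous_on A v" for A unfolding v_def E_def r2_def by (intro continuous_intros)
  \<comment> \<open>An annulus, because near the centre p the sign of L v is not under
    control.\<close>
  define K where "K = cball p R - ball p (R / 2)"
  have cK: "compact K" unfolding K_def by (intro compact_diff compact_cball open_ball)
  have KO: "K \<subseteq> Omega_ext"
  proof -
    have "cball p R = closure (ball p R)" using R by simp
    also have "\<dots> \<subseteq> closure Omega_int" by (rule closure_mono[OF ball])
    also have "\<dots> \<subseteq> Omega_ext"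
      by (rule closure_minimal) (auto simp: Omega_int_def Omega_ext_def closed_Times)
    finally show ?thesis by (auto simp: K_def)
  qed
  have "compact (sphere p (R / 2))" "sphere p (R / 2) \<noteq> {}" using R by auto
  moreover have sph: "sphere p (R / 2) \<subseteq> ball p R" using R by auto
  moreover have "continuous_on (sphere p (R / 2)) u"
    using continuous_on_subset[OF cu] sph ball int_ext by blast
  ultimately obtain z where z: "z \<in> sphere p (R / 2)" "\<And>q. q \<in> sphere p (R / 2) \<Longrightarrow> u q \<le> u z"
    using continuous_attains_sup by metis
  \<comment> \<open>The gap below m on the inner sphere. Since v <= 1, adding
    \<open>\<epsilon>\<close> times v does not exceed m there.\<close>
  define \<epsilon> where "\<epsilon> = m - u z"
  have eps: "\<epsilon> > 0" using less[of z] z sph by (auto simp: \<epsilon>_def)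
  let ?w = "\<lambda>q. u q + \<epsilon> * v q"
  have jw: "jet ?w (\<lambda>q. u1 q + \<epsilon> * v1 q) (\<lambda>q. u2 q + \<epsilon> * v2 q) (\<lambda>q. u11 q + \<epsilon> * v11 q) (\<lambda>q. u12 q + \<epsilon> * v12 q) (\<lambda>q. u22 q + \<epsilon> * v22 q)"
    by (rule jet_add_cmult[OF j jv])
  \<comment> \<open>On the outer sphere v is 0. Between the spheres L of the sum is positive, which
    \<open>no_interior_max\<close> forbids at a maximum.\<close>
  have w_le: "?w q \<le> m" if qK: "q \<in> K" for q
  proof -
    have "continuous_on K ?w" by (intro continuous_intros continuous_on_subset[OF cu KO] cp)
    then obtain t where t: "t \<in> K" "\<And>q. q \<in> K \<Longrightarrow> ?w q \<le> ?w t"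
      using continuous_attains_sup[OF cK, of ?w] qK by blast
    have "?w t \<le> m"
    proof (cases "dist p t = R \<or> dist p t = R / 2")
      case True
      then show ?thesis
      proof
        assume "dist p t = R"
        then have "v t = 0" by (simp add: v_def E_def r2)
        then show ?thesis using max[OF subsetD[OF KO t(1)]] by simp
      next
        assume t2: "dist p t = R / 2"
        then have "u t \<le> m - \<epsilon>" using z(2)[of t] by (simp add: \<epsilon>_def)
        moreover have "v t \<le> 1"
        proof -
          have "E t \<le> 1" unfolding E_def using k by (simp add: r2)
          then show ?thesis unfolding v_def by (smt (verit) exp_gt_zero)
        qed
        then have "\<epsilon> * v t \<le> \<epsilon> * 1" using eps by (intro mult_left_mono) auto
        ultimately show ?thesis by linarith
      qed
    next
      case False
      with t(1) have d: "R / 2 < dist p t" "dist p t < R" by (auto simp: K_def)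
      have ti: "t \<in> Omega_int" using ball d by auto
      define r where "r = min (dist p t - R / 2) (R - dist p t)"
      have r: "r > 0" using d by (simp add: r_def)
      have "?w q' \<le> ?w t" if "dist t q' < r" for q'
      proof (rule t(2))
        have "dist p q' < R" "dist p q' > R / 2"
          using that dist_triangle[of p q' t] dist_triangle[of p t q'] by (auto simp: r_def dist_commute)
        then show "q' \<in> K" by (simp add: K_def)
      qed
      from no_interior_max[OF jw ti r this]
      have "L u1 u2 u11 u12 u22 t + \<epsilon> * L v1 v2 v11 v12 v22 t \<le> 0"
        by (simp add: L_def algebra_simps)
      moreover have "\<epsilon> * L v1 v2 v11 v12 v22 t > 0" using eps Lv[OF int_ext[OF ti]] d by simp
      ultimately show ?thesis using sub[OF ti] by linarith
    qed
    then show ?thesis using t(2)[OF qK] by linarith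
  qed
  \<comment> \<open>A lower bound for the slope of the barrier from s towards p. At the parameter t
    it equals exp (- k R^2) (exp (k R^2 (2 t - t^2)) - 1), and 2 t - t^2 >= t.\<close>
  define \<delta> where "\<delta> = \<epsilon> * exp (- k * R\<^sup>2) * (k * R\<^sup>2)"
  have del: "\<delta> > 0" using eps k R by (simp add: \<delta>_def)
  have slope: "u (s + t *\<^sub>R (p - s)) - u s \<le> - \<delta> * t" if t: "0 \<le> t" "t \<le> 1/2" for t
  proof -
    let ?q = "s + t *\<^sub>R (p - s)"
    have "p - ?q = (1 - t) *\<^sub>R (p - s)" by (simp add: algebra_simps)
    then have dq: "dist p ?q = (1 - t) * R" using t s(1) by (simp add: dist_norm)
    have "R / 2 \<le> (1 - t) * R" "(1 - t) * R \<le> R"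
      using mult_right_mono[of "1/2" "1 - t" R] mult_right_mono[of "1 - t" 1 R] t R by simp_all
    then have "?q \<in> K" by (simp add: K_def dq)
    from w_le[OF this] have "u ?q \<le> m - \<epsilon> * v ?q" by simp
    moreover have "v ?q \<ge> exp (- k * R\<^sup>2) * (k * R\<^sup>2 * t)"
    proof -
      have "- k * r2 ?q = - k * R\<^sup>2 + k * R\<^sup>2 * (2 * t - t\<^sup>2)"
        unfolding r2 dq by (simp add: power2_eq_square algebra_simps)
      then have "v ?q = exp (- k * R\<^sup>2) * (exp (k * R\<^sup>2 * (2 * t - t\<^sup>2)) - 1)"
        unfolding v_def E_def by (simp only: exp_add right_diff_distrib mult_1_right)
      also have "\<dots> \<ge> exp (- k * R\<^sup>2) * (k * R\<^sup>2 * t)"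
      proof (rule mult_left_mono)
        have "t\<^sup>2 \<le> t" using t by (simp add: power2_eq_square mult_left_le)
        then have "k * R\<^sup>2 * t \<le> k * R\<^sup>2 * (2 * t - t\<^sup>2)" using k by (intro mult_left_mono) auto
        also have "\<dots> \<le> exp (k * R\<^sup>2 * (2 * t - t\<^sup>2)) - 1" using exp_ge_add_one_self[of "k * R\<^sup>2 * (2 * t - t\<^sup>2)"] by linarith
        finally show "k * R\<^sup>2 * t \<le> exp (k * R\<^sup>2 * (2 * t - t\<^sup>2)) - 1" .
      qed simp
      finally show ?thesis .
    qed
    then have "\<epsilon> * (exp (- k * R\<^sup>2) * (k * R\<^sup>2 * t)) \<le> \<epsilon> * v ?q" using eps by (intro mult_left_mono) auto
    ultimately show ?thesis using s(2) by (simp add: \<delta>_def mult_ac)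
  qed
  \<comment> \<open>The segment from s to p stays in the closed strip even if s is a boundary point,
    so the vanishing derivative at s applies along it.\<close>
  have "((\<lambda>t. u (s + t *\<^sub>R (p - s))) has_derivative (\<lambda>h. 0)) (at 0 within {0..1/2})"
  proof -
    have im: "(\<lambda>t. s + t *\<^sub>R (p - s)) ` {0..1/2} \<subseteq> Omega_ext"
    proof
      fix q assume "q \<in> (\<lambda>t. s + t *\<^sub>R (p - s)) ` {0..1/2}"
      then obtain t where t: "t \<in> {0..1/2}" "q = s + t *\<^sub>R (p - s)" by auto
      have "p \<in> ball p R" using R by simp
      then have "p \<in> Omega_ext" using ball int_ext by blast
      moreover have "convex Omega_ext" unfolding Omega_ext_def by (intro convex_Times) auto
      moreover have "q = (1 - t) *\<^sub>R s + t *\<^sub>R p" using t by (simp add: algebra_simps)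
      ultimately show "q \<in> Omega_ext" using sin t by (simp add: convexD)
    qed
    have "((\<lambda>t. s + t *\<^sub>R (p - s)) has_derivative (\<lambda>h. h *\<^sub>R (p - s))) (at 0 within {0..1/2})"
      by (auto intro!: derivative_eq_intros)
    from has_derivative_in_compose[OF this, of u "\<lambda>h. 0"] show ?thesis
      using has_derivative_subset[OF der im] by simp
  qed
  then have "((\<lambda>t. u (s + t *\<^sub>R (p - s))) has_real_derivative 0) (at 0 within {0..1/2})"
    by (simp add: has_field_derivative_def lambda_zero)
  then have lim: "((\<lambda>t. (u (s + t *\<^sub>R (p - s)) - u s) / t) \<longlongrightarrow> 0) (at 0 within {0..1/2})"
    by (simp add: has_field_derivative_iff)
  have "\<forall>\<^sub>F t in at 0 within {0..1/2}. (u (s + t *\<^sub>R (p - s)) - u s) / t \<le> - \<delta>"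
    unfolding eventually_at_filter
  proof (intro always_eventually allI impI)
    fix t :: real assume "t \<noteq> 0" "t \<in> {0..1/2}"
    then show "(u (s + t *\<^sub>R (p - s)) - u s) / t \<le> - \<delta>" using slope[of t] by (simp add: divide_le_eq)
  qed
  moreover have "at (0::real) within {0..1/2} \<noteq> bot" by (simp add: at_within_Icc_at_right)
  ultimately have "0 \<le> - \<delta>" using tendsto_upperbound[OF lim] by blast
  then show False using del by linarith
qed

end

context elliptic_operator begin

text \<open>Every maximum point is critical within the closed strip: in the interior by Fermat, and
  on the boundary because the tangential derivative vanishes and the conormal condition with G22 > 0
  removes the normal one. So \<open>Hopf\<close> forbids a ball in the open strip that is free of
  maximum points but has one on its sphere, be it interior or on the boundary.\<close>

theorem strong_maximum_principle:
  assumes j: "jet u u1 u2 u11 u12 u22" and cu: "continuous_on Omega_ext u" and cu2: "continuous_on Omega_ext u2"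
    and per: "\<And>x y. y \<in> {-1..1} \<Longrightarrow> u (x + 2 * pi, y) = u (x, y)"
    and D1: "dx1 u u1" and D2: "dx2 u u2"
    and sub: "\<And>q. q \<in> Omega_int \<Longrightarrow> 0 \<le> L u1 u2 u11 u12 u22 q"
    and bc: "\<And>x y. y \<in> {-1, 1} \<Longrightarrow> G12 (x, y) * u1 (x, y) + G22 (x, y) * u2 (x, y) = 0"
  shows "\<exists>c. \<forall>q\<in>Omega_ext. u q = c"
proof -
  obtain ua where ja: "jeta ua u u1 u2 u11 u12 u22" using j unfolding jet_def by blast
  have cp: "cper u" using cu per by (simp add: cper_def)
  have "Omega = cbox (0, -1) (2 * pi, 1)" unfolding Omega_def by (simp add: cbox_Pair_eq)
  then have "compact Omega" by (metis compact_cbox)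
  moreover have "Omega \<noteq> {}" by (auto simp: Omega_def)
  moreover have "continuous_on Omega u"
    by (rule continuous_on_subset[OF cu]) (auto simp: Omega_def Omega_ext_def)
  ultimately obtain z where z: "z \<in> Omega" "\<And>q. q \<in> Omega \<Longrightarrow> u q \<le> u z"
    using continuous_attains_sup by metis
  define m where "m = u z"
  have max: "u q \<le> m" if q: "q \<in> Omega_ext" for q
  proof -
    obtain x y where xy: "q = (x, y)" "y \<in> {-1..1}" using q by (auto simp: Omega_ext_def)
    obtain t where t: "x - 2 * pi * real_of_int t \<in> {0..2*pi}" by (rule reduce_period)
    have "u (x, y) = u (x - 2 * pi * real_of_int t, y)"
      using cper_periodic_int[OF cp xy(2), of "x - 2 * pi * real_of_int t" t] by simp
    then show ?thesis using z(2)[of "(x - 2 * pi * real_of_int t, y)"] t xy by (simp add: Omega_def m_def)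
  qed
  have zin: "z \<in> Omega_ext" using z(1) by (auto simp: Omega_def Omega_ext_def)
  have crit: "(u has_derivative (\<lambda>h. 0)) (at s within Omega_ext)" if s: "s \<in> Omega_ext" "u s = m" for s
  proof -
    obtain x y where xy: "s = (x, y)" and y: "y \<in> {-1..1}" using s by (auto simp: Omega_ext_def)
    have d1: "((\<lambda>x. u (x, y)) has_real_derivative u1 (x, y)) (at x)" for x using D1 y by (simp add: dx1_def)
    have 1: "u1 (x, y) = 0"
      by (rule DERIV_local_max[OF d1, of 1 x]) (use max s y in \<open>auto simp: xy Omega_ext_def\<close>)
    have 2: "u2 (x, y) = 0"
    proof (cases "y \<in> {-1, 1}")
      case True
      then show ?thesis using bc[OF True, of x] 1 G_pos(1)[OF s(1)] by (simp add: xy)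
    next
      case False
      then have y': "y \<in> {-1<..<1}" using y by auto
      have "((\<lambda>y. u (x, y)) has_real_derivative u2 (x, y)) (at y)" by (rule jetaD(5)[OF ja y'])
      moreover define r where "r = min (1 - y) (1 + y)"
      moreover have "r > 0" using y' by (simp add: r_def)
      moreover have "\<forall>y'. \<bar>y - y'\<bar> < r \<longrightarrow> u (x, y') \<le> u (x, y)"
      proof (intro allI impI)
        fix y' assume "\<bar>y - y'\<bar> < r"
        then have "-1 \<le> y'" "y' \<le> 1" unfolding r_def by linarith+
        then show "u (x, y') \<le> u (x, y)" using max[of "(x, y')"] s by (simp add: xy Omega_ext_def)
      qed
      ultimately show ?thesis by (metis DERIV_local_max)
    qed
    have "(u has_derivative (\<lambda>h. u1 (x, y) * fst h + u2 (x, y) * snd h)) (at (x, y) within UNIV \<times> {-1..1})"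
      by (rule has_derivative_of_partials[where F = u and ?F1.0 = u1 and ?F2.0 = u2])
        (use d1 D2 y cu2 in \<open>auto simp: dx2_def Omega_ext_def\<close>)
    then show ?thesis by (simp add: 1 2 xy Omega_ext_def)
  qed
  have touch: False if "R > 0" "ball p R \<subseteq> Omega_int" "\<And>q. q \<in> ball p R \<Longrightarrow> u q < m" "dist p s = R" "u s = m" "s \<in> Omega_ext" for p R s
    using Hopf[OF j cu sub that(1,2) _ max that(4,5) crit[OF that(6,5)] that(6)] that(3) by blast
  have lt: "u q < m" if "q \<in> Omega_ext" "u q \<noteq> m" for q using max[OF that(1)] that(2) by simp
  have ball_in: "ball p R \<subseteq> Omega_int" if "R \<le> 1 - \<bar>snd p\<bar>" for p :: "real \<times> real" and R
  proof
    fix q assume "q \<in> ball p R"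
    then have "\<bar>snd p - snd q\<bar> < R" using dist_snd_le[of p q] by (simp add: dist_real_def)
    then have "\<bar>snd q\<bar> < 1" using that by linarith
    then show "q \<in> Omega_int" by (cases q) (auto simp: Omega_int_def abs_less_iff)
  qed
  let ?T = "{q \<in> Omega_int. u q = m}"
  \<comment> \<open>If the maximum were attained on the boundary only, the unit ball around the
    midpoint (x, 0) would touch it at z.\<close>
  have interior_max: "?T \<noteq> {}"
  proof
    assume T: "?T = {}"
    obtain x y where xy: "z = (x, y)" "y \<in> {-1..1}" using zin by (auto simp: Omega_ext_def)
    have "z \<notin> Omega_int"
    proof
      assume "z \<in> Omega_int"
      then have "z \<in> ?T" by (simp add: m_def)
      then show False using T by blast
    qed
    then have "y \<in> {-1, 1}" using xy by (auto simp: Omega_int_def)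
    then have dz: "dist (x, 0) z = 1" by (auto simp: xy dist_prod_def dist_real_def)
    have b: "ball (x, 0) 1 \<subseteq> Omega_int" by (rule ball_in) simp
    have "u q < m" if "q \<in> ball (x, 0) 1" for q
    proof (rule lt)
      have "q \<in> Omega_int" using b that by (rule subsetD)
      then show "q \<in> Omega_ext" by (rule int_ext)
      have "q \<notin> ?T" unfolding T by simp
      then show "u q \<noteq> m" using \<open>q \<in> Omega_int\<close> by simp
    qed
    from touch[OF zero_less_one b this dz _ zin] show False by (simp add: m_def)
  qed
  have "openin (top_of_set Omega_int) ?T"
    unfolding openin_open_eq[OF open_Omega_int]
  proof
    show "?T \<subseteq> Omega_int" by auto
    show "open ?T"
      unfolding open_contains_ball
    proof
      fix e assume e: "e \<in> ?T"
      \<comment> \<open>Half the distance from e to the boundary: for p in this ball, the closed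
        ball around p through e stays in the open strip.\<close>
      define r where "r = (1 - \<bar>snd e\<bar>) / 2"
      have r: "r > 0" using e by (auto simp: r_def Omega_int_def)
      have "ball e r \<subseteq> ?T"
      proof
        fix p assume p: "p \<in> ball e r"
        have pi: "p \<in> Omega_int" using ball_in[of r e] p r unfolding r_def by auto
        have "u p = m"
        proof (rule ccontr)
          assume ne: "u p \<noteq> m"
          define d where "d = dist p e"
          have d: "d < r" using p by (simp add: d_def dist_commute)
          have sp: "\<bar>snd p\<bar> \<le> \<bar>snd e\<bar> + d" using dist_snd_le[of p e] by (simp add: d_def dist_real_def)
          have cb: "cball p d \<subseteq> Omega_int"
          proof
            fix q assume "q \<in> cball p d"
            then have "q \<in> ball p (d + (r - d))" using d by auto
            moreover have "d + (r - d) \<le> 1 - \<bar>snd p\<bar>" using sp d unfolding r_def by (simp add: field_simps)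
            ultimately show "q \<in> Omega_int" using ball_in by blast
          qed
          let ?S = "{q \<in> cball p d. u q = m}"
          have "continuous_on (cball p d) u" by (rule continuous_on_subset[OF cu]) (use cb int_ext in blast)
          then have "closed ?S" using continuous_closed_preimage_constant[of "cball p d" u m] by simp
          moreover have "bounded ?S" by (rule bounded_subset[OF bounded_cball[of p d]]) auto
          ultimately have cS: "compact ?S" by (simp add: compact_eq_bounded_closed)
          have eS: "e \<in> ?S" using e by (simp add: d_def)
          have "continuous_on ?S (dist p)" by (intro continuous_intros)
          \<comment> \<open>A maximum point nearest to p: the open ball around p through s contains
            no maximum point.\<close>
          then obtain s where s: "s \<in> ?S" "\<And>q. q \<in> ?S \<Longrightarrow> dist p s \<le> dist p q"
            using continuous_attains_inf[OF cS] eS by blast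
          have sd: "dist p s \<le> d" using s(1) by simp
          have pos: "dist p s > 0" using s(1) ne by auto
          have bs: "ball p (dist p s) \<subseteq> cball p d" using sd by auto
          show False
          proof (rule touch[OF pos _ _ refl])
            show "ball p (dist p s) \<subseteq> Omega_int" using bs cb by blast
            show "u q < m" if q: "q \<in> ball p (dist p s)" for q
            proof (rule lt)
              show "q \<in> Omega_ext" using q bs cb int_ext by blast
              show "u q \<noteq> m" using s(2)[of q] q bs by auto
            qed
            show "u s = m" using s(1) by simp
            show "s \<in> Omega_ext" using s(1) cb int_ext by blast
          qed
        qed
        then show "p \<in> ?T" using pi by simp
      qed
      then show "\<exists>r>0. ball e r \<subseteq> ?T" using r by blast
    qed
  qed
  moreover have "closedin (top_of_set Omega_int) ?T"
    by (rule continuous_closedin_preimage_constant) (rule continuous_on_subset[OF cu], use int_ext in blast)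
  moreover have "connected Omega_int"
    unfolding Omega_int_def by (intro convex_connected convex_Times) auto
  ultimately have T: "?T = Omega_int" using interior_max unfolding connected_clopen by blast
  have "u q = m" if q: "q \<in> Omega_ext" for q
  proof -
    have "closure Omega_int = Omega_ext" unfolding Omega_int_def Omega_ext_def closure_Times by simp
    then have "continuous_on (closure Omega_int) u" using cu by simp
    from continuous_constant_on_closure[OF this, of m q] T q \<open>closure Omega_int = Omega_ext\<close> show ?thesis by auto
  qed
  then show ?thesis by blast
qed

text \<open>Whichever the sign of \<open>\<kappa>\<close>, either u or - u is a subsolution and thus
  constant. A constant has its maximum everywhere, so \<open>no_interior_max\<close> at the origin
  gives the opposite sign.\<close>

lemma constant_source:
  assumes j: "jet u u1 u2 u11 u12 u22" and cu: "continuous_on Omega_ext u" and cu2: "continuous_on Omega_ext u2"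
    and per: "\<And>x y. y \<in> {-1..1} \<Longrightarrow> u (x + 2 * pi, y) = u (x, y)"
    and D1: "dx1 u u1" and D2: "dx2 u u2"
    and eq: "\<And>q. q \<in> Omega_int \<Longrightarrow> L u1 u2 u11 u12 u22 q = \<kappa>"
    and bc: "\<And>x y. y \<in> {-1, 1} \<Longrightarrow> G12 (x, y) * u1 (x, y) + G22 (x, y) * u2 (x, y) = 0"
  shows "\<kappa> = 0 \<and> (\<exists>c. \<forall>q\<in>Omega_ext. u q = c)"
proof -
  have z: "(0, 0) \<in> Omega_int" by (simp add: Omega_int_def)
  have b: "q' \<in> Omega_ext" if "dist (0, 0) q' < 1" for q' :: "real \<times> real"
    using that dist_snd_le[of "(0,0)" q'] by (cases q') (auto simp: Omega_ext_def dist_real_def)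
  let ?n = "\<lambda>f q. - f q :: real"
  have jn: "jet (?n u) (?n u1) (?n u2) (?n u11) (?n u12) (?n u22)"
  proof -
    have "jet (\<lambda>q. 0) (\<lambda>q. 0) (\<lambda>q. 0) (\<lambda>q. 0) (\<lambda>q. 0) (\<lambda>q. 0)"
      unfolding jet_def jeta_def by (intro exI[of _ "\<lambda>q. 0"]) simp
    from jet_add_cmult[OF this j, of "-1"] show ?thesis by simp
  qed
  have Ln: "L (?n u1) (?n u2) (?n u11) (?n u12) (?n u22) q = - L u1 u2 u11 u12 u22 q" for q
    by (simp add: L_def)
  show ?thesis
  proof (cases "\<kappa> \<ge> 0")
    case True
    then obtain c where c: "\<And>q. q \<in> Omega_ext \<Longrightarrow> u q = c"
      using strong_maximum_principle[OF j cu cu2 per D1 D2 _ bc] eq by auto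
    have "L u1 u2 u11 u12 u22 (0, 0) \<le> 0"
      by (rule no_interior_max[OF j z zero_less_one]) (use c b int_ext[OF z] in simp)
    then show ?thesis using True eq[OF z] c by auto
  next
    case False
    have d: "dx1 (?n u) (?n u1)" "dx2 (?n u) (?n u2)" using D1 D2 by (auto simp: dx1_def dx2_def intro: DERIV_minus)
    have "\<exists>c. \<forall>q\<in>Omega_ext. ?n u q = c"
    proof (rule strong_maximum_principle[OF jn _ _ _ d])
      show "continuous_on Omega_ext (?n u)" "continuous_on Omega_ext (?n u2)" by (intro continuous_intros cu cu2)+
      show "0 \<le> L (?n u1) (?n u2) (?n u11) (?n u12) (?n u22) q" if "q \<in> Omega_int" for q using False eq[OF that] by (simp add: Ln)
      show "G12 (x, y) * - u1 (x, y) + G22 (x, y) * - u2 (x, y) = 0" if "y \<in> {-1, 1}" for x y using bc[OF that, of x] by simp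
    qed (use per in simp)
    then obtain c where c: "\<And>q. q \<in> Omega_ext \<Longrightarrow> - u q = c" by blast
    have "L (?n u1) (?n u2) (?n u11) (?n u12) (?n u22) (0, 0) \<le> 0"
      by (rule no_interior_max[OF jn z zero_less_one]) (use c b int_ext[OF z] in simp)
    then have "\<kappa> \<ge> 0" using eq[OF z] by (simp add: Ln)
    then show ?thesis using False by simp
  qed
qed

end

section \<open>The generator, its adjoint and the probability current\<close>

definition pdx1 :: "real set \<Rightarrow> (real \<times> real \<Rightarrow> real) \<Rightarrow> (real \<times> real \<Rightarrow> real) \<Rightarrow> bool" where
  "pdx1 Y X X' \<longleftrightarrow> (\<forall>x y. y \<in> Y \<longrightarrow> ((\<lambda>x. X (x, y)) has_real_derivative X' (x, y)) (at x))"

text \<open>The derivative is taken within \<open>{-1..1}\<close> whatever \<open>Y\<close> is, so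
  that it agrees with \<open>pd 2\<close>.\<close>

definition pdx2 :: "real set \<Rightarrow> (real \<times> real \<Rightarrow> real) \<Rightarrow> (real \<times> real \<Rightarrow> real) \<Rightarrow> bool" where
  "pdx2 Y X X' \<longleftrightarrow> (\<forall>x y. y \<in> Y \<longrightarrow> ((\<lambda>y. X (x, y)) has_real_derivative X' (x, y)) (at y within {-1..1}))"

lemma dx1_pdx1: "dx1 = pdx1 {-1..1}" and dx2_pdx2: "dx2 = pdx2 {-1..1}"
  by (auto simp: fun_eq_iff dx1_def pdx1_def dx2_def pdx2_def)

lemma pdx1_mono: "pdx1 Y X X' \<Longrightarrow> Z \<subseteq> Y \<Longrightarrow> pdx1 Z X X'" and pdx2_mono: "pdx2 Y X X' \<Longrightarrow> Z \<subseteq> Y \<Longrightarrow> pdx2 Z X X'"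
  unfolding pdx1_def pdx2_def by blast+

lemma pdx1_mult: "pdx1 Y A A' \<Longrightarrow> pdx1 Y B B' \<Longrightarrow> pdx1 Y (\<lambda>q. A q * B q) (\<lambda>q. A' q * B q + A q * B' q)"
  and pdx2_mult: "pdx2 Y A A' \<Longrightarrow> pdx2 Y B B' \<Longrightarrow> pdx2 Y (\<lambda>q. A q * B q) (\<lambda>q. A' q * B q + A q * B' q)"
  unfolding pdx1_def pdx2_def by (auto intro!: DERIV_cong[OF DERIV_mult])

lemma pdx1_add: "pdx1 Y A A' \<Longrightarrow> pdx1 Y B B' \<Longrightarrow> pdx1 Y (\<lambda>q. A q + B q) (\<lambda>q. A' q + B' q)"
  and pdx2_add: "pdx2 Y A A' \<Longrightarrow> pdx2 Y B B' \<Longrightarrow> pdx2 Y (\<lambda>q. A q + B q) (\<lambda>q. A' q + B' q)"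
  and pdx1_cmult: "pdx1 Y A A' \<Longrightarrow> pdx1 Y (\<lambda>q. r * A q) (\<lambda>q. r * A' q)"
  and pdx2_cmult: "pdx2 Y A A' \<Longrightarrow> pdx2 Y (\<lambda>q. r * A q) (\<lambda>q. r * A' q)"
  unfolding pdx1_def pdx2_def by (auto intro!: DERIV_add DERIV_cmult)

lemma pdx1_inverse: "pdx1 Y A A' \<Longrightarrow> (\<And>x y. y \<in> Y \<Longrightarrow> A (x, y) \<noteq> 0) \<Longrightarrow> pdx1 Y (\<lambda>q. inverse (A q)) (\<lambda>q. -1 * (A' q * (inverse (A q) * inverse (A q))))"
  and pdx2_inverse: "pdx2 Y A A' \<Longrightarrow> (\<And>x y. y \<in> Y \<Longrightarrow> A (x, y) \<noteq> 0) \<Longrightarrow> pdx2 Y (\<lambda>q. inverse (A q)) (\<lambda>q. -1 * (A' q * (inverse (A q) * inverse (A q))))"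
  unfolding pdx1_def pdx2_def by (auto intro!: DERIV_cong[OF DERIV_inverse'])

lemma pdx1_cong: "pdx1 Y A A' \<Longrightarrow> (\<And>x y. y \<in> Y \<Longrightarrow> B (x, y) = A (x, y)) \<Longrightarrow> (\<And>x y. y \<in> Y \<Longrightarrow> B' (x, y) = A' (x, y)) \<Longrightarrow> pdx1 Y B B'"
  unfolding pdx1_def by simp

lemma pdx1_pd: "pdx1 Y A A' \<Longrightarrow> y \<in> Y \<Longrightarrow> pd 1 A (x, y) = A' (x, y)"
  unfolding pdx1_def pd_def
  by (auto intro!: vector_derivative_at simp: has_real_derivative_iff_has_vector_derivative)

lemma pdx2_pd:
  assumes "pdx2 Y A A'" "y \<in> Y" "Y \<subseteq> {-1..1}" shows "pd 2 A (x, y) = A' (x, y)"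
proof -
  have "((\<lambda>y. A (x, y)) has_vector_derivative A' (x, y)) (at y within {-1..1})"
    using assms unfolding pdx2_def has_real_derivative_iff_has_vector_derivative by blast
  from vector_derivative_within_closed_interval[OF _ _ this] assms(2,3)
  show ?thesis by (auto simp: pd_def)
qed

lemma has_pds_pdx:
  assumes "\<And>p. p \<in> UNIV \<times> Y \<Longrightarrow> has_pds u p"
  shows "pdx1 Y u (pd 1 u)" "pdx2 Y u (pd 2 u)"
proof -
  have "((\<lambda>a. u (a, y)) has_real_derivative pd 1 u (x, y)) (at x)" "((\<lambda>b. u (x, b)) has_real_derivative pd 2 u (x, y)) (at y within {-1..1})" if "y \<in> Y" for x y
    using assms[of "(x, y)"] that unfolding has_pds_def pd_def has_real_derivative_iff_has_vector_derivative
    by (simp_all add: vector_derivative_works)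
  then show "pdx1 Y u (pd 1 u)" "pdx2 Y u (pd 2 u)" unfolding pdx1_def pdx2_def by blast+
qed

lemma C1_extD:
  assumes "C1_on Omega_ext u"
  shows "continuous_on Omega_ext u" "continuous_on Omega_ext (pd 1 u)" "continuous_on Omega_ext (pd 2 u)"
    "pdx1 {-1..1} u (pd 1 u)" "pdx2 {-1..1} u (pd 2 u)"
  using assms has_pds_pdx[of "{-1..1}" u] unfolding C1_on_def Omega_ext_def by auto

lemma C1_intD:
  assumes "C1_on Omega_int u"
  shows "continuous_on Omega_int u" "continuous_on Omega_int (pd 1 u)" "continuous_on Omega_int (pd 2 u)"
    "pdx1 {-1<..<1} u (pd 1 u)" "pdx2 {-1<..<1} u (pd 2 u)"
  using assms has_pds_pdx[of "{-1<..<1}" u] unfolding C1_on_def Omega_int_def by auto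

lemma C1_onI:
  assumes "S = UNIV \<times> Y" "Y \<subseteq> {-1..1}" "continuous_on S u" "continuous_on S u1" "continuous_on S u2" "pdx1 Y u u1" "pdx2 Y u u2"
  shows "C1_on S u"
  unfolding C1_on_def
proof (intro conjI ballI)
  show "continuous_on S (pd 1 u)" by (rule continuous_on_eq[OF assms(4)]) (use pdx1_pd[OF assms(6)] assms(1) in auto)
  show "continuous_on S (pd 2 u)" by (rule continuous_on_eq[OF assms(5)]) (use pdx2_pd[OF assms(7) _ assms(2)] assms(1) in auto)
  show "has_pds u p" if "p \<in> S" for p
    using that assms(1,6,7) unfolding has_pds_def pdx1_def pdx2_def
    by (auto simp: real_differentiable_def) blast+
qed (rule assms(3))

text \<open>The constant r admits functions that are periodic up to an additive constant, as a
  solution T is; their derivatives are periodic.\<close>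

lemma pdx1_periodic:
  assumes "pdx1 Y u u1" "\<And>x y. y \<in> Y \<Longrightarrow> u (x + 2 * pi, y) = u (x, y) + r" "y \<in> Y"
  shows "u1 (x + 2 * pi, y) = u1 (x, y)"
proof -
  have "((\<lambda>x. u (x, y)) has_real_derivative u1 (x + 2 * pi, y)) (at (x + 2 * pi))"
    using assms(1,3) unfolding pdx1_def by blast
  then have "((\<lambda>x. u (x + 2 * pi, y)) has_real_derivative u1 (x + 2 * pi, y)) (at x)" by (rule DERIV_shift[THEN iffD1])
  then have "((\<lambda>x. u (x, y) + r) has_real_derivative u1 (x + 2 * pi, y)) (at x)" using assms(2,3) by simp
  moreover have "((\<lambda>x. u (x, y) + r) has_real_derivative u1 (x, y) + 0) (at x)"
    using assms(1,3) unfolding pdx1_def by (intro DERIV_add DERIV_const) blast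
  ultimately show ?thesis using DERIV_unique by fastforce
qed

lemma pdx2_periodic:
  assumes "pdx2 Y u u2" "\<And>x y. y \<in> {-1..1} \<Longrightarrow> u (x + 2 * pi, y) = u (x, y) + r" "y \<in> Y" "Y \<subseteq> {-1..1}"
  shows "u2 (x + 2 * pi, y) = u2 (x, y)"
proof -
  have yy: "y \<in> {-1..1}" using assms by auto
  have "((\<lambda>y. u (x, y) + r) has_real_derivative u2 (x, y) + 0) (at y within {-1..1})"
    using assms(1,3) unfolding pdx2_def by (intro DERIV_add DERIV_const) blast
  then have a: "((\<lambda>y. u (x + 2 * pi, y)) has_real_derivative u2 (x, y)) (at y within {-1..1})"
    using has_field_derivative_transform_within[OF _ zero_less_one yy, of "\<lambda>y. u (x, y) + r" "u2 (x, y) + 0" "\<lambda>y. u (x + 2 * pi, y)"] assms(2) by simp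
  have b: "((\<lambda>y. u (x + 2 * pi, y)) has_real_derivative u2 (x + 2 * pi, y)) (at y within {-1..1})"
    using assms(1,3) unfolding pdx2_def by blast
  show ?thesis
    using vector_derivative_within_closed_interval[OF _ yy a[unfolded has_real_derivative_iff_has_vector_derivative]]
      vector_derivative_within_closed_interval[OF _ yy b[unfolded has_real_derivative_iff_has_vector_derivative]] by simp
qed

section \<open>The algebra of periodic C^2 coefficients\<close>

definition C2x :: "(real \<times> real \<Rightarrow> real) \<Rightarrow> bool" where
  "C2x X \<longleftrightarrow> (\<exists>X1 X2 X11 X12 X21 X22. cper X \<and> cper X1 \<and> cper X2 \<and> cper X11 \<and> cper X12 \<and> cper X21 \<and> cper X22
     \<and> pdx1 {-1..1} X X1 \<and> pdx2 {-1..1} X X2 \<and> pdx1 {-1..1} X1 X11 \<and> pdx2 {-1..1} X1 X12 \<and> pdx1 {-1..1} X2 X21 \<and> pdx2 {-1..1} X2 X22)"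

lemma C2xI:
  assumes "pdx1 {-1..1} X X1" "pdx2 {-1..1} X X2" "pdx1 {-1..1} X1 X11" "pdx2 {-1..1} X1 X12" "pdx1 {-1..1} X2 X21" "pdx2 {-1..1} X2 X22"
    "cper X" "cper X1" "cper X2" "cper X11" "cper X12" "cper X21" "cper X22"
  shows "C2x X"
  unfolding C2x_def using assms by blast

lemma C2x_C2p: "C2x X \<Longrightarrow> C2p X"
  unfolding C2x_def C2p_def dx1_pdx1 dx2_pdx2 by blast

lemma cper_mult: "cper X \<Longrightarrow> cper Y \<Longrightarrow> cper (\<lambda>q. X q * Y q)"
  and cper_add: "cper X \<Longrightarrow> cper Y \<Longrightarrow> cper (\<lambda>q. X q + Y q)"
  and cper_cmult: "cper X \<Longrightarrow> cper (\<lambda>q. r * X q)"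
  unfolding cper_def by (auto intro: continuous_intros)

lemma cper_inverse: "cper X \<Longrightarrow> (\<And>x y. y \<in> {-1..1} \<Longrightarrow> X (x, y) \<noteq> 0) \<Longrightarrow> cper (\<lambda>q. inverse (X q))"
  unfolding cper_def by (auto intro!: continuous_on_inverse simp: Omega_ext_def)

lemma C2x_mult: assumes "C2x X" "C2x Y" shows "C2x (\<lambda>q. X q * Y q)"
proof -
  obtain X1 X2 X11 X12 X21 X22 where cX: "cper X" "cper X1" "cper X2" "cper X11" "cper X12" "cper X21" "cper X22"
    and dX: "pdx1 {-1..1} X X1" "pdx2 {-1..1} X X2" "pdx1 {-1..1} X1 X11" "pdx2 {-1..1} X1 X12" "pdx1 {-1..1} X2 X21" "pdx2 {-1..1} X2 X22"
    using assms(1) unfolding C2x_def by blast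
  obtain Y1 Y2 Y11 Y12 Y21 Y22 where cY: "cper Y" "cper Y1" "cper Y2" "cper Y11" "cper Y12" "cper Y21" "cper Y22"
    and dY: "pdx1 {-1..1} Y Y1" "pdx2 {-1..1} Y Y2" "pdx1 {-1..1} Y1 Y11" "pdx2 {-1..1} Y1 Y12" "pdx1 {-1..1} Y2 Y21" "pdx2 {-1..1} Y2 Y22"
    using assms(2) unfolding C2x_def by blast
  show ?thesis
    by (rule C2xI[OF pdx1_mult[OF dX(1) dY(1)] pdx2_mult[OF dX(2) dY(2)]
       pdx1_add[OF pdx1_mult[OF dX(3) dY(1)] pdx1_mult[OF dX(1) dY(3)]] pdx2_add[OF pdx2_mult[OF dX(4) dY(2)] pdx2_mult[OF dX(2) dY(4)]]
       pdx1_add[OF pdx1_mult[OF dX(5) dY(1)] pdx1_mult[OF dX(1) dY(5)]] pdx2_add[OF pdx2_mult[OF dX(6) dY(2)] pdx2_mult[OF dX(2) dY(6)]]])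
      (intro cper_add cper_mult cX cY)+
qed

lemma C2x_add: assumes "C2x X" "C2x Y" shows "C2x (\<lambda>q. X q + Y q)"
proof -
  obtain X1 X2 X11 X12 X21 X22 where cX: "cper X" "cper X1" "cper X2" "cper X11" "cper X12" "cper X21" "cper X22"
    and dX: "pdx1 {-1..1} X X1" "pdx2 {-1..1} X X2" "pdx1 {-1..1} X1 X11" "pdx2 {-1..1} X1 X12" "pdx1 {-1..1} X2 X21" "pdx2 {-1..1} X2 X22"
    using assms(1) unfolding C2x_def by blast
  obtain Y1 Y2 Y11 Y12 Y21 Y22 where cY: "cper Y" "cper Y1" "cper Y2" "cper Y11" "cper Y12" "cper Y21" "cper Y22"
    and dY: "pdx1 {-1..1} Y Y1" "pdx2 {-1..1} Y Y2" "pdx1 {-1..1} Y1 Y11" "pdx2 {-1..1} Y1 Y12" "pdx1 {-1..1} Y2 Y21" "pdx2 {-1..1} Y2 Y22"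
    using assms(2) unfolding C2x_def by blast
  show ?thesis
    by (rule C2xI[OF pdx1_add[OF dX(1) dY(1)] pdx2_add[OF dX(2) dY(2)] pdx1_add[OF dX(3) dY(3)] pdx2_add[OF dX(4) dY(4)]
       pdx1_add[OF dX(5) dY(5)] pdx2_add[OF dX(6) dY(6)]]) (intro cper_add cX cY)+
qed

lemma C2x_cmult: assumes "C2x X" shows "C2x (\<lambda>q. r * X q)"
proof -
  obtain X1 X2 X11 X12 X21 X22 where cX: "cper X" "cper X1" "cper X2" "cper X11" "cper X12" "cper X21" "cper X22"
    and dX: "pdx1 {-1..1} X X1" "pdx2 {-1..1} X X2" "pdx1 {-1..1} X1 X11" "pdx2 {-1..1} X1 X12" "pdx1 {-1..1} X2 X21" "pdx2 {-1..1} X2 X22"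
    using assms(1) unfolding C2x_def by blast
  show ?thesis
    by (rule C2xI[OF pdx1_cmult[OF dX(1)] pdx2_cmult[OF dX(2)] pdx1_cmult[OF dX(3)] pdx2_cmult[OF dX(4)]
       pdx1_cmult[OF dX(5)] pdx2_cmult[OF dX(6)]]) (intro cper_cmult cX)+
qed

text \<open>Applied to \<open>Gm g 2 2\<close>, by which the equation is divided.\<close>

lemma C2x_inverse: assumes "C2x X" and nz: "\<And>x y. y \<in> {-1..1} \<Longrightarrow> X (x, y) \<noteq> 0" shows "C2x (\<lambda>q. inverse (X q))"
proof -
  obtain X1 X2 X11 X12 X21 X22 where cX: "cper X" "cper X1" "cper X2" "cper X11" "cper X12" "cper X21" "cper X22"
    and dX: "pdx1 {-1..1} X X1" "pdx2 {-1..1} X X2" "pdx1 {-1..1} X1 X11" "pdx2 {-1..1} X1 X12" "pdx1 {-1..1} X2 X21" "pdx2 {-1..1} X2 X22"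
    using assms(1) unfolding C2x_def by blast
  note i1 = pdx1_inverse[OF dX(1) nz] and i2 = pdx2_inverse[OF dX(2) nz]
  note c = cper_inverse[OF cX(1) nz]
  show ?thesis
    by (rule C2xI[OF i1 i2 pdx1_cmult[OF pdx1_mult[OF dX(3) pdx1_mult[OF i1 i1]]] pdx2_cmult[OF pdx2_mult[OF dX(4) pdx2_mult[OF i2 i2]]]
       pdx1_cmult[OF pdx1_mult[OF dX(5) pdx1_mult[OF i1 i1]]] pdx2_cmult[OF pdx2_mult[OF dX(6) pdx2_mult[OF i2 i2]]]])
     (assumption | intro cper_add cper_cmult cper_mult cX c)+
qed

lemma C2_on_C2x:
  assumes C: "C2_on Omega_ext X" and per: "\<And>x y. y \<in> {-1..1} \<Longrightarrow> X (x + 2 * pi, y) = X (x, y)"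
  shows "C2x X"
proof -
  have C': "C1_on Omega_ext X" "C1_on Omega_ext (pd 1 X)" "C1_on Omega_ext (pd 2 X)" using C by (auto simp: C2_on_def)
  note D = C1_extD[OF C'(1)] and D1 = C1_extD[OF C'(2)] and D2 = C1_extD[OF C'(3)]
  have p1: "pd 1 X (x + 2 * pi, y) = pd 1 X (x, y)" "pd 2 X (x + 2 * pi, y) = pd 2 X (x, y)" if "y \<in> {-1..1}" for x y
    using pdx1_periodic[OF D(4) _ that, of 0] pdx2_periodic[OF D(5) _ that, of 0] per by simp_all
  have p2: "pd 1 (pd 1 X) (x + 2 * pi, y) = pd 1 (pd 1 X) (x, y)" "pd 2 (pd 1 X) (x + 2 * pi, y) = pd 2 (pd 1 X) (x, y)"
     "pd 1 (pd 2 X) (x + 2 * pi, y) = pd 1 (pd 2 X) (x, y)" "pd 2 (pd 2 X) (x + 2 * pi, y) = pd 2 (pd 2 X) (x, y)" if "y \<in> {-1..1}" for x y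
    using pdx1_periodic[OF D1(4) _ that, of 0] pdx2_periodic[OF D1(5) _ that, of 0]
      pdx1_periodic[OF D2(4) _ that, of 0] pdx2_periodic[OF D2(5) _ that, of 0] p1 by simp_all
  show ?thesis
    by (rule C2xI[OF D(4,5) D1(4,5) D2(4,5)]) (use D D1 D2 per p1 p2 in \<open>simp_all add: cper_def\<close>)
qed

text \<open>The divergence theorem on a rectangle that may reach the edges of the strip, where the
  derivatives \<open>D1\<close> and \<open>D2\<close> may be unbounded. The integral of
  \<open>V2\<close> over a horizontal section is continuous up to the edges and differentiable
  inside; the fundamental theorem for interior derivatives then gives the vertical integral.\<close>

lemma divergence_identity:
  fixes V1 V2 d D1 D2 :: "real \<times> real \<Rightarrow> real"
  assumes c: "continuous_on Omega_ext V2"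
    and cD: "continuous_on Omega_int D1" "continuous_on Omega_int D2"
    and p: "pdx1 {-1<..<1} V1 D1" "pdx2 {-1<..<1} V2 D2"
    and d: "\<And>q. q \<in> Omega_int \<Longrightarrow> D1 q + D2 q = d q" and x: "x0 \<le> x1" and b: "-1 \<le> b0" "b0 \<le> b1" "b1 \<le> 1"
  shows "((\<lambda>y. V1 (x1, y) - V1 (x0, y) - integral {x0..x1} (\<lambda>x. d (x, y))) has_integral
     (integral {x0..x1} (\<lambda>x. V2 (x, b0)) - integral {x0..x1} (\<lambda>x. V2 (x, b1)))) {b0..b1}"
proof -
  let ?m = "\<lambda>y. integral {x0..x1} (\<lambda>x. V2 (x, y))"
  let ?h = "\<lambda>y. V1 (x1, y) - V1 (x0, y) - integral {x0..x1} (\<lambda>x. d (x, y))"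
  have cm: "continuous_on {-1..1} ?m"
  proof -
    have "continuous_on ({-1..1} \<times> cbox x0 x1) (\<lambda>(y, x). V2 (x, y))"
      unfolding split_beta by (rule continuous_on_compose2[OF c]) (auto intro!: continuous_intros simp: Omega_ext_def)
    from integral_continuous_on_param[OF this] show ?thesis by simp
  qed
  have sec: "continuous_on {x0..x1} (\<lambda>x. F (x, y))" if "continuous_on Omega_int F" "y \<in> {-1<..<1}" for F and y :: real
    by (rule continuous_on_compose2[OF that(1)]) (use that(2) in \<open>auto intro!: continuous_intros simp: Omega_int_def\<close>)
  have dm: "(?m has_real_derivative - ?h y) (at y)" if y: "y \<in> {-1<..<1}" for y
  proof -
    have "((\<lambda>y. integral (cbox x0 x1) ((\<lambda>y x. V2 (x, y)) y)) has_field_derivative integral (cbox x0 x1) ((\<lambda>y x. D2 (x, y)) y)) (at y within {-1<..<1})"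
    proof (rule leibniz_rule_field_derivative)
      show "((\<lambda>y. V2 (t, y)) has_real_derivative D2 (t, y)) (at y within {-1<..<1})" if "y \<in> {-1<..<1}" for y t
        using p(2) that unfolding pdx2_def by (meson greaterThanLessThan_subseteq_atLeastAtMost_iff has_field_derivative_subset order_refl)
      show "(\<lambda>x. V2 (x, y)) integrable_on cbox x0 x1" if "y \<in> {-1<..<1}" for y
      proof -
        have "continuous_on (cbox x0 x1) (\<lambda>x. V2 (x, y))"
          by (rule continuous_on_compose2[OF c]) (use that in \<open>auto intro!: continuous_intros simp: Omega_ext_def\<close>)
        then show ?thesis by (rule integrable_continuous)
      qed
      show "continuous_on ({-1<..<1} \<times> cbox x0 x1) (\<lambda>(y, x). D2 (x, y))"
        unfolding split_beta by (rule continuous_on_compose2[OF cD(2)]) (auto intro!: continuous_intros simp: Omega_int_def)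
    qed (use y in auto)
    then have "(?m has_real_derivative integral {x0..x1} (\<lambda>x. D2 (x, y))) (at y)"
      using at_within_open[OF y] by simp
    moreover have "integral {x0..x1} (\<lambda>x. D2 (x, y)) = - ?h y"
    proof -
      have "((\<lambda>x. D1 (x, y)) has_integral (V1 (x1, y) - V1 (x0, y))) {x0..x1}"
        by (rule fundamental_theorem_of_calculus[OF x])
          (use p(1) y in \<open>auto simp: pdx1_def has_real_derivative_iff_has_vector_derivative[symmetric] intro: has_field_derivative_at_within\<close>)
      then have i1: "integral {x0..x1} (\<lambda>x. D1 (x, y)) = V1 (x1, y) - V1 (x0, y)" by (rule integral_unique)
      have "integral {x0..x1} (\<lambda>x. d (x, y)) = integral {x0..x1} (\<lambda>x. D1 (x, y) + D2 (x, y))"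
        by (rule integral_cong) (use d y in \<open>auto simp: Omega_int_def\<close>)
      also have "\<dots> = integral {x0..x1} (\<lambda>x. D1 (x, y)) + integral {x0..x1} (\<lambda>x. D2 (x, y))"
        by (rule integral_add) (intro integrable_continuous_real sec cD y)+
      finally show ?thesis using i1 by simp
    qed
    ultimately show ?thesis by simp
  qed
  have "((\<lambda>y. - ?h y) has_integral (?m b1 - ?m b0)) {b0..b1}"
  proof (rule fundamental_theorem_of_calculus_interior[OF b(2)])
    show "continuous_on {b0..b1} ?m" by (rule continuous_on_subset[OF cm]) (use b in auto)
    show "(?m has_vector_derivative - ?h y) (at y)" if "y \<in> {b0<..<b1}" for y
      using dm[of y] that b by (simp add: has_real_derivative_iff_has_vector_derivative)
  qed
  from has_integral_neg[OF this] show ?thesis by simp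
qed

text \<open>Keeps the index \<open>1\<close> from turning into \<open>Suc 0\<close>, so that facts
  about \<open>pd 1\<close> and \<open>g 1 2\<close> still match.\<close>

declare One_nat_def [simp del]

lemma pdx2_cong: 
  assumes "pdx2 Y A A'" "Y \<subseteq> {-1..1}" "\<And>x y. y \<in> {-1..1} \<Longrightarrow> B (x, y) = A (x, y)" shows "pdx2 Y B A'"
  unfolding pdx2_def
proof (intro allI impI)
  fix x y assume y: "y \<in> Y"
  then have "((\<lambda>y. A (x, y)) has_real_derivative A' (x, y)) (at y within {-1..1})" using assms(1) unfolding pdx2_def by blast
  then show "((\<lambda>y. B (x, y)) has_real_derivative A' (x, y)) (at y within {-1..1})"
    by (rule has_field_derivative_transform_within[OF _ zero_less_one]) (use y assms in auto)
qed

text \<open>The witnesses in \<open>C2x\<close> coincide with iterated \<open>pd\<close> on the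
  strip, which is where all the properties are stated.\<close>

lemma C2x_pd:
  assumes "C2x X"
  shows "cper X" "cper (pd 1 X)" "cper (pd 2 X)" "pdx1 {-1..1} X (pd 1 X)" "pdx2 {-1..1} X (pd 2 X)"
    "pdx1 {-1..1} (pd 1 X) (pd 1 (pd 1 X))" "pdx1 {-1..1} (pd 2 X) (pd 1 (pd 2 X))"
    "pdx2 {-1..1} (pd 1 X) (pd 2 (pd 1 X))" "pdx2 {-1..1} (pd 2 X) (pd 2 (pd 2 X))"
    "continuous_on Omega_ext (pd 1 (pd 1 X))" "continuous_on Omega_ext (pd 1 (pd 2 X))"
    "continuous_on Omega_ext (pd 2 (pd 1 X))" "continuous_on Omega_ext (pd 2 (pd 2 X))"
proof -
  obtain X1 X2 X11 X12 X21 X22 where c: "cper X" "cper X1" "cper X2" "cper X11" "cper X12" "cper X21" "cper X22"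
    and d: "pdx1 {-1..1} X X1" "pdx2 {-1..1} X X2" "pdx1 {-1..1} X1 X11" "pdx2 {-1..1} X1 X12" "pdx1 {-1..1} X2 X21" "pdx2 {-1..1} X2 X22"
    using assms unfolding C2x_def by blast
  have e: "y \<in> {-1..1} \<Longrightarrow> pd 1 X (x, y) = X1 (x, y)" "y \<in> {-1..1} \<Longrightarrow> pd 2 X (x, y) = X2 (x, y)" for x y
    using pdx1_pd[OF d(1)] pdx2_pd[OF d(2)] by auto
  have 1: "pdx1 {-1..1} (pd 1 X) X11" "pdx1 {-1..1} (pd 2 X) X21" by (rule pdx1_cong[OF d(3)] pdx1_cong[OF d(5)]; simp add: e)+
  have 2: "pdx2 {-1..1} (pd 1 X) X12" "pdx2 {-1..1} (pd 2 X) X22" by (rule pdx2_cong[OF d(4)] pdx2_cong[OF d(6)]; simp add: e)+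
  have ee: "y \<in> {-1..1} \<Longrightarrow> pd 1 (pd 1 X) (x, y) = X11 (x, y)" "y \<in> {-1..1} \<Longrightarrow> pd 1 (pd 2 X) (x, y) = X21 (x, y)"
      "y \<in> {-1..1} \<Longrightarrow> pd 2 (pd 1 X) (x, y) = X12 (x, y)" "y \<in> {-1..1} \<Longrightarrow> pd 2 (pd 2 X) (x, y) = X22 (x, y)" for x y
    using pdx1_pd[OF 1(1)] pdx1_pd[OF 1(2)] pdx2_pd[OF 2(1)] pdx2_pd[OF 2(2)] by auto
  have cc: "continuous_on Omega_ext B" if "cper A" "\<And>x y. y \<in> {-1..1} \<Longrightarrow> B (x, y) = A (x, y)" for A B :: "real \<times> real \<Rightarrow> real"
    by (rule continuous_on_eq[of _ A]) (use that in \<open>auto simp: cper_def Omega_ext_def\<close>)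
  have cpc: "cper B" if "cper A" "\<And>x y. y \<in> {-1..1} \<Longrightarrow> B (x, y) = A (x, y)" for A B :: "real \<times> real \<Rightarrow> real"
    using cc[OF that] that unfolding cper_def by simp
  show "cper X" by (rule c)
  show "cper (pd 1 X)" "cper (pd 2 X)" by (rule cpc[OF c(2)] cpc[OF c(3)]; simp add: e)+
  show "continuous_on Omega_ext (pd 1 (pd 1 X))" "continuous_on Omega_ext (pd 1 (pd 2 X))"
    "continuous_on Omega_ext (pd 2 (pd 1 X))" "continuous_on Omega_ext (pd 2 (pd 2 X))"
    by (rule cc[OF c(4)] cc[OF c(5)] cc[OF c(6)] cc[OF c(7)]; simp add: ee)+
  show "pdx1 {-1..1} X (pd 1 X)" "pdx1 {-1..1} (pd 1 X) (pd 1 (pd 1 X))" "pdx1 {-1..1} (pd 2 X) (pd 1 (pd 2 X))"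
    by (rule pdx1_cong[OF d(1)] pdx1_cong[OF d(3)] pdx1_cong[OF d(5)]; simp add: e ee)+
  show "pdx2 {-1..1} X (pd 2 X)" "pdx2 {-1..1} (pd 1 X) (pd 2 (pd 1 X))" "pdx2 {-1..1} (pd 2 X) (pd 2 (pd 2 X))"
    using d(2) 2 unfolding pdx2_def by (simp_all add: e ee)
qed

lemma sol_classD:
  assumes "sol_class u"
  shows "continuous_on Omega_ext u" "continuous_on Omega_ext (pd 1 u)" "continuous_on Omega_ext (pd 2 u)"
    "pdx1 {-1..1} u (pd 1 u)" "pdx2 {-1..1} u (pd 2 u)"
    "pdx1 {-1<..<1} (pd 1 u) (pd 1 (pd 1 u))" "pdx2 {-1<..<1} (pd 1 u) (pd 2 (pd 1 u))"
    "pdx1 {-1<..<1} (pd 2 u) (pd 1 (pd 2 u))" "pdx2 {-1<..<1} (pd 2 u) (pd 2 (pd 2 u))"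
    "continuous_on Omega_int (pd 1 (pd 1 u))" "continuous_on Omega_int (pd 2 (pd 1 u))"
    "continuous_on Omega_int (pd 1 (pd 2 u))" "continuous_on Omega_int (pd 2 (pd 2 u))"
  using assms C1_extD[of u] C1_intD[of "pd 1 u"] C1_intD[of "pd 2 u"] unfolding sol_class_def C2_on_def by auto

lemma sol_class_jet:
  assumes "sol_class u"
  shows "jet u (pd 1 u) (pd 2 u) (pd 1 (pd 1 u)) (\<lambda>q. (pd 2 (pd 1 u) q + pd 1 (pd 2 u) q) / 2) (pd 2 (pd 2 u))"
proof -
  note S = sol_classD[OF assms]
  have at: "at y within {-1..1} = at y" if "y \<in> {-1<..<1}" for y :: real
    using that by (intro at_within_interior) simp
  have i: "continuous_on Omega_int (pd 2 u)" by (rule continuous_on_subset[OF S(3)]) (auto simp: Omega_ext_def Omega_int_def)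
  show ?thesis
    unfolding jet_def jeta_def
  proof (intro exI[of _ "pd 2 (pd 1 u)"] conjI allI impI)
    fix x y :: real assume y: "y \<in> {-1<..<1}"
    then have y': "y \<in> {-1..1}" by auto
    show "((\<lambda>x. u (x, y)) has_real_derivative pd 1 u (x, y)) (at x)" using S(4) y' unfolding pdx1_def by blast
    show "((\<lambda>y. u (x, y)) has_real_derivative pd 2 u (x, y)) (at y)" using S(5) y' at[OF y] unfolding pdx2_def by metis
    show "((\<lambda>x. pd 1 u (x, y)) has_real_derivative pd 1 (pd 1 u) (x, y)) (at x)" using S(6) y unfolding pdx1_def by blast
    show "((\<lambda>y. pd 1 u (x, y)) has_real_derivative pd 2 (pd 1 u) (x, y)) (at y)" using S(7) y at[OF y] unfolding pdx2_def by metis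
    have "((\<lambda>x. pd 2 u (x, y)) has_real_derivative pd 1 (pd 2 u) (x, y)) (at x)" using S(8) y unfolding pdx1_def by blast
    then show "((\<lambda>x. pd 2 u (x, y)) has_real_derivative 2 * ((pd 2 (pd 1 u) (x, y) + pd 1 (pd 2 u) (x, y)) / 2) - pd 2 (pd 1 u) (x, y)) (at x)"
      by (rule DERIV_cong) (simp add: field_simps)
    show "((\<lambda>y. pd 2 u (x, y)) has_real_derivative pd 2 (pd 2 u) (x, y)) (at y)" using S(9) y at[OF y] unfolding pdx2_def by metis
  qed (rule i S)+
qed

section \<open>Generator, adjoint and current expressed by fluxes\<close>

locale mrt =
  fixes f :: "nat \<Rightarrow> real \<times> real \<Rightarrow> real" and g :: "nat \<Rightarrow> nat \<Rightarrow> real \<times> real \<Rightarrow> real"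
  assumes fC: "C2x (f 1)" "C2x (f 2)"
    and gC: "C2x (g 1 1)" "C2x (g 1 2)" "C2x (g 2 1)" "C2x (g 2 2)" and se: "strongly_elliptic g"
begin

lemma Gm_eq: "Gm g j k = (\<lambda>p. g j 1 p * g k 1 p + g j 2 p * g k 2 p)"
  by (simp add: Gm_def fun_eq_iff)

lemma Gm_sym: "Gm g 2 1 = Gm g 1 2" and Ac_sym: "Acoef g 2 1 = Acoef g 1 2"
  by (simp_all add: Acoef_def[abs_def] Gm_eq mult.commute)

lemma GC: "C2x (Gm g 1 1)" "C2x (Gm g 1 2)" "C2x (Gm g 2 2)"
  unfolding Gm_eq by (intro C2x_add C2x_mult gC)+

lemma Ac_eq: "Acoef g j k = (\<lambda>p. (-1/2) * Gm g j k p)"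
  by (simp add: Acoef_def fun_eq_iff)

lemma AcC: "C2x (Acoef g 1 1)" "C2x (Acoef g 1 2)" "C2x (Acoef g 2 2)"
  unfolding Ac_eq by (intro C2x_cmult GC)+

lemma Av_eq: "Avec f g 1 = (\<lambda>p. (-1/2) * (pd 1 (Gm g 1 1) p + pd 2 (Gm g 1 2) p) + f 1 p)"
  "Avec f g 2 = (\<lambda>p. (-1/2) * (pd 1 (Gm g 1 2) p + pd 2 (Gm g 2 2) p) + f 2 p)"
  by (simp_all add: Avec_def fun_eq_iff Gm_sym)

text \<open>The derivatives of \<open>Avec f g 1\<close> in the first and of
  \<open>Avec f g 2\<close> in the second coordinate.\<close>

definition "Av1' = (\<lambda>p. (-1/2) * (pd 1 (pd 1 (Gm g 1 1)) p + pd 1 (pd 2 (Gm g 1 2)) p) + pd 1 (f 1) p)"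
definition "Av2' = (\<lambda>p. (-1/2) * (pd 2 (pd 1 (Gm g 1 2)) p + pd 2 (pd 2 (Gm g 2 2)) p) + pd 2 (f 2) p)"

lemma Av: "cper (Avec f g 1)" "cper (Avec f g 2)" "pdx1 {-1..1} (Avec f g 1) Av1'" "pdx2 {-1..1} (Avec f g 2) Av2'"
  "continuous_on Omega_ext Av1'" "continuous_on Omega_ext Av2'"
proof -
  note G11 = C2x_pd[OF GC(1)] and G12 = C2x_pd[OF GC(2)] and G22 = C2x_pd[OF GC(3)] and F1 = C2x_pd[OF fC(1)] and F2 = C2x_pd[OF fC(2)]
  show "cper (Avec f g 1)" "cper (Avec f g 2)" unfolding Av_eq by (intro cper_add cper_cmult G11 G12 G22 F1 F2)+
  show "pdx1 {-1..1} (Avec f g 1) Av1'" unfolding Av_eq Av1'_def by (intro pdx1_add pdx1_cmult G11 G12 F1)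
  show "pdx2 {-1..1} (Avec f g 2) Av2'" unfolding Av_eq Av2'_def by (intro pdx2_add pdx2_cmult G22 G12 F2)
  show "continuous_on Omega_ext Av1'" "continuous_on Omega_ext Av2'"
    unfolding Av1'_def Av2'_def using F1(2) F2(3) unfolding cper_def
    by (intro continuous_intros G11(10) G12(11) G12(12) G22(13); simp)+
qed

text \<open>The components of the flux A grad u; \<open>fl1\<close> and \<open>fl2\<close> are the
  two terms of its divergence.\<close>

definition "Fl1 u = (\<lambda>q. Acoef g 1 1 q * pd 1 u q + Acoef g 1 2 q * pd 2 u q)"
definition "Fl2 u = (\<lambda>q. Acoef g 1 2 q * pd 1 u q + Acoef g 2 2 q * pd 2 u q)"
definition "fl1 u = (\<lambda>q. (pd 1 (Acoef g 1 1) q * pd 1 u q + Acoef g 1 1 q * pd 1 (pd 1 u) q)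
   + (pd 1 (Acoef g 1 2) q * pd 2 u q + Acoef g 1 2 q * pd 1 (pd 2 u) q))"
definition "fl2 u = (\<lambda>q. (pd 2 (Acoef g 1 2) q * pd 1 u q + Acoef g 1 2 q * pd 2 (pd 1 u) q)
   + (pd 2 (Acoef g 2 2) q * pd 2 u q + Acoef g 2 2 q * pd 2 (pd 2 u) q))"

lemma int_sub: "{-1<..<1} \<subseteq> {-1..(1::real)}" by auto

lemma Ac_pdx:
  "pdx1 {-1<..<1} (Acoef g 1 1) (pd 1 (Acoef g 1 1))" "pdx1 {-1<..<1} (Acoef g 1 2) (pd 1 (Acoef g 1 2))"
  "pdx2 {-1<..<1} (Acoef g 1 2) (pd 2 (Acoef g 1 2))" "pdx2 {-1<..<1} (Acoef g 2 2) (pd 2 (Acoef g 2 2))"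
  using pdx1_mono[OF C2x_pd(4)[OF AcC(1)] int_sub] pdx1_mono[OF C2x_pd(4)[OF AcC(2)] int_sub]
   pdx2_mono[OF C2x_pd(5)[OF AcC(2)] int_sub] pdx2_mono[OF C2x_pd(5)[OF AcC(3)] int_sub] by auto

lemma flux_derivatives:
  assumes "sol_class u"
  shows "pdx1 {-1<..<1} (Fl1 u) (fl1 u)" "pdx2 {-1<..<1} (Fl2 u) (fl2 u)"
    "continuous_on Omega_ext (Fl1 u)" "continuous_on Omega_ext (Fl2 u)"
    "continuous_on Omega_int (fl1 u)" "continuous_on Omega_int (fl2 u)"
proof -
  note S = sol_classD[OF assms]
  show "pdx1 {-1<..<1} (Fl1 u) (fl1 u)" unfolding Fl1_def fl1_def by (intro pdx1_add pdx1_mult Ac_pdx S)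
  show "pdx2 {-1<..<1} (Fl2 u) (fl2 u)" unfolding Fl2_def fl2_def by (intro pdx2_add pdx2_mult Ac_pdx S)
  have c: "continuous_on Omega_ext (Acoef g 1 1)" "continuous_on Omega_ext (Acoef g 1 2)" "continuous_on Omega_ext (Acoef g 2 2)"
    "continuous_on Omega_ext (pd 1 (Acoef g 1 1))" "continuous_on Omega_ext (pd 1 (Acoef g 1 2))"
    "continuous_on Omega_ext (pd 2 (Acoef g 1 2))" "continuous_on Omega_ext (pd 2 (Acoef g 2 2))"
    using C2x_pd(1-3)[OF AcC(1)] C2x_pd(1-3)[OF AcC(2)] C2x_pd(1-3)[OF AcC(3)] by (auto simp: cper_def)
  show "continuous_on Omega_ext (Fl1 u)" "continuous_on Omega_ext (Fl2 u)"
    unfolding Fl1_def Fl2_def by (intro continuous_intros c S)+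
  show "continuous_on Omega_int (fl1 u)" "continuous_on Omega_int (fl2 u)"
    unfolding fl1_def fl2_def by (intro continuous_on_add continuous_on_mult continuous_on_sub c S)+
qed

lemma Pop_flux:
  assumes "sol_class u" "y \<in> {-1<..<1}"
  shows "Pop f g u (x, y) = - (fl1 u (x, y) + fl2 u (x, y)) + (Avec f g 1 (x, y) * pd 1 u (x, y) + Avec f g 2 (x, y) * pd 2 u (x, y))"
proof -
  note S = sol_classD[OF assms(1)]
  have "pd 1 (\<lambda>q. Acoef g 1 1 q * pd 1 u q) (x, y) = pd 1 (Acoef g 1 1) (x, y) * pd 1 u (x, y) + Acoef g 1 1 (x, y) * pd 1 (pd 1 u) (x, y)"
    "pd 1 (\<lambda>q. Acoef g 1 2 q * pd 2 u q) (x, y) = pd 1 (Acoef g 1 2) (x, y) * pd 2 u (x, y) + Acoef g 1 2 (x, y) * pd 1 (pd 2 u) (x, y)"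
    by (rule pdx1_pd[OF pdx1_mult[OF Ac_pdx(1) S(6)] assms(2)] pdx1_pd[OF pdx1_mult[OF Ac_pdx(2) S(8)] assms(2)])+
  moreover have "pd 2 (\<lambda>q. Acoef g 1 2 q * pd 1 u q) (x, y) = pd 2 (Acoef g 1 2) (x, y) * pd 1 u (x, y) + Acoef g 1 2 (x, y) * pd 2 (pd 1 u) (x, y)"
    "pd 2 (\<lambda>q. Acoef g 2 2 q * pd 2 u q) (x, y) = pd 2 (Acoef g 2 2) (x, y) * pd 2 u (x, y) + Acoef g 2 2 (x, y) * pd 2 (pd 2 u) (x, y)"
    by (rule pdx2_pd[OF pdx2_mult[OF Ac_pdx(3) S(7)] assms(2) int_sub] pdx2_pd[OF pdx2_mult[OF Ac_pdx(4) S(9)] assms(2) int_sub])+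
  ultimately show ?thesis by (simp add: Pop_def fl1_def fl2_def Ac_sym)
qed

lemma Padj_flux:
  assumes "sol_class u" "y \<in> {-1<..<1}"
  shows "Padj f g u (x, y) = - (fl1 u (x, y) + fl2 u (x, y))
     - (Av1' (x, y) * u (x, y) + Avec f g 1 (x, y) * pd 1 u (x, y)) - (Av2' (x, y) * u (x, y) + Avec f g 2 (x, y) * pd 2 u (x, y))"
proof -
  note S = sol_classD[OF assms(1)]
  have y: "y \<in> {-1..1}" using assms(2) by auto
  have 1: "pd 1 (\<lambda>q. Avec f g 1 q * u q) (x, y) = Av1' (x, y) * u (x, y) + Avec f g 1 (x, y) * pd 1 u (x, y)"
    by (rule pdx1_pd[OF pdx1_mult[OF Av(3) S(4)] y])
  have 2: "pd 2 (\<lambda>q. Avec f g 2 q * u q) (x, y) = Av2' (x, y) * u (x, y) + Avec f g 2 (x, y) * pd 2 u (x, y)"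
    by (rule pdx2_pd[OF pdx2_mult[OF Av(4) S(5)] y order_refl])
  have "Padj f g u (x, y) = Pop f g u (x, y) - (Avec f g 1 (x, y) * pd 1 u (x, y) + Avec f g 2 (x, y) * pd 2 u (x, y))
    - (pd 1 (\<lambda>q. Avec f g 1 q * u q) (x, y) + pd 2 (\<lambda>q. Avec f g 2 q * u q) (x, y))"
    by (simp add: Padj_def Pop_def)
  then show ?thesis unfolding 1 2 Pop_flux[OF assms] by simp
qed

text \<open>The product rule splits the derivatives of G times the density into the diffusive flux
  and the correction contained in \<open>Avec\<close>.\<close>

lemma Jss_flux:
  assumes "sol_class u" "y \<in> {-1..1}"
  shows "Jss f g u 1 (x, y) = Fl1 u (x, y) + Avec f g 1 (x, y) * u (x, y)"
    "Jss f g u 2 (x, y) = Fl2 u (x, y) + Avec f g 2 (x, y) * u (x, y)"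
proof -
  note S = sol_classD[OF assms(1)]
  have 1: "pd 1 (\<lambda>q. X q * u q) (x, y) = pd 1 X (x, y) * u (x, y) + X (x, y) * pd 1 u (x, y)"
    "pd 2 (\<lambda>q. X q * u q) (x, y) = pd 2 X (x, y) * u (x, y) + X (x, y) * pd 2 u (x, y)" if "C2x X" for X
    using pdx1_pd[OF pdx1_mult[OF C2x_pd(4)[OF that] S(4)] assms(2)] pdx2_pd[OF pdx2_mult[OF C2x_pd(5)[OF that] S(5)] assms(2) order_refl] by auto
  show "Jss f g u 1 (x, y) = Fl1 u (x, y) + Avec f g 1 (x, y) * u (x, y)"
    "Jss f g u 2 (x, y) = Fl2 u (x, y) + Avec f g 2 (x, y) * u (x, y)"
    unfolding Jss_def Fl1_def Fl2_def Av_eq Ac_eq by (simp_all add: Gm_sym 1[OF GC(1)] 1[OF GC(2)] 1[OF GC(3)]) (simp_all add: algebra_simps)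
qed

end

section \<open>The stationary current and Green's identity\<close>

context mrt begin

text \<open>\<open>Padj\<close> of the density is minus the divergence of the current, and the
  reflecting condition is the vanishing of its second component at the edges.\<close>

lemma current:
  assumes sd: "stationary_density f g \<rho>"
  defines "J1 \<equiv> \<lambda>q. Fl1 \<rho> q + Avec f g 1 q * \<rho> q" and "J2 \<equiv> \<lambda>q. Fl2 \<rho> q + Avec f g 2 q * \<rho> q"
    and "j1 \<equiv> \<lambda>q. fl1 \<rho> q + (Av1' q * \<rho> q + Avec f g 1 q * pd 1 \<rho> q)"
    and "j2 \<equiv> \<lambda>q. fl2 \<rho> q + (Av2' q * \<rho> q + Avec f g 2 q * pd 2 \<rho> q)"
  shows "continuous_on Omega_ext J1" "continuous_on Omega_ext J2" "continuous_on Omega_int j1" "continuous_on Omega_int j2"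
    "pdx1 {-1<..<1} J1 j1" "pdx2 {-1<..<1} J2 j2" "\<And>q. q \<in> Omega_int \<Longrightarrow> j1 q + j2 q = 0"
    "\<And>x y. y \<in> {-1, 1} \<Longrightarrow> J2 (x, y) = 0" "\<And>x y. y \<in> {-1..1} \<Longrightarrow> J1 (x + 2 * pi, y) = J1 (x, y)"
proof -
  have sc: "sol_class \<rho>" and per: "\<And>x y. y \<in> {-1..1} \<Longrightarrow> \<rho> (x + 2 * pi, y) = \<rho> (x, y)"
    and adj: "\<And>q. q \<in> Omega_int \<Longrightarrow> Padj f g \<rho> q = 0"
    and bc: "\<And>x y. y \<in> {-1, 1} \<Longrightarrow> (\<Sum>k\<in>{1,2}. Acoef g k 2 (x, y) * pd k \<rho> (x, y)) + Avec f g 2 (x, y) * \<rho> (x, y) = 0"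
    using sd unfolding stationary_density_def by blast+
  note S = sol_classD[OF sc] and F = flux_derivatives[OF sc]
  have ca: "continuous_on Omega_ext (Avec f g 1)" "continuous_on Omega_ext (Avec f g 2)" using Av by (auto simp: cper_def)
  show "continuous_on Omega_ext J1" "continuous_on Omega_ext J2"
    unfolding J1_def J2_def by (intro continuous_intros F ca S)+
  show "continuous_on Omega_int j1" "continuous_on Omega_int j2"
    unfolding j1_def j2_def by (intro continuous_on_add continuous_on_mult F continuous_on_sub ca S Av(5,6))+
  show "pdx1 {-1<..<1} J1 j1" "pdx2 {-1<..<1} J2 j2"
    unfolding J1_def j1_def J2_def j2_def
    by (intro pdx1_add pdx1_mult F pdx1_mono[OF Av(3) int_sub] pdx1_mono[OF S(4) int_sub])
       (intro pdx2_add pdx2_mult F pdx2_mono[OF Av(4) int_sub] pdx2_mono[OF S(5) int_sub])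
  show "j1 q + j2 q = 0" if "q \<in> Omega_int" for q
    using adj[OF that] that Padj_flux[OF sc, of "snd q" "fst q"] by (auto simp: Omega_int_def j1_def j2_def)
  show "J2 (x, y) = 0" if "y \<in> {-1, 1}" for x y
    using bc[OF that, of x] by (simp add: J2_def Fl2_def)
  show "J1 (x + 2 * pi, y) = J1 (x, y)" if y: "y \<in> {-1..1}" for x y
  proof -
    have "pd 1 \<rho> (x + 2 * pi, y) = pd 1 \<rho> (x, y)" "pd 2 \<rho> (x + 2 * pi, y) = pd 2 \<rho> (x, y)"
      using pdx1_periodic[OF S(4) _ y, of 0] pdx2_periodic[OF S(5) _ y, of 0] per by simp_all
    moreover have "Acoef g 1 1 (x + 2 * pi, y) = Acoef g 1 1 (x, y)" "Acoef g 1 2 (x + 2 * pi, y) = Acoef g 1 2 (x, y)"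
      "Avec f g 1 (x + 2 * pi, y) = Avec f g 1 (x, y)"
      using C2x_pd(1)[OF AcC(1)] C2x_pd(1)[OF AcC(2)] Av(1) y unfolding cper_def by auto
    ultimately show ?thesis using per[OF y, of x] by (simp add: J1_def Fl1_def)
  qed
qed

text \<open>Through psi (x, y) = integral of J_1 (x, .) over [-1, y], a stream function of the divergence-free
  current, the flux through a curve depends on its end points only.\<close>

lemma Jbar_eq:
  assumes sd: "stationary_density f g \<rho>" and ac: "admissible_curve \<gamma> \<gamma>'"
  shows "Jbar f g \<rho> \<gamma> \<gamma>' = integral {-1..1} (\<lambda>y. Fl1 \<rho> (0, y) + Avec f g 1 (0, y) * \<rho> (0, y))"
proof -
  define J1 where "J1 = (\<lambda>q. Fl1 \<rho> q + Avec f g 1 q * \<rho> q)"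
  define J2 where "J2 = (\<lambda>q. Fl2 \<rho> q + Avec f g 2 q * \<rho> q)"
  note C = current[OF sd, folded J1_def J2_def]
  have sc: "sol_class \<rho>" using sd by (simp add: stationary_density_def)
  define \<psi> where "\<psi> q = integral {-1..snd q} (\<lambda>b. J1 (fst q, b))" for q
  have cy: "continuous_on {-1..1} (\<lambda>b. J1 (x, b))" for x
    by (rule continuous_on_compose2[OF C(1)]) (auto intro!: continuous_intros simp: Omega_ext_def)
  have cx: "continuous_on A (\<lambda>a. J2 (a, y))" if "y \<in> {-1..1}" for A y
    by (rule continuous_on_compose2[OF C(2)]) (use that in \<open>auto intro!: continuous_intros simp: Omega_ext_def\<close>)
  have ib: "(\<lambda>b. J1 (x, b)) integrable_on {-1..y}" if "y \<in> {-1..1}" for x y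
    by (rule integrable_continuous_real) (rule continuous_on_subset[OF cy], use that in auto)
  have diff: "\<psi> (x1, y) - \<psi> (x0, y) = - integral {x0..x1} (\<lambda>a. J2 (a, y))" if "x0 \<le> x1" "y \<in> {-1..1}" for x0 x1 y
  proof -
    have b: "(-1::real) \<le> -1" "-1 \<le> y" "y \<le> 1" using that by auto
    have "((\<lambda>b. J1 (x1, b) - J1 (x0, b) - integral {x0..x1} (\<lambda>a. 0)) has_integral
       (integral {x0..x1} (\<lambda>a. J2 (a, -1)) - integral {x0..x1} (\<lambda>a. J2 (a, y)))) {-1..y}"
      using divergence_identity[OF C(2,3,4,5,6,7) that(1) b] by simp
    moreover have "integral {x0..x1} (\<lambda>a. J2 (a, -1)) = 0" using C(8)[of "-1"] by (simp add: J2_def)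
    ultimately have "integral {-1..y} (\<lambda>b. J1 (x1, b) - J1 (x0, b)) = - integral {x0..x1} (\<lambda>a. J2 (a, y))"
      by (simp add: integral_unique)
    then show ?thesis using integral_diff[OF ib[OF that(2)] ib[OF that(2)], of x1 x0] by (simp add: \<psi>_def)
  qed
  have dx: "((\<lambda>x. \<psi> (x, y)) has_real_derivative - J2 (x, y)) (at x)" if y: "y \<in> {-1..1}" for x y
  proof -
    have eqt: "\<psi> (x-1, y) + - integral {x-1..t} (\<lambda>a. J2 (a, y)) = \<psi> (t, y)" if "x - 1 \<le> t" for t
      using diff[OF that y] by simp
    \<comment> \<open>The base point x - 1 makes x interior to the interval, so that the derivative
      is two-sided.\<close>
    have "((\<lambda>t. integral {x-1..t} (\<lambda>a. J2 (a, y))) has_real_derivative J2 (x, y)) (at x within {x-1..x+1})"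
      by (rule integral_has_real_derivative[OF cx[OF y]]) simp
    then have "((\<lambda>t. \<psi> (x-1, y) + - integral {x-1..t} (\<lambda>a. J2 (a, y))) has_real_derivative 0 + - J2 (x, y)) (at x within {x-1..x+1})"
      by (intro DERIV_add DERIV_const DERIV_minus)
    then have "((\<lambda>t. \<psi> (t, y)) has_real_derivative 0 + - J2 (x, y)) (at x within {x-1..x+1})"
      by (rule has_field_derivative_transform_within[OF _ zero_less_one]) (simp_all add: eqt[simplified])
    moreover have "at x within {x-1..x+1} = at x" by (rule at_within_interior) simp
    ultimately show ?thesis by simp
  qed
  have dy: "((\<lambda>y. \<psi> (x, y)) has_real_derivative J1 (x, y)) (at y within {-1..1})" if "y \<in> {-1..1}" for x y
    using integral_has_real_derivative[OF cy that, of x] by (simp add: \<psi>_def)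
  have g1: "(\<gamma> has_real_derivative \<gamma>' b) (at b within {-1..1})" if "b \<in> {-1..1}" for b
    using ac that unfolding admissible_curve_def by blast
  have dcurve: "((\<lambda>b. \<psi> (\<gamma> b, b)) has_real_derivative J1 (\<gamma> b, b) - \<gamma>' b * J2 (\<gamma> b, b)) (at b within {-1..1})" if b: "b \<in> {-1..1}" for b
  proof -
    have cJ: "continuous_on (UNIV \<times> {-1..1}) J1" using C(1) by (simp add: Omega_ext_def)
    have "(\<psi> has_derivative (\<lambda>h. - J2 (\<gamma> b, b) * fst h + J1 (\<gamma> b, b) * snd h)) (at (\<gamma> b, b) within UNIV \<times> {-1..1})"
      using has_derivative_of_partials[where F = \<psi> and ?F1.0 = "\<lambda>q. - J2 q" and ?F2.0 = J1 and Y = "{-1..1}", OF dx[OF b] dy b _ cJ] by simp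
    then have 1: "(\<psi> has_derivative (\<lambda>h. - J2 (\<gamma> b, b) * fst h + J1 (\<gamma> b, b) * snd h)) (at (\<gamma> b, b) within (\<lambda>b. (\<gamma> b, b)) ` {-1..1})"
      by (rule has_derivative_subset) auto
    have 2: "((\<lambda>b. (\<gamma> b, b)) has_derivative (\<lambda>h. (\<gamma>' b * h, h))) (at b within {-1..1})"
      using g1[OF b] unfolding has_field_derivative_def by (intro has_derivative_Pair has_derivative_ident)
    have "((\<lambda>b. \<psi> (\<gamma> b, b)) has_derivative (\<lambda>h. - J2 (\<gamma> b, b) * fst (\<gamma>' b * h, h) + J1 (\<gamma> b, b) * snd (\<gamma>' b * h, h))) (at b within {-1..1})"
      by (rule has_derivative_in_compose[OF 2 1])
    then show ?thesis unfolding has_field_derivative_def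
      by (rule has_derivative_eq_rhs) (auto simp: fun_eq_iff algebra_simps)
  qed
  have int: "((\<lambda>b. J1 (\<gamma> b, b) - \<gamma>' b * J2 (\<gamma> b, b)) has_integral (\<psi> (\<gamma> 1, 1) - \<psi> (\<gamma> (-1), -1))) {-1..1}"
    by (rule fundamental_theorem_of_calculus) (use dcurve in \<open>auto simp: has_real_derivative_iff_has_vector_derivative[symmetric]\<close>)
  have z: "integral {x0..x1} (\<lambda>a. J2 (a, 1)) = 0" for x0 x1 using C(8)[of 1] by (simp add: J2_def)
  \<comment> \<open>No current crosses y = 1, so \<open>\<psi>\<close> is constant along that edge;
    on y = -1 it is 0 by definition.\<close>
  have top: "\<psi> (\<gamma> 1, 1) = \<psi> (0, 1)"
    using diff[of 0 "\<gamma> 1" 1] diff[of "\<gamma> 1" 0 1] z by (cases "0 \<le> \<gamma> 1") auto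
  have bot: "\<psi> (\<gamma> (-1), -1) = 0" by (simp add: \<psi>_def)
  have "Jbar f g \<rho> \<gamma> \<gamma>' = integral {-1..1} (\<lambda>b. J1 (\<gamma> b, b) - \<gamma>' b * J2 (\<gamma> b, b))"
    unfolding Jbar_def
  proof (rule integral_cong)
    fix b :: real assume b: "b \<in> {-1..1}"
    have "1 + (\<gamma>' b)\<^sup>2 > 0" by (meson add_pos_nonneg zero_le_power2 zero_less_one)
    then have s: "sqrt (1 + (\<gamma>' b)\<^sup>2) \<noteq> 0" by simp
    have j: "Jss f g \<rho> 1 (\<gamma> b, b) = J1 (\<gamma> b, b)" "Jss f g \<rho> 2 (\<gamma> b, b) = J2 (\<gamma> b, b)"
      using Jss_flux[OF sc b] by (simp_all add: J1_def J2_def)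
    \<comment> \<open>The normalisation of the normal vector cancels the line element.\<close>
    have "(1 / t * p + - c / t * q) * t = p - c * q" if "t \<noteq> 0" for p q c t :: real
      using that by (simp add: field_simps)
    from this[OF s] show "(\<Sum>j\<in>{1,2}. unit_normal \<gamma>' j b * Jss f g \<rho> j (\<gamma> b, b)) * sqrt (1 + (\<gamma>' b)\<^sup>2) = J1 (\<gamma> b, b) - \<gamma>' b * J2 (\<gamma> b, b)"
      by (simp add: unit_normal_def j)
  qed
  also have "\<dots> = \<psi> (0, 1)" using integral_unique[OF int] top bot by simp
  finally show ?thesis by (simp add: \<psi>_def J1_def)
qed

text \<open>The field V = - rho A grad T + T J has divergence rho P T = k rho: the gradient terms
  cancel by the symmetry of A, and J is divergence free. Its vertical component vanishes at both
  edges, and over one period its horizontal component changes by r times the first component of J.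
  Integrating over one period, where the density has mass 1, gives the claim.\<close>

lemma Green:
  assumes sd: "stationary_density f g \<rho>" and T: "sol_class T"
    and k: "\<And>q. q \<in> Omega_int \<Longrightarrow> Pop f g T q = k"
    and bc: "\<And>x y. y \<in> {-1, 1} \<Longrightarrow> (\<Sum>k\<in>{1,2}. Gm g 2 k (x, y) * pd k T (x, y)) = 0"
    and qp: "\<And>x y. y \<in> {-1..1} \<Longrightarrow> T (x + 2 * pi, y) = T (x, y) + r"
  shows "k = r * integral {-1..1} (\<lambda>y. Fl1 \<rho> (0, y) + Avec f g 1 (0, y) * \<rho> (0, y))"
proof -
  define J1 where "J1 = (\<lambda>q. Fl1 \<rho> q + Avec f g 1 q * \<rho> q)"
  define J2 where "J2 = (\<lambda>q. Fl2 \<rho> q + Avec f g 2 q * \<rho> q)"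
  define j1 where "j1 = (\<lambda>q. fl1 \<rho> q + (Av1' q * \<rho> q + Avec f g 1 q * pd 1 \<rho> q))"
  define j2 where "j2 = (\<lambda>q. fl2 \<rho> q + (Av2' q * \<rho> q + Avec f g 2 q * pd 2 \<rho> q))"
  note C = current[OF sd, folded J1_def J2_def j1_def j2_def]
  have sc: "sol_class \<rho>" and per: "\<And>x y. y \<in> {-1..1} \<Longrightarrow> \<rho> (x + 2 * pi, y) = \<rho> (x, y)" and one: "(\<rho> has_integral 1) Omega"
    using sd by (auto simp: stationary_density_def)
  note S = sol_classD[OF sc] and St = sol_classD[OF T] and Ft = flux_derivatives[OF T]
  define V1 where "V1 = (\<lambda>q. (-1) * (\<rho> q * Fl1 T q) + T q * J1 q)"
  define V2 where "V2 = (\<lambda>q. (-1) * (\<rho> q * Fl2 T q) + T q * J2 q)"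
  define D1 where "D1 = (\<lambda>q. (-1) * (pd 1 \<rho> q * Fl1 T q + \<rho> q * fl1 T q) + (pd 1 T q * J1 q + T q * j1 q))"
  define D2 where "D2 = (\<lambda>q. (-1) * (pd 2 \<rho> q * Fl2 T q + \<rho> q * fl2 T q) + (pd 2 T q * J2 q + T q * j2 q))"
  have p: "pdx1 {-1<..<1} V1 D1" "pdx2 {-1<..<1} V2 D2"
    unfolding V1_def D1_def V2_def D2_def
    by (intro pdx1_add pdx1_cmult pdx1_mult Ft C pdx1_mono[OF S(4) int_sub] pdx1_mono[OF St(4) int_sub])
       (intro pdx2_add pdx2_cmult pdx2_mult Ft C pdx2_mono[OF S(5) int_sub] pdx2_mono[OF St(5) int_sub])
  have c: "continuous_on Omega_ext V2" unfolding V2_def by (intro continuous_intros S Ft St C)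
  have cD: "continuous_on Omega_int D1" "continuous_on Omega_int D2"
    unfolding D1_def D2_def
    by (intro continuous_on_add continuous_on_mult continuous_on_const Ft C continuous_on_sub[OF S(1)] continuous_on_sub[OF S(2)] continuous_on_sub[OF S(3)]
      continuous_on_sub[OF St(1)] continuous_on_sub[OF St(2)] continuous_on_sub[OF St(3)] continuous_on_sub[OF Ft(3)] continuous_on_sub[OF Ft(4)]
      continuous_on_sub[OF C(1)] continuous_on_sub[OF C(2)])+
  have d: "D1 q + D2 q = k * \<rho> q" if q: "q \<in> Omega_int" for q
  proof -
    obtain x y where xy: "q = (x, y)" "y \<in> {-1<..<1}" using q by (auto simp: Omega_int_def)
    have P: "k = - (fl1 T q + fl2 T q) + (Avec f g 1 q * pd 1 T q + Avec f g 2 q * pd 2 T q)"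
      using Pop_flux[OF T xy(2), of x] k[OF q] xy by simp
    have j: "j2 q = - j1 q" using C(7)[OF q] by (simp add: j1_def j2_def)
    show ?thesis unfolding D1_def D2_def j P J1_def J2_def Fl1_def Fl2_def by (simp add: algebra_simps)
  qed
  have V20: "V2 (x, y) = 0" if y: "y \<in> {-1, 1}" for x y
  proof -
    have "Fl2 T (x, y) = 0" using bc[OF y, of x] by (simp add: Fl2_def Ac_eq Gm_sym)
    then show ?thesis using C(8)[OF y] by (simp add: V2_def J2_def)
  qed
  have "((\<lambda>y. V1 (2 * pi, y) - V1 (0, y) - integral {0..2*pi} (\<lambda>x. k * \<rho> (x, y))) has_integral
     (integral {0..2*pi} (\<lambda>x. V2 (x, -1)) - integral {0..2*pi} (\<lambda>x. V2 (x, 1)))) {-1..1}"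
    by (rule divergence_identity[OF c cD p d]) auto
  then have I: "((\<lambda>y. V1 (2 * pi, y) - V1 (0, y) - integral {0..2*pi} (\<lambda>x. k * \<rho> (x, y))) has_integral 0) {-1..1}"
    by (simp add: V20)
  have V1d: "V1 (2 * pi, y) - V1 (0, y) = r * J1 (0, y)" if y: "y \<in> {-1..1}" for y
  proof -
    have "pd 1 T (0 + 2 * pi, y) = pd 1 T (0, y)" "pd 2 T (0 + 2 * pi, y) = pd 2 T (0, y)"
      using pdx1_periodic[OF St(4) _ y, of r] pdx2_periodic[OF St(5) _ y, of r] qp by blast+
    moreover have "Acoef g 1 1 (0 + 2 * pi, y) = Acoef g 1 1 (0, y)" "Acoef g 1 2 (0 + 2 * pi, y) = Acoef g 1 2 (0, y)"
      using C2x_pd(1)[OF AcC(1)] C2x_pd(1)[OF AcC(2)] y unfolding cper_def by blast+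
    ultimately have "Fl1 T (2 * pi, y) = Fl1 T (0, y)" by (simp add: Fl1_def)
    moreover have "J1 (2 * pi, y) = J1 (0, y)" "\<rho> (2 * pi, y) = \<rho> (0, y)" "T (2 * pi, y) = T (0, y) + r"
      using C(9)[OF y, of 0] per[OF y, of 0] qp[OF y, of 0] by (simp_all add: J1_def)
    ultimately show ?thesis unfolding V1_def by (simp add: algebra_simps)
  qed
  have cJ: "continuous_on {-1..1} (\<lambda>y. J1 (0, y))"
    by (rule continuous_on_compose2[OF C(1)]) (auto intro!: continuous_intros simp: Omega_ext_def)
  have cr: "continuous_on ({-1..1} \<times> cbox 0 (2 * pi)) (\<lambda>(y, x). \<rho> (x, y))"
    unfolding split_beta by (rule continuous_on_compose2[OF S(1)]) (auto intro!: continuous_intros simp: Omega_ext_def)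
  have ci: "continuous_on {-1..1} (\<lambda>y. integral {0..2*pi} (\<lambda>x. \<rho> (x, y)))"
    using integral_continuous_on_param[OF cr] by simp
  have "0 = integral {-1..1} (\<lambda>y. r * J1 (0, y) - k * integral {0..2*pi} (\<lambda>x. \<rho> (x, y)))"
    using integral_unique[OF I] integral_cong[of "{-1..1}" "\<lambda>y. V1 (2 * pi, y) - V1 (0, y) - integral {0..2*pi} (\<lambda>x. k * \<rho> (x, y))"
      "\<lambda>y. r * J1 (0, y) - k * integral {0..2*pi} (\<lambda>x. \<rho> (x, y))"] V1d by simp
  also have "\<dots> = integral {-1..1} (\<lambda>y. r * J1 (0, y)) - integral {-1..1} (\<lambda>y. k * integral {0..2*pi} (\<lambda>x. \<rho> (x, y)))"
    by (rule integral_diff) (intro integrable_continuous_real continuous_intros cJ ci)+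
  also have "\<dots> = r * integral {-1..1} (\<lambda>y. J1 (0, y)) - k * integral {-1..1} (\<lambda>y. integral {0..2*pi} (\<lambda>x. \<rho> (x, y)))"
    by simp
  also have "integral {-1..1} (\<lambda>y. integral {0..2*pi} (\<lambda>x. \<rho> (x, y))) = 1"
  proof -
    have O: "Omega = cbox (0, -1) (2 * pi, 1)" unfolding Omega_def by (simp add: cbox_Pair_eq)
    have co: "continuous_on (cbox (0, -1) (2 * pi, 1)) \<rho>"
      by (rule continuous_on_subset[OF S(1)]) (auto simp: Omega_ext_def cbox_Pair_eq)
    have "1 = integral (cbox (0, -1) (2 * pi, 1)) \<rho>" using integral_unique[OF one] O by simp
    also have "\<dots> = integral (cbox 0 (2 * pi)) (\<lambda>x. integral (cbox (-1) 1) (\<lambda>y. \<rho> (x, y)))"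
      by (rule integral_prod_continuous[OF co])
    also have "\<dots> = integral (cbox (-1) 1) (\<lambda>y. integral (cbox 0 (2 * pi)) (\<lambda>x. \<rho> (x, y)))"
      by (rule integral_swap_continuous) (use co in \<open>simp add: case_prod_eta\<close>)
    finally show ?thesis by simp
  qed
  finally show ?thesis by (simp add: J1_def)
qed

end

section \<open>Nondivergence form, periodic extension and uniqueness\<close>

context mrt begin

text \<open>The operator in question is twice the generator, whence the drift 2 f and the constant 2
  c. \<open>M\<close> is the sum of four separate bounds.\<close>

lemma elliptic:
  obtains \<theta> M where "\<theta> > 0" "M > 0" "elliptic_operator (Gm g 1 1) (Gm g 1 2) (Gm g 2 2) (\<lambda>q. 2 * f 1 q) (\<lambda>q. 2 * f 2 q) \<theta> M"
proof -
  from se obtain c where c: "c > 0" and el: "\<forall>p\<in>Omega_ext. \<forall>\<xi>::nat \<Rightarrow> real.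
      (\<Sum>j\<in>{1,2}. \<Sum>k\<in>{1,2}. - Acoef g j k p * \<xi> j * \<xi> k) \<ge> c * ((\<xi> 1)\<^sup>2 + (\<xi> 2)\<^sup>2)"
    unfolding strongly_elliptic_def by (elim exE conjE) (rule that)
  have e: "2 * c * (x\<^sup>2 + y\<^sup>2) \<le> Gm g 1 1 q * x\<^sup>2 + 2 * Gm g 1 2 q * x * y + Gm g 2 2 q * y\<^sup>2" if "q \<in> Omega_ext" for q x y
  proof -
    define \<xi> where "\<xi> j = (if j = 1 then x else y)" for j :: nat
    have x: "\<xi> 1 = x" "\<xi> 2 = y" by (simp_all add: \<xi>_def)
    have S: "(\<Sum>j\<in>{1,2}. \<Sum>k\<in>{1,2}. h j k) = h 1 1 + h 1 2 + (h 2 1 + h 2 2)" for h :: "nat \<Rightarrow> nat \<Rightarrow> real"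
      by simp
    have "c * (x\<^sup>2 + y\<^sup>2) \<le> - Acoef g 1 1 q * x * x + - Acoef g 1 2 q * x * y + (- Acoef g 2 1 q * y * x + - Acoef g 2 2 q * y * y)"
      using bspec[OF el that, rule_format, of \<xi>] unfolding S x .
    also have "\<dots> = (Gm g 1 1 q * x\<^sup>2 + 2 * Gm g 1 2 q * x * y + Gm g 2 2 q * y\<^sup>2) / 2"
      unfolding Ac_eq Gm_sym power2_eq_square by (simp add: field_simps)
    finally show ?thesis by simp
  qed
  have B: "\<exists>B>0. \<forall>q\<in>Omega_ext. \<bar>X q\<bar> \<le> B" if X: "C2x X" for X
  proof -
    obtain B where B: "B \<ge> 0" "\<And>x y. y \<in> {-1..1} \<Longrightarrow> \<bar>X (x, y)\<bar> \<le> B" by (rule cper_bounded[OF C2x_pd(1)[OF X]]) (rule that)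
    have "\<bar>X q\<bar> \<le> B + 1" if "q \<in> Omega_ext" for q
      using that B(2)[of "snd q" "fst q"] by (simp add: Omega_ext_def mem_Times_iff)
    with B(1) show ?thesis by (intro exI[of _ "B + 1"] conjI ballI) simp_all
  qed
  obtain B1 where B1: "B1 > 0" "\<forall>q\<in>Omega_ext. \<bar>Gm g 1 1 q\<bar> \<le> B1"
    using B[OF GC(1)] by (elim exE conjE) (rule that)
  obtain B2 where B2: "B2 > 0" "\<forall>q\<in>Omega_ext. \<bar>Gm g 2 2 q\<bar> \<le> B2"
    using B[OF GC(3)] by (elim exE conjE) (rule that)
  obtain B3 where B3: "B3 > 0" "\<forall>q\<in>Omega_ext. \<bar>2 * f 1 q\<bar> \<le> B3"
    using B[OF C2x_cmult[OF fC(1), of 2]] by (elim exE conjE) (rule that)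
  obtain B4 where B4: "B4 > 0" "\<forall>q\<in>Omega_ext. \<bar>2 * f 2 q\<bar> \<le> B4"
    using B[OF C2x_cmult[OF fC(2), of 2]] by (elim exE conjE) (rule that)
  have "elliptic_operator (Gm g 1 1) (Gm g 1 2) (Gm g 2 2) (\<lambda>q. 2 * f 1 q) (\<lambda>q. 2 * f 2 q) (2 * c) (B1 + B2 + B3 + B4)"
  proof
    fix q assume q: "q \<in> Omega_ext"
    show "\<bar>Gm g 1 1 q\<bar> \<le> B1 + B2 + B3 + B4 \<and> \<bar>Gm g 2 2 q\<bar> \<le> B1 + B2 + B3 + B4 \<and> \<bar>2 * f 1 q\<bar> \<le> B1 + B2 + B3 + B4 \<and> \<bar>2 * f 2 q\<bar> \<le> B1 + B2 + B3 + B4"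
      using order_trans[OF bspec[OF B1(2) q], of "B1 + B2 + B3 + B4"] order_trans[OF bspec[OF B2(2) q], of "B1 + B2 + B3 + B4"]
        order_trans[OF bspec[OF B3(2) q], of "B1 + B2 + B3 + B4"] order_trans[OF bspec[OF B4(2) q], of "B1 + B2 + B3 + B4"] B1(1) B2(1) B3(1) B4(1)
      by simp
  next
    show "0 < 2 * c" using c by simp
  qed (rule e)
  then show thesis by (rule that[rotated 2]) (use c B1(1) B2(1) B3(1) B4(1) in simp_all)
qed

text \<open>The correction in \<open>Avec\<close> cancels the derivatives of \<open>Acoef\<close>,
  which leaves twice the backward Kolmogorov operator. The mixed derivatives appear as a sum,
  matching the mean used in \<open>jet\<close>.\<close>

lemma Pop_nondivergence:
  assumes T: "sol_class u" and y: "y \<in> {-1<..<1}"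
  shows "2 * Pop f g u (x, y) = Gm g 1 1 (x, y) * pd 1 (pd 1 u) (x, y) + Gm g 1 2 (x, y) * (pd 2 (pd 1 u) (x, y) + pd 1 (pd 2 u) (x, y))
     + Gm g 2 2 (x, y) * pd 2 (pd 2 u) (x, y) + 2 * f 1 (x, y) * pd 1 u (x, y) + 2 * f 2 (x, y) * pd 2 u (x, y)"
proof -
  have yy: "y \<in> {-1..1}" using y by auto
  have "pd 1 (Acoef g 1 1) (x, y) = (-1/2) * pd 1 (Gm g 1 1) (x, y)" "pd 1 (Acoef g 1 2) (x, y) = (-1/2) * pd 1 (Gm g 1 2) (x, y)"
    unfolding Ac_eq by (rule pdx1_pd[OF pdx1_cmult[OF C2x_pd(4)[OF GC(1)]] yy] pdx1_pd[OF pdx1_cmult[OF C2x_pd(4)[OF GC(2)]] yy])+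
  moreover have "pd 2 (Acoef g 1 2) (x, y) = (-1/2) * pd 2 (Gm g 1 2) (x, y)" "pd 2 (Acoef g 2 2) (x, y) = (-1/2) * pd 2 (Gm g 2 2) (x, y)"
    unfolding Ac_eq by (rule pdx2_pd[OF pdx2_cmult[OF C2x_pd(5)[OF GC(2)]] yy order_refl] pdx2_pd[OF pdx2_cmult[OF C2x_pd(5)[OF GC(3)]] yy order_refl])+
  ultimately have e: "pd 1 (Acoef g 1 1) (x, y) = (-1/2) * pd 1 (Gm g 1 1) (x, y)" "pd 1 (Acoef g 1 2) (x, y) = (-1/2) * pd 1 (Gm g 1 2) (x, y)"
    "pd 2 (Acoef g 1 2) (x, y) = (-1/2) * pd 2 (Gm g 1 2) (x, y)" "pd 2 (Acoef g 2 2) (x, y) = (-1/2) * pd 2 (Gm g 2 2) (x, y)" by blast+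
  have a: "Acoef g j k (x, y) = (-1/2) * Gm g j k (x, y)" for j k by (simp add: Ac_eq)
  show ?thesis unfolding Pop_flux[OF T y] fl1_def fl2_def e a Av_eq by (simp add: algebra_simps)
qed

text \<open>Carries the equation from the single period on which \<open>MRT_solution\<close> states
  it to the whole open strip, in \<open>MRT_interior\<close>.\<close>

lemma Pop_periodic:
  assumes T: "sol_class u" and qp: "\<And>x y. y \<in> {-1..1} \<Longrightarrow> u (x + 2 * pi, y) = u (x, y) + r" and y: "y \<in> {-1<..<1}"
  shows "Pop f g u (x + 2 * pi * real_of_int t, y) = Pop f g u (x, y)"
proof -
  note S = sol_classD[OF T]
  have yy: "y \<in> {-1..1}" using y by auto
  have p1: "pd 1 u (x + 2 * pi, y) = pd 1 u (x, y)" "pd 2 u (x + 2 * pi, y) = pd 2 u (x, y)" if y: "y \<in> {-1..1}" for x y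
  proof -
    show "pd 1 u (x + 2 * pi, y) = pd 1 u (x, y)"
      by (rule pdx1_periodic[OF S(4), where r = r]) (rule qp, assumption, rule y)
    show "pd 2 u (x + 2 * pi, y) = pd 2 u (x, y)"
      by (rule pdx2_periodic[OF S(5), where r = r]) (rule qp, assumption, rule y, rule order_refl)
  qed
  have p1': "pd 1 u (x + 2 * pi, y) = pd 1 u (x, y) + 0" "pd 2 u (x + 2 * pi, y) = pd 2 u (x, y) + 0" if "y \<in> {-1..1}" for x y
    by (simp_all only: p1[OF that] add_0_right)
  have i: "y \<in> {-1..1}" if "y \<in> {-1<..<1}" for y :: real using that by simp
  have p2: "pd 1 (pd 1 u) (x + 2 * pi, y) = pd 1 (pd 1 u) (x, y)" "pd 1 (pd 2 u) (x + 2 * pi, y) = pd 1 (pd 2 u) (x, y)"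
    "pd 2 (pd 1 u) (x + 2 * pi, y) = pd 2 (pd 1 u) (x, y)" "pd 2 (pd 2 u) (x + 2 * pi, y) = pd 2 (pd 2 u) (x, y)" for x
  proof -
    show "pd 1 (pd 1 u) (x + 2 * pi, y) = pd 1 (pd 1 u) (x, y)"
      by (rule pdx1_periodic[OF S(6), where r = 0]) (rule p1'(1), erule i, rule y)
    show "pd 1 (pd 2 u) (x + 2 * pi, y) = pd 1 (pd 2 u) (x, y)"
      by (rule pdx1_periodic[OF S(8), where r = 0]) (rule p1'(2), erule i, rule y)
    show "pd 2 (pd 1 u) (x + 2 * pi, y) = pd 2 (pd 1 u) (x, y)"
      by (rule pdx2_periodic[OF S(7), where r = 0]) (rule p1'(1), assumption, rule y, rule int_sub)
    show "pd 2 (pd 2 u) (x + 2 * pi, y) = pd 2 (pd 2 u) (x, y)"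
      by (rule pdx2_periodic[OF S(9), where r = 0]) (rule p1'(2), assumption, rule y, rule int_sub)
  qed
  have cf: "X (x + 2 * pi, y) = X (x, y)" if "C2x X" for X x using C2x_pd(1)[OF that] yy by (simp add: cper_def)
  have 1: "Pop f g u (x + 2 * pi, y) = Pop f g u (x, y)" for x
  proof -
    have "2 * Pop f g u (x + 2 * pi, y) = 2 * Pop f g u (x, y)"
      unfolding Pop_nondivergence[OF T y] p1[OF yy] p2 cf[OF GC(1)] cf[OF GC(2)] cf[OF GC(3)] cf[OF fC(1)] cf[OF fC(2)] ..
    then show ?thesis by simp
  qed
  show ?thesis
  proof (induction t rule: int_induct[of _ 0])
    case (step1 i)
    have e: "x + 2 * pi * real_of_int (i + 1) = (x + 2 * pi * real_of_int i) + 2 * pi" by (simp add: algebra_simps)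
    show ?case unfolding e 1 by (rule step1(2))
  next
    case (step2 i)
    have e: "x + 2 * pi * real_of_int i = (x + 2 * pi * real_of_int (i - 1)) + 2 * pi" by (simp add: algebra_simps)
    show ?case using step2(2) unfolding e 1 .
  qed simp
qed

lemma MRT_qp:
  assumes "MRT_solution f g Tb T" "y \<in> {-1..1}"
  shows "T (x + 2 * pi, y) = T (x, y) - Tb"
proof -
  have "(x, y) \<in> Omega_ext" using assms(2) by (simp add: Omega_ext_def)
  then have "T (x, y) - T (fst (x, y) + 2 * pi, snd (x, y)) = Tb" using assms(1) unfolding MRT_solution_def by blast
  then show ?thesis by simp
qed

lemma MRT_bc:
  assumes "MRT_solution f g Tb T" "y \<in> {-1, 1}"
  shows "Gm g 1 2 (x, y) * pd 1 T (x, y) + Gm g 2 2 (x, y) * pd 2 T (x, y) = 0"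
proof -
  have "(\<Sum>k\<in>{1,2}. Gm g 2 k (x, y) * pd k T (x, y)) = 0" using assms unfolding MRT_solution_def by blast
  then show ?thesis by (simp add: Gm_sym)
qed

lemma MRT_interior:
  assumes "MRT_solution f g Tb T" "q \<in> Omega_int"
  shows "Pop f g T q = -1"
proof -
  obtain x y where xy: "q = (x, y)" "y \<in> {-1<..<1}" using assms(2) by (auto simp: Omega_int_def)
  have qp: "T (x + 2 * pi, y) = T (x, y) + (- Tb)" if "y \<in> {-1..1}" for x y
    using MRT_qp[OF assms(1) that, of x] by simp
  have T: "sol_class T" using assms(1) by (simp add: MRT_solution_def)
  obtain t where t: "x - 2 * pi * real_of_int t \<in> {0..2*pi}" by (rule reduce_period)
  have "Pop f g T (x, y) = Pop f g T (x - 2 * pi * real_of_int t, y)"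
    using Pop_periodic[OF T qp xy(2), of "x - 2 * pi * real_of_int t" t] by simp
  also have "(x - 2 * pi * real_of_int t, y) \<in> {0..2*pi} \<times> {-1<..<1}" using t xy(2) by simp
  then have "Pop f g T (x - 2 * pi * real_of_int t, y) = -1" using assms(1) unfolding MRT_solution_def by blast
  finally show ?thesis by (simp add: xy)
qed

theorem uniqueness:
  assumes S1: "MRT_solution f g Tb T1" and S2: "MRT_solution f g Tb T2"
  shows "\<exists>c. \<forall>p\<in>Omega_ext. T1 p = T2 p + c"
proof -
  obtain \<theta> M where "elliptic_operator (Gm g 1 1) (Gm g 1 2) (Gm g 2 2) (\<lambda>q. 2 * f 1 q) (\<lambda>q. 2 * f 2 q) \<theta> M"
    by (rule elliptic) (rule that)
  then interpret E: elliptic_operator "Gm g 1 1" "Gm g 1 2" "Gm g 2 2" "\<lambda>q. 2 * f 1 q" "\<lambda>q. 2 * f 2 q" \<theta> M .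
  have T: "sol_class T1" "sol_class T2" using S1 S2 by (auto simp: MRT_solution_def)
  note D1 = sol_classD[OF T(1)] and D2 = sol_classD[OF T(2)]
  have qp: "T1 (x + 2 * pi, y) = T1 (x, y) - Tb" "T2 (x + 2 * pi, y) = T2 (x, y) - Tb" if "y \<in> {-1..1}" for x y
    using MRT_qp[OF S1 that] MRT_qp[OF S2 that] by blast+
  have bc: "Gm g 1 2 (x, y) * pd 1 T1 (x, y) + Gm g 2 2 (x, y) * pd 2 T1 (x, y) = 0"
    "Gm g 1 2 (x, y) * pd 1 T2 (x, y) + Gm g 2 2 (x, y) * pd 2 T2 (x, y) = 0" if "y \<in> {-1, 1}" for x y
    using MRT_bc[OF S1 that] MRT_bc[OF S2 that] by blast+
  have "0 = (0::real) \<and> (\<exists>c. \<forall>q\<in>Omega_ext. T1 q + (-1) * T2 q = c)"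
  proof (rule E.constant_source[OF jet_add_cmult[OF sol_class_jet[OF T(1)] sol_class_jet[OF T(2)], of "-1"]])
    show "continuous_on Omega_ext (\<lambda>q. T1 q + (-1) * T2 q)" "continuous_on Omega_ext (\<lambda>q. pd 2 T1 q + (-1) * pd 2 T2 q)"
      by (intro continuous_intros D1 D2)+
    show "T1 (x + 2 * pi, y) + (-1) * T2 (x + 2 * pi, y) = T1 (x, y) + (-1) * T2 (x, y)" if "y \<in> {-1..1}" for x y
      using qp[OF that, of x] by simp
    show "dx1 (\<lambda>q. T1 q + (-1) * T2 q) (\<lambda>q. pd 1 T1 q + (-1) * pd 1 T2 q)" "dx2 (\<lambda>q. T1 q + (-1) * T2 q) (\<lambda>q. pd 2 T1 q + (-1) * pd 2 T2 q)"
      unfolding dx1_pdx1 dx2_pdx2 by (intro pdx1_add pdx1_cmult D1 D2) (intro pdx2_add pdx2_cmult D1 D2)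
    show "E.L (\<lambda>q. pd 1 T1 q + (-1) * pd 1 T2 q) (\<lambda>q. pd 2 T1 q + (-1) * pd 2 T2 q) (\<lambda>q. pd 1 (pd 1 T1) q + (-1) * pd 1 (pd 1 T2) q)
      (\<lambda>q. (pd 2 (pd 1 T1) q + pd 1 (pd 2 T1) q) / 2 + (-1) * ((pd 2 (pd 1 T2) q + pd 1 (pd 2 T2) q) / 2))
      (\<lambda>q. pd 2 (pd 2 T1) q + (-1) * pd 2 (pd 2 T2) q) q = 0" if q: "q \<in> Omega_int" for q
    proof -
      obtain x y where xy: "q = (x, y)" "y \<in> {-1<..<1}" using q by (auto simp: Omega_int_def)
      have "2 * Pop f g T1 q - 2 * Pop f g T2 q = 0" using MRT_interior[OF S1 q] MRT_interior[OF S2 q] by simp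
      then show ?thesis unfolding xy(1) Pop_nondivergence[OF T(1) xy(2)] Pop_nondivergence[OF T(2) xy(2)] E.L_def
        by (simp add: add_divide_distrib algebra_simps)
    qed
    show "Gm g 1 2 (x, y) * (pd 1 T1 (x, y) + (-1) * pd 1 T2 (x, y)) + Gm g 2 2 (x, y) * (pd 2 T1 (x, y) + (-1) * pd 2 T2 (x, y)) = 0"
      if "y \<in> {-1, 1}" for x y using bc[OF that, of x] by (simp add: algebra_simps)
  qed
  then obtain c where "\<And>q. q \<in> Omega_ext \<Longrightarrow> T1 q + (-1) * T2 q = c" by blast
  then show ?thesis by (intro exI[of _ c]) force
qed

end

text \<open>Turns derivatives given as relations, such as those found in the limit, into statements
  about the function \<open>pd\<close>.\<close>

lemma sol_classI:
  assumes c: "continuous_on Omega_ext u" "continuous_on Omega_ext u1" "continuous_on Omega_ext u2"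
    "continuous_on Omega_int u11" "continuous_on Omega_int u12" "continuous_on Omega_int u21" "continuous_on Omega_int u22"
    and d: "pdx1 {-1..1} u u1" "pdx2 {-1..1} u u2" "pdx1 {-1<..<1} u1 u11" "pdx2 {-1<..<1} u1 u12"
    "pdx1 {-1<..<1} u2 u21" "pdx2 {-1<..<1} u2 u22"
  shows "sol_class u" "\<And>x y. y \<in> {-1..1} \<Longrightarrow> pd 1 u (x, y) = u1 (x, y)" "\<And>x y. y \<in> {-1..1} \<Longrightarrow> pd 2 u (x, y) = u2 (x, y)"
    "\<And>x y. y \<in> {-1<..<1} \<Longrightarrow> pd 1 (pd 1 u) (x, y) = u11 (x, y)" "\<And>x y. y \<in> {-1<..<1} \<Longrightarrow> pd 2 (pd 1 u) (x, y) = u12 (x, y)"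
    "\<And>x y. y \<in> {-1<..<1} \<Longrightarrow> pd 1 (pd 2 u) (x, y) = u21 (x, y)" "\<And>x y. y \<in> {-1<..<1} \<Longrightarrow> pd 2 (pd 2 u) (x, y) = u22 (x, y)"
proof -
  have sub: "{-1<..<1} \<subseteq> {-1..(1::real)}" by auto
  have osub: "Omega_int \<subseteq> Omega_ext" by (auto simp: Omega_int_def Omega_ext_def)
  show e1: "pd 1 u (x, y) = u1 (x, y)" if "y \<in> {-1..1}" for x y by (rule pdx1_pd[OF d(1) that])
  show e2: "pd 2 u (x, y) = u2 (x, y)" if "y \<in> {-1..1}" for x y by (rule pdx2_pd[OF d(2) that order_refl])
  have p11: "pdx1 {-1<..<1} (pd 1 u) u11" by (rule pdx1_cong[OF d(3)]) (simp_all add: e1)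
  have p12: "pdx2 {-1<..<1} (pd 1 u) u12" by (rule pdx2_cong[OF d(4) sub]) (simp add: e1)
  have p21: "pdx1 {-1<..<1} (pd 2 u) u21" by (rule pdx1_cong[OF d(5)]) (simp_all add: e2)
  have p22: "pdx2 {-1<..<1} (pd 2 u) u22" by (rule pdx2_cong[OF d(6) sub]) (simp add: e2)
  show "pd 1 (pd 1 u) (x, y) = u11 (x, y)" if "y \<in> {-1<..<1}" for x y by (rule pdx1_pd[OF p11 that])
  show "pd 2 (pd 1 u) (x, y) = u12 (x, y)" if "y \<in> {-1<..<1}" for x y by (rule pdx2_pd[OF p12 that sub])
  show "pd 1 (pd 2 u) (x, y) = u21 (x, y)" if "y \<in> {-1<..<1}" for x y by (rule pdx1_pd[OF p21 that])
  show "pd 2 (pd 2 u) (x, y) = u22 (x, y)" if "y \<in> {-1<..<1}" for x y by (rule pdx2_pd[OF p22 that sub])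
  have ci: "continuous_on Omega_int X" if "continuous_on Omega_ext X" for X :: "real \<times> real \<Rightarrow> real"
    by (rule continuous_on_subset[OF that osub])
  have cp: "continuous_on Omega_int (pd 1 u)" "continuous_on Omega_int (pd 2 u)"
  proof -
    show "continuous_on Omega_int (pd 1 u)"
      by (rule continuous_on_eq[OF ci[OF c(2)]]) (auto simp: Omega_int_def e1)
    show "continuous_on Omega_int (pd 2 u)"
      by (rule continuous_on_eq[OF ci[OF c(3)]]) (auto simp: Omega_int_def e2)
  qed
  show "sol_class u"
    unfolding sol_class_def C2_on_def
    by (intro conjI C1_onI[OF Omega_ext_def order_refl c(1-3) d(1,2)] C1_onI[OF Omega_int_def sub ci[OF c(1)] ci[OF c(2)] ci[OF c(3)] pdx1_mono[OF d(1) sub] pdx2_mono[OF d(2) sub]]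
      C1_onI[OF Omega_int_def sub cp(1) c(4,5) p11 p12] C1_onI[OF Omega_int_def sub cp(2) c(6,7) p21 p22])
qed

section \<open>Existence and conclusion\<close>

context mrt begin

theorem existence:
  assumes sd: "stationary_density f g \<rho>"
    and J: "J = integral {-1..1} (\<lambda>y. Fl1 \<rho> (0, y) + Avec f g 1 (0, y) * \<rho> (0, y))" and J0: "J \<noteq> 0"
  shows "\<exists>T. MRT_solution f g (1 / J) T"
proof -
  obtain \<theta> M where "elliptic_operator (Gm g 1 1) (Gm g 1 2) (Gm g 2 2) (\<lambda>q. 2 * f 1 q) (\<lambda>q. 2 * f 2 q) \<theta> M"
    by (rule elliptic) (rule that)
  then interpret E: elliptic_operator "Gm g 1 1" "Gm g 1 2" "Gm g 2 2" "\<lambda>q. 2 * f 1 q" "\<lambda>q. 2 * f 2 q" \<theta> M .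
  have "(0, 0) \<in> Omega_ext" by (simp add: Omega_ext_def)
  then have M: "M > 0" using E.G_pos(1)[of "(0, 0)"] E.bdd[of "(0, 0)"] by simp
  define I where "I = (\<lambda>q. inverse (Gm g 2 2 q))"
  have "Gm g 2 2 (x, y) \<noteq> 0" if "y \<in> {-1..1}" for x y
    using E.G_pos(1)[of "(x, y)"] that by (simp add: Omega_ext_def)
  then have CI: "C2x I" unfolding I_def by (rule C2x_inverse[OF GC(3)])
  have GI: "Gm g 2 2 q * I q = 1" if "q \<in> Omega_ext" for q using E.G_pos(1)[OF that] by (simp add: I_def)
  define fA where "fA = (\<lambda>q. Gm g 1 1 q * I q)"
  define fB where "fB = (\<lambda>q. Gm g 1 2 q * I q)"
  define fF1 where "fF1 = (\<lambda>q. 2 * (f 1 q * I q))"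
  define fF2 where "fF2 = (\<lambda>q. 2 * (f 2 q * I q))"
  define fK where "fK = (\<lambda>q. 2 * I q)"
  have "C2x fA" "C2x fB" "C2x fF1" "C2x fF2" "C2x fK" unfolding fA_def fB_def fF1_def fF2_def fK_def
    by (intro C2x_mult C2x_cmult GC fC CI)+
  note C = this[THEN C2x_C2p]
  \<comment> \<open>Division by G22 <= M lowers the ellipticity constant at most to this
    value.\<close>
  have e: "\<theta> / M > 0" using E.th M by simp
  have ell: "\<theta> / M * (x\<^sup>2 + y\<^sup>2) \<le> fA q * x\<^sup>2 + 2 * fB q * x * y + y\<^sup>2" if q: "q \<in> Omega_ext" for q x y
  proof -
    have g: "0 < Gm g 2 2 q" "Gm g 2 2 q \<le> M" using E.G_pos(1)[OF q] E.bdd[OF q] by auto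
    have "\<theta> / M * (x\<^sup>2 + y\<^sup>2) \<le> \<theta> / Gm g 2 2 q * (x\<^sup>2 + y\<^sup>2)"
      using g M E.th by (intro mult_right_mono frac_le) auto
    also have "\<dots> \<le> (Gm g 1 1 q * x\<^sup>2 + 2 * Gm g 1 2 q * x * y + Gm g 2 2 q * y\<^sup>2) / Gm g 2 2 q"
      using divide_right_mono[OF E.ell[OF q, of x y], of "Gm g 2 2 q"] g by simp
    also have "\<dots> = fA q * x\<^sup>2 + 2 * fB q * x * y + y\<^sup>2"
      using g by (simp add: fA_def fB_def I_def field_simps)
    finally show ?thesis .
  qed
  show ?thesis
  proof (rule corrector_exists[OF C e ell])
    fix U U1 U2 U11 U12 U22 :: "real \<times> real \<Rightarrow> real" and \<sigma> \<kappa> :: real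
    assume c: "continuous_on Omega_ext U" "continuous_on Omega_ext U1" "continuous_on Omega_ext U2"
        "continuous_on Omega_int U11" "continuous_on Omega_int U12" "continuous_on Omega_int U22"
      and per: "\<And>x y. U (x + 2 * pi, y) = U (x, y)"
      and d: "\<And>x y. y \<in> {-1..1} \<Longrightarrow> ((\<lambda>x. U (x, y)) has_real_derivative U1 (x, y)) (at x)"
        "\<And>x y. y \<in> {-1..1} \<Longrightarrow> ((\<lambda>y. U (x, y)) has_real_derivative U2 (x, y)) (at y within {-1..1})"
        "\<And>x y. y \<in> {-1<..<1} \<Longrightarrow> ((\<lambda>x. U1 (x, y)) has_real_derivative U11 (x, y)) (at x)"
        "\<And>x y. y \<in> {-1<..<1} \<Longrightarrow> ((\<lambda>y. U1 (x, y)) has_real_derivative U12 (x, y)) (at y within {-1..1})"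
        "\<And>x y. y \<in> {-1<..<1} \<Longrightarrow> ((\<lambda>x. U2 (x, y)) has_real_derivative U12 (x, y)) (at x)"
        "\<And>x y. y \<in> {-1<..<1} \<Longrightarrow> ((\<lambda>y. U2 (x, y)) has_real_derivative U22 (x, y)) (at y within {-1..1})"
      and eq: "\<And>q. q \<in> Omega_int \<Longrightarrow> fA q * U11 q + 2 * fB q * U12 q + U22 q + fF1 q * (U1 q + \<sigma>) + fF2 q * U2 q = \<kappa> * fK q"
      and bc: "\<And>x y. y \<in> {-1, 1} \<Longrightarrow> fB (x, y) * (U1 (x, y) + \<sigma>) + U2 (x, y) = 0"
      and U0: "U (0, -1) = 0" and nt: "\<not> (\<sigma> = 0 \<and> \<kappa> = 0 \<and> (\<forall>q\<in>Omega_ext. U q = 0))"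
    have p: "pdx1 {-1..1} U U1" "pdx2 {-1..1} U U2" "pdx1 {-1<..<1} U1 U11" "pdx2 {-1<..<1} U1 U12"
        "pdx1 {-1<..<1} U2 U12" "pdx2 {-1<..<1} U2 U22"
      unfolding pdx1_def pdx2_def using d by blast+
    have lin: "pdx1 {-1..1} (\<lambda>q. \<sigma> * fst q) (\<lambda>q. \<sigma>)" "pdx2 {-1..1} (\<lambda>q. \<sigma> * fst q) (\<lambda>q. 0)"
        "pdx1 {-1<..<1} (\<lambda>q. \<sigma>) (\<lambda>q. 0)" "pdx2 {-1<..<1} (\<lambda>q. \<sigma>) (\<lambda>q. 0)"
      unfolding pdx1_def pdx2_def by (auto intro!: derivative_eq_intros)
    \<comment> \<open>The factor s stays free: s = 1 serves to find sigma and kappa, and the scaling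
      is fixed at the end.\<close>
    define u where "u s q = s * (U q + \<sigma> * fst q)" for s q
    have S: "sol_class (u s)" "y \<in> {-1..1} \<Longrightarrow> pd 1 (u s) (x, y) = s * (U1 (x, y) + \<sigma>)"
      "y \<in> {-1..1} \<Longrightarrow> pd 2 (u s) (x, y) = s * (U2 (x, y) + 0)"
      "y \<in> {-1<..<1} \<Longrightarrow> pd 1 (pd 1 (u s)) (x, y) = s * (U11 (x, y) + 0)" "y \<in> {-1<..<1} \<Longrightarrow> pd 2 (pd 1 (u s)) (x, y) = s * (U12 (x, y) + 0)"
      "y \<in> {-1<..<1} \<Longrightarrow> pd 1 (pd 2 (u s)) (x, y) = s * U12 (x, y)" "y \<in> {-1<..<1} \<Longrightarrow> pd 2 (pd 2 (u s)) (x, y) = s * U22 (x, y)" for s x y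
    proof -
      have cu: "continuous_on Omega_ext (u s)" unfolding u_def by (intro continuous_intros c)
      have cc: "continuous_on Omega_ext (\<lambda>q. s * (U1 q + \<sigma>))" "continuous_on Omega_ext (\<lambda>q. s * (U2 q + 0))"
        "continuous_on Omega_int (\<lambda>q. s * (U11 q + 0))" "continuous_on Omega_int (\<lambda>q. s * (U12 q + 0))"
        "continuous_on Omega_int (\<lambda>q. s * U12 q)" "continuous_on Omega_int (\<lambda>q. s * U22 q)"
        by (intro continuous_intros c)+
      have ue: "u s = (\<lambda>q. s * (U q + \<sigma> * fst q))" by (simp add: u_def fun_eq_iff)
      have pu: "pdx1 {-1..1} (u s) (\<lambda>q. s * (U1 q + \<sigma>))" "pdx2 {-1..1} (u s) (\<lambda>q. s * (U2 q + 0))"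
        unfolding ue by (intro pdx1_cmult pdx1_add p lin) (intro pdx2_cmult pdx2_add p lin)
      have p1: "pdx1 {-1<..<1} (\<lambda>q. s * (U1 q + \<sigma>)) (\<lambda>q. s * (U11 q + 0))" by (intro pdx1_cmult pdx1_add p lin)
      have p2: "pdx2 {-1<..<1} (\<lambda>q. s * (U1 q + \<sigma>)) (\<lambda>q. s * (U12 q + 0))" by (intro pdx2_cmult pdx2_add p lin)
      have p3: "pdx1 {-1<..<1} (\<lambda>q. s * (U2 q + 0)) (\<lambda>q. s * U12 q)" "pdx2 {-1<..<1} (\<lambda>q. s * (U2 q + 0)) (\<lambda>q. s * U22 q)"
        unfolding add_0_right by (intro pdx1_cmult p) (intro pdx2_cmult p)
      note SI = sol_classI[OF cu cc pu p1 p2 p3]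
      show "sol_class (u s)" by (rule SI(1))
      show "pd 1 (u s) (x, y) = s * (U1 (x, y) + \<sigma>)" "pd 2 (u s) (x, y) = s * (U2 (x, y) + 0)" if "y \<in> {-1..1}"
        by (rule SI(2)[OF that] SI(3)[OF that])+
      show "pd 1 (pd 1 (u s)) (x, y) = s * (U11 (x, y) + 0)" "pd 2 (pd 1 (u s)) (x, y) = s * (U12 (x, y) + 0)"
        "pd 1 (pd 2 (u s)) (x, y) = s * U12 (x, y)" "pd 2 (pd 2 (u s)) (x, y) = s * U22 (x, y)" if "y \<in> {-1<..<1}"
        by (rule SI(4)[OF that] SI(5)[OF that] SI(6)[OF that] SI(7)[OF that])+
    qed
    have P: "Pop f g (u s) q = s * \<kappa>" if q: "q \<in> Omega_int" for s q
    proof -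
      obtain x y where xy: "q = (x, y)" "y \<in> {-1<..<1}" using q by (auto simp: Omega_int_def)
      then have yy: "y \<in> {-1..1}" and qe: "q \<in> Omega_ext" by (auto simp: Omega_ext_def)
      let ?g = "Gm g 2 2 q"
      have h: "?g * (X * I q) = X" for X using GI[OF qe] by (simp add: mult.left_commute)
      have "?g * (fA q * U11 q + 2 * fB q * U12 q + U22 q + fF1 q * (U1 q + \<sigma>) + fF2 q * U2 q) = ?g * (\<kappa> * fK q)"
        using eq[OF q] by simp
      moreover have "?g * (fA q * U11 q + 2 * fB q * U12 q + U22 q + fF1 q * (U1 q + \<sigma>) + fF2 q * U2 q)
        = ?g * (Gm g 1 1 q * I q) * U11 q + 2 * (?g * (Gm g 1 2 q * I q)) * U12 q + ?g * U22 q + 2 * (?g * (f 1 q * I q)) * (U1 q + \<sigma>) + 2 * (?g * (f 2 q * I q)) * U2 q"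
        by (simp add: fA_def fB_def fF1_def fF2_def algebra_simps)
      moreover have "?g * (\<kappa> * fK q) = 2 * (?g * (\<kappa> * I q))" by (simp add: fK_def)
      ultimately have E: "Gm g 1 1 q * U11 q + 2 * Gm g 1 2 q * U12 q + ?g * U22 q + 2 * f 1 q * (U1 q + \<sigma>) + 2 * f 2 q * U2 q = 2 * \<kappa>"
        unfolding h by simp
      have "2 * Pop f g (u s) (x, y) = s * (Gm g 1 1 q * U11 q + 2 * Gm g 1 2 q * U12 q + ?g * U22 q + 2 * f 1 q * (U1 q + \<sigma>) + 2 * f 2 q * U2 q)"
        unfolding Pop_nondivergence[OF S(1) xy(2)] S(2,3)[OF yy] S(4-7)[OF xy(2)] xy(1) by (simp add: algebra_simps)
      then show ?thesis unfolding E using xy(1) by simp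
    qed
    have B: "Gm g 1 2 (x, y) * pd 1 (u s) (x, y) + Gm g 2 2 (x, y) * pd 2 (u s) (x, y) = 0" if y: "y \<in> {-1, 1}" for s x y
    proof -
      have yy: "y \<in> {-1..1}" using y by auto
      then have "(x, y) \<in> Omega_ext" by (simp add: Omega_ext_def)
      from GI[OF this] have h: "Gm g 2 2 (x, y) * (X * I (x, y)) = X" for X by (simp add: mult.left_commute)
      have "Gm g 2 2 (x, y) * (fB (x, y) * (U1 (x, y) + \<sigma>) + U2 (x, y)) = 0" using bc[OF y] by simp
      then have "Gm g 2 2 (x, y) * (Gm g 1 2 (x, y) * I (x, y)) * (U1 (x, y) + \<sigma>) + Gm g 2 2 (x, y) * U2 (x, y) = 0"
        by (simp add: fB_def algebra_simps)
      then have "s * (Gm g 1 2 (x, y) * (U1 (x, y) + \<sigma>) + Gm g 2 2 (x, y) * U2 (x, y)) = 0" unfolding h by simp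
      then show ?thesis unfolding S(2,3)[OF yy] by (simp add: algebra_simps)
    qed
    have qp: "u s (x + 2 * pi, y) = u s (x, y) + s * (2 * pi * \<sigma>)" for s x y
      unfolding u_def per fst_conv by (simp add: algebra_simps)
    have s0: "\<sigma> \<noteq> 0"
    proof
      assume z: "\<sigma> = 0"
      note S1 = sol_classD[OF S(1)[of 1]]
      have "2 * \<kappa> = 0 \<and> (\<exists>c. \<forall>q\<in>Omega_ext. u 1 q = c)"
      proof (rule E.constant_source[OF sol_class_jet[OF S(1)]])
        show "continuous_on Omega_ext (u 1)" "continuous_on Omega_ext (pd 2 (u 1))" by (rule S1)+
        show "u 1 (x + 2 * pi, y) = u 1 (x, y)" for x y using qp[of 1 x y] z by simp
        show "dx1 (u 1) (pd 1 (u 1))" "dx2 (u 1) (pd 2 (u 1))" unfolding dx1_pdx1 dx2_pdx2 by (rule S1)+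
        show "Gm g 1 2 (x, y) * pd 1 (u 1) (x, y) + Gm g 2 2 (x, y) * pd 2 (u 1) (x, y) = 0" if "y \<in> {-1, 1}" for x y
          by (rule B[OF that])
        show "E.L (pd 1 (u 1)) (pd 2 (u 1)) (pd 1 (pd 1 (u 1))) (\<lambda>q. (pd 2 (pd 1 (u 1)) q + pd 1 (pd 2 (u 1)) q) / 2) (pd 2 (pd 2 (u 1))) q = 2 * \<kappa>"
          if q: "q \<in> Omega_int" for q
        proof -
          obtain x y where xy: "q = (x, y)" "y \<in> {-1<..<1}" using q by (auto simp: Omega_int_def)
          show ?thesis using P[OF q, of 1] Pop_nondivergence[OF S(1)[of 1] xy(2), of x] by (simp add: xy(1) E.L_def)
        qed
      qed
      then obtain c where k: "\<kappa> = 0" and c: "\<And>q. q \<in> Omega_ext \<Longrightarrow> u 1 q = c" by auto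
      have "U q = c" if "q \<in> Omega_ext" for q using c[OF that] z by (simp add: u_def)
      moreover from this[of "(0, -1)"] U0 have "c = 0" by (simp add: Omega_ext_def)
      ultimately show False using nt z k by simp
    qed
    have k: "\<kappa> = 2 * pi * \<sigma> * J"
      using Green[OF sd S(1)[of 1], of \<kappa> "2 * pi * \<sigma>"] P[of _ 1] B[of _ _ 1] qp[of 1] by (simp add: J Gm_sym)
    \<comment> \<open>Determined by the two demands s kappa = -1 and 2 pi sigma s = -1/J, which
      agree because of \<open>k\<close>.\<close>
    define s where "s = - 1 / (2 * pi * \<sigma> * J)"
    have "MRT_solution f g (1 / J) (u s)"
      unfolding MRT_solution_def
    proof (intro conjI allI ballI)
      show "sol_class (u s)" by (rule S(1))
      show "Pop f g (u s) q = -1" if "q \<in> {0..2 * pi} \<times> {-1<..<1}" for q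
      proof -
        have "q \<in> Omega_int" using that by (auto simp: Omega_int_def)
        then show ?thesis using P[of q s] s0 J0 by (simp add: s_def k)
      qed
      show "(\<Sum>k\<in>{1,2}. Gm g 2 k (x, y) * pd k (u s) (x, y)) = 0" if "y \<in> {-1, 1}" for x y
        using B[OF that, of x s] by (simp add: Gm_sym)
      show "u s q - u s (fst q + 2 * pi, snd q) = 1 / J" for q
        using qp[of s "fst q" "snd q"] s0 by (simp add: s_def)
    qed
    then show ?thesis by (rule exI[of _ "u s"])
  qed
qed

end

theorem theorem3p1:
  fixes f :: "nat \<Rightarrow> real \<times> real \<Rightarrow> real"
    and g :: "nat \<Rightarrow> nat \<Rightarrow> real \<times> real \<Rightarrow> real"
    and \<rho>ss :: "real \<times> real \<Rightarrow> real"
    and \<gamma>0 \<gamma>0' :: "real \<Rightarrow> real"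
  assumes A1_f: "\<forall>j\<in>{1,2}. C2_on Omega_ext (f j)"
    and A1_g: "\<forall>j\<in>{1,2}. \<forall>k\<in>{1,2}. C2_on Omega_ext (g j k)"
    and A2_f: "\<forall>j\<in>{1,2}. \<forall>a. \<forall>b\<in>{-1..1}. f j (a + 2*pi, b) = f j (a, b)"
    and A2_g: "\<forall>j\<in>{1,2}. \<forall>k\<in>{1,2}. \<forall>a. \<forall>b\<in>{-1..1}. g j k (a + 2*pi, b) = g j k (a, b)"
    and A3: "strongly_elliptic g"
    and A4_sol: "stationary_density f g \<rho>ss"
    and A4_nonneg: "\<forall>p\<in>Omega. \<rho>ss p \<ge> 0"
    and A4_unique: "\<forall>\<rho>. stationary_density f g \<rho> \<longrightarrow> (\<forall>p\<in>Omega. \<rho> p = \<rho>ss p)"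
    and A5: "\<forall>\<gamma> \<gamma>'. admissible_curve \<gamma> \<gamma>' \<longrightarrow> Jbar f g \<rho>ss \<gamma> \<gamma>' > 0"
    and \<gamma>0: "admissible_curve \<gamma>0 \<gamma>0'"
  shows "(\<exists>T. MRT_solution f g (1 / Jbar f g \<rho>ss \<gamma>0 \<gamma>0') T)
       \<and> (\<forall>T1 T2. MRT_solution f g (1 / Jbar f g \<rho>ss \<gamma>0 \<gamma>0') T1
                 \<and> MRT_solution f g (1 / Jbar f g \<rho>ss \<gamma>0 \<gamma>0') T2
                 \<longrightarrow> (\<exists>c. \<forall>p\<in>Omega_ext. T1 p = T2 p + c))"
proof -
  have f: "C2x (f j)" if "j \<in> {1,2}" for j
    using C2_on_C2x[of "f j"] A1_f A2_f that by blast
  have g: "C2x (g j k)" if "j \<in> {1,2}" "k \<in> {1,2}" for j k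
    using C2_on_C2x[of "g j k"] A1_g A2_g that by blast
  interpret mrt f g
    by unfold_locales (rule f g A3; simp)+
  have J0: "Jbar f g \<rho>ss \<gamma>0 \<gamma>0' \<noteq> 0" using A5 \<gamma>0 by (metis less_irrefl)
  show ?thesis
    using existence[OF A4_sol Jbar_eq[OF A4_sol \<gamma>0] J0] uniqueness by blast
qed

end
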